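(* Let $(X,\Sigma_X,\mu_X)$ and $(Y,\Sigma_Y,\mu_Y)$ be separable and $\sigma$-finite measure spaces, let $\varphi\colon Y\to X$ be a measurable map with $\varphi_*\mu_Y=\mu_X$, let $p,q\in(1,\infty)$ with $\frac1p+\frac1q=1$, and let $\mathscr M$ be an $L^p(\mu_X)$-normed module. Consider on $(Y,\Sigma_Y,\mathcal N_{\mu_Y})$ the weak Banach bundle given by the Banach spaces $\hat{\mathscr M}_{\varphi(y)}$, $y\in Y$ (with duals $(\hat{\mathscr M}_{\varphi(y)})'$), and by the set of test vectors $\{\mathrm{Rep}(v)\circ\varphi : v\in\mathscr M\}$, and let $L^q_{\sf weak}(\hat{\mathscr M}'_{\varphi(\star)};\mu_Y)$ be the corresponding space of $L^q$-weakly integrable sections. For $\omega\in L^q_{\sf weak}(\hat{\mathscr M}'_{\varphi(\star)};\mu_Y)$ with representative $\bar\omega$, let $\mathcal I(\omega)\colon\varphi^*\mathscr M\to L^1(\mu_Y)$ be the unique $L^\infty(\mu_Y)$-linear and continuous map such that $$\mathcal I(\omega)(\varphi^*v)=\big[\,y\mapsto\langle\bar\omega(y),\mathrm{Rep}(v)(\varphi(y))\rangle\,\big]\qquad\text{for every }v\in\mathscr M,$$ where $[f]$ is the $\mu_Y$-a.e. equivalence class of $f$. Then $L^q_{\sf weak}(\hat{\mathscr M}'_{\varphi(\star)};\mu_Y)$ is an $L^q(\mu_Y)$-normed module and the map $$\mathcal I\colon L^q_{\sf weak}(\hat{\mathscr M}'_{\varphi(\star)};\mu_Y)\to(\varphi^*\mathscr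 M)^*$$ is an isomorphism of $L^q(\mu_Y)$-normed modules.
   Context: **Normed modules.** For a $\sigma$-finite measure $\mu$ and $p\in(1,\infty)$, an $L^p(\mu)$-normed module is a Banach space $\mathscr M$ which is a module over the ring $L^\infty(\mu)$ and has a pointwise norm $|\cdot|\colon\mathscr M\to L^p(\mu)^+$ with $\|v\|_{\mathscr M}=\||v|\|_{L^p(\mu)}$ and $|fv|=|f||v|$ $\mu$-a.e. for $f\in L^\infty(\mu)$, $v\in\mathscr M$. An isomorphism of such modules is an $L^\infty(\mu)$-linear bijection preserving the pointwise norm. A set generates $\mathscr M$ if its $L^\infty(\mu)$-linear combinations are dense in $\mathscr M$. **Dual.** The dual $\mathscr M^*$ of an $L^p(\mu)$-normed module is the space of $L^\infty(\mu)$-linear continuous maps $L\colon\mathscr M\to L^1(\mu)$, with the operator norm, the obvious multiplication by $L^\infty(\mu)$-functions and pointwise norm $|L|:=\operatorname{ess\,sup}\{L(v):v\in\mathscr M,\ |v|\le1\ \mu\text{-a.e.}\}$; it is an $L^q(\mu)$-normed module. **Pullback.** With $\varphi_*\mu_Y=\mu_X$, the pullback $(\varphi^*\mathscr M,\varphi^* )$ of an $L^p(\mu_X)$-normed module $\mathscr M$ is the couple, unique up to unique isomorphism, where $\varphi^*\mathscr M$ is an $L^p(\mu_Y)$-normed module and $\varphi^*\colon\mathscr M\to\varphi^*\mathscr M$ is linear, with $|\varphi^*v|=|v|\circ\varphi$ for all $v$, and $\{\varphi^*v:v\in\mathscr M\}$ generates $\varphi^*\mathscr M$. **Separability and representatives.**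 A measure space $(X,\Sigma,\mu)$ is separable if there is a (dense) sequence $(A_n)\subset\Sigma$ with $\inf_n\mu(A_n\Delta B)=0$ for every $B\in\Sigma$ with $\mu(B)<\infty$. Fix such a sequence on $X$. Let $\Sigma_k$ be the finite $\sigma$-algebra generated by $A_1,\dots,A_k$ and $\mathcal P_k=\{E_k^n\}_n$ the finest partition of $X$ into sets of $\Sigma_k$. For $f\in L^1(\mu)$ let $P_k(f):=\sum_{n:\mu(E^n_k)>0}\big(\frac1{\mu(E^n_k)}\int_{E^n_k}f\,d\mu\big)\mathbf 1_{E^n_k}$ (with $1/\infty=0$), $\mathrm{Leb}(f):=\{x:\lim_kP_k(f)(x)\text{ exists in }\mathbb R\}$. One has $\mu(X\setminus\mathrm{Leb}(f))=0$. Let $\mathrm{Rep}(f)(x):=\lim_kP_k(f)(x)$ for $x\in\mathrm{Leb}(f)$ and $\mathrm{Rep}(f)(x):=0$ otherwise. For $f\in L^p(\mu)^+$ put $\mathrm{Leb}_p(f):=\mathrm{Leb}(f^p)$, $\mathrm{Rep}_p(f):=\mathrm{Rep}(f^p)^{1/p}$. **Fibres of $\mathscr M$.** For $x\in X$ let $\mathscr M_x:=\{v\in\mathscr M:x\in\mathrm{Leb}_p(|v|)\}$, $\tilde{\mathscr M}_x$ its linear span, with seminorm $\|v\|_x:=\inf\{\sum_{i=1}^n\mathrm{Rep}_p(|v_i|)(x):v_i\in\mathscr M_x,\ v=\sum_{i=1}^nv_i\}$. Let $\hat{\mathscr M}_x$ be the Banach space completion of $\tilde{\mathscr M}_x/\{\|\cdot\|_x=0\}$,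 $\iota_x\colon\tilde{\mathscr M}_x\to\hat{\mathscr M}_x$ the canonical map. For $v\in\mathscr M$ set $\mathrm{Rep}(v)(x):=\iota_x(v)$ if $x\in\mathrm{Leb}_p(|v|)$ and $\mathrm{Rep}(v)(x):=0\in\hat{\mathscr M}_x$ otherwise. **Weak Banach bundles.** For a $\sigma$-finite measure space $(Y,\Sigma,\mu)$ let $\mathcal N_\mu$ be the $\mu$-negligible sets in $\Sigma$. For a family $V_\star=\{V_y\}_{y\in Y}$ of Banach spaces let $\mathscr S(V_\star)=\prod_yV_y$ and let $V'_\star=\{V'_y\}$ be the family of topological duals. A weak Banach bundle is given by these data and a set $\mathrm{Test}(V_\star)\subset\mathscr S(V_\star)$ of test vectors such that for $v_1,v_2\in\mathrm{Test}(V_\star)$, $\alpha_1,\alpha_2\in\mathbb R$ there are $v\in\mathrm{Test}(V_\star)$, $N\in\mathcal N_\mu$ with $\alpha_1v_1+\alpha_2v_2=v$ on $Y\setminus N$. $\mathscr S_{\sf weak}(V'_\star)$ is the set of $w\in\mathscr S(V'_\star)$ such that for every test vector $v$ there is $N\in\mathcal N_\mu$ for which $Y\setminus N\ni y\mapsto\langle w(y),v(y)\rangle$ is measurable. $w_1\sim_{\sf weak}w_2$ iff for every test vector $v$, $\langle w_1-w_2,v\rangle=0$ outside some $N\in\mathcal N_\mu$. $\widetilde{\mathrm{Test}}(V_\star)$ is the set of finite sums $\sum_if_iv_i$ with $f_i\colon Y\to\mathbb R$ measurable, $v_i\in\mathrm{Test}(V_\star)$. The pointwise norm is $|w|:=\operatorname{ess\,sup}\{\langle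 w,v\rangle:v\in\widetilde{\mathrm{Test}}(V_\star),\ \|v(\cdot)\|_{V_\cdot}\le1\}$, and $L^q_{\sf weak}(V'_\star;\mu):=\{w\in\mathscr S_{\sf weak}(V'_\star):|w|\in L^q(\mu)\}/\sim_{\sf weak}$, with pointwise operations, pointwise norm $|\cdot|$ and norm $\||w|\|_{L^q(\mu)}$. *)

theory Defs
  imports "HOL-Analysis.Analysis" "HOL-Algebra.Module"
begin

section \<open>Spaces of a.e. equivalence classes\<close>

text \<open>Also used when \<open>f\<close> is only a.e. equal to a measurable function.\<close>

definition ae_class :: "'a measure \<Rightarrow> ('a \<Rightarrow> real) \<Rightarrow> ('a \<Rightarrow> real) set" where
  "ae_class \<mu> f = {g \<in> borel_measurable \<mu>. AE x in \<mu>. g x = f x}"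

definition ae_rep :: "('a \<Rightarrow> real) set \<Rightarrow> 'a \<Rightarrow> real" where
  "ae_rep F = (SOME f. f \<in> F)"

definition ae_map2 ::
  "'a measure \<Rightarrow> (real \<Rightarrow> real \<Rightarrow> real) \<Rightarrow> ('a \<Rightarrow> real) set \<Rightarrow> ('a \<Rightarrow> real) set \<Rightarrow> ('a \<Rightarrow> real) set" where
  "ae_map2 \<mu> h F G = ae_class \<mu> (\<lambda>x. h (ae_rep F x) (ae_rep G x))"

definition Linf :: "'a measure \<Rightarrow> ('a \<Rightarrow> real) set ring" where
  "Linf \<mu> =
    \<lparr>carrier = ae_class \<mu> ` {f \<in> borel_measurable \<mu>. \<exists>c. AE x in \<mu>. \<bar>f x\<bar> \<le> c},
     mult = ae_map2 \<mu> (*), one = ae_class \<mu> (\<lambda>_. 1),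
     zero = ae_class \<mu> (\<lambda>_. 0), add = ae_map2 \<mu> (+)\<rparr>"

definition Lp_set :: "'a measure \<Rightarrow> real \<Rightarrow> ('a \<Rightarrow> real) set set" where
  "Lp_set \<mu> p = ae_class \<mu> ` {f \<in> borel_measurable \<mu>. integrable \<mu> (\<lambda>x. \<bar>f x\<bar> powr p)}"

definition Lp_norm :: "'a measure \<Rightarrow> real \<Rightarrow> ('a \<Rightarrow> real) set \<Rightarrow> real" where
  "Lp_norm \<mu> p F = (LINT x|\<mu>. \<bar>ae_rep F x\<bar> powr p) powr (1 / p)"

text \<open>
  The essential supremum of a family of a.e. defined functions: the a.e. least measurable
  extended-real function that dominates every member a.e.; it is determined up to null sets.
\<close>

definition ess_sup :: "'a measure \<Rightarrow> ('a \<Rightarrow> real) set \<Rightarrow> 'a \<Rightarrow> ereal" where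
  "ess_sup \<mu> \<F> =
    (SOME g. g \<in> borel_measurable \<mu> \<and> (\<forall>f\<in>\<F>. AE x in \<mu>. ereal (f x) \<le> g x) \<and>
      (\<forall>h \<in> borel_measurable \<mu>. (\<forall>f\<in>\<F>. AE x in \<mu>. ereal (f x) \<le> h x) \<longrightarrow>
         (AE x in \<mu>. g x \<le> h x)))"

section \<open>Normed spaces with explicit carriers\<close>

text \<open>
  The fields \<open>mult\<close> and \<open>one\<close>, which the record \<open>module\<close> inherits from \<open>ring\<close>,
  play no role and are left undefined.
\<close>

record ('a, 'v) nmodule = "('a, 'v) module" +
  nrm :: "'v \<Rightarrow> real"

definition real_ring :: "real ring" where
  "real_ring = \<lparr>carrier = UNIV, mult = (*), one = 1, zero = 0, add = (+)\<rparr>"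

text \<open>The locale \<open>Metric_space\<close> requires symmetry and nonnegativity also outside the carrier.\<close>

definition ndist :: "(real, 'v) nmodule \<Rightarrow> 'v \<Rightarrow> 'v \<Rightarrow> real" where
  "ndist V u v = (if u \<in> carrier V \<and> v \<in> carrier V then nrm V (u \<ominus>\<^bsub>V\<^esub> v) else 0)"

definition ntopology :: "(real, 'v) nmodule \<Rightarrow> 'v topology" where
  "ntopology V = Metric_space.mtopology (carrier V) (ndist V)"

definition banach_space :: "(real, 'v) nmodule \<Rightarrow> bool" where
  "banach_space V \<longleftrightarrow>
    Module.module real_ring V \<and>
    (\<forall>u\<in>carrier V. nrm V u \<ge> 0 \<and> (nrm V u = 0 \<longleftrightarrow> u = \<zero>\<^bsub>V\<^esub>)) \<and>
    (\<forall>c. \<forall>u\<in>carrier V. nrm V (c \<odot>\<^bsub>V\<^esub> u) = \<bar>c\<bar> * nrm V u) \<and>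
    (\<forall>u\<in>carrier V. \<forall>v\<in>carrier V. nrm V (u \<oplus>\<^bsub>V\<^esub> v) \<le> nrm V u + nrm V v) \<and>
    Metric_space.mcomplete (carrier V) (ndist V)"

definition topological_dual :: "(real, 'v) nmodule \<Rightarrow> ('v \<Rightarrow> real) set" where
  "topological_dual V =
    {l \<in> extensional (carrier V).
       (\<forall>u\<in>carrier V. \<forall>v\<in>carrier V. l (u \<oplus>\<^bsub>V\<^esub> v) = l u + l v) \<and>
       (\<forall>c. \<forall>u\<in>carrier V. l (c \<odot>\<^bsub>V\<^esub> u) = c * l u) \<and>
       continuous_map (ntopology V) euclideanreal l}"

definition lin_span :: "'a ring \<Rightarrow> ('a, 'v, 'z) module_scheme \<Rightarrow> 'v set \<Rightarrow> 'v set" where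
  "lin_span R V S =
    {\<Oplus>\<^bsub>V\<^esub>s\<in>F. c s \<odot>\<^bsub>V\<^esub> s | F c. finite F \<and> F \<subseteq> S \<and> c \<in> F \<rightarrow> carrier R}"

text \<open>
  Completion of a seminormed space \<open>V\<close> (the field \<open>nrm\<close> need only be a seminorm) by Cauchy
  sequences. Sequences whose difference is a null sequence are identified, which divides out
  the kernel of the seminorm at the same time; the canonical map sends \<open>v\<close> to the class
  of the constant sequence \<open>v\<close>.
\<close>

definition cauchy_seqs :: "(real, 'v) nmodule \<Rightarrow> (nat \<Rightarrow> 'v) set" where
  "cauchy_seqs V =
    {s. range s \<subseteq> carrier V \<and> (\<forall>e>0. \<exists>n0. \<forall>m\<ge>n0. \<forall>n\<ge>n0. nrm V (s m \<ominus>\<^bsub>V\<^esub> s n) < e)}"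

definition seq_class :: "(real, 'v) nmodule \<Rightarrow> (nat \<Rightarrow> 'v) \<Rightarrow> (nat \<Rightarrow> 'v) set" where
  "seq_class V s = {t \<in> cauchy_seqs V. (\<lambda>n. nrm V (t n \<ominus>\<^bsub>V\<^esub> s n)) \<longlonglongrightarrow> 0}"

definition seq_rep :: "(nat \<Rightarrow> 'v) set \<Rightarrow> nat \<Rightarrow> 'v" where
  "seq_rep S = (SOME s. s \<in> S)"

definition completion :: "(real, 'v) nmodule \<Rightarrow> (real, (nat \<Rightarrow> 'v) set) nmodule" where
  "completion V =
    \<lparr>carrier = seq_class V ` cauchy_seqs V, mult = undefined, one = undefined,
     zero = seq_class V (\<lambda>_. \<zero>\<^bsub>V\<^esub>),
     add = (\<lambda>S T. seq_class V (\<lambda>n. seq_rep S n \<oplus>\<^bsub>V\<^esub> seq_rep T n)),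
     smult = (\<lambda>c S. seq_class V (\<lambda>n. c \<odot>\<^bsub>V\<^esub> seq_rep S n)),
     nrm = (\<lambda>S. lim (\<lambda>n. nrm V (seq_rep S n)))\<rparr>"

definition completion_map :: "(real, 'v) nmodule \<Rightarrow> 'v \<Rightarrow> (nat \<Rightarrow> 'v) set" where
  "completion_map V v = seq_class V (\<lambda>_. v)"

definition Lp_space :: "'a measure \<Rightarrow> real \<Rightarrow> (real, ('a \<Rightarrow> real) set) nmodule" where
  "Lp_space \<mu> p =
    \<lparr>carrier = Lp_set \<mu> p, mult = undefined, one = undefined,
     zero = ae_class \<mu> (\<lambda>_. 0), add = ae_map2 \<mu> (+),
     smult = (\<lambda>c F. ae_class \<mu> (\<lambda>x. c * ae_rep F x)), nrm = Lp_norm \<mu> p\<rparr>"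

section \<open>Normed modules, their duals and pullbacks\<close>

record ('x, 'v) Lmodule = "(('x \<Rightarrow> real) set, 'v) nmodule" +
  pnorm :: "'v \<Rightarrow> ('x \<Rightarrow> real) set"

text \<open>
  The real scalars act through the constant functions. This is no restriction: a module
  multiplication with \<open>|f v| = |f| |v|\<close> on a Banach space necessarily has this
  property, as both actions of the reals agree on the rationals and are continuous.
\<close>

definition real_nspace :: "'x measure \<Rightarrow> ('x, 'v) Lmodule \<Rightarrow> (real, 'v) nmodule" where
  "real_nspace \<mu> M =
    \<lparr>carrier = carrier M, mult = undefined, one = undefined, zero = \<zero>\<^bsub>M\<^esub>, add = (\<oplus>\<^bsub>M\<^esub>),
     smult = (\<lambda>c v. ae_class \<mu> (\<lambda>_. c) \<odot>\<^bsub>M\<^esub> v), nrm = nrm M\<rparr>"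

definition Lp_normed_module :: "'x measure \<Rightarrow> real \<Rightarrow> ('x, 'v) Lmodule \<Rightarrow> bool" where
  "Lp_normed_module \<mu> p M \<longleftrightarrow>
    Module.module (Linf \<mu>) M \<and>
    banach_space (real_nspace \<mu> M) \<and>
    (\<forall>v\<in>carrier M. pnorm M v \<in> Lp_set \<mu> p \<and> (AE x in \<mu>. ae_rep (pnorm M v) x \<ge> 0)) \<and>
    (\<forall>v\<in>carrier M. nrm M v = Lp_norm \<mu> p (pnorm M v)) \<and>
    (\<forall>F\<in>carrier (Linf \<mu>). \<forall>v\<in>carrier M.
       pnorm M (F \<odot>\<^bsub>M\<^esub> v) = ae_map2 \<mu> (\<lambda>a b. \<bar>a\<bar> * b) F (pnorm M v))"

definition normed_module_iso ::
  "'x measure \<Rightarrow> real \<Rightarrow> ('x, 'v) Lmodule \<Rightarrow> ('x, 'w) Lmodule \<Rightarrow> ('v \<Rightarrow> 'w) \<Rightarrow> bool" where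
  "normed_module_iso \<mu> p M N T \<longleftrightarrow>
    Lp_normed_module \<mu> p M \<and> Lp_normed_module \<mu> p N \<and>
    bij_betw T (carrier M) (carrier N) \<and>
    (\<forall>u\<in>carrier M. \<forall>v\<in>carrier M. T (u \<oplus>\<^bsub>M\<^esub> v) = T u \<oplus>\<^bsub>N\<^esub> T v) \<and>
    (\<forall>F\<in>carrier (Linf \<mu>). \<forall>v\<in>carrier M. T (F \<odot>\<^bsub>M\<^esub> v) = F \<odot>\<^bsub>N\<^esub> T v) \<and>
    (\<forall>v\<in>carrier M. pnorm N (T v) = pnorm M v)"

definition generates :: "'x measure \<Rightarrow> ('x, 'v) Lmodule \<Rightarrow> 'v set \<Rightarrow> bool" where
  "generates \<mu> M S \<longleftrightarrow>
    ntopology (real_nspace \<mu> M) closure_of (lin_span (Linf \<mu>) M S) = carrier M"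

definition module_dual :: "'x measure \<Rightarrow> ('x, 'v) Lmodule \<Rightarrow> ('x, 'v \<Rightarrow> ('x \<Rightarrow> real) set) Lmodule" where
  "module_dual \<mu> M =
    \<lparr>carrier =
       {L \<in> carrier M \<rightarrow>\<^sub>E Lp_set \<mu> 1.
          (\<forall>u\<in>carrier M. \<forall>v\<in>carrier M. L (u \<oplus>\<^bsub>M\<^esub> v) = ae_map2 \<mu> (+) (L u) (L v)) \<and>
          (\<forall>F\<in>carrier (Linf \<mu>). \<forall>v\<in>carrier M. L (F \<odot>\<^bsub>M\<^esub> v) = ae_map2 \<mu> (*) F (L v)) \<and>
          continuous_map (ntopology (real_nspace \<mu> M)) (ntopology (Lp_space \<mu> 1)) L},
     mult = undefined, one = undefined,
     zero = (\<lambda>v\<in>carrier M. ae_class \<mu> (\<lambda>_. 0)),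
     add = (\<lambda>L1 L2. \<lambda>v\<in>carrier M. ae_map2 \<mu> (+) (L1 v) (L2 v)),
     smult = (\<lambda>F L. \<lambda>v\<in>carrier M. ae_map2 \<mu> (*) F (L v)),
     nrm = (\<lambda>L. SUP v\<in>{v \<in> carrier M. nrm M v \<le> 1}. Lp_norm \<mu> 1 (L v)),
     pnorm = (\<lambda>L. ae_class \<mu> (\<lambda>x. real_of_ereal (ess_sup \<mu>
       {ae_rep (L v) | v. v \<in> carrier M \<and> (AE y in \<mu>. ae_rep (pnorm M v) y \<le> 1)} x)))\<rparr>"

definition is_pullback ::
  "'x measure \<Rightarrow> 'y measure \<Rightarrow> ('y \<Rightarrow> 'x) \<Rightarrow> real \<Rightarrow> ('x, 'v) Lmodule \<Rightarrow> ('y, 'w) Lmodule \<Rightarrow> ('v \<Rightarrow> 'w) \<Rightarrow> bool" where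
  "is_pullback \<mu> \<nu> \<phi> p M N \<phi>s \<longleftrightarrow>
    Lp_normed_module \<nu> p N \<and>
    \<phi>s \<in> carrier M \<rightarrow> carrier N \<and>
    (\<forall>u\<in>carrier M. \<forall>v\<in>carrier M. \<phi>s (u \<oplus>\<^bsub>M\<^esub> v) = \<phi>s u \<oplus>\<^bsub>N\<^esub> \<phi>s v) \<and>
    (\<forall>c. \<forall>v\<in>carrier M. \<phi>s (ae_class \<mu> (\<lambda>_. c) \<odot>\<^bsub>M\<^esub> v) = ae_class \<nu> (\<lambda>_. c) \<odot>\<^bsub>N\<^esub> \<phi>s v) \<and>
    (\<forall>v\<in>carrier M. pnorm N (\<phi>s v) = ae_class \<nu> (\<lambda>y. ae_rep (pnorm M v) (\<phi> y))) \<and>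
    generates \<nu> N (\<phi>s ` carrier M)"

section \<open>Separable measure spaces and Lebesgue points\<close>

definition dense_sequence :: "'a measure \<Rightarrow> (nat \<Rightarrow> 'a set) \<Rightarrow> bool" where
  "dense_sequence \<mu> A \<longleftrightarrow>
    range A \<subseteq> sets \<mu> \<and>
    (\<forall>B\<in>sets \<mu>. emeasure \<mu> B < \<infinity> \<longrightarrow> (INF n. emeasure \<mu> (sym_diff (A n) B)) = 0)"

definition separable_measure :: "'a measure \<Rightarrow> bool" where
  "separable_measure \<mu> \<longleftrightarrow> (\<exists>A. dense_sequence \<mu> A)"

text \<open>
  Sequences start at index 0, so the first \<open>k\<close> sets are \<open>A 0, \<dots>, A (k - 1)\<close>. The finest
  partition into sets of the finite sigma-algebra \<open>\<Sigma>\<^sub>k\<close> consists of its atoms.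
\<close>

definition Sigma_k :: "'a measure \<Rightarrow> (nat \<Rightarrow> 'a set) \<Rightarrow> nat \<Rightarrow> 'a set set" where
  "Sigma_k \<mu> A k = sigma_sets (space \<mu>) (A ` {..<k})"

definition cells :: "'a measure \<Rightarrow> (nat \<Rightarrow> 'a set) \<Rightarrow> nat \<Rightarrow> 'a set set" where
  "cells \<mu> A k =
    {E \<in> Sigma_k \<mu> A k. E \<noteq> {} \<and> (\<forall>F\<in>Sigma_k \<mu> A k. F \<subseteq> E \<longrightarrow> F = {} \<or> F = E)}"

text \<open>
  For a cell of infinite measure, \<open>measure \<mu> E = 0\<close> and \<open>1 / 0 = 0\<close>, in accordance with the
  convention \<open>1 / \<infinity> = 0\<close>.
\<close>

definition cell_avg :: "'a measure \<Rightarrow> (nat \<Rightarrow> 'a set) \<Rightarrow> nat \<Rightarrow> ('a \<Rightarrow> real) \<Rightarrow> 'a \<Rightarrow> real" where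
  "cell_avg \<mu> A k f x =
    (\<Sum>E\<in>{E \<in> cells \<mu> A k. emeasure \<mu> E > 0}.
       (1 / measure \<mu> E * (LINT z:E|\<mu>. f z)) * indicator E x)"

definition Leb :: "'a measure \<Rightarrow> (nat \<Rightarrow> 'a set) \<Rightarrow> ('a \<Rightarrow> real) \<Rightarrow> 'a set" where
  "Leb \<mu> A f = {x \<in> space \<mu>. convergent (\<lambda>k. cell_avg \<mu> A k f x)}"

definition Rep :: "'a measure \<Rightarrow> (nat \<Rightarrow> 'a set) \<Rightarrow> ('a \<Rightarrow> real) \<Rightarrow> 'a \<Rightarrow> real" where
  "Rep \<mu> A f x = (if x \<in> Leb \<mu> A f then lim (\<lambda>k. cell_avg \<mu> A k f x) else 0)"

definition Leb_p :: "'a measure \<Rightarrow> (nat \<Rightarrow> 'a set) \<Rightarrow> real \<Rightarrow> ('a \<Rightarrow> real) set \<Rightarrow> 'a set" where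
  "Leb_p \<mu> A p F = Leb \<mu> A (\<lambda>x. ae_rep F x powr p)"

definition Rep_p :: "'a measure \<Rightarrow> (nat \<Rightarrow> 'a set) \<Rightarrow> real \<Rightarrow> ('a \<Rightarrow> real) set \<Rightarrow> 'a \<Rightarrow> real" where
  "Rep_p \<mu> A p F x = Rep \<mu> A (\<lambda>x. ae_rep F x powr p) x powr (1 / p)"

section \<open>Fibres of a normed module\<close>

definition Leb_vectors ::
  "'x measure \<Rightarrow> (nat \<Rightarrow> 'x set) \<Rightarrow> real \<Rightarrow> ('x, 'v) Lmodule \<Rightarrow> 'x \<Rightarrow> 'v set" where
  "Leb_vectors \<mu> A p M x = {v \<in> carrier M. x \<in> Leb_p \<mu> A p (pnorm M v)}"

definition fibre_seminorm ::
  "'x measure \<Rightarrow> (nat \<Rightarrow> 'x set) \<Rightarrow> real \<Rightarrow> ('x, 'v) Lmodule \<Rightarrow> 'x \<Rightarrow> 'v \<Rightarrow> real" where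
  "fibre_seminorm \<mu> A p M x v =
    Inf {(\<Sum>i<n. Rep_p \<mu> A p (pnorm M (u i)) x) | (n::nat) u.
           u \<in> {..<n} \<rightarrow> Leb_vectors \<mu> A p M x \<and> v = (\<Oplus>\<^bsub>M\<^esub>i\<in>{..<n}. u i)}"

definition pre_fibre ::
  "'x measure \<Rightarrow> (nat \<Rightarrow> 'x set) \<Rightarrow> real \<Rightarrow> ('x, 'v) Lmodule \<Rightarrow> 'x \<Rightarrow> (real, 'v) nmodule" where
  "pre_fibre \<mu> A p M x =
    (real_nspace \<mu> M)
      \<lparr>carrier := lin_span real_ring (real_nspace \<mu> M) (Leb_vectors \<mu> A p M x),
       nrm := fibre_seminorm \<mu> A p M x\<rparr>"

definition fibre ::
  "'x measure \<Rightarrow> (nat \<Rightarrow> 'x set) \<Rightarrow> real \<Rightarrow> ('x, 'v) Lmodule \<Rightarrow> 'x \<Rightarrow> (real, (nat \<Rightarrow> 'v) set) nmodule" where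
  "fibre \<mu> A p M x = completion (pre_fibre \<mu> A p M x)"

definition Rep_vector ::
  "'x measure \<Rightarrow> (nat \<Rightarrow> 'x set) \<Rightarrow> real \<Rightarrow> ('x, 'v) Lmodule \<Rightarrow> 'v \<Rightarrow> 'x \<Rightarrow> (nat \<Rightarrow> 'v) set" where
  "Rep_vector \<mu> A p M v x =
    (if x \<in> Leb_p \<mu> A p (pnorm M v) then completion_map (pre_fibre \<mu> A p M x) v
     else \<zero>\<^bsub>fibre \<mu> A p M x\<^esub>)"

section \<open>Weak Banach bundles\<close>

definition weak_banach_bundle ::
  "'y measure \<Rightarrow> ('y \<Rightarrow> (real, 'b) nmodule) \<Rightarrow> ('y \<Rightarrow> 'b) set \<Rightarrow> bool" where
  "weak_banach_bundle \<mu> V Test \<longleftrightarrow>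
    sigma_finite_measure \<mu> \<and>
    (\<forall>y\<in>space \<mu>. banach_space (V y)) \<and>
    Test \<subseteq> (\<Pi>\<^sub>E y\<in>space \<mu>. carrier (V y)) \<and>
    (\<forall>v1\<in>Test. \<forall>v2\<in>Test. \<forall>a1 a2. \<exists>v\<in>Test. \<exists>N\<in>null_sets \<mu>. \<forall>y\<in>space \<mu> - N.
       a1 \<odot>\<^bsub>V y\<^esub> v1 y \<oplus>\<^bsub>V y\<^esub> a2 \<odot>\<^bsub>V y\<^esub> v2 y = v y)"

definition weak_sections ::
  "'y measure \<Rightarrow> ('y \<Rightarrow> (real, 'b) nmodule) \<Rightarrow> ('y \<Rightarrow> 'b) set \<Rightarrow> ('y \<Rightarrow> 'b \<Rightarrow> real) set" where
  "weak_sections \<mu> V Test =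
    {w \<in> (\<Pi>\<^sub>E y\<in>space \<mu>. topological_dual (V y)).
       \<forall>v\<in>Test. \<exists>N\<in>null_sets \<mu>.
         (\<lambda>y. w y (v y)) \<in> borel_measurable (restrict_space \<mu> (space \<mu> - N))}"

definition weak_class ::
  "'y measure \<Rightarrow> ('y \<Rightarrow> (real, 'b) nmodule) \<Rightarrow> ('y \<Rightarrow> 'b) set \<Rightarrow> ('y \<Rightarrow> 'b \<Rightarrow> real) \<Rightarrow> ('y \<Rightarrow> 'b \<Rightarrow> real) set" where
  "weak_class \<mu> V Test w =
    {w' \<in> weak_sections \<mu> V Test.
       \<forall>v\<in>Test. \<exists>N\<in>null_sets \<mu>. \<forall>y\<in>space \<mu> - N. w' y (v y) - w y (v y) = 0}"

definition weak_rep :: "('y \<Rightarrow> 'b \<Rightarrow> real) set \<Rightarrow> 'y \<Rightarrow> 'b \<Rightarrow> real" where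
  "weak_rep W = (SOME w. w \<in> W)"

definition test_combinations ::
  "'y measure \<Rightarrow> ('y \<Rightarrow> (real, 'b) nmodule) \<Rightarrow> ('y \<Rightarrow> 'b) set \<Rightarrow> ('y \<Rightarrow> 'b) set" where
  "test_combinations \<mu> V Test =
    {(\<lambda>y\<in>space \<mu>. \<Oplus>\<^bsub>V y\<^esub>i\<in>{..<n}. f i y \<odot>\<^bsub>V y\<^esub> v i y) | (n::nat) f v.
       f \<in> {..<n} \<rightarrow> borel_measurable \<mu> \<and> v \<in> {..<n} \<rightarrow> Test}"

definition weak_pnorm ::
  "'y measure \<Rightarrow> ('y \<Rightarrow> (real, 'b) nmodule) \<Rightarrow> ('y \<Rightarrow> 'b) set \<Rightarrow> ('y \<Rightarrow> 'b \<Rightarrow> real) \<Rightarrow> 'y \<Rightarrow> ereal" where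
  "weak_pnorm \<mu> V Test w =
    ess_sup \<mu> {(\<lambda>y. w y (v y)) | v.
      v \<in> test_combinations \<mu> V Test \<and> (\<forall>y\<in>space \<mu>. nrm (V y) (v y) \<le> 1)}"

definition Lq_weak ::
  "'y measure \<Rightarrow> ('y \<Rightarrow> (real, 'b) nmodule) \<Rightarrow> ('y \<Rightarrow> 'b) set \<Rightarrow> real \<Rightarrow> ('y, ('y \<Rightarrow> 'b \<Rightarrow> real) set) Lmodule" where
  "Lq_weak \<mu> V Test q =
    (let pn = (\<lambda>W. ae_class \<mu> (\<lambda>y. real_of_ereal (weak_pnorm \<mu> V Test (weak_rep W) y))) in
    \<lparr>carrier = weak_class \<mu> V Test `
       {w \<in> weak_sections \<mu> V Test.
          (AE y in \<mu>. \<bar>weak_pnorm \<mu> V Test w y\<bar> \<noteq> \<infinity>) \<and>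
          ae_class \<mu> (\<lambda>y. real_of_ereal (weak_pnorm \<mu> V Test w y)) \<in> Lp_set \<mu> q},
     mult = undefined, one = undefined,
     zero = weak_class \<mu> V Test (\<lambda>y\<in>space \<mu>. \<lambda>b\<in>carrier (V y). 0),
     add = (\<lambda>W1 W2. weak_class \<mu> V Test
              (\<lambda>y\<in>space \<mu>. \<lambda>b\<in>carrier (V y). weak_rep W1 y b + weak_rep W2 y b)),
     smult = (\<lambda>F W. weak_class \<mu> V Test
              (\<lambda>y\<in>space \<mu>. \<lambda>b\<in>carrier (V y). ae_rep F y * weak_rep W y b)),
     nrm = (\<lambda>W. Lp_norm \<mu> q (pn W)),
     pnorm = pn\<rparr>)"

section \<open>The bundle of the pulled back fibres\<close>

definition pb_fibre ::
  "'x measure \<Rightarrow> (nat \<Rightarrow> 'x set) \<Rightarrow> real \<Rightarrow> ('x, 'v) Lmodule \<Rightarrow> ('y \<Rightarrow> 'x) \<Rightarrow> 'y \<Rightarrow> (real, (nat \<Rightarrow> 'v) set) nmodule" where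
  "pb_fibre \<mu> A p M \<phi> y = fibre \<mu> A p M (\<phi> y)"

definition pb_test ::
  "'x measure \<Rightarrow> (nat \<Rightarrow> 'x set) \<Rightarrow> real \<Rightarrow> ('x, 'v) Lmodule \<Rightarrow> 'y measure \<Rightarrow> ('y \<Rightarrow> 'x) \<Rightarrow> ('y \<Rightarrow> (nat \<Rightarrow> 'v) set) set" where
  "pb_test \<mu> A p M \<nu> \<phi> = {(\<lambda>y\<in>space \<nu>. Rep_vector \<mu> A p M v (\<phi> y)) | v. v \<in> carrier M}"

definition Lq_weak_pb ::
  "'x measure \<Rightarrow> (nat \<Rightarrow> 'x set) \<Rightarrow> real \<Rightarrow> ('x, 'v) Lmodule \<Rightarrow> 'y measure \<Rightarrow> ('y \<Rightarrow> 'x) \<Rightarrow> real \<Rightarrow>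
    ('y, ('y \<Rightarrow> (nat \<Rightarrow> 'v) set \<Rightarrow> real) set) Lmodule" where
  "Lq_weak_pb \<mu> A p M \<nu> \<phi> q = Lq_weak \<nu> (pb_fibre \<mu> A p M \<phi>) (pb_test \<mu> A p M \<nu> \<phi>) q"

text \<open>\<open>L\<close> is an \<open>L\<^sup>\<infinity>\<close>-linear continuous map that acts on pulled back vectors through every
  representative \<open>w\<close> of the class \<open>W\<close>.\<close>

definition induced_by ::
  "'x measure \<Rightarrow> (nat \<Rightarrow> 'x set) \<Rightarrow> real \<Rightarrow> ('x, 'v) Lmodule \<Rightarrow> 'y measure \<Rightarrow> ('y \<Rightarrow> 'x) \<Rightarrow>
    ('y, 'w) Lmodule \<Rightarrow> ('v \<Rightarrow> 'w) \<Rightarrow>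
    ('y \<Rightarrow> (nat \<Rightarrow> 'v) set \<Rightarrow> real) set \<Rightarrow> ('w \<Rightarrow> ('y \<Rightarrow> real) set) \<Rightarrow> bool" where
  "induced_by \<mu> A p M \<nu> \<phi> N \<phi>s W L \<longleftrightarrow>
    L \<in> carrier (module_dual \<nu> N) \<and>
    (\<forall>w\<in>W. \<forall>v\<in>carrier M. L (\<phi>s v) = ae_class \<nu> (\<lambda>y. w y (Rep_vector \<mu> A p M v (\<phi> y))))"

definition I_map ::
  "'x measure \<Rightarrow> (nat \<Rightarrow> 'x set) \<Rightarrow> real \<Rightarrow> ('x, 'v) Lmodule \<Rightarrow> 'y measure \<Rightarrow> ('y \<Rightarrow> 'x) \<Rightarrow>
    ('y, 'w) Lmodule \<Rightarrow> ('v \<Rightarrow> 'w) \<Rightarrow>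
    ('y \<Rightarrow> (nat \<Rightarrow> 'v) set \<Rightarrow> real) set \<Rightarrow> 'w \<Rightarrow> ('y \<Rightarrow> real) set" where
  "I_map \<mu> A p M \<nu> \<phi> N \<phi>s W = (THE L. induced_by \<mu> A p M \<nu> \<phi> N \<phi>s W L)"

end

theory Submission
  imports Defs "HOL-Probability.Conditional_Expectation"
begin

text \<open>
  A weak section \<open>w\<close> and a functional \<open>L\<close> on the pullback correspond to each other if
  \<open>L (\<phi>\<^sup>*v) = \<langle>w, Rep v \<circ> \<phi>\<rangle>\<close> almost everywhere, for every vector \<open>v\<close>. The isomorphism is this relation
  (\<open>corr\<close>), and the proof shows that it is a norm preserving bijection between classes of sections
  and functionals.

  Sections give functionals (\<open>section_induces\<close>). The pointwise norm of a combination \<open>\<Sum> f\<^sub>i \<phi>\<^sup>*u\<^sub>i\<close> in the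
  pullback is a.e. the norm of \<open>\<Sum> f\<^sub>i(y) Rep u\<^sub>i (\<phi> y)\<close> in the fibre (\<open>AE_pcomb_nrm\<close>): for constant coefficients
  because \<open>Rep\<close> preserves norms and is linear a.e., and in general by approximating the value
  \<open>f\<^sub>i(y)\<close> by rational numbers. So the prescription of \<open>L\<close> on combinations is bounded by the weak norm
  of \<open>w\<close> (\<open>weak_pnorm_bound\<close>), and extends to the closure.

  Functionals give sections (\<open>functional_induced\<close>). At a point \<open>y\<close> the section has to be linear on the
  span of all vectors that have \<open>\<phi> y\<close> as a Lebesgue point. There are in general uncountably many of
  them, so choosing representatives of the functions \<open>L (\<phi>\<^sup>*v)\<close> and evaluating them at \<open>y\<close> need not
  be linear. The remedy is a lifting (\<open>linear_lifting\<close>): an operator \<open>\<Lambda>\<close> on the functions \<open>g\<close> with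
  \<open>|g| \<le> m \<circ> \<phi>\<close> which satisfies \<open>\<Lambda> y g = g y\<close> for almost every \<open>y\<close>, is linear at every point \<open>y\<close> where the
  cell averages of the bounds \<open>m\<close> around \<open>\<phi> y\<close> are bounded, and is bounded there by the upper limit
  of these averages.
  It is built from averages of \<open>g\<close> over the points \<open>y'\<close> for which \<open>\<phi> y'\<close> lies in the \<open>k\<close>-th cell
  around \<open>\<phi> y\<close> and which no one of the first \<open>j\<close> sets of a dense sequence on \<open>Y\<close> separates from \<open>y\<close>, by
  taking a generalised limit first in \<open>k\<close> and then in \<open>j\<close>. Almost everywhere these are true limits:
  the first one is a conditional expectation given \<open>\<phi>\<close> and finitely many sets, by Lebesgue differentiation on \<open>X\<close>,
  and the conditional expectations converge to \<open>g\<close>. Both convergence theorems are instances of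
  one (locale \<open>averaging\<close>): a weak type maximal inequality and convergence on a dense class.
  Applied to \<open>L (\<phi>\<^sup>*v) / (1 + |L|)\<close>, which is dominated by \<open>|v| \<circ> \<phi>\<close>, the lifting gives a linear functional that is
  bounded by a multiple of the fibre seminorm, because the triangle inequality for averages over
  cells passes to the limit (\<open>avg_norm_limsup\<close>). It extends to the completion.

  The pointwise norms agree (\<open>corr_weak_pnorm\<close>) because each of the two essential suprema bounds
  the family that defines the other one, after truncation of coefficients in one direction and
  by density in the other. That the dual is a normed module is proved directly (\<open>DM_Lp_normed\<close>), and its
  structure is transported to the space of sections.
\<close>

section \<open>Almost-everywhere classes and Lebesgue spaces\<close>

definition ae_classes :: "'a measure \<Rightarrow> ('a \<Rightarrow> real) set set" where
  "ae_classes \<mu> = ae_class \<mu> ` borel_measurable \<mu>"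

lemma ae_class_in_ae_classes [intro, simp]:
  "f \<in> borel_measurable \<mu> \<Longrightarrow> ae_class \<mu> f \<in> ae_classes \<mu>"
  by (auto simp: ae_classes_def)

lemma ae_class_eqI:
  assumes "AE x in \<mu>. f x = g x"
  shows "ae_class \<mu> f = ae_class \<mu> g"
proof -
  have "(AE x in \<mu>. h x = f x) \<longleftrightarrow> (AE x in \<mu>. h x = g x)" for h
    using assms by (auto elim!: eventually_elim2)
  then show ?thesis unfolding ae_class_def by auto
qed

lemma ae_rep_mem:
  assumes "g \<in> borel_measurable \<mu>" "AE x in \<mu>. g x = f x"
  shows "ae_rep (ae_class \<mu> f) \<in> borel_measurable \<mu>"
    "AE x in \<mu>. ae_rep (ae_class \<mu> f) x = f x"
proof -
  have "g \<in> ae_class \<mu> f" using assms by (auto simp: ae_class_def)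
  then have "ae_rep (ae_class \<mu> f) \<in> ae_class \<mu> f" unfolding ae_rep_def by (rule someI[of "\<lambda>g. g \<in> ae_class \<mu> f"])
  then show "ae_rep (ae_class \<mu> f) \<in> borel_measurable \<mu>"
    "AE x in \<mu>. ae_rep (ae_class \<mu> f) x = f x" by (auto simp: ae_class_def)
qed

lemma AE_ae_rep_class:
  "f \<in> borel_measurable \<mu> \<Longrightarrow> AE x in \<mu>. ae_rep (ae_class \<mu> f) x = f x"
  by (rule ae_rep_mem(2)) auto

lemma ae_rep_measurable [measurable (raw), simp, intro]:
  "F \<in> ae_classes \<mu> \<Longrightarrow> ae_rep F \<in> borel_measurable \<mu>"
  by (auto simp: ae_classes_def intro: ae_rep_mem(1))

lemma ae_class_ae_rep:
  assumes "F \<in> ae_classes \<mu>"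
  shows "ae_class \<mu> (ae_rep F) = F"
proof -
  obtain f where f: "f \<in> borel_measurable \<mu>" "F = ae_class \<mu> f"
    using assms by (auto simp: ae_classes_def)
  show ?thesis unfolding f(2) by (rule ae_class_eqI[OF AE_ae_rep_class[OF f(1)]])
qed

lemma ae_classes_eq_iff:
  assumes "F \<in> ae_classes \<mu>" "G \<in> ae_classes \<mu>"
  shows "F = G \<longleftrightarrow> (AE x in \<mu>. ae_rep F x = ae_rep G x)"
  using ae_class_eqI[of "ae_rep F" "ae_rep G" \<mu>] assms by (auto simp: ae_class_ae_rep)

lemma ae_classes_eqI:
  assumes "F \<in> ae_classes \<mu>" "G \<in> ae_classes \<mu>" "AE x in \<mu>. ae_rep F x = ae_rep G x"
  shows "F = G"
  using ae_classes_eq_iff assms by blast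

lemma ae_map2_classes:
  assumes "F \<in> ae_classes \<mu>" "G \<in> ae_classes \<mu>"
  shows "ae_map2 \<mu> (+) F G \<in> ae_classes \<mu>" "ae_map2 \<mu> (*) F G \<in> ae_classes \<mu>"
    "ae_map2 \<mu> (\<lambda>a b. \<bar>a\<bar> * b) F G \<in> ae_classes \<mu>"
    "AE x in \<mu>. ae_rep (ae_map2 \<mu> (+) F G) x = ae_rep F x + ae_rep G x"
    "AE x in \<mu>. ae_rep (ae_map2 \<mu> (*) F G) x = ae_rep F x * ae_rep G x"
    "AE x in \<mu>. ae_rep (ae_map2 \<mu> (\<lambda>a b. \<bar>a\<bar> * b) F G) x = \<bar>ae_rep F x\<bar> * ae_rep G x"
  unfolding ae_map2_def using assms by (auto intro!: AE_ae_rep_class)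

lemma ae_map2_ae_class:
  assumes "f \<in> borel_measurable \<mu>" "g \<in> borel_measurable \<mu>"
  shows "ae_map2 \<mu> (+) (ae_class \<mu> f) (ae_class \<mu> g) = ae_class \<mu> (\<lambda>x. f x + g x)"
    "ae_map2 \<mu> (*) (ae_class \<mu> f) (ae_class \<mu> g) = ae_class \<mu> (\<lambda>x. f x * g x)"
    "ae_map2 \<mu> (\<lambda>a b. \<bar>a\<bar> * b) (ae_class \<mu> f) (ae_class \<mu> g) = ae_class \<mu> (\<lambda>x. \<bar>f x\<bar> * g x)"
  unfolding ae_map2_def using AE_ae_rep_class[OF assms(1)] AE_ae_rep_class[OF assms(2)]
  by (auto intro!: ae_class_eqI elim!: eventually_elim2)

lemma Linf_carrier_iff:
  "F \<in> carrier (Linf \<mu>) \<longleftrightarrow> F \<in> ae_classes \<mu> \<and> (\<exists>c. AE x in \<mu>. \<bar>ae_rep F x\<bar> \<le> c)"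
proof
  assume "F \<in> carrier (Linf \<mu>)"
  then obtain f c where f: "f \<in> borel_measurable \<mu>" "F = ae_class \<mu> f" "AE x in \<mu>. \<bar>f x\<bar> \<le> c"
    by (auto simp: Linf_def)
  have "AE x in \<mu>. \<bar>ae_rep F x\<bar> \<le> c"
    using AE_ae_rep_class[OF f(1)] f(3) unfolding f(2) by eventually_elim auto
  then show "F \<in> ae_classes \<mu> \<and> (\<exists>c. AE x in \<mu>. \<bar>ae_rep F x\<bar> \<le> c)" using f by auto
next
  assume F: "F \<in> ae_classes \<mu> \<and> (\<exists>c. AE x in \<mu>. \<bar>ae_rep F x\<bar> \<le> c)"
  then show "F \<in> carrier (Linf \<mu>)"
    by (auto simp: Linf_def intro!: image_eqI[of _ _ "ae_rep F"] ae_class_ae_rep[symmetric])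
qed

lemma ae_class_Linf:
  assumes "f \<in> borel_measurable \<mu>" "AE x in \<mu>. \<bar>f x\<bar> \<le> c"
  shows "ae_class \<mu> f \<in> carrier (Linf \<mu>)"
  using assms by (auto simp: Linf_def)

lemma Linf_ae_classes: "F \<in> carrier (Linf \<mu>) \<Longrightarrow> F \<in> ae_classes \<mu>"
  by (simp add: Linf_carrier_iff)

lemma Lp_set_iff:
  "F \<in> Lp_set \<mu> p \<longleftrightarrow> F \<in> ae_classes \<mu> \<and> integrable \<mu> (\<lambda>x. \<bar>ae_rep F x\<bar> powr p)"
proof
  assume "F \<in> Lp_set \<mu> p"
  then obtain f where f: "f \<in> borel_measurable \<mu>" "F = ae_class \<mu> f"
    "integrable \<mu> (\<lambda>x. \<bar>f x\<bar> powr p)" by (auto simp: Lp_set_def)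
  have "AE x in \<mu>. \<bar>f x\<bar> powr p = \<bar>ae_rep F x\<bar> powr p"
    using AE_ae_rep_class[OF f(1)] unfolding f(2) by eventually_elim auto
  then have "integrable \<mu> (\<lambda>x. \<bar>ae_rep F x\<bar> powr p)"
    using f by (subst integrable_cong_AE[symmetric]) auto
  then show "F \<in> ae_classes \<mu> \<and> integrable \<mu> (\<lambda>x. \<bar>ae_rep F x\<bar> powr p)" using f by auto
next
  assume F: "F \<in> ae_classes \<mu> \<and> integrable \<mu> (\<lambda>x. \<bar>ae_rep F x\<bar> powr p)"
  then show "F \<in> Lp_set \<mu> p"
    by (auto simp: Lp_set_def intro!: image_eqI[of _ _ "ae_rep F"] ae_class_ae_rep[symmetric])
qed

lemma Lp_set_ae_classes: "F \<in> Lp_set \<mu> p \<Longrightarrow> F \<in> ae_classes \<mu>"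
  by (simp add: Lp_set_iff)

lemma Lp_setI:
  assumes "f \<in> borel_measurable \<mu>" "integrable \<mu> (\<lambda>x. \<bar>f x\<bar> powr p)"
  shows "ae_class \<mu> f \<in> Lp_set \<mu> p"
  using assms by (auto simp: Lp_set_def)

lemma Lp1_set_iff: "F \<in> Lp_set \<mu> 1 \<longleftrightarrow> F \<in> ae_classes \<mu> \<and> integrable \<mu> (ae_rep F)"
  by (auto simp: Lp_set_iff integrable_abs_iff cong: conj_cong)

lemma Lp1_norm: "Lp_norm \<mu> 1 F = (LINT x|\<mu>. \<bar>ae_rep F x\<bar>)"
  by (simp add: Lp_norm_def)

lemma ae_class_L1: "integrable \<mu> f \<Longrightarrow> ae_class \<mu> f \<in> Lp_set \<mu> 1"
  by (rule Lp_setI) (auto simp: integrable_abs_iff)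

lemma Lp_norm_ae_class:
  assumes "f \<in> borel_measurable \<mu>"
  shows "Lp_norm \<mu> p (ae_class \<mu> f) = (LINT x|\<mu>. \<bar>f x\<bar> powr p) powr (1/p)"
proof -
  have "(LINT x|\<mu>. \<bar>ae_rep (ae_class \<mu> f) x\<bar> powr p) = (LINT x|\<mu>. \<bar>f x\<bar> powr p)"
    using AE_ae_rep_class[OF assms] assms by (intro integral_cong_AE) (auto elim: eventually_mono)
  then show ?thesis by (simp add: Lp_norm_def)
qed

lemma Lp_set_scale:
  assumes "F \<in> Linf_car" "Linf_car = carrier (Linf \<mu>)" "G \<in> Lp_set \<mu> p" "0 < p"
  shows "ae_map2 \<mu> (*) F G \<in> Lp_set \<mu> p"
proof -
  have F: "F \<in> ae_classes \<mu>" and G: "G \<in> ae_classes \<mu>"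
    using assms Linf_ae_classes Lp_set_ae_classes by blast+
  obtain c where c: "AE x in \<mu>. \<bar>ae_rep F x\<bar> \<le> c" using assms Linf_carrier_iff by blast
  have "integrable \<mu> (\<lambda>x. \<bar>ae_rep F x * ae_rep G x\<bar> powr p)"
  proof (rule Bochner_Integration.integrable_bound)
    show "integrable \<mu> (\<lambda>x. \<bar>c\<bar> powr p * \<bar>ae_rep G x\<bar> powr p)"
      using assms(3) by (auto simp: Lp_set_iff)
    show "AE x in \<mu>. norm (\<bar>ae_rep F x * ae_rep G x\<bar> powr p) \<le> norm (\<bar>c\<bar> powr p * \<bar>ae_rep G x\<bar> powr p)"
      using c by eventually_elim
        (auto simp: abs_mult powr_mult \<open>0 < p\<close> less_imp_le intro!: mult_right_mono powr_mono2)
  qed (use F G in measurable)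
  then show ?thesis unfolding ae_map2_def using F G by (intro Lp_setI) auto
qed

text \<open>Young's inequality for \<open>\<bar>f\<bar> / \<parallel>f\<parallel>\<close> and \<open>\<bar>g\<bar> / \<parallel>g\<parallel>\<close>, integrated.\<close>

lemma Hoelder:
  fixes f g :: "'a \<Rightarrow> real"
  assumes pq: "1 < p" "1 < q" "1 / p + 1 / q = 1"
    and [measurable]: "f \<in> borel_measurable \<mu>" "g \<in> borel_measurable \<mu>"
    and fp: "integrable \<mu> (\<lambda>x. \<bar>f x\<bar> powr p)" and gq: "integrable \<mu> (\<lambda>x. \<bar>g x\<bar> powr q)"
  shows "integrable \<mu> (\<lambda>x. f x * g x)"
    "(LINT x|\<mu>. \<bar>f x * g x\<bar>) \<le>
      (LINT x|\<mu>. \<bar>f x\<bar> powr p) powr (1/p) * (LINT x|\<mu>. \<bar>g x\<bar> powr q) powr (1/q)"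
proof -
  have Y: "a * b \<le> a powr p / p + b powr q / q" if "0 \<le> a" "0 \<le> b" for a b
    using Youngs_inequality[of p q a b] pq that by auto
  show int: "integrable \<mu> (\<lambda>x. f x * g x)"
  proof (rule Bochner_Integration.integrable_bound)
    show "integrable \<mu> (\<lambda>x. \<bar>f x\<bar> powr p / p + \<bar>g x\<bar> powr q / q)" using fp gq by auto
    show "AE x in \<mu>. norm (f x * g x) \<le> norm (\<bar>f x\<bar> powr p / p + \<bar>g x\<bar> powr q / q)"
      using Y[of "\<bar>f _\<bar>" "\<bar>g _\<bar>"] pq by (auto simp: abs_mult intro!: order_trans[OF Y])
  qed simp
  define a where "a = (LINT x|\<mu>. \<bar>f x\<bar> powr p) powr (1/p)"
  define b where "b = (LINT x|\<mu>. \<bar>g x\<bar> powr q) powr (1/q)"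
  have nn: "0 \<le> (LINT x|\<mu>. \<bar>f x\<bar> powr p)" "0 \<le> (LINT x|\<mu>. \<bar>g x\<bar> powr q)" by auto
  have ap: "a powr p = (LINT x|\<mu>. \<bar>f x\<bar> powr p)" and bq: "b powr q = (LINT x|\<mu>. \<bar>g x\<bar> powr q)"
    using pq nn by (auto simp: a_def b_def powr_powr)
  have "(LINT x|\<mu>. \<bar>f x * g x\<bar>) \<le> a * b"
  proof (cases "a = 0 \<or> b = 0")
    case True
    then have "AE x in \<mu>. f x * g x = 0"
    proof
      assume "a = 0"
      then have "(LINT x|\<mu>. \<bar>f x\<bar> powr p) = 0" using ap pq by simp
      then have "AE x in \<mu>. \<bar>f x\<bar> powr p = 0"
        using integral_nonneg_eq_0_iff_AE[OF fp] by auto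
      then show ?thesis by eventually_elim auto
    next
      assume "b = 0"
      then have "(LINT x|\<mu>. \<bar>g x\<bar> powr q) = 0" using bq pq by simp
      then have "AE x in \<mu>. \<bar>g x\<bar> powr q = 0"
        using integral_nonneg_eq_0_iff_AE[OF gq] by auto
      then show ?thesis by eventually_elim auto
    qed
    then have "(LINT x|\<mu>. \<bar>f x * g x\<bar>) = (LINT x|\<mu>. 0)"
      by (intro integral_cong_AE) (auto elim: eventually_mono)
    then show ?thesis using True by auto
  next
    case False
    then have pos: "0 < a" "0 < b" by (auto simp: a_def b_def)
    have "(LINT x|\<mu>. \<bar>f x * g x\<bar> / (a * b)) \<le>
      (LINT x|\<mu>. (\<bar>f x\<bar> powr p / a powr p) / p + (\<bar>g x\<bar> powr q / b powr q) / q)"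
    proof (rule integral_mono)
      show "integrable \<mu> (\<lambda>x. \<bar>f x * g x\<bar> / (a * b))" using int by auto
      show "integrable \<mu> (\<lambda>x. (\<bar>f x\<bar> powr p / a powr p) / p + (\<bar>g x\<bar> powr q / b powr q) / q)"
        using fp gq by auto
      show "\<bar>f x * g x\<bar> / (a * b) \<le> (\<bar>f x\<bar> powr p / a powr p) / p + (\<bar>g x\<bar> powr q / b powr q) / q" for x
        using Y[of "\<bar>f x\<bar> / a" "\<bar>g x\<bar> / b"] pos by (simp add: abs_mult powr_divide)
    qed
    also have "\<dots> = ((LINT x|\<mu>. \<bar>f x\<bar> powr p) / a powr p) / p + ((LINT x|\<mu>. \<bar>g x\<bar> powr q) / b powr q) / q"
      using fp gq by simp
    also have "\<dots> = 1" using pq pos ap bq by (simp add: ap[symmetric] bq[symmetric])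
    finally have "(LINT x|\<mu>. \<bar>f x * g x\<bar>) / (a * b) \<le> 1" by simp
    then show ?thesis using pos by (simp add: divide_simps split: if_splits)
  qed
  then show "(LINT x|\<mu>. \<bar>f x * g x\<bar>) \<le>
      (LINT x|\<mu>. \<bar>f x\<bar> powr p) powr (1/p) * (LINT x|\<mu>. \<bar>g x\<bar> powr q) powr (1/q)"
    by (simp add: a_def b_def)
qed

text \<open>
  An almost everywhere convergent subsequence supplies the limit; Fatou's lemma along it bounds the
  distance of the remaining members to that limit.
\<close>

lemma L1_complete:
  fixes f :: "nat \<Rightarrow> 'a \<Rightarrow> real"
  assumes int: "\<And>n. integrable \<mu> (f n)"
    and cau: "\<And>e. 0 < e \<Longrightarrow> \<exists>n0. \<forall>m\<ge>n0. \<forall>n\<ge>n0. (LINT x|\<mu>. \<bar>f m x - f n x\<bar>) < e"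
  obtains g where "integrable \<mu> g" "(\<lambda>n. LINT x|\<mu>. \<bar>f n x - g x\<bar>) \<longlonglongrightarrow> 0"
proof -
  note [measurable] = borel_measurable_integrable[OF int]
  obtain r where r: "strict_mono (r :: nat \<Rightarrow> nat)" "AE x in \<mu>. Cauchy (\<lambda>i. f (r i) x)"
    using cauchy_L1_AE_cauchy_subseq[of \<mu> f, OF int] cau by auto
  define g where "g x = lim (\<lambda>i. f (r i) x)" for x
  have [measurable]: "g \<in> borel_measurable \<mu>" unfolding g_def[abs_def] by measurable
  have small: "\<exists>n0. \<forall>m\<ge>n0. integrable \<mu> (\<lambda>x. f m x - g x) \<and> (LINT x|\<mu>. \<bar>f m x - g x\<bar>) \<le> e" if e: "0 < e" for e
  proof -
    obtain n0 where n0: "\<And>m n. m \<ge> n0 \<Longrightarrow> n \<ge> n0 \<Longrightarrow> (LINT x|\<mu>. \<bar>f m x - f n x\<bar>) < e" using cau[OF e] by blast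
    have "integrable \<mu> (\<lambda>x. f m x - g x) \<and> (LINT x|\<mu>. \<bar>f m x - g x\<bar>) \<le> e" if m: "m \<ge> n0" for m
    proof -
      let ?d = "\<lambda>i x. ennreal \<bar>f m x - f (r i) x\<bar>"
      have "(\<integral>\<^sup>+x. ennreal \<bar>f m x - g x\<bar> \<partial>\<mu>) = (\<integral>\<^sup>+x. liminf (\<lambda>i. ?d i x) \<partial>\<mu>)"
        using r(2)
      proof (intro nn_integral_cong_AE, eventually_elim)
        case (elim x)
        then have "(\<lambda>i. f (r i) x) \<longlonglongrightarrow> g x" unfolding g_def using real_Cauchy_convergent convergent_LIMSEQ_iff by blast
        then have "(\<lambda>i. ?d i x) \<longlonglongrightarrow> ennreal \<bar>f m x - g x\<bar>" by (intro tendsto_intros)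
        then show ?case by (rule lim_imp_Liminf[OF sequentially_bot, symmetric])
      qed
      also have "\<dots> \<le> liminf (\<lambda>i. \<integral>\<^sup>+x. ?d i x \<partial>\<mu>)" by (rule nn_integral_liminf) measurable
      also have "\<dots> \<le> limsup (\<lambda>i. \<integral>\<^sup>+x. ?d i x \<partial>\<mu>)" by (rule Liminf_le_Limsup) simp
      also have "\<dots> \<le> ennreal e"
      proof (rule Limsup_bounded, rule eventually_sequentiallyI[of n0])
        fix i assume "n0 \<le> i"
        then have "(LINT x|\<mu>. \<bar>f m x - f (r i) x\<bar>) < e" using n0[OF m] seq_suble[OF r(1), of i] by simp
        then show "(\<integral>\<^sup>+x. ?d i x \<partial>\<mu>) \<le> ennreal e"
          using int by (subst nn_integral_eq_integral) (auto intro: ennreal_leI)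
      qed
      finally have le: "(\<integral>\<^sup>+x. ennreal \<bar>f m x - g x\<bar> \<partial>\<mu>) \<le> ennreal e" .
      then have i: "integrable \<mu> (\<lambda>x. f m x - g x)"
        by (intro integrableI_bounded) (auto simp: ennreal_less_top le_less_trans)
      have "ennreal (LINT x|\<mu>. \<bar>f m x - g x\<bar>) \<le> ennreal e" using le i by (subst nn_integral_eq_integral[symmetric]) auto
      with i e show ?thesis by simp
    qed
    then show ?thesis by blast
  qed
  obtain m where "integrable \<mu> (\<lambda>x. f m x - g x)" using small[of 1] by auto
  then have "integrable \<mu> (\<lambda>x. f m x - (f m x - g x))" by (rule Bochner_Integration.integrable_diff[OF int])
  then have "integrable \<mu> g" by (simp only: diff_diff_eq2 add_diff_cancel_left')
  moreover have "(\<lambda>n. LINT x|\<mu>. \<bar>f n x - g x\<bar>) \<longlonglongrightarrow> 0"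
  proof (rule LIMSEQ_I)
    fix e :: real assume "0 < e"
    then have e: "0 < e/2" "e/2 < e" by auto
    obtain n0 where "\<And>m. m \<ge> n0 \<Longrightarrow> (LINT x|\<mu>. \<bar>f m x - g x\<bar>) \<le> e/2" using small[OF e(1)] by blast
    then have "\<forall>m\<ge>n0. norm ((LINT x|\<mu>. \<bar>f m x - g x\<bar>) - 0) < e" using e(2) order_le_less_trans by fastforce
    then show "\<exists>n0. \<forall>m\<ge>n0. norm ((LINT x|\<mu>. \<bar>f m x - g x\<bar>) - 0) < e" ..
  qed
  ultimately show ?thesis by (rule that)
qed

lemma L1_limit_AE_subseq:
  fixes f :: "nat \<Rightarrow> 'a \<Rightarrow> real"
  assumes "\<And>n. integrable \<mu> (f n)" "(\<lambda>n. LINT x|\<mu>. \<bar>f n x\<bar>) \<longlonglongrightarrow> 0"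
  obtains r where "strict_mono (r :: nat \<Rightarrow> nat)" "AE x in \<mu>. (\<lambda>n. f (r n) x) \<longlonglongrightarrow> 0"
  using tendsto_L1_AE_subseq[of \<mu> f] assms by auto

section \<open>Essential suprema\<close>

text \<open>
  The strictly increasing \<open>squash\<close> maps the extended reals to a bounded interval, so that
  suprema of countable subfamilies can be compared through their integrals.
\<close>

definition squash :: "ereal \<Rightarrow> real" where
  "squash x = (if x = \<infinity> then pi else if x = -\<infinity> then - pi else arctan (real_of_ereal x))"

lemma squash_measurable [measurable]: "squash \<in> borel_measurable borel"
  unfolding squash_def by measurable

lemma squash_bound: "\<bar>squash x\<bar> \<le> pi"
  using arctan_lbound[of "real_of_ereal x"] arctan_ubound[of "real_of_ereal x"] pi_gt_zero
  unfolding squash_def by (auto simp: abs_le_iff)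

lemma squash_strict: assumes "x < y" shows "squash x < squash y"
  using assms arctan_lbound[of "real_of_ereal x"] arctan_ubound[of "real_of_ereal x"]
    arctan_lbound[of "real_of_ereal y"] arctan_ubound[of "real_of_ereal y"] pi_gt_zero
  unfolding squash_def
  by (cases x; cases y) (auto simp: arctan_less_iff)

lemma squash_mono: "x \<le> y \<Longrightarrow> squash x \<le> squash y"
  using squash_strict[of x y] by (auto simp: le_less)

definition is_ess_sup :: "'a measure \<Rightarrow> ('a \<Rightarrow> real) set \<Rightarrow> ('a \<Rightarrow> ereal) \<Rightarrow> bool" where
  "is_ess_sup \<mu> \<F> g \<longleftrightarrow> g \<in> borel_measurable \<mu> \<and> (\<forall>f\<in>\<F>. AE x in \<mu>. ereal (f x) \<le> g x) \<and>
      (\<forall>h \<in> borel_measurable \<mu>. (\<forall>f\<in>\<F>. AE x in \<mu>. ereal (f x) \<le> h x) \<longrightarrow>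
         (AE x in \<mu>. g x \<le> h x))"

text \<open>
  Among the countable subfamilies there is one whose pointwise supremum has the largest integral
  after squashing; adjoining a further member cannot increase this supremum on a set of positive
  measure.
\<close>

lemma ess_sup_countable:
  assumes "sigma_finite_measure \<mu>"
    and meas: "\<And>f. f \<in> \<F> \<Longrightarrow> \<exists>g\<in>borel_measurable \<mu>. AE x in \<mu>. g x = f x"
  obtains S where "countable S" "S \<subseteq> \<F>" "is_ess_sup \<mu> \<F> (ess_sup \<mu> \<F>)"
    "AE x in \<mu>. ess_sup \<mu> \<F> x = (SUP f\<in>S. ereal (f x))"
proof -
  interpret sigma_finite_measure \<mu> by fact
  from meas obtain m where m: "\<And>f. f \<in> \<F> \<Longrightarrow> m f \<in> borel_measurable \<mu>"
    "\<And>f. f \<in> \<F> \<Longrightarrow> AE x in \<mu>. m f x = f x" by metis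
  obtain h where h: "h \<in> borel_measurable \<mu>" "integral\<^sup>N \<mu> h \<noteq> \<infinity>"
    "\<forall>x\<in>space \<mu>. 0 < h x \<and> h x < \<infinity>" using Ex_finite_integrable_function by blast
  define D where "D = density \<mu> h"
  interpret D: finite_measure D
    using h by (auto intro!: finite_measureI simp: D_def emeasure_density cong: nn_integral_cong)
  have AED: "(AE x in D. P x) \<longleftrightarrow> (AE x in \<mu>. P x)" for P
    unfolding D_def using h by (subst AE_density) (auto intro!: AE_cong)
  have bmD: "borel_measurable D = borel_measurable \<mu>" by (simp add: D_def measurable_def)
  define G where "G S x = (SUP f\<in>S. ereal (m f x))" for S x
  have Gm: "G S \<in> borel_measurable \<mu>" if "countable S" "S \<subseteq> \<F>" for S
    unfolding G_def using that m(1) by (intro borel_measurable_SUP) auto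
  have Gmono: "G S x \<le> G T x" if "S \<subseteq> T" for S T x
    unfolding G_def using that by (intro SUP_subset_mono) auto
  define J where "J S = (LINT x|D. squash (G S x))" for S
  have sint: "integrable D (\<lambda>x. squash (G S x))" if "countable S" "S \<subseteq> \<F>" for S
    using squash_bound Gm[OF that] by (intro D.integrable_const_bound[of _ pi]) (auto simp: bmD)
  have Jmono: "J S \<le> J T" if "countable T" "T \<subseteq> \<F>" "S \<subseteq> T" for S T
    unfolding J_def using that squash_mono[OF Gmono[OF that(3)]]
    by (intro integral_mono sint) (auto intro: countable_subset)
  define \<S> where "\<S> = {S. countable S \<and> S \<subseteq> \<F>}"
  have bdd: "bdd_above (J ` \<S>)"
  proof (rule bdd_aboveI2)
    fix S assume "S \<in> \<S>"
    then have "J S \<le> (LINT x|D. pi)" unfolding J_def \<S>_def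
      using squash_bound by (intro integral_mono sint) (auto simp: abs_le_iff)
    then show "J S \<le> (LINT x|D. pi)" .
  qed
  have ne: "\<S> \<noteq> {}" by (auto simp: \<S>_def)
  have "\<exists>S\<in>\<S>. (SUP S\<in>\<S>. J S) - 1 / Suc n < J S" for n
    using less_cSUP_iff[OF ne bdd, of "(SUP S\<in>\<S>. J S) - 1 / Suc n"] by auto
  then obtain T where T: "\<And>n. T n \<in> \<S>" "\<And>n. (SUP S\<in>\<S>. J S) - 1 / Suc n < J (T n)" by metis
  define S where "S = (\<Union>n. T n)"
  have S: "countable S" "S \<subseteq> \<F>" using T(1) by (auto simp: S_def \<S>_def)
  have max: "J U \<le> J S" if "countable U" "U \<subseteq> \<F>" for U
  proof -
    have "J U - 1 / Suc n \<le> J S" for n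
    proof -
      have "J U \<le> (SUP S\<in>\<S>. J S)" using that bdd by (auto intro!: cSUP_upper simp: \<S>_def)
      moreover have "J (T n) \<le> J S" using S by (intro Jmono) (auto simp: S_def)
      ultimately show ?thesis using T(2)[of n] by auto
    qed
    moreover have "(\<lambda>n. J U - 1 / Suc n) \<longlonglongrightarrow> J U - 0"
      by (intro tendsto_intros LIMSEQ_Suc[OF lim_1_over_n])
    ultimately show ?thesis using LIMSEQ_le_const2[of "\<lambda>n. J U - 1 / Suc n" "J U"] by auto
  qed
  have upper: "AE x in \<mu>. ereal (f x) \<le> G S x" if f: "f \<in> \<F>" for f
  proof -
    have U: "countable (insert f S)" "insert f S \<subseteq> \<F>" using S f by auto
    have "AE x in D. squash (G S x) = squash (G (insert f S) x)"
    proof (rule integral_ineq_eq_0_then_AE)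
      show "AE x in D. squash (G S x) \<le> squash (G (insert f S) x)"
        by (intro AE_I2 squash_mono Gmono) auto
      show "(LINT x|D. squash (G S x)) = (LINT x|D. squash (G (insert f S) x))"
        using max[OF U] Jmono[OF U, of S] by (auto simp: J_def)
    qed (use sint S U in auto)
    then have "AE x in \<mu>. squash (G S x) = squash (G (insert f S) x)" by (simp add: AED)
    then show ?thesis using m(2)[OF f]
    proof eventually_elim
      case (elim x)
      have "G (insert f S) x \<le> G S x"
        using squash_strict[of "G S x" "G (insert f S) x"] elim by (metis less_irrefl not_le)
      moreover have "ereal (m f x) \<le> G (insert f S) x" unfolding G_def by (intro SUP_upper) auto
      ultimately show ?case using elim by auto
    qed
  qed
  have sup_eq: "AE x in \<mu>. G S x = (SUP f\<in>S. ereal (f x))"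
  proof -
    have "AE x in \<mu>. \<forall>f\<in>S. m f x = f x" using S m(2) by (subst AE_ball_countable) auto
    then show ?thesis by eventually_elim (auto simp: G_def intro!: SUP_cong)
  qed
  have "is_ess_sup \<mu> \<F> (G S)"
    unfolding is_ess_sup_def
  proof (intro conjI ballI impI)
    fix h' assume h': "\<forall>f\<in>\<F>. AE x in \<mu>. ereal (f x) \<le> h' x"
    then have "AE x in \<mu>. \<forall>f\<in>S. ereal (f x) \<le> h' x" using S by (subst AE_ball_countable) auto
    with sup_eq show "AE x in \<mu>. G S x \<le> h' x"
      by eventually_elim (auto intro: SUP_least)
  qed (use Gm S upper in auto)
  then have ess: "is_ess_sup \<mu> \<F> (ess_sup \<mu> \<F>)"
    unfolding ess_sup_def is_ess_sup_def[symmetric] by (rule someI[of "is_ess_sup \<mu> \<F>"])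
  have "AE x in \<mu>. ess_sup \<mu> \<F> x \<le> G S x" "AE x in \<mu>. G S x \<le> ess_sup \<mu> \<F> x"
    using ess \<open>is_ess_sup \<mu> \<F> (G S)\<close> by (auto simp: is_ess_sup_def)
  with sup_eq have "AE x in \<mu>. ess_sup \<mu> \<F> x = (SUP f\<in>S. ereal (f x))"
    by eventually_elim auto
  with S ess show ?thesis by (intro that)
qed


section \<open>Differentiation along averaging operators\<close>

text \<open>
  Cut the exceptional set according to the first index at which the average is large. On each piece
  the average at that index alone bounds the measure by the mass of \<open>|f|\<close>.
\<close>

lemma maximal_inequality:
  fixes T :: "nat \<Rightarrow> 'a \<Rightarrow> real" and f :: "'a \<Rightarrow> real"
  assumes G: "\<And>k. G k = {x \<in> space M. l < \<bar>T k x\<bar>}"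
    and [measurable]: "\<And>k. T k \<in> borel_measurable M" "f \<in> borel_measurable M"
    and avg: "\<And>k. ennreal l * emeasure M (disjointed G k) \<le> emeasure (density M (\<lambda>x. ennreal \<bar>f x\<bar>)) (disjointed G k)"
  shows "ennreal l * emeasure M (\<Union>k. G k) \<le> (\<integral>\<^sup>+x. ennreal \<bar>f x\<bar> \<partial>M)"
proof -
  have "range G \<subseteq> sets M" unfolding G by auto
  then have D: "range (disjointed G) \<subseteq> sets M" by (rule sets.range_disjointed_sets)
  have dj: "disjoint_family (disjointed G)" by (rule disjoint_family_disjointed)
  let ?N = "density M (\<lambda>x. ennreal \<bar>f x\<bar>)"
  have "ennreal l * emeasure M (\<Union>k. G k) = ennreal l * (\<Sum>k. emeasure M (disjointed G k))"
    using suminf_emeasure[OF D dj] by (simp add: UN_disjointed_eq)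
  also have "\<dots> = (\<Sum>k. ennreal l * emeasure M (disjointed G k))" by simp
  also have "\<dots> \<le> (\<Sum>k. emeasure ?N (disjointed G k))"
    using avg by (intro suminf_le) auto
  also have "\<dots> = emeasure ?N (\<Union>k. disjointed G k)"
    using D dj by (intro suminf_emeasure) auto
  also have "\<dots> \<le> emeasure ?N (space ?N)" by (rule emeasure_space)
  also have "\<dots> = (\<integral>\<^sup>+x. ennreal \<bar>f x\<bar> \<partial>M)" by (simp add: emeasure_density cong: nn_integral_cong)
  finally show ?thesis .
qed

text \<open>
  Operators \<open>T k\<close> that behave like conditional expectations along a sequence of sets: they are
  linear, satisfy a weak type \<open>(1,1)\<close> maximal inequality and recover the sets of the sequence.
\<close>

locale averaging =
  fixes M :: "'a measure" and A :: "nat \<Rightarrow> 'a set" and T :: "nat \<Rightarrow> ('a \<Rightarrow> real) \<Rightarrow> 'a \<Rightarrow> real"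
  assumes dense: "dense_sequence M A"
    and T_measurable: "\<And>k f. integrable M f \<Longrightarrow> T k f \<in> borel_measurable M"
    and weak_type: "\<And>f l. integrable M f \<Longrightarrow> 0 < l \<Longrightarrow>
      ennreal l * emeasure M (\<Union>k. {x \<in> space M. l < \<bar>T k f x\<bar>}) \<le> (\<integral>\<^sup>+x. ennreal \<bar>f x\<bar> \<partial>M)"
    and T_linear: "\<And>f g a b k. integrable M f \<Longrightarrow> integrable M g \<Longrightarrow>
      AE x in M. T k (\<lambda>x. a * f x + b * g x) x = a * T k f x + b * T k g x"
    and T_recovers: "\<And>n. emeasure M (A n) < \<infinity> \<Longrightarrow>
      AE x in M. (\<lambda>k. T k (indicator (A n)) x) \<longlonglongrightarrow> indicator (A n) x"
begin

text \<open>
  By the maximal inequality the oscillation of \<open>T k f\<close> around \<open>f\<close> is controlled in measure by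
  the distance of \<open>f\<close> to a function for which the convergence is known; the Borel-Cantelli
  lemma turns this into convergence almost everywhere.
\<close>

lemma converges_if_approximable:
  assumes f: "integrable M f"
    and approx: "\<And>e. 0 < e \<Longrightarrow> \<exists>g. integrable M g \<and> (LINT x|M. \<bar>f x - g x\<bar>) < e \<and>
      (AE x in M. (\<lambda>k. T k g x) \<longlonglongrightarrow> g x)"
  shows "AE x in M. (\<lambda>k. T k f x) \<longlonglongrightarrow> f x"
proof -
  \<comment> \<open>At level \<open>(1/2)^m\<close> an \<open>L\<^sup>1\<close> distance of \<open>(1/4)^m\<close> leaves exceptional sets of measure \<open>(1/2)^m\<close>,
    which is summable.\<close>
  have "\<forall>m. \<exists>g. integrable M g \<and> (LINT x|M. \<bar>f x - g x\<bar>) < (1/4)^m \<and>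
      (AE x in M. (\<lambda>k. T k g x) \<longlonglongrightarrow> g x)" using approx by simp
  from choice[OF this] obtain g where g0: "\<forall>m. integrable M (g m) \<and>
      (LINT x|M. \<bar>f x - g m x\<bar>) < (1/4)^m \<and> (AE x in M. (\<lambda>k. T k (g m) x) \<longlonglongrightarrow> g m x)" ..
  then have g: "\<And>m. integrable M (g m)" "\<And>m. (LINT x|M. \<bar>f x - g m x\<bar>) < (1/4)^m"
    "\<And>m. AE x in M. (\<lambda>k. T k (g m) x) \<longlonglongrightarrow> g m x" by blast+
  define d where "d m x = f x - g m x" for m x
  have d: "integrable M (d m)" for m unfolding d_def using f g by auto
  have [measurable]: "T k (d m) \<in> borel_measurable M" "d m \<in> borel_measurable M" for k m
    using T_measurable[OF d] d by auto
  define B where "B m = (\<Union>k. {x \<in> space M. (1/2)^m < \<bar>T k (d m) x\<bar>})" for m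
  define C where "C m = {x \<in> space M. (1/2)^m < \<bar>d m x\<bar>}" for m
  have [measurable]: "B m \<in> sets M" "C m \<in> sets M" for m unfolding B_def C_def by auto
  have dm: "(\<integral>\<^sup>+x. ennreal \<bar>d m x\<bar> \<partial>M) \<le> ennreal ((1/4)^m)" for m
    using g(2)[of m] integrable_abs[OF d[of m]]
    by (subst nn_integral_eq_integral) (auto simp: d_def intro!: ennreal_leI)
  have weak: "emeasure M E \<le> ennreal ((1/2)^m)"
    if "ennreal ((1/2)^m) * emeasure M E \<le> (\<integral>\<^sup>+x. ennreal \<bar>d m x\<bar> \<partial>M)" for E m
  proof -
    have "emeasure M E = ennreal (2^m) * (ennreal ((1/2)^m) * emeasure M E)"
      by (simp add: mult.assoc[symmetric] ennreal_mult[symmetric] power_mult_distrib[symmetric])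
    also have "\<dots> \<le> ennreal (2^m) * ennreal ((1/4)^m)"
      using that dm[of m] by (intro mult_left_mono) auto
    also have "\<dots> = ennreal ((1/2)^m)"
      by (simp add: ennreal_mult[symmetric] power_mult_distrib[symmetric])
    finally show ?thesis .
  qed
  have B: "emeasure M (B m) \<le> ennreal ((1/2)^m)" for m
    using weak_type[OF d, of "(1/2)^m" m] unfolding B_def by (intro weak) auto
  have C: "emeasure M (C m) \<le> ennreal ((1/2)^m)" for m
  proof (rule weak)
    have "ennreal ((1/2)^m) * emeasure M (C m) = (\<integral>\<^sup>+x. ennreal ((1/2)^m) * indicator (C m) x \<partial>M)"
      by (simp add: nn_integral_cmult)
    also have "\<dots> \<le> (\<integral>\<^sup>+x. ennreal \<bar>d m x\<bar> \<partial>M)"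
      by (intro nn_integral_mono) (auto simp: C_def indicator_def intro!: ennreal_leI)
    finally show "ennreal ((1/2)^m) * emeasure M (C m) \<le> (\<integral>\<^sup>+x. ennreal \<bar>d m x\<bar> \<partial>M)" .
  qed
  have bc: "AE x in M. eventually (\<lambda>m. x \<in> space M - E m) sequentially"
    if E: "\<And>m. E m \<in> sets M" "\<And>m. emeasure M (E m) \<le> ennreal ((1/2)^m)" for E
  proof (rule borel_cantelli_AE1)
    show "emeasure M (E m) < \<infinity>" for m
      using E(2)[of m] by (auto intro: le_less_trans[OF _ ennreal_less_top])
    have "measure M (E m) \<le> (1/2)^m" for m
      using E(2)[of m] by (auto simp: measure_def intro!: enn2real_leI)
    then show "summable (\<lambda>m. measure M (E m))"
      by (intro summable_comparison_test'[OF summable_geometric[of "1/2::real"]]) auto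
  qed (use E in auto)
  have lin: "AE x in M. \<forall>m k. T k (d m) x = T k f x - T k (g m) x"
  proof -
    have "AE x in M. T k (d m) x = T k f x - T k (g m) x" for m k
      using T_linear[OF f g(1)[of m], of k 1 "-1"] by (auto simp: d_def[abs_def])
    then show ?thesis by (simp add: AE_all_countable)
  qed
  have "AE x in M. \<forall>m. (\<lambda>k. T k (g m) x) \<longlonglongrightarrow> g m x"
    using g(3) by (simp add: AE_all_countable)
  then show ?thesis
    using AE_space lin bc[of B, OF _ B, simplified] bc[of C, OF _ C, simplified]
  proof (eventually_elim)
    case (elim x)
    show ?case
    proof (rule LIMSEQ_I)
      fix e :: real assume e: "0 < e"
      have "(\<lambda>m. 3 * (1/2::real)^m) \<longlonglongrightarrow> 3 * 0" by (intro tendsto_intros) auto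
      then have "eventually (\<lambda>m. 3 * (1/2::real)^m < e) sequentially"
        using e by (intro order_tendstoD(2)[of _ "3 * 0"]) auto
      with elim have "eventually (\<lambda>m. x \<notin> B m \<and> x \<notin> C m \<and> x \<in> space M \<and> 3 * (1/2::real)^m < e) sequentially"
        by (auto elim: eventually_elim2 simp: eventually_conj_iff)
      then obtain m where m: "x \<notin> B m" "x \<notin> C m" "x \<in> space M" "3 * (1/2::real)^m < e"
        by (auto simp: eventually_sequentially)
      obtain k0 where k0: "\<And>k. k \<ge> k0 \<Longrightarrow> \<bar>T k (g m) x - g m x\<bar> < (1/2)^m"
        using LIMSEQ_D[of "\<lambda>k. T k (g m) x" "g m x" "(1/2)^m"] elim by auto
      have "norm (T k f x - f x) < e" if "k \<ge> k0" for k
      proof -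
        have "\<bar>T k (d m) x\<bar> \<le> (1/2)^m" using m by (auto simp: B_def not_less)
        moreover have "\<bar>f x - g m x\<bar> \<le> (1/2)^m" using m by (auto simp: C_def d_def)
        moreover have "T k (d m) x = T k f x - T k (g m) x" using elim by blast
        ultimately show ?thesis using k0[OF that] m(4) by (auto simp: abs_le_iff abs_less_iff)
      qed
      then show "\<exists>no. \<forall>n\<ge>no. norm (T n f x - f x) < e" by blast
    qed
  qed
qed

text \<open>
  A set of finite measure is approximated by members of the sequence, on which convergence is
  assumed.
\<close>

lemma converges_indicator:
  assumes S: "S \<in> sets M" "emeasure M S < \<infinity>"
  shows "AE x in M. (\<lambda>k. T k (\<lambda>x. indicator S x * c) x) \<longlonglongrightarrow> indicator S x * c"
proof (rule converges_if_approximable)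
  show "integrable M (\<lambda>x. indicator S x * c)" using S by auto
  fix e :: real assume e: "0 < e"
  have "(INF n. emeasure M (sym_diff (A n) S)) < ennreal (e / (1 + \<bar>c\<bar>))"
    using dense S e by (auto simp: dense_sequence_def)
  then obtain n where n: "emeasure M (sym_diff (A n) S) < ennreal (e / (1 + \<bar>c\<bar>))"
    by (auto simp: INF_less_iff)
  have An[measurable]: "A n \<in> sets M" using dense by (auto simp: dense_sequence_def)
  note [measurable] = S(1)
  have "emeasure M (A n) \<le> emeasure M (S \<union> sym_diff (A n) S)" by (intro emeasure_mono) auto
  also have "\<dots> \<le> emeasure M S + emeasure M (sym_diff (A n) S)" by (intro emeasure_subadditive) auto
  also have "\<dots> < \<infinity>" using S n by (auto simp: less_top[symmetric])
  finally have fin: "emeasure M (A n) < \<infinity>" .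
  have int: "integrable M (indicator (A n) :: _ \<Rightarrow> real)" using fin by auto
  have fin': "emeasure M (sym_diff (A n) S) < \<infinity>" using n by (auto intro: less_trans)
  have "(LINT x|M. \<bar>indicator S x * c - indicator (A n) x * c\<bar>) = (LINT x|M. \<bar>c\<bar> * indicator (sym_diff (A n) S) x)"
    by (intro Bochner_Integration.integral_cong) (auto simp: indicator_def)
  also have "\<dots> = \<bar>c\<bar> * measure M (sym_diff (A n) S)" using fin' by simp
  also have "\<dots> \<le> \<bar>c\<bar> * (e / (1 + \<bar>c\<bar>))"
    using n e by (intro mult_left_mono) (auto simp: measure_def intro!: enn2real_leI)
  also have "\<dots> < e" using e by (simp add: field_simps)
  finally have dist: "(LINT x|M. \<bar>indicator S x * c - indicator (A n) x * c\<bar>) < e" .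
  have "AE x in M. \<forall>k. T k (\<lambda>x. indicator (A n) x * c) x = c * T k (indicator (A n)) x"
    using T_linear[OF int int, of _ c 0] by (auto simp: AE_all_countable mult.commute)
  with T_recovers[OF fin] have "AE x in M. (\<lambda>k. T k (\<lambda>x. indicator (A n) x * c) x) \<longlonglongrightarrow> indicator (A n) x * c"
    by eventually_elim (auto simp: mult.commute intro!: tendsto_mult_left)
  with dist int show "\<exists>g. integrable M g \<and> (LINT x|M. \<bar>indicator S x * c - g x\<bar>) < e \<and>
      (AE x in M. (\<lambda>k. T k g x) \<longlonglongrightarrow> g x)"
    by (intro exI[of _ "\<lambda>x. indicator (A n) x * c"]) auto
qed

text \<open>
  The class of functions for which the averages converge contains the indicators of sets of finite
  measure and is closed under sums and \<open>L\<^sup>1\<close> limits.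
\<close>

theorem converges:
  assumes "integrable M f"
  shows "AE x in M. (\<lambda>k. T k f x) \<longlonglongrightarrow> f x"
  using assms
proof (induct rule: integrable_induct)
  case (base S c)
  then show ?case using converges_indicator[of S c] by simp
next
  case (add f g)
  have "AE x in M. \<forall>k. T k (\<lambda>x. f x + g x) x = T k f x + T k g x"
    using T_linear[OF add(1) add(3), of _ 1 1] by (auto simp: AE_all_countable)
  with add(2,4) show ?case
    by eventually_elim (auto intro: tendsto_add)
next
  case (lim f s)
  have L1: "(\<lambda>i. LINT x|M. \<bar>f x - s i x\<bar>) \<longlonglongrightarrow> (LINT x|M. 0)"
  proof (rule integral_dominated_convergence[where w="\<lambda>x. 3 * norm (f x)"])
    show "AE x in M. (\<lambda>i. \<bar>f x - s i x\<bar>) \<longlonglongrightarrow> 0"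
    proof (rule AE_I2)
      fix x assume "x \<in> space M"
      then have "(\<lambda>i. \<bar>f x - s i x\<bar>) \<longlonglongrightarrow> \<bar>f x - f x\<bar>" by (intro tendsto_intros lim)
      then show "(\<lambda>i. \<bar>f x - s i x\<bar>) \<longlonglongrightarrow> 0" by simp
    qed
    show "AE x in M. norm \<bar>f x - s i x\<bar> \<le> 3 * norm (f x)" for i
    proof (rule AE_I2)
      fix x assume "x \<in> space M"
      from lim(4)[OF this, of i] show "norm \<bar>f x - s i x\<bar> \<le> 3 * norm (f x)"
        unfolding real_norm_def by arith
    qed
  qed (use lim in auto)
  show ?case
  proof (rule converges_if_approximable)
    show "integrable M f" using lim by simp
    fix e :: real assume "0 < e"
    then have "eventually (\<lambda>i. (LINT x|M. \<bar>f x - s i x\<bar>) < e) sequentially"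
      using order_tendstoD(2)[OF L1, of e] by simp
    then obtain i where "(LINT x|M. \<bar>f x - s i x\<bar>) < e" by (auto simp: eventually_sequentially)
    with lim show "\<exists>g. integrable M g \<and> (LINT x|M. \<bar>f x - g x\<bar>) < e \<and>
      (AE x in M. (\<lambda>k. T k g x) \<longlonglongrightarrow> g x)" by blast
  qed
qed

end

section \<open>Lebesgue points\<close>

text \<open>
  The atom around a point of the finite \<open>\<sigma>\<close>-algebra generated by the first \<open>k\<close> sets.
\<close>

definition atom :: "'a measure \<Rightarrow> (nat \<Rightarrow> 'a set) \<Rightarrow> nat \<Rightarrow> 'a \<Rightarrow> 'a set" where
  "atom M A k x = {y \<in> space M. \<forall>i<k. y \<in> A i \<longleftrightarrow> x \<in> A i}"

lemma mem_atom: "x \<in> space M \<Longrightarrow> x \<in> atom M A k x"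
  by (simp add: atom_def)

lemma atom_eq: "y \<in> atom M A k x \<Longrightarrow> atom M A k y = atom M A k x"
  by (auto simp: atom_def)

lemma atom_anti: "i \<le> k \<Longrightarrow> atom M A k x \<subseteq> atom M A i x"
  by (auto simp: atom_def)

lemma atom_Suc: "atom M A (Suc k) x = atom M A k x \<inter> (if x \<in> A k then A k else space M - A k)"
  by (auto simp: atom_def less_Suc_eq)

lemma atom_sigma:
  assumes "A ` {..<k} \<subseteq> Pow (space M)"
  shows "atom M A k x \<in> sigma_sets (space M) (A ` {..<k})"
proof -
  interpret sigma_algebra "space M" "sigma_sets (space M) (A ` {..<k})"
    using assms by (rule sigma_algebra_sigma_sets)
  have "atom M A j x \<in> sigma_sets (space M) (A ` {..<k})" if "j \<le> k" for j
    using that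
  proof (induction j)
    case 0
    then show ?case by (simp add: atom_def)
  next
    case (Suc j)
    then have "A j \<in> sigma_sets (space M) (A ` {..<k})" by (intro sigma_sets.Basic) auto
    then have "A j \<in> sigma_sets (space M) (A ` {..<k})" "space M - A j \<in> sigma_sets (space M) (A ` {..<k})"
      by (auto intro: sigma_sets.Compl)
    with Suc show ?case unfolding atom_Suc by auto
  qed
  then show ?thesis by simp
qed

lemma atom_saturated:
  assumes "S \<in> sigma_sets (space M) (A ` {..<k})" "x \<in> S" "x \<in> space M" "y \<in> atom M A k x"
  shows "y \<in> S"
  using assms
proof (induct arbitrary: x y)
  case (Compl S)
  show ?case
  proof
    show "y \<in> space M" using Compl by (auto simp: atom_def)
    show "y \<notin> S"
    proof
      assume "y \<in> S"
      moreover have "x \<in> atom M A k y" using Compl by (auto simp: atom_def)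
      ultimately have "x \<in> S" using Compl(2) \<open>y \<in> space M\<close> by blast
      with Compl show False by auto
    qed
  qed
next
  case (Union S)
  then obtain i where "x \<in> S i" by blast
  then have "y \<in> S i" using Union by blast
  then show ?case by blast
qed (auto simp: atom_def)

lemma finite_atoms: "finite (range (atom M A k))"
proof (rule finite_subset)
  show "range (atom M A k) \<subseteq> (\<lambda>J. {y \<in> space M. \<forall>i<k. y \<in> A i \<longleftrightarrow> i \<in> J}) ` Pow {..<k}"
  proof
    fix E assume "E \<in> range (atom M A k)"
    then obtain x where "E = atom M A k x" by auto
    then have "E = {y \<in> space M. \<forall>i<k. y \<in> A i \<longleftrightarrow> i \<in> {i. i < k \<and> x \<in> A i}}" by (auto simp: atom_def)
    then show "E \<in> (\<lambda>J. {y \<in> space M. \<forall>i<k. y \<in> A i \<longleftrightarrow> i \<in> J}) ` Pow {..<k}"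
      by (rule image_eqI) auto
  qed
qed auto

lemma cells_eq_atoms:
  assumes "range A \<subseteq> sets M"
  shows "cells M A k = atom M A k ` space M"
proof -
  have sub: "A ` {..<k} \<subseteq> Pow (space M)" using assms sets.sets_into_space by blast
  have Sig: "S \<subseteq> space M" if "S \<in> Sigma_k M A k" for S
    using that sigma_sets_into_sp[OF sub] by (auto simp: Sigma_k_def)
  have at: "atom M A k x \<in> Sigma_k M A k" for x
    using atom_sigma[OF sub] by (simp add: Sigma_k_def)
  have sat: "atom M A k x \<subseteq> S" if "S \<in> Sigma_k M A k" "x \<in> S" for S x
    using atom_saturated[of S M A k x] that Sig[OF that(1)] by (auto simp: Sigma_k_def)
  show ?thesis
  proof (intro equalityI subsetI)
    fix E assume E: "E \<in> cells M A k"
    then obtain x where x: "x \<in> E" by (auto simp: cells_def)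
    then have xs: "x \<in> space M" using E Sig by (auto simp: cells_def)
    have "atom M A k x = E"
    proof -
      have "E \<in> Sigma_k M A k" "\<And>F. F \<in> Sigma_k M A k \<Longrightarrow> F \<subseteq> E \<Longrightarrow> F = {} \<or> F = E"
        using E by (auto simp: cells_def)
      then show ?thesis using at[of x] sat[of E x] x mem_atom[OF xs, of A k] by blast
    qed
    then show "E \<in> atom M A k ` space M" using xs by auto
  next
    fix E assume "E \<in> atom M A k ` space M"
    then obtain x where x: "x \<in> space M" "E = atom M A k x" by auto
    have "F = E" if F: "F \<in> Sigma_k M A k" "F \<subseteq> E" "F \<noteq> {}" for F
    proof -
      obtain y where y: "y \<in> F" using F by auto
      then have "atom M A k y = E" using F(2) atom_eq[of y M A k x] unfolding x(2) by blast
      then show ?thesis using sat[OF F(1) y] F by auto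
    qed
    moreover have "E \<in> Sigma_k M A k" "E \<noteq> {}" using x at[of x] mem_atom[OF x(1), of A k] by auto
    ultimately show "E \<in> cells M A k" by (auto simp: cells_def)
  qed
qed

lemma atom_sets [measurable]:
  assumes "range A \<subseteq> sets M"
  shows "atom M A k x \<in> sets M"
proof -
  have A: "A i \<in> sets M" for i using assms by auto
  show ?thesis
  proof (induction k)
    case 0
    then show ?case by (simp add: atom_def)
  next
    case (Suc k)
    have "A k \<in> sets M" "space M - A k \<in> sets M" using A by auto
    with Suc show ?case unfolding atom_Suc by auto
  qed
qed

text \<open>A null cell and a cell of infinite measure both contribute \<open>0\<close>.\<close>

lemma cell_avg_eq:
  assumes A: "range A \<subseteq> sets M" and x: "x \<in> space M"
  shows "cell_avg M A k f x = (1 / measure M (atom M A k x)) * (LINT z:atom M A k x|M. f z)"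
proof -
  let ?a = "\<lambda>E. 1 / measure M E * (LINT z:E|M. f z)"
  have fin: "finite (cells M A k)"
    unfolding cells_eq_atoms[OF A] using finite_atoms[of M A k] by (rule finite_subset[rotated]) auto
  have ind: "indicator E x = (if E = atom M A k x then 1 else 0 :: real)" if "E \<in> cells M A k" for E
  proof (cases "x \<in> E")
    case True
    then have "atom M A k x = E" using that atom_eq[of x M A k] by (auto simp: cells_eq_atoms[OF A])
    then show ?thesis using True by simp
  next
    case False
    then show ?thesis using mem_atom[OF x, of A k] by auto
  qed
  have "cell_avg M A k f x = (\<Sum>E\<in>{E \<in> cells M A k. emeasure M E > 0}. if E = atom M A k x then ?a E else 0)"
    unfolding cell_avg_def by (intro sum.cong) (auto simp: ind)
  also have "\<dots> = (if atom M A k x \<in> {E \<in> cells M A k. emeasure M E > 0} then ?a (atom M A k x) else 0)"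
    using fin by (subst sum.delta) auto
  also have "\<dots> = ?a (atom M A k x)"
    using x by (auto simp: cells_eq_atoms[OF A] measure_def)
  finally show ?thesis .
qed

lemma cell_avg_const_on_atom:
  assumes "range A \<subseteq> sets M" "x \<in> space M" "y \<in> atom M A k x"
  shows "cell_avg M A k f y = cell_avg M A k f x"
proof -
  have "y \<in> space M" using assms by (auto simp: atom_def)
  then show ?thesis using assms by (simp add: cell_avg_eq atom_eq)
qed

lemma cells_measurable:
  assumes "range A \<subseteq> sets M" "E \<in> cells M A k"
  shows "E \<in> sets M"
  using assms by (auto simp: cells_eq_atoms)

lemma cell_avg_measurable [measurable]:
  assumes "range A \<subseteq> sets M"
  shows "cell_avg M A k f \<in> borel_measurable M"
  unfolding cell_avg_def using cells_measurable[OF assms]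
  by (intro borel_measurable_sum borel_measurable_times borel_measurable_indicator) auto

lemma set_integrable_atom:
  fixes f :: "'a \<Rightarrow> real"
  assumes "range A \<subseteq> sets M" "integrable M f"
  shows "set_integrable M (atom M A k x) f"
  unfolding set_integrable_def by (rule integrable_mult_indicator[OF atom_sets[OF assms(1)] assms(2)])

text \<open>
  The averages of index at most \<open>k\<close> are constant on the atoms of level \<open>k\<close>, so that the set where
  the average of index \<open>k\<close> is the first large one is a union of such atoms.
\<close>

lemma cell_avg_maximal:
  fixes f :: "'a \<Rightarrow> real"
  assumes A: "range A \<subseteq> sets M" and f: "integrable M f" and l: "0 < l"
  shows "ennreal l * emeasure M (\<Union>k. {x \<in> space M. l < \<bar>cell_avg M A k f x\<bar>}) \<le> (\<integral>\<^sup>+x. ennreal \<bar>f x\<bar> \<partial>M)"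
proof (rule maximal_inequality[OF refl])
  fix k
  define G where "G k = {x \<in> space M. l < \<bar>cell_avg M A k f x\<bar>}" for k
  define D where "D = disjointed G k"
  let ?N = "density M (\<lambda>x. ennreal \<bar>f x\<bar>)"
  have [measurable]: "f \<in> borel_measurable M" using f by auto
  have sat: "atom M A k x \<subseteq> D" if x: "x \<in> D" for x
  proof
    fix y assume y: "y \<in> atom M A k x"
    have xs: "x \<in> space M" using x by (auto simp: D_def disjointed_def G_def)
    have "y \<in> G i \<longleftrightarrow> x \<in> G i" if "i \<le> k" for i
      using cell_avg_const_on_atom[OF A xs, of y i f] y atom_anti[OF that, of M A x] xs
      by (auto simp: G_def atom_def)
    with x show "y \<in> D" by (auto simp: D_def disjointed_def)
  qed
  have Dsp: "D \<subseteq> space M" by (auto simp: D_def disjointed_def G_def)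
  define P where "P = atom M A k ` D"
  have P: "finite P" unfolding P_def by (rule finite_subset[OF _ finite_atoms[of M A k]]) auto
  have UP: "D = \<Union>P" using sat mem_atom Dsp by (fastforce simp: P_def)
  have disj: "disjoint_family_on (\<lambda>E. E) P"
    unfolding disjoint_family_on_def P_def using atom_eq[of _ M A k] by blast
  have Pm: "(\<lambda>E. E) ` P \<subseteq> sets M" using A by (auto simp: P_def)
  have each: "ennreal l * emeasure M E \<le> emeasure ?N E" if "E \<in> P" for E
  proof -
    from that obtain x where x: "x \<in> D" "E = atom M A k x" unfolding P_def image_iff by blast
    then have xs: "x \<in> space M" and "x \<in> G k" using Dsp by (auto simp: D_def disjointed_def)
    then have avg: "l < \<bar>1 / measure M E * (LINT z:E|M. f z)\<bar>"
      using cell_avg_eq[OF A xs] x by (auto simp: G_def)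
    have mpos: "0 < measure M E"
      using avg l by (metis abs_zero div_by_0 measure_nonneg mult_zero_left order_less_le order_less_asym)
    then have fin: "emeasure M E = ennreal (measure M E)"
      by (metis emeasure_eq_ennreal_measure measure_def enn2real_top less_irrefl)
    have Em: "E \<in> sets M" using x A by auto
    have int: "set_integrable M E f" using set_integrable_atom[OF A f] x by simp
    have "l * measure M E < \<bar>LINT z:E|M. f z\<bar>"
      using avg mpos by (simp add: abs_mult field_simps)
    also have "\<dots> \<le> (LINT z:E|M. \<bar>f z\<bar>)"
      using set_integral_norm_bound[OF int] by simp
    finally have "l * measure M E \<le> (LINT z:E|M. \<bar>f z\<bar>)" by simp
    then have "ennreal l * emeasure M E \<le> ennreal (LINT z:E|M. \<bar>f z\<bar>)"
      using l by (simp add: fin ennreal_mult[symmetric] ennreal_leI)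
    also have "\<dots> = (\<integral>\<^sup>+z. ennreal (indicator E z * \<bar>f z\<bar>) \<partial>M)"
    proof -
      have "integrable M (\<lambda>z. indicator E z * \<bar>f z\<bar>)"
        using set_integrable_abs[OF int] by (simp add: set_integrable_def)
      then show ?thesis unfolding set_lebesgue_integral_def
        by (subst nn_integral_eq_integral) auto
    qed
    also have "\<dots> = emeasure ?N E" using Em
      by (subst emeasure_density) (auto intro!: nn_integral_cong simp: indicator_def)
    finally show ?thesis .
  qed
  have "ennreal l * emeasure M D = ennreal l * (\<Sum>E\<in>P. emeasure M E)"
    using sum_emeasure[OF Pm disj P] UP by simp
  also have "\<dots> \<le> (\<Sum>E\<in>P. emeasure ?N E)"
    unfolding sum_distrib_left by (intro sum_mono each)
  also have "\<dots> = emeasure ?N D"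
    using sum_emeasure[of "\<lambda>E. E" P ?N] Pm disj P UP by simp
  finally show "ennreal l * emeasure M (disjointed (\<lambda>k. {x \<in> space M. l < \<bar>cell_avg M A k f x\<bar>}) k)
      \<le> emeasure ?N (disjointed (\<lambda>k. {x \<in> space M. l < \<bar>cell_avg M A k f x\<bar>}) k)"
    by (simp add: D_def G_def[abs_def])
qed (use A f in auto)

lemma AE_atom_pos:
  assumes A: "range A \<subseteq> sets M"
  shows "AE x in M. \<forall>k. emeasure M (atom M A k x) > 0"
proof -
  have "AE x in M. emeasure M (atom M A k x) > 0" for k
  proof (rule AE_I')
    let ?Z = "{E \<in> range (atom M A k). emeasure M E = 0}"
    have "finite ?Z" using finite_atoms[of M A k] by auto
    then show "\<Union>?Z \<in> null_sets M"
      using A by (intro null_sets_UN'[of ?Z "\<lambda>E. E", simplified]) (auto simp: countable_finite)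
    show "{x \<in> space M. \<not> emeasure M (atom M A k x) > 0} \<subseteq> \<Union>?Z"
      using mem_atom by (force simp: not_gr_zero)
  qed
  then show ?thesis by (simp add: AE_all_countable)
qed

text \<open>
  If \<open>A n\<close> has finite measure, the averages over cells reproduce its indicator from index \<open>n + 1\<close> on, at
  every point whose atoms have positive measure.
\<close>

lemma averaging_cell_avg:
  assumes "dense_sequence M A"
  shows "averaging M A (cell_avg M A)"
proof
  have A: "range A \<subseteq> sets M" using assms by (simp add: dense_sequence_def)
  show "dense_sequence M A" by fact
  show "cell_avg M A k f \<in> borel_measurable M" for k and f :: "_ \<Rightarrow> real" using A by simp
  show "ennreal l * emeasure M (\<Union>k. {x \<in> space M. l < \<bar>cell_avg M A k f x\<bar>}) \<le> (\<integral>\<^sup>+x. ennreal \<bar>f x\<bar> \<partial>M)"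
    if "integrable M f" "0 < l" for f l using cell_avg_maximal[OF A that] .
  show "AE x in M. cell_avg M A k (\<lambda>x. a * f x + b * g x) x = a * cell_avg M A k f x + b * cell_avg M A k g x"
    if "integrable M f" "integrable M g" for f g a b k
    using set_integrable_atom[OF A that(1)] set_integrable_atom[OF A that(2)]
    by (intro AE_I2) (simp add: cell_avg_eq[OF A] distrib_left)
  show "AE x in M. (\<lambda>k. cell_avg M A k (indicator (A n)) x) \<longlonglongrightarrow> indicator (A n) x"
    if fin: "emeasure M (A n) < \<infinity>" for n
    using AE_atom_pos[OF A] AE_space
  proof eventually_elim
    case (elim x)
    have "cell_avg M A k (indicator (A n)) x = indicator (A n) x" if "n < k" for k
    proof (cases "x \<in> A n")
      case True
      then have sub: "atom M A k x \<subseteq> A n" using that by (auto simp: atom_def)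
      then have "emeasure M (atom M A k x) < \<infinity>"
        using fin A emeasure_mono[of "atom M A k x" "A n" M] by (auto intro: le_less_trans)
      then have "measure M (atom M A k x) > 0"
        using elim by (simp add: measure_def enn2real_positive_iff)
      moreover have "(LINT z:atom M A k x|M. indicator (A n) z :: real) = measure M (atom M A k x)"
      proof -
        have "(LINT z:atom M A k x|M. indicator (A n) z :: real) = (LINT z|M. indicator (atom M A k x) z)"
          unfolding set_lebesgue_integral_def using sub
          by (intro Bochner_Integration.integral_cong) (auto simp: indicator_def)
        then show ?thesis using A by (simp add: Int_absorb2 sets.sets_into_space)
      qed
      ultimately show ?thesis using True elim by (simp add: cell_avg_eq[OF A])
    next
      case False
      then have "atom M A k x \<inter> A n = {}" using that by (auto simp: atom_def)
      then have "(LINT z:atom M A k x|M. indicator (A n) z :: real) = (LINT z|M. 0)"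
        unfolding set_lebesgue_integral_def
        by (intro Bochner_Integration.integral_cong) (auto simp: indicator_def)
      then show ?thesis using False elim by (simp add: cell_avg_eq[OF A])
    qed
    then show ?case
      by (intro tendsto_eventually) (auto simp: eventually_sequentially intro!: exI[of _ "Suc n"])
  qed
qed

theorem Lebesgue_differentiation:
  assumes "dense_sequence M A" "integrable M f"
  shows "AE x in M. (\<lambda>k. cell_avg M A k f x) \<longlonglongrightarrow> f x"
proof -
  interpret averaging M A "cell_avg M A" using assms(1) by (rule averaging_cell_avg)
  show ?thesis using assms(2) by (rule converges)
qed

text \<open>
  A set of finite measure is approximated by members of the sequence, and the members of infinite
  measure are infinitely far from it.
\<close>

lemma AE_in_finite_set_of_sequence:
  assumes "sigma_finite_measure M" and dense: "dense_sequence M A"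
  shows "AE x in M. \<exists>n. x \<in> A n \<and> emeasure M (A n) < \<infinity>"
proof -
  interpret sigma_finite_measure M by fact
  obtain B :: "nat \<Rightarrow> 'a set" where B: "range B \<subseteq> sets M" "(\<Union>i. B i) = space M" "\<And>i. emeasure M (B i) \<noteq> \<infinity>"
    using sigma_finite by metis
  have A: "range A \<subseteq> sets M" using dense by (simp add: dense_sequence_def)
  let ?U = "\<Union>n\<in>{n. emeasure M (A n) < \<infinity>}. A n"
  have U: "?U \<in> sets M" using A by (intro sets.countable_UN'') auto
  have "B i - ?U \<in> null_sets M" for i
  proof -
    have "emeasure M (B i - ?U) \<le> emeasure M (sym_diff (A n) (B i))" for n
    proof (cases "emeasure M (A n) < \<infinity>")
      case True
      then show ?thesis using A B U by (intro emeasure_mono) auto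
    next
      case False
      have "emeasure M (A n) \<le> emeasure M (B i \<union> sym_diff (A n) (B i))"
        using A B by (intro emeasure_mono sets.Un sets.Diff) auto
      also have "\<dots> \<le> emeasure M (B i) + emeasure M (sym_diff (A n) (B i))"
        using A B by (intro emeasure_subadditive sets.Un sets.Diff) auto
      finally have "emeasure M (sym_diff (A n) (B i)) = \<infinity>"
        using False B(3)[of i] by (auto simp: less_top[symmetric] top_unique)
      then show ?thesis by simp
    qed
    then have "emeasure M (B i - ?U) \<le> (INF n. emeasure M (sym_diff (A n) (B i)))" by (rule INF_greatest)
    also have "\<dots> = 0" using dense B by (auto simp: dense_sequence_def less_top[symmetric])
    finally show ?thesis using U B by (auto simp: null_sets_def)
  qed
  then have "(\<Union>i. B i - ?U) \<in> null_sets M" by (intro null_sets_UN) auto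
  then show ?thesis
    by (rule AE_I') (use B(2) in auto)
qed

text \<open>Near almost every point the averages only see a set of finite measure.\<close>

lemma Lebesgue_differentiation_local:
  fixes f :: "'a \<Rightarrow> real"
  assumes "sigma_finite_measure M" and dense: "dense_sequence M A"
    and loc: "\<And>S. S \<in> sets M \<Longrightarrow> emeasure M S < \<infinity> \<Longrightarrow> set_integrable M S f"
  shows "AE x in M. (\<lambda>k. cell_avg M A k f x) \<longlonglongrightarrow> f x"
proof -
  have A: "range A \<subseteq> sets M" using dense by (simp add: dense_sequence_def)
  have "AE x in M. emeasure M (A n) < \<infinity> \<longrightarrow> (\<lambda>k. cell_avg M A k (\<lambda>x. indicator (A n) x * f x) x) \<longlonglongrightarrow> indicator (A n) x * f x" for n
    using Lebesgue_differentiation[OF dense, of "\<lambda>x. indicator (A n) x * f x"] loc[of "A n"] A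
    by (cases "emeasure M (A n) < \<infinity>") (auto simp: set_integrable_def)
  then have "AE x in M. \<forall>n. emeasure M (A n) < \<infinity> \<longrightarrow> (\<lambda>k. cell_avg M A k (\<lambda>x. indicator (A n) x * f x) x) \<longlonglongrightarrow> indicator (A n) x * f x"
    by (simp add: AE_all_countable)
  then show ?thesis using AE_in_finite_set_of_sequence[OF assms(1) dense] AE_space
  proof eventually_elim
    case (elim x)
    then obtain n where n: "x \<in> A n" "emeasure M (A n) < \<infinity>" by auto
    then have lim: "(\<lambda>k. cell_avg M A k (\<lambda>x. indicator (A n) x * f x) x) \<longlonglongrightarrow> f x" using elim by auto
    have "cell_avg M A k (\<lambda>x. indicator (A n) x * f x) x = cell_avg M A k f x" if "k > n" for k
    proof -
      have "atom M A k x \<subseteq> A n" using n that by (auto simp: atom_def)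
      then have "(LINT z:atom M A k x|M. indicator (A n) z * f z) = (LINT z:atom M A k x|M. f z)"
        unfolding set_lebesgue_integral_def
        by (intro Bochner_Integration.integral_cong) (auto simp: indicator_def)
      then show ?thesis using elim by (simp add: cell_avg_eq[OF A])
    qed
    then have "eventually (\<lambda>k. cell_avg M A k (\<lambda>x. indicator (A n) x * f x) x = cell_avg M A k f x) sequentially"
      by (auto simp: eventually_sequentially intro!: exI[of _ "Suc n"])
    then show ?case using lim by (rule Lim_transform_eventually[rotated])
  qed
qed

lemma AE_Leb_Rep:
  assumes "dense_sequence M A" "integrable M f"
  shows "AE x in M. x \<in> Leb M A f \<and> Rep M A f x = f x"
  using Lebesgue_differentiation[OF assms] AE_space
proof eventually_elim
  case (elim x)
  then show ?case by (auto simp: Leb_def Rep_def convergent_def intro: limI)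
qed

section \<open>Linear spans\<close>

locale scalar_module = Module.module R M
  for R :: "'a ring" and M :: "('a, 'v, 'z) module_scheme" (structure)
begin

lemma lin_span_incl:
  assumes "S \<subseteq> carrier M" "s \<in> S"
  shows "s \<in> lin_span R M S"
proof -
  have "s = (\<Oplus>t\<in>{s}. \<one>\<^bsub>R\<^esub> \<odot> t)" using assms by (subst M.finsum_insert) auto
  then show ?thesis unfolding lin_span_def using assms
    by (intro CollectI exI[of _ "{s}"] exI[of _ "\<lambda>_. \<one>\<^bsub>R\<^esub>"]) auto
qed

lemma lin_span_add:
  assumes S: "S \<subseteq> carrier M" and "x \<in> lin_span R M S" "y \<in> lin_span R M S"
  shows "x \<oplus> y \<in> lin_span R M S"
proof -
  obtain F c where F: "finite F" "F \<subseteq> S" "c \<in> F \<rightarrow> carrier R" "x = (\<Oplus>s\<in>F. c s \<odot> s)"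
    using assms(2) by (auto simp: lin_span_def)
  obtain G d where G: "finite G" "G \<subseteq> S" "d \<in> G \<rightarrow> carrier R" "y = (\<Oplus>s\<in>G. d s \<odot> s)"
    using assms(3) by (auto simp: lin_span_def)
  define c' where "c' s = (if s \<in> F then c s else \<zero>\<^bsub>R\<^esub>)" for s
  define d' where "d' s = (if s \<in> G then d s else \<zero>\<^bsub>R\<^esub>)" for s
  have c': "c' s \<in> carrier R" "d' s \<in> carrier R" for s using F G by (auto simp: c'_def d'_def)
  have sc: "s \<in> carrier M" if "s \<in> F \<union> G" for s using that F G S by auto
  have cd: "s \<in> F \<Longrightarrow> c s \<in> carrier R" "s \<in> G \<Longrightarrow> d s \<in> carrier R" for s using F G by auto
  have x: "x = (\<Oplus>s\<in>F \<union> G. c' s \<odot> s)"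
    unfolding F(4)
    by (rule M.add.finprod_mono_neutral_cong_left) (use F G c' sc cd in \<open>auto simp: c'_def\<close>)
  have y: "y = (\<Oplus>s\<in>F \<union> G. d' s \<odot> s)"
    unfolding G(4)
    by (rule M.add.finprod_mono_neutral_cong_left) (use F G c' sc cd in \<open>auto simp: d'_def\<close>)
  have "x \<oplus> y = (\<Oplus>s\<in>F \<union> G. c' s \<odot> s \<oplus> d' s \<odot> s)"
    unfolding x y using c' sc by (subst M.finsum_addf) auto
  also have "\<dots> = (\<Oplus>s\<in>F \<union> G. (c' s \<oplus>\<^bsub>R\<^esub> d' s) \<odot> s)"
    using c' sc by (intro M.finsum_cong') (auto simp: smult_l_distr)
  finally show ?thesis unfolding lin_span_def using F G c'
    by (intro CollectI exI[of _ "F \<union> G"] exI[of _ "\<lambda>s. c' s \<oplus>\<^bsub>R\<^esub> d' s"]) auto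
qed

lemma lin_span_smult:
  assumes S: "S \<subseteq> carrier M" and "a \<in> carrier R" "x \<in> lin_span R M S"
  shows "a \<odot> x \<in> lin_span R M S"
proof -
  obtain F c where F: "finite F" "F \<subseteq> S" "c \<in> F \<rightarrow> carrier R" "x = (\<Oplus>s\<in>F. c s \<odot> s)"
    using assms(3) by (auto simp: lin_span_def)
  have sc: "s \<in> carrier M" "c s \<in> carrier R" if "s \<in> F" for s using that F S by auto
  have "a \<odot> x = (\<Oplus>s\<in>F. a \<odot> (c s \<odot> s))"
    unfolding F(4) using sc assms(2) F(1) by (intro finsum_smult_ldistr) auto
  also have "\<dots> = (\<Oplus>s\<in>F. (a \<otimes>\<^bsub>R\<^esub> c s) \<odot> s)"
    using sc assms(2) by (intro M.finsum_cong') (auto simp: smult_assoc1)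
  finally show ?thesis unfolding lin_span_def using F assms(2)
    by (intro CollectI exI[of _ F] exI[of _ "\<lambda>s. a \<otimes>\<^bsub>R\<^esub> c s"]) auto
qed

lemma lin_span_least:
  assumes S: "S \<subseteq> carrier M" and "\<zero> \<in> K"
    and add: "\<And>x y. x \<in> K \<Longrightarrow> y \<in> K \<Longrightarrow> x \<oplus> y \<in> K"
    and smult: "\<And>a s. a \<in> carrier R \<Longrightarrow> s \<in> S \<Longrightarrow> a \<odot> s \<in> K"
  shows "lin_span R M S \<subseteq> K"
proof
  fix x assume "x \<in> lin_span R M S"
  then obtain F c where F: "finite F" "F \<subseteq> S" "c \<in> F \<rightarrow> carrier R" "x = (\<Oplus>s\<in>F. c s \<odot> s)"
    by (auto simp: lin_span_def)
  have "(\<Oplus>s\<in>F. c s \<odot> s) \<in> K" using F(1,2,3)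
  proof (induction F rule: finite_induct)
    case empty
    then show ?case using assms by simp
  next
    case (insert s F)
    have "(\<Oplus>s\<in>insert s F. c s \<odot> s) = c s \<odot> s \<oplus> (\<Oplus>s\<in>F. c s \<odot> s)"
      using insert S by (intro M.finsum_insert) (auto simp: subset_iff)
    then show ?case using insert add smult by auto
  qed
  then show "x \<in> K" using F by simp
qed

lemma lin_span_zero: "\<zero> \<in> lin_span R M S"
  unfolding lin_span_def by (intro CollectI exI[of _ "{}"] exI[of _ "\<lambda>_. \<zero>\<^bsub>R\<^esub>"]) auto

lemma lin_span_carrier: "S \<subseteq> carrier M \<Longrightarrow> lin_span R M S \<subseteq> carrier M"
  by (rule lin_span_least) auto

lemma finsum_lessThan_Suc:
  assumes "\<And>i. i < Suc n \<Longrightarrow> f i \<in> carrier M"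
  shows "(\<Oplus>i\<in>{..<Suc n}. f i) = f n \<oplus> (\<Oplus>i\<in>{..<n}. f i)"
  using assms unfolding lessThan_Suc by (intro M.finsum_insert) auto

end

section \<open>Seminormed spaces and their completions\<close>

lemma real_ring_simps [simp]:
  "carrier real_ring = UNIV" "a \<otimes>\<^bsub>real_ring\<^esub> b = a * b" "a \<oplus>\<^bsub>real_ring\<^esub> b = a + b"
  "\<one>\<^bsub>real_ring\<^esub> = 1" "\<zero>\<^bsub>real_ring\<^esub> = 0"
  by (auto simp: real_ring_def)

lemma cring_real_ring: "cring real_ring"
  by (intro cringI abelian_groupI comm_monoidI)
    (auto simp: algebra_simps intro: exI[of _ "- _"])

lemma real_ring_minus [simp]: "\<ominus>\<^bsub>real_ring\<^esub> a = - a"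
proof -
  interpret cring real_ring by (rule cring_real_ring)
  show ?thesis by (rule minus_equality) auto
qed

locale seminormed_space =
  fixes V :: "(real, 'v) nmodule" (structure)
  assumes module_V: "Module.module real_ring V"
    and nrm_nonneg: "\<And>u. u \<in> carrier V \<Longrightarrow> 0 \<le> nrm V u"
    and nrm_scale: "\<And>c u. u \<in> carrier V \<Longrightarrow> nrm V (c \<odot>\<^bsub>V\<^esub> u) = \<bar>c\<bar> * nrm V u"
    and nrm_triangle: "\<And>u v. u \<in> carrier V \<Longrightarrow> v \<in> carrier V \<Longrightarrow> nrm V (u \<oplus>\<^bsub>V\<^esub> v) \<le> nrm V u + nrm V v"
begin

sublocale V: scalar_module real_ring V unfolding scalar_module_def by (rule module_V)

lemma smult_closed' [simp, intro]: "u \<in> carrier V \<Longrightarrow> c \<odot> u \<in> carrier V"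
  by (rule V.smult_closed) auto

lemma smult_simps:
  assumes "u \<in> carrier V"
  shows "(a + b) \<odot> u = a \<odot> u \<oplus> b \<odot> u"
    "v \<in> carrier V \<Longrightarrow> a \<odot> (u \<oplus> v) = a \<odot> u \<oplus> a \<odot> v"
    "a \<odot> (b \<odot> u) = (a * b) \<odot> u"
    "1 \<odot> u = u" "0 \<odot> u = \<zero>" "(-1) \<odot> u = \<ominus> u"
  using assms V.smult_l_distr[of a b u] V.smult_r_distr[of a u v] V.smult_assoc1[of a b u]
    V.smult_one[of u] V.smult_l_null[of u] V.smult_l_minus[of 1 u] by auto

lemma nrm_zero [simp]: "nrm V \<zero> = 0"
  using nrm_scale[of "\<zero>" 0] by (simp add: smult_simps)

lemma nrm_minus [simp]: "u \<in> carrier V \<Longrightarrow> nrm V (\<ominus> u) = nrm V u"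
  using nrm_scale[of u "-1"] smult_simps(6)[of u] by simp

lemma diff_trans:
  assumes "u \<in> carrier V" "v \<in> carrier V" "w \<in> carrier V"
  shows "u \<ominus> w = (u \<ominus> v) \<oplus> (v \<ominus> w)"
  using assms by (simp add: a_minus_def V.a_assoc V.r_neg1 V.a_lcomm[of "\<ominus> v"] V.l_neg V.r_neg2)

lemma diff_add:
  assumes "a \<in> carrier V" "b \<in> carrier V" "c \<in> carrier V" "d \<in> carrier V"
  shows "(a \<oplus> b) \<ominus> (c \<oplus> d) = (a \<ominus> c) \<oplus> (b \<ominus> d)"
  using assms by (simp add: a_minus_def V.minus_add V.a_ac)

lemma diff_scale:
  assumes "u \<in> carrier V" "v \<in> carrier V"
  shows "c \<odot> u \<ominus> c \<odot> v = c \<odot> (u \<ominus> v)"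
proof -
  have "\<ominus> (c \<odot> v) = c \<odot> (\<ominus> v)"
    using assms smult_simps(3)[of v "-1" c] smult_simps(3)[of v c "-1"]
      smult_simps(6)[of v] smult_simps(6)[of "c \<odot> v"] by (metis mult.commute smult_closed')
  then show ?thesis using assms by (simp add: a_minus_def smult_simps)
qed

lemma diff_scale_left:
  assumes "u \<in> carrier V"
  shows "a \<odot> u \<ominus> b \<odot> u = (a - b) \<odot> u"
  using assms smult_simps(1)[of u a "-b"] smult_simps(3)[of u "-1" b] smult_simps(6)[of "b \<odot> u"]
  by (simp add: a_minus_def)

lemma diff_self [simp]: "u \<in> carrier V \<Longrightarrow> u \<ominus> u = \<zero>"
  by (simp add: a_minus_def V.r_neg)

lemma diff_zero [simp]: "u \<in> carrier V \<Longrightarrow> u \<ominus> \<zero> = u"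
  by (simp add: a_minus_def)

lemma diff_flip: "u \<in> carrier V \<Longrightarrow> v \<in> carrier V \<Longrightarrow> \<ominus> (u \<ominus> v) = v \<ominus> u"
  by (simp add: a_minus_def V.minus_add V.a_comm)

lemma add_diff: "u \<in> carrier V \<Longrightarrow> v \<in> carrier V \<Longrightarrow> v \<oplus> (u \<ominus> v) = u"
  by (simp add: a_minus_def V.a_lcomm[of v] V.r_neg)

lemma diff_closed [simp]: "u \<in> carrier V \<Longrightarrow> v \<in> carrier V \<Longrightarrow> u \<ominus> v \<in> carrier V"
  by (rule V.minus_closed)

lemma diff_zero_eq: "u \<in> carrier V \<Longrightarrow> v \<in> carrier V \<Longrightarrow> u \<ominus> v = \<zero> \<Longrightarrow> u = v"
  using add_diff[of u v] by simp

lemma nrm_flip: "u \<in> carrier V \<Longrightarrow> v \<in> carrier V \<Longrightarrow> nrm V (u \<ominus> v) = nrm V (v \<ominus> u)"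
  using nrm_minus[of "u \<ominus> v"] diff_flip[of u v] by simp

lemma nrm_diff_triangle:
  "u \<in> carrier V \<Longrightarrow> v \<in> carrier V \<Longrightarrow> w \<in> carrier V \<Longrightarrow>
    nrm V (u \<ominus> w) \<le> nrm V (u \<ominus> v) + nrm V (v \<ominus> w)"
  using nrm_triangle[of "u \<ominus> v" "v \<ominus> w"] diff_trans[of u v w] by simp

lemma nrm_reverse_triangle:
  assumes "u \<in> carrier V" "v \<in> carrier V"
  shows "\<bar>nrm V u - nrm V v\<bar> \<le> nrm V (u \<ominus> v)"
  using nrm_diff_triangle[of u v "\<zero>"] nrm_diff_triangle[of v u "\<zero>"] nrm_flip[of u v] assms by auto

lemma nrm_finsum:
  assumes "\<And>i. i < n \<Longrightarrow> u i \<in> carrier V"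
  shows "nrm V (\<Oplus>i\<in>{..<n::nat}. u i) \<le> (\<Sum>i<n. nrm V (u i))"
  using assms
proof (induction n)
  case (Suc n)
  have "(\<Oplus>i\<in>{..<Suc n}. u i) = u n \<oplus> (\<Oplus>i\<in>{..<n}. u i)"
    using Suc.prems unfolding lessThan_Suc by (intro V.finsum_insert) auto
  then show ?case
    using Suc nrm_triangle[of "u n" "\<Oplus>i\<in>{..<n}. u i"] V.finsum_closed[of u "{..<n}"]
    by (force simp: Pi_def)
qed simp

lemma linear_diff:
  fixes l :: "'v \<Rightarrow> real"
  assumes add: "\<And>u v. u \<in> carrier V \<Longrightarrow> v \<in> carrier V \<Longrightarrow> l (u \<oplus> v) = l u + l v"
    and scale: "\<And>c u. u \<in> carrier V \<Longrightarrow> l (c \<odot> u) = c * l u"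
    and "u \<in> carrier V" "v \<in> carrier V"
  shows "l (u \<ominus> v) = l u - l v"
  using assms(3,4) add[of u "\<ominus> v"] scale[of v "-1"] smult_simps(6)[of v] by (simp add: a_minus_def)

end

text \<open>
  Homogeneity follows from its upper half, applied to \<open>c\<close> and to \<open>1 / c\<close>.
\<close>

lemma seminormed_spaceI:
  assumes module: "Module.module real_ring V"
    and nonneg: "\<And>u. u \<in> carrier V \<Longrightarrow> 0 \<le> nrm V u"
    and scale: "\<And>c u. u \<in> carrier V \<Longrightarrow> nrm V (c \<odot>\<^bsub>V\<^esub> u) \<le> \<bar>c\<bar> * nrm V u"
    and triangle: "\<And>u v. u \<in> carrier V \<Longrightarrow> v \<in> carrier V \<Longrightarrow> nrm V (u \<oplus>\<^bsub>V\<^esub> v) \<le> nrm V u + nrm V v"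
  shows "seminormed_space V"
proof (rule seminormed_space.intro[OF module nonneg _ triangle])
  interpret Module.module real_ring V by (rule module)
  fix c u assume u: "u \<in> carrier V"
  have cl: "c \<odot>\<^bsub>V\<^esub> u \<in> carrier V" for c using u by (intro smult_closed) auto
  show "nrm V (c \<odot>\<^bsub>V\<^esub> u) = \<bar>c\<bar> * nrm V u"
  proof (cases "c = 0")
    case True
    then show ?thesis using scale[OF u, of 0] nonneg[OF cl, of 0] by simp
  next
    case False
    have "(1/c) \<odot>\<^bsub>V\<^esub> (c \<odot>\<^bsub>V\<^esub> u) = u" using smult_assoc1[of "1/c" c u] smult_one[of u] u False by simp
    then have "nrm V u \<le> \<bar>1/c\<bar> * nrm V (c \<odot>\<^bsub>V\<^esub> u)" using scale[OF cl[of c], of "1/c"] by simp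
    then have "\<bar>c\<bar> * nrm V u \<le> nrm V (c \<odot>\<^bsub>V\<^esub> u)" using False by (simp add: field_simps)
    with scale[OF u, of c] show ?thesis by simp
  qed
qed

locale normed_space = seminormed_space V for V :: "(real, 'v) nmodule" (structure) +
  assumes nrm_zero_imp: "\<And>u. u \<in> carrier V \<Longrightarrow> nrm V u = 0 \<Longrightarrow> u = \<zero>\<^bsub>V\<^esub>"
begin

sublocale metric: Metric_space "carrier V" "ndist V"
proof
  show "0 \<le> ndist V x y" for x y by (auto simp: ndist_def nrm_nonneg)
  show "ndist V x y = ndist V y x" for x y by (auto simp: ndist_def intro: nrm_flip)
  show "(ndist V x y = 0) = (x = y)" if "x \<in> carrier V" "y \<in> carrier V" for x y
    using that nrm_zero_imp[of "x \<ominus> y"] diff_zero_eq[of x y] by (auto simp: ndist_def)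
  show "ndist V x z \<le> ndist V x y + ndist V y z" if "x \<in> carrier V" "y \<in> carrier V" "z \<in> carrier V" for x y z
    using that nrm_diff_triangle[of x y z] by (auto simp: ndist_def)
qed

lemma continuous_functional:
  fixes l :: "'v \<Rightarrow> real"
  assumes add: "\<And>u v. u \<in> carrier V \<Longrightarrow> v \<in> carrier V \<Longrightarrow> l (u \<oplus> v) = l u + l v"
    and scale: "\<And>c u. u \<in> carrier V \<Longrightarrow> l (c \<odot> u) = c * l u"
    and bound: "\<And>u. u \<in> carrier V \<Longrightarrow> \<bar>l u\<bar> \<le> K * nrm V u"
  shows "continuous_map (ntopology V) euclideanreal l"
proof -
  have "continuous_map metric.mtopology Met_TC.mtopology l"
  proof (subst metric.metric_continuous_map[OF Met_TC.Metric_space_axioms], intro conjI ballI allI impI)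
    fix a e :: real and u assume u: "u \<in> carrier V" and e: "0 < (e::real)"
    show "\<exists>d>0. \<forall>x. x \<in> carrier V \<and> ndist V u x < d \<longrightarrow> dist (l u) (l x) < e"
    proof (intro exI[of _ "e / (\<bar>K\<bar> + 1)"] conjI allI impI)
      show "0 < e / (\<bar>K\<bar> + 1)" using e by simp
      fix x assume x: "x \<in> carrier V \<and> ndist V u x < e / (\<bar>K\<bar> + 1)"
      have "dist (l u) (l x) = \<bar>l (u \<ominus> x)\<bar>"
        using linear_diff[of l u x] add scale u x by (simp add: dist_real_def)
      also have "\<dots> \<le> K * nrm V (u \<ominus> x)" using bound u x by simp
      also have "\<dots> \<le> (\<bar>K\<bar> + 1) * nrm V (u \<ominus> x)"
        using u x by (intro mult_right_mono) (auto simp: nrm_nonneg)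
      also have "\<dots> < e" using conjunct1[OF x] conjunct2[OF x] u by (simp add: ndist_def field_simps)
      finally show "dist (l u) (l x) < e" .
    qed
  qed auto
  then show ?thesis by (simp add: ntopology_def)
qed

text \<open>
  Continuity at the origin bounds the map on a small ball, and homogeneity spreads the bound.
\<close>

lemma continuous_linear_bounded:
  assumes "normed_space W" and T: "T \<in> carrier V \<rightarrow> carrier W"
    and add: "\<And>u v. u \<in> carrier V \<Longrightarrow> v \<in> carrier V \<Longrightarrow> T (u \<oplus> v) = T u \<oplus>\<^bsub>W\<^esub> T v"
    and scale: "\<And>c u. u \<in> carrier V \<Longrightarrow> T (c \<odot> u) = c \<odot>\<^bsub>W\<^esub> T u"
  shows "continuous_map (ntopology V) (ntopology W) T \<longleftrightarrow> (\<exists>K. \<forall>u\<in>carrier V. nrm W (T u) \<le> K * nrm V u)"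
proof -
  interpret W: normed_space W by fact
  have Tc: "T u \<in> carrier W" if "u \<in> carrier V" for u using T that by auto
  have diff: "T (u \<ominus> v) = T u \<ominus>\<^bsub>W\<^esub> T v" if "u \<in> carrier V" "v \<in> carrier V" for u v
    using that add[of u "\<ominus> v"] scale[of v "-1"] smult_simps(6)[of v] W.smult_simps(6)[of "T v"] Tc
    by (simp add: a_minus_def)
  have T0: "T \<zero> = \<zero>\<^bsub>W\<^esub>"
    using scale[of "\<zero>" 0] smult_simps(5)[of "\<zero>"] W.smult_simps(5)[OF Tc, of "\<zero>"] by simp
  have eq: "continuous_map (ntopology V) (ntopology W) T \<longleftrightarrow>
    (\<forall>a\<in>carrier V. \<forall>e>0. \<exists>d>0. \<forall>x. x \<in> carrier V \<and> ndist V a x < d \<longrightarrow> ndist W (T a) (T x) < e)"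
    unfolding ntopology_def using T
    by (subst metric.metric_continuous_map[OF W.metric.Metric_space_axioms]) (auto simp: image_subset_iff)
  show ?thesis
  proof
    assume "continuous_map (ntopology V) (ntopology W) T"
    from this[unfolded eq, rule_format, OF V.zero_closed zero_less_one]
    obtain d where d: "0 < d"
      "\<And>x. x \<in> carrier V \<Longrightarrow> ndist V \<zero> x < d \<Longrightarrow> ndist W (T \<zero>) (T x) < 1" by blast
    have small: "nrm W (T x) < 1" if "x \<in> carrier V" "nrm V x < d" for x
      using d(2)[of x] that Tc[of x] nrm_flip[of x "\<zero>"] W.nrm_flip[of "T x" "\<zero>\<^bsub>W\<^esub>"]
      by (simp add: ndist_def T0)
    have "nrm W (T u) \<le> 2 / d * nrm V u" if u: "u \<in> carrier V" for u
    proof (cases "nrm V u = 0")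
      case True
      then have "u = \<zero>" using nrm_zero_imp[OF u] by simp
      then show ?thesis by (simp add: T0)
    next
      case False
      then have pos: "0 < nrm V u" using nrm_nonneg[OF u] by simp
      let ?c = "d / (2 * nrm V u)"
      have "nrm W (T (?c \<odot> u)) < 1"
        using pos d u by (intro small) (auto simp: nrm_scale abs_mult)
      then have "?c * nrm W (T u) < 1" using pos d u Tc[OF u] by (simp add: scale W.nrm_scale)
      then show ?thesis using pos d by (simp add: field_simps)
    qed
    then show "\<exists>K. \<forall>u\<in>carrier V. nrm W (T u) \<le> K * nrm V u" by blast
  next
    assume "\<exists>K. \<forall>u\<in>carrier V. nrm W (T u) \<le> K * nrm V u"
    then obtain K where K: "\<And>u. u \<in> carrier V \<Longrightarrow> nrm W (T u) \<le> K * nrm V u" by blast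
    show "continuous_map (ntopology V) (ntopology W) T"
      unfolding eq
    proof (intro ballI allI impI)
      fix a and e :: real assume a: "a \<in> carrier V" and e: "0 < e"
      show "\<exists>d>0. \<forall>x. x \<in> carrier V \<and> ndist V a x < d \<longrightarrow> ndist W (T a) (T x) < e"
      proof (intro exI[of _ "e / (\<bar>K\<bar> + 1)"] conjI allI impI)
        show "0 < e / (\<bar>K\<bar> + 1)" using e by simp
        fix x assume x: "x \<in> carrier V \<and> ndist V a x < e / (\<bar>K\<bar> + 1)"
        have "ndist W (T a) (T x) = nrm W (T (a \<ominus> x))" using a x Tc by (simp add: ndist_def diff)
        also have "\<dots> \<le> K * nrm V (a \<ominus> x)" using K a x by simp
        also have "\<dots> \<le> (\<bar>K\<bar> + 1) * nrm V (a \<ominus> x)"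
          using a x by (intro mult_right_mono) (auto simp: nrm_nonneg)
        also have "\<dots> < e" using conjunct1[OF x] conjunct2[OF x] a by (simp add: ndist_def field_simps)
        finally show "ndist W (T a) (T x) < e" .
      qed
    qed
  qed
qed

lemma closure_of_sequence:
  assumes "u \<in> ntopology V closure_of S" "S \<subseteq> carrier V"
  obtains s where "\<And>n. s n \<in> S" "(\<lambda>n. nrm V (s n \<ominus> u)) \<longlonglongrightarrow> 0"
proof -
  have u: "u \<in> carrier V" "\<And>r. 0 < r \<Longrightarrow> \<exists>y\<in>S. y \<in> metric.mball u r"
    using assms(1) unfolding ntopology_def metric.metric_closure_of by auto
  have "\<exists>s\<in>S. nrm V (s \<ominus> u) < 1 / Suc n" for n
  proof -
    obtain y where y: "y \<in> S" "y \<in> metric.mball u (1 / Suc n)" using u(2)[of "1 / Suc n"] by auto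
    then have "nrm V (u \<ominus> y) < 1 / Suc n" by (auto simp: ndist_def)
    then show ?thesis using y u(1) assms(2) nrm_flip[of y u] by (intro bexI[of _ y]) auto
  qed
  then have "\<forall>n. \<exists>s. s \<in> S \<and> nrm V (s \<ominus> u) < 1 / Suc n" by blast
  from choice[OF this] obtain s where s: "\<forall>n. s n \<in> S \<and> nrm V (s n \<ominus> u) < 1 / Suc n" ..
  have "(\<lambda>n. nrm V (s n \<ominus> u)) \<longlonglongrightarrow> 0"
  proof (rule tendsto_sandwich[OF _ _ tendsto_const LIMSEQ_Suc[OF lim_1_over_n]])
    show "\<forall>\<^sub>F n in sequentially. 0 \<le> nrm V (s n \<ominus> u)"
      using s u assms by (intro always_eventually allI nrm_nonneg) auto
    show "\<forall>\<^sub>F n in sequentially. nrm V (s n \<ominus> u) \<le> 1 / of_nat (Suc n)"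
      using s by (intro always_eventually allI less_imp_le) auto
  qed
  with s show ?thesis by (intro that) auto
qed

lemma mcompleteI:
  assumes lim: "\<And>s. (\<And>n. s n \<in> carrier V) \<Longrightarrow>
      (\<And>e. 0 < e \<Longrightarrow> \<exists>n0. \<forall>m\<ge>n0. \<forall>n\<ge>n0. nrm V (s m \<ominus> s n) < e) \<Longrightarrow>
      \<exists>u\<in>carrier V. (\<lambda>n. nrm V (s n \<ominus> u)) \<longlonglongrightarrow> 0"
  shows "metric.mcomplete"
  unfolding metric.mcomplete_def
proof (intro allI impI)
  fix s assume s: "metric.MCauchy s"
  then have sc: "\<And>n. s n \<in> carrier V" by (auto simp: metric.MCauchy_def)
  have "\<exists>n0. \<forall>m\<ge>n0. \<forall>n\<ge>n0. nrm V (s m \<ominus> s n) < e" if "0 < e" for e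
    using s that sc by (simp add: metric.MCauchy_def ndist_def)
  with lim[of s] sc obtain u where u: "u \<in> carrier V" "(\<lambda>n. nrm V (s n \<ominus> u)) \<longlonglongrightarrow> 0" by blast
  have "\<exists>N. \<forall>n\<ge>N. s n \<in> carrier V \<and> ndist V (s n) u < e" if "0 < e" for e
    using LIMSEQ_D[OF u(2) that] sc u nrm_nonneg by (simp add: ndist_def)
  with u show "\<exists>x. limitin metric.mtopology s x sequentially"
    unfolding metric.limit_metric_sequentially by blast
qed

end

lemma normed_space_banach:
  "banach_space V \<longleftrightarrow> normed_space V \<and> Metric_space.mcomplete (carrier V) (ndist V)"
proof
  assume "banach_space V"
  then show "normed_space V \<and> Metric_space.mcomplete (carrier V) (ndist V)"
    unfolding banach_space_def normed_space_def seminormed_space_def normed_space_axioms_def by blast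
next
  assume V: "normed_space V \<and> Metric_space.mcomplete (carrier V) (ndist V)"
  then interpret normed_space V by simp
  show "banach_space V" unfolding banach_space_def
    using V module_V nrm_nonneg nrm_scale nrm_triangle nrm_zero_imp by auto
qed

subsection \<open>The completion is a Banach space\<close>

context seminormed_space
begin

definition null_diff :: "(nat \<Rightarrow> 'v) \<Rightarrow> (nat \<Rightarrow> 'v) \<Rightarrow> bool" where
  "null_diff s t \<longleftrightarrow> (\<lambda>n. nrm V (s n \<ominus> t n)) \<longlonglongrightarrow> 0"

lemma cauchy_carrier: "s \<in> cauchy_seqs V \<Longrightarrow> s n \<in> carrier V"
  by (auto simp: cauchy_seqs_def)

lemma null_diff_refl: "s \<in> cauchy_seqs V \<Longrightarrow> null_diff s s"
  by (simp add: null_diff_def cauchy_carrier)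

lemma null_diff_sym: "s \<in> cauchy_seqs V \<Longrightarrow> t \<in> cauchy_seqs V \<Longrightarrow> null_diff s t \<Longrightarrow> null_diff t s"
  unfolding null_diff_def by (subst nrm_flip) (auto simp: cauchy_carrier)

lemma null_by_bound:
  fixes f g :: "nat \<Rightarrow> real"
  assumes "\<And>n. 0 \<le> f n" "\<And>n. f n \<le> g n" "g \<longlonglongrightarrow> 0"
  shows "f \<longlonglongrightarrow> 0"
  by (rule tendsto_sandwich[OF _ _ tendsto_const assms(3)]) (use assms in auto)

lemma null_diff_trans:
  assumes "s \<in> cauchy_seqs V" "t \<in> cauchy_seqs V" "r \<in> cauchy_seqs V" "null_diff s t" "null_diff t r"
  shows "null_diff s r"
  unfolding null_diff_def
proof (rule null_by_bound)
  show "(\<lambda>n. nrm V (s n \<ominus> t n) + nrm V (t n \<ominus> r n)) \<longlonglongrightarrow> 0"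
    using tendsto_add[of _ 0 _ _ 0] assms(4,5) unfolding null_diff_def by force
qed (use assms cauchy_carrier in \<open>auto intro!: nrm_nonneg nrm_diff_triangle\<close>)

lemma seq_class_eq_iff:
  assumes "s \<in> cauchy_seqs V" "t \<in> cauchy_seqs V"
  shows "seq_class V s = seq_class V t \<longleftrightarrow> null_diff s t"
proof
  assume "seq_class V s = seq_class V t"
  then have "s \<in> seq_class V t" using assms null_diff_refl[of s] by (auto simp: seq_class_def null_diff_def)
  then show "null_diff s t" by (auto simp: seq_class_def null_diff_def)
next
  assume st: "null_diff s t"
  have "null_diff r s \<longleftrightarrow> null_diff r t" if "r \<in> cauchy_seqs V" for r
    using null_diff_trans[of r s t] null_diff_trans[of r t s] st assms that null_diff_sym[of s t] by blast
  then show "seq_class V s = seq_class V t" by (auto simp: seq_class_def null_diff_def)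
qed

lemma seq_rep_class:
  assumes "s \<in> cauchy_seqs V"
  shows "seq_rep (seq_class V s) \<in> cauchy_seqs V" "null_diff (seq_rep (seq_class V s)) s"
proof -
  have "s \<in> seq_class V s" using assms null_diff_refl[of s] by (auto simp: seq_class_def null_diff_def)
  then have "seq_rep (seq_class V s) \<in> seq_class V s"
    unfolding seq_rep_def by (rule someI[of "\<lambda>t. t \<in> seq_class V s"])
  then show "seq_rep (seq_class V s) \<in> cauchy_seqs V" "null_diff (seq_rep (seq_class V s)) s"
    by (auto simp: seq_class_def null_diff_def)
qed

lemma cauchyI:
  assumes "\<And>n. s n \<in> carrier V" "\<And>e. 0 < e \<Longrightarrow> \<exists>n0. \<forall>m\<ge>n0. \<forall>n\<ge>n0. nrm V (s m \<ominus> s n) < e"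
  shows "s \<in> cauchy_seqs V"
  using assms by (auto simp: cauchy_seqs_def)

lemma cauchyD:
  assumes "s \<in> cauchy_seqs V" "0 < e"
  obtains n0 where "\<And>m n. m \<ge> n0 \<Longrightarrow> n \<ge> n0 \<Longrightarrow> nrm V (s m \<ominus> s n) < e"
proof -
  have "\<exists>n0. \<forall>m\<ge>n0. \<forall>n\<ge>n0. nrm V (s m \<ominus> s n) < e"
    using assms by (simp add: cauchy_seqs_def)
  then show ?thesis using that by blast
qed

lemma cauchy_const: "u \<in> carrier V \<Longrightarrow> (\<lambda>_. u) \<in> cauchy_seqs V"
  by (rule cauchyI) auto

lemma cauchy_add:
  assumes "s \<in> cauchy_seqs V" "t \<in> cauchy_seqs V"
  shows "(\<lambda>n. s n \<oplus> t n) \<in> cauchy_seqs V"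
proof (rule cauchyI)
  note sc = cauchy_carrier[OF assms(1)] and tc = cauchy_carrier[OF assms(2)]
  show "s n \<oplus> t n \<in> carrier V" for n using sc tc by auto
  fix e :: real assume "0 < e"
  then have e2: "0 < e / 2" by simp
  obtain n0 where n0: "\<And>m n. m \<ge> n0 \<Longrightarrow> n \<ge> n0 \<Longrightarrow> nrm V (s m \<ominus> s n) < e/2"
    using cauchyD[OF assms(1) e2] by blast
  obtain n1 where n1: "\<And>m n. m \<ge> n1 \<Longrightarrow> n \<ge> n1 \<Longrightarrow> nrm V (t m \<ominus> t n) < e/2"
    using cauchyD[OF assms(2) e2] by blast
  have "nrm V ((s m \<oplus> t m) \<ominus> (s n \<oplus> t n)) < e" if "m \<ge> max n0 n1" "n \<ge> max n0 n1" for m n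
    using nrm_triangle[of "s m \<ominus> s n" "t m \<ominus> t n"] n0[of m n] n1[of m n] that sc tc
    by (simp add: diff_add)
  then show "\<exists>n0. \<forall>m\<ge>n0. \<forall>n\<ge>n0. nrm V ((s m \<oplus> t m) \<ominus> (s n \<oplus> t n)) < e" by blast
qed

lemma cauchy_scale:
  assumes "s \<in> cauchy_seqs V"
  shows "(\<lambda>n. c \<odot> s n) \<in> cauchy_seqs V"
proof (rule cauchyI)
  note sc = cauchy_carrier[OF assms]
  show "c \<odot> s n \<in> carrier V" for n using sc by auto
  fix e :: real assume "0 < e"
  then have "0 < e / (\<bar>c\<bar> + 1)" by simp
  then obtain n0 where n0: "\<And>m n. m \<ge> n0 \<Longrightarrow> n \<ge> n0 \<Longrightarrow> nrm V (s m \<ominus> s n) < e / (\<bar>c\<bar> + 1)"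
    using cauchyD[OF assms] by blast
  have "nrm V (c \<odot> s m \<ominus> c \<odot> s n) < e" if "m \<ge> n0" "n \<ge> n0" for m n
  proof -
    have "\<bar>c\<bar> * nrm V (s m \<ominus> s n) \<le> (\<bar>c\<bar> + 1) * nrm V (s m \<ominus> s n)"
      using sc by (intro mult_right_mono nrm_nonneg) auto
    also have "\<dots> < e" using n0[OF that] by (simp add: field_simps)
    finally show ?thesis using sc by (simp add: diff_scale nrm_scale)
  qed
  then show "\<exists>n0. \<forall>m\<ge>n0. \<forall>n\<ge>n0. nrm V (c \<odot> s m \<ominus> c \<odot> s n) < e" by blast
qed

lemma cauchy_convergent:
  fixes l :: "'v \<Rightarrow> real"
  assumes s: "s \<in> cauchy_seqs V"
    and l: "\<And>u v. u \<in> carrier V \<Longrightarrow> v \<in> carrier V \<Longrightarrow> \<bar>l u - l v\<bar> \<le> K * nrm V (u \<ominus> v)"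
  shows "convergent (\<lambda>n. l (s n))"
proof (rule Cauchy_convergent, rule CauchyI)
  note sc = cauchy_carrier[OF s]
  fix e :: real assume "0 < e"
  then have "0 < e / (\<bar>K\<bar> + 1)" by simp
  then obtain n0 where n0: "\<And>m n. m \<ge> n0 \<Longrightarrow> n \<ge> n0 \<Longrightarrow> nrm V (s m \<ominus> s n) < e / (\<bar>K\<bar> + 1)"
    using cauchyD[OF s] by blast
  have "norm (l (s m) - l (s n)) < e" if "m \<ge> n0" "n \<ge> n0" for m n
  proof -
    have "norm (l (s m) - l (s n)) \<le> K * nrm V (s m \<ominus> s n)" using l sc by simp
    also have "\<dots> \<le> (\<bar>K\<bar> + 1) * nrm V (s m \<ominus> s n)"
      using sc by (intro mult_right_mono nrm_nonneg) auto
    also have "\<dots> < e" using n0[OF that] by (simp add: field_simps)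
    finally show ?thesis .
  qed
  then show "\<exists>M. \<forall>m\<ge>M. \<forall>n\<ge>M. norm (l (s m) - l (s n)) < e" by blast
qed

text \<open>A uniformly continuous function has the same limit along equivalent Cauchy sequences.\<close>

lemma lim_seq_rep:
  fixes l :: "'v \<Rightarrow> real"
  assumes s: "s \<in> cauchy_seqs V"
    and l: "\<And>u v. u \<in> carrier V \<Longrightarrow> v \<in> carrier V \<Longrightarrow> \<bar>l u - l v\<bar> \<le> K * nrm V (u \<ominus> v)"
  shows "(\<lambda>n. l (s n)) \<longlonglongrightarrow> lim (\<lambda>n. l (seq_rep (seq_class V s) n))"
proof -
  let ?r = "seq_rep (seq_class V s)"
  note r = seq_rep_class[OF s]
  have lim: "(\<lambda>n. l (?r n)) \<longlonglongrightarrow> lim (\<lambda>n. l (?r n))"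
    using cauchy_convergent[OF r(1) l] by (simp add: convergent_LIMSEQ_iff)
  have "(\<lambda>n. \<bar>l (s n) - l (?r n)\<bar>) \<longlonglongrightarrow> 0"
  proof (rule null_by_bound)
    show "\<bar>l (s n) - l (?r n)\<bar> \<le> K * nrm V (s n \<ominus> ?r n)" for n
      using l cauchy_carrier[OF s] cauchy_carrier[OF r(1)] by simp
    show "(\<lambda>n. K * nrm V (s n \<ominus> ?r n)) \<longlonglongrightarrow> 0"
      using tendsto_mult_left[of _ 0 _ K] null_diff_sym[OF r(1) s r(2)] by (simp add: null_diff_def)
  qed simp
  then have "(\<lambda>n. l (s n) - l (?r n)) \<longlonglongrightarrow> 0" by (rule tendsto_rabs_zero_cancel)
  from tendsto_add[OF this lim] show ?thesis by simp
qed

lemma completion_carrierE: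
  assumes "S \<in> carrier (completion V)"
  obtains s where "s \<in> cauchy_seqs V" "S = seq_class V s"
  using assms by (auto simp: completion_def)

lemma completion_carrierI: "s \<in> cauchy_seqs V \<Longrightarrow> seq_class V s \<in> carrier (completion V)"
  by (auto simp: completion_def)

lemma completion_zero: "\<zero>\<^bsub>completion V\<^esub> = seq_class V (\<lambda>_. \<zero>)"
  by (simp add: completion_def)

text \<open>
  The operations of the completion act on chosen representatives; these lemmas evaluate them on
  arbitrary ones, as the choice only contributes a null sequence.
\<close>

lemma completion_add:
  assumes s: "s \<in> cauchy_seqs V" and t: "t \<in> cauchy_seqs V"
  shows "seq_class V s \<oplus>\<^bsub>completion V\<^esub> seq_class V t = seq_class V (\<lambda>n. s n \<oplus> t n)"
proof -
  let ?r = "seq_rep (seq_class V s)" and ?q = "seq_rep (seq_class V t)"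
  note r = seq_rep_class[OF s] and q = seq_rep_class[OF t]
  note c = cauchy_carrier[OF s] cauchy_carrier[OF t] cauchy_carrier[OF r(1)] cauchy_carrier[OF q(1)]
  have "null_diff (\<lambda>n. ?r n \<oplus> ?q n) (\<lambda>n. s n \<oplus> t n)"
    unfolding null_diff_def
  proof (rule null_by_bound)
    show "nrm V ((?r n \<oplus> ?q n) \<ominus> (s n \<oplus> t n)) \<le> nrm V (?r n \<ominus> s n) + nrm V (?q n \<ominus> t n)" for n
      using c by (simp add: diff_add nrm_triangle)
    show "(\<lambda>n. nrm V (?r n \<ominus> s n) + nrm V (?q n \<ominus> t n)) \<longlonglongrightarrow> 0"
      using tendsto_add[of _ 0 _ _ 0] r(2) q(2) unfolding null_diff_def by force
  qed (use c in \<open>auto intro!: nrm_nonneg\<close>)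
  then show ?thesis
    using r q s t by (simp add: completion_def seq_class_eq_iff cauchy_add)
qed

lemma completion_scale:
  assumes s: "s \<in> cauchy_seqs V"
  shows "c \<odot>\<^bsub>completion V\<^esub> seq_class V s = seq_class V (\<lambda>n. c \<odot> s n)"
proof -
  let ?r = "seq_rep (seq_class V s)"
  note r = seq_rep_class[OF s]
  note c = cauchy_carrier[OF s] cauchy_carrier[OF r(1)]
  have "null_diff (\<lambda>n. c \<odot> ?r n) (\<lambda>n. c \<odot> s n)"
    using r(2) tendsto_mult_left[of _ 0 _ "\<bar>c\<bar>"] c by (simp add: null_diff_def diff_scale nrm_scale)
  then show ?thesis
    using r s by (simp add: completion_def seq_class_eq_iff cauchy_scale)
qed

lemma completion_nrm:
  assumes s: "s \<in> cauchy_seqs V"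
  shows "(\<lambda>n. nrm V (s n)) \<longlonglongrightarrow> nrm (completion V) (seq_class V s)"
  using lim_seq_rep[OF s, of "nrm V" 1] nrm_reverse_triangle by (simp add: completion_def)

lemma completion_module: "Module.module real_ring (completion V)"
proof (rule moduleI[OF cring_real_ring])
  let ?C = "completion V"
  show "abelian_group ?C"
  proof (rule abelian_groupI)
    show "\<zero>\<^bsub>?C\<^esub> \<in> carrier ?C" by (simp add: completion_zero completion_carrierI cauchy_const)
    fix S assume S: "S \<in> carrier ?C"
    then obtain s where s: "s \<in> cauchy_seqs V" "S = seq_class V s" by (rule completion_carrierE)
    note sc = cauchy_carrier[OF s(1)]
    show "\<zero>\<^bsub>?C\<^esub> \<oplus>\<^bsub>?C\<^esub> S = S"
      using s sc by (simp add: completion_zero completion_add cauchy_const)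
    show "\<exists>T\<in>carrier ?C. T \<oplus>\<^bsub>?C\<^esub> S = \<zero>\<^bsub>?C\<^esub>"
    proof (rule bexI[of _ "seq_class V (\<lambda>n. (-1) \<odot> s n)"])
      have "(-1) \<odot> s n \<oplus> s n = \<zero>" for n
        using sc[of n] by (simp add: smult_simps V.l_neg)
      then show "seq_class V (\<lambda>n. (-1) \<odot> s n) \<oplus>\<^bsub>?C\<^esub> S = \<zero>\<^bsub>?C\<^esub>"
        using s by (simp add: completion_add cauchy_scale completion_zero)
    qed (use s in \<open>auto intro: completion_carrierI cauchy_scale\<close>)
    fix T assume T: "T \<in> carrier ?C"
    then obtain t where t: "t \<in> cauchy_seqs V" "T = seq_class V t" by (rule completion_carrierE)
    note tc = cauchy_carrier[OF t(1)]
    show "S \<oplus>\<^bsub>?C\<^esub> T \<in> carrier ?C"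
      using s t by (simp add: completion_add cauchy_add completion_carrierI)
    show "S \<oplus>\<^bsub>?C\<^esub> T = T \<oplus>\<^bsub>?C\<^esub> S"
      using s t sc tc by (simp add: completion_add V.a_comm)
    fix R assume R: "R \<in> carrier ?C"
    then obtain r where r: "r \<in> cauchy_seqs V" "R = seq_class V r" by (rule completion_carrierE)
    note rc = cauchy_carrier[OF r(1)]
    show "S \<oplus>\<^bsub>?C\<^esub> T \<oplus>\<^bsub>?C\<^esub> R = S \<oplus>\<^bsub>?C\<^esub> (T \<oplus>\<^bsub>?C\<^esub> R)"
      using s t r sc tc rc by (simp add: completion_add cauchy_add V.a_assoc)
  qed
  fix S assume "S \<in> carrier ?C"
  then obtain s where s: "s \<in> cauchy_seqs V" "S = seq_class V s" by (rule completion_carrierE)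
  note sc = cauchy_carrier[OF s(1)]
  show "\<one>\<^bsub>real_ring\<^esub> \<odot>\<^bsub>?C\<^esub> S = S" using s sc by (simp add: completion_scale smult_simps)
  fix a :: real
  show "a \<odot>\<^bsub>?C\<^esub> S \<in> carrier ?C" using s by (simp add: completion_scale cauchy_scale completion_carrierI)
  fix b :: real
  show "(a \<oplus>\<^bsub>real_ring\<^esub> b) \<odot>\<^bsub>?C\<^esub> S = a \<odot>\<^bsub>?C\<^esub> S \<oplus>\<^bsub>?C\<^esub> b \<odot>\<^bsub>?C\<^esub> S"
    using s sc by (simp add: completion_scale completion_add cauchy_scale smult_simps)
  show "(a \<otimes>\<^bsub>real_ring\<^esub> b) \<odot>\<^bsub>?C\<^esub> S = a \<odot>\<^bsub>?C\<^esub> (b \<odot>\<^bsub>?C\<^esub> S)"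
    using s sc by (simp add: completion_scale cauchy_scale smult_simps)
next
  let ?C = "completion V"
  fix S T and a :: real assume "S \<in> carrier ?C" "T \<in> carrier ?C"
  then obtain s t where s: "s \<in> cauchy_seqs V" "S = seq_class V s" and t: "t \<in> cauchy_seqs V" "T = seq_class V t"
    by (metis completion_carrierE)
  show "a \<odot>\<^bsub>?C\<^esub> (S \<oplus>\<^bsub>?C\<^esub> T) = a \<odot>\<^bsub>?C\<^esub> S \<oplus>\<^bsub>?C\<^esub> a \<odot>\<^bsub>?C\<^esub> T"
    using s t cauchy_carrier[OF s(1)] cauchy_carrier[OF t(1)]
    by (simp add: completion_scale completion_add cauchy_scale cauchy_add smult_simps)
qed

lemma completion_normed: "normed_space (completion V)"
proof (intro normed_space.intro seminormed_space.intro normed_space_axioms.intro)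
  let ?C = "completion V"
  show "Module.module real_ring ?C" by (rule completion_module)
  fix S assume "S \<in> carrier ?C"
  then obtain s where s: "s \<in> cauchy_seqs V" "S = seq_class V s" by (rule completion_carrierE)
  note sc = cauchy_carrier[OF s(1)] and nS = completion_nrm[OF s(1)]
  show "0 \<le> nrm ?C S"
    using LIMSEQ_le_const[OF nS, of 0] sc nrm_nonneg s by auto
  show "nrm ?C (c \<odot>\<^bsub>?C\<^esub> S) = \<bar>c\<bar> * nrm ?C S" for c
  proof (rule LIMSEQ_unique)
    show "(\<lambda>n. nrm V (c \<odot> s n)) \<longlonglongrightarrow> nrm ?C (c \<odot>\<^bsub>?C\<^esub> S)"
      using completion_nrm[OF cauchy_scale[OF s(1)]] s by (simp add: completion_scale)
    show "(\<lambda>n. nrm V (c \<odot> s n)) \<longlonglongrightarrow> \<bar>c\<bar> * nrm ?C S"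
      using tendsto_mult_left[OF nS, of "\<bar>c\<bar>"] s sc by (simp add: nrm_scale)
  qed
  show "nrm ?C S = 0 \<Longrightarrow> S = \<zero>\<^bsub>?C\<^esub>"
    using nS s sc by (simp add: completion_zero seq_class_eq_iff cauchy_const null_diff_def)
  fix T assume "T \<in> carrier ?C"
  then obtain t where t: "t \<in> cauchy_seqs V" "T = seq_class V t" by (rule completion_carrierE)
  note tc = cauchy_carrier[OF t(1)] and nT = completion_nrm[OF t(1)]
  show "nrm ?C (S \<oplus>\<^bsub>?C\<^esub> T) \<le> nrm ?C S + nrm ?C T"
  proof (rule LIMSEQ_le)
    show "(\<lambda>n. nrm V (s n \<oplus> t n)) \<longlonglongrightarrow> nrm ?C (S \<oplus>\<^bsub>?C\<^esub> T)"
      using completion_nrm[OF cauchy_add[OF s(1) t(1)]] s t by (simp add: completion_add)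
    show "(\<lambda>n. nrm V (s n) + nrm V (t n)) \<longlonglongrightarrow> nrm ?C S + nrm ?C T"
      using tendsto_add[OF nS nT] s t by simp
    show "\<exists>N. \<forall>n\<ge>N. nrm V (s n \<oplus> t n) \<le> nrm V (s n) + nrm V (t n)"
      using sc tc nrm_triangle by blast
  qed
qed

lemma completion_map_carrier: "u \<in> carrier V \<Longrightarrow> completion_map V u \<in> carrier (completion V)"
  by (simp add: completion_map_def completion_carrierI cauchy_const)

lemma completion_map_add:
  "u \<in> carrier V \<Longrightarrow> v \<in> carrier V \<Longrightarrow>
    completion_map V (u \<oplus> v) = completion_map V u \<oplus>\<^bsub>completion V\<^esub> completion_map V v"
  by (simp add: completion_map_def completion_add cauchy_const)

lemma completion_map_scale:
  "u \<in> carrier V \<Longrightarrow> completion_map V (c \<odot> u) = c \<odot>\<^bsub>completion V\<^esub> completion_map V u"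
  by (simp add: completion_map_def completion_scale cauchy_const)

lemma completion_map_nrm: "u \<in> carrier V \<Longrightarrow> nrm (completion V) (completion_map V u) = nrm V u"
  using LIMSEQ_unique[OF completion_nrm[OF cauchy_const]] by (simp add: completion_map_def)

text \<open>
  Diagonal argument: the \<open>n\<close>-th member of a Cauchy sequence of classes is approximated up to
  \<open>1 / Suc n\<close> by an element of \<open>V\<close>; these elements form a Cauchy sequence whose class is the limit.
\<close>

theorem completion_banach: "banach_space (completion V)"
proof -
  let ?C = "completion V"
  interpret C: normed_space ?C by (rule completion_normed)
  have "C.metric.mcomplete"
  proof (rule C.mcompleteI)
    fix \<sigma> :: "nat \<Rightarrow> (nat \<Rightarrow> 'v) set" assume \<sigma>: "\<And>n. \<sigma> n \<in> carrier ?C"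
      and cau: "\<And>e. 0 < e \<Longrightarrow> \<exists>n0. \<forall>m\<ge>n0. \<forall>n\<ge>n0. nrm ?C (\<sigma> m \<ominus>\<^bsub>?C\<^esub> \<sigma> n) < e"
    have diff: "nrm ?C (completion_map V u \<ominus>\<^bsub>?C\<^esub> seq_class V s) \<le> e"
      if "s \<in> cauchy_seqs V" "u \<in> carrier V" "\<And>k. k \<ge> n0 \<Longrightarrow> nrm V (u \<ominus> s k) \<le> e" for u s e and n0 :: nat
    proof -
      note sc = cauchy_carrier[OF that(1)]
      have "completion_map V u \<ominus>\<^bsub>?C\<^esub> seq_class V s = completion_map V u \<oplus>\<^bsub>?C\<^esub> (-1) \<odot>\<^bsub>?C\<^esub> seq_class V s"
        using C.smult_simps(6)[OF completion_carrierI, OF that(1)] by (simp add: a_minus_def)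
      also have "\<dots> = seq_class V (\<lambda>k. u \<oplus> (-1) \<odot> s k)"
        using that by (simp add: completion_map_def completion_scale completion_add cauchy_const cauchy_scale)
      also have "(\<lambda>k. u \<oplus> (-1) \<odot> s k) = (\<lambda>k. u \<ominus> s k)"
        using sc smult_simps(6) by (auto simp: a_minus_def)
      finally have eq: "completion_map V u \<ominus>\<^bsub>?C\<^esub> seq_class V s = seq_class V (\<lambda>k. u \<ominus> s k)" .
      have "(\<lambda>k. u \<oplus> (-1) \<odot> s k) \<in> cauchy_seqs V"
        using that by (intro cauchy_add cauchy_const cauchy_scale)
      then have "(\<lambda>k. u \<ominus> s k) \<in> cauchy_seqs V"
        using sc by (simp add: a_minus_def smult_simps(6)[OF sc])
      from completion_nrm[OF this] show ?thesis
        unfolding eq by (rule LIMSEQ_le_const2) (use that(3) in blast)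
    qed
    have "\<exists>v\<in>carrier V. nrm ?C (completion_map V v \<ominus>\<^bsub>?C\<^esub> \<sigma> n) \<le> 1 / Suc n" for n :: nat
    proof -
      obtain s where s: "s \<in> cauchy_seqs V" "\<sigma> n = seq_class V s" using \<sigma> by (metis completion_carrierE)
      have "0 < 1 / real (Suc n)" by simp
      then obtain n0 where n0: "\<And>m k. m \<ge> n0 \<Longrightarrow> k \<ge> n0 \<Longrightarrow> nrm V (s m \<ominus> s k) < 1 / Suc n"
        using cauchyD[OF s(1)] by blast
      have "nrm ?C (completion_map V (s n0) \<ominus>\<^bsub>?C\<^esub> seq_class V s) \<le> 1 / Suc n"
        by (rule diff[OF s(1) cauchy_carrier[OF s(1)], of n0]) (use n0 in \<open>auto intro: less_imp_le\<close>)
      then show ?thesis using s cauchy_carrier[OF s(1)] by auto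
    qed
    then have "\<forall>n. \<exists>v. v \<in> carrier V \<and> nrm ?C (completion_map V v \<ominus>\<^bsub>?C\<^esub> \<sigma> n) \<le> 1 / Suc n" by blast
    from choice[OF this] obtain v where v0: "\<forall>n. v n \<in> carrier V \<and> nrm ?C (completion_map V (v n) \<ominus>\<^bsub>?C\<^esub> \<sigma> n) \<le> 1 / Suc n" ..
    then have v: "\<And>n. v n \<in> carrier V" "\<And>n. nrm ?C (completion_map V (v n) \<ominus>\<^bsub>?C\<^esub> \<sigma> n) \<le> 1 / Suc n" by blast+
    note vC = completion_map_carrier[OF v(1)]
    have vdiff: "nrm V (v m \<ominus> v n) \<le> 1 / Suc m + 1 / Suc n + nrm ?C (\<sigma> m \<ominus>\<^bsub>?C\<^esub> \<sigma> n)" for m n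
    proof -
      have "completion_map V (v m \<ominus> v n) = completion_map V (v m) \<ominus>\<^bsub>?C\<^esub> completion_map V (v n)"
        using v(1) vC smult_simps(6)[OF v(1), of n] C.smult_simps(6)[OF vC, of n]
          completion_map_scale[OF v(1), of "-1" n]
        by (simp add: a_minus_def completion_map_add)
      then have "nrm V (v m \<ominus> v n) = nrm ?C (completion_map V (v m) \<ominus>\<^bsub>?C\<^esub> completion_map V (v n))"
        using completion_map_nrm[of "v m \<ominus> v n"] v(1) by simp
      also have "\<dots> \<le> nrm ?C (completion_map V (v m) \<ominus>\<^bsub>?C\<^esub> \<sigma> m) + (nrm ?C (\<sigma> m \<ominus>\<^bsub>?C\<^esub> \<sigma> n) + nrm ?C (\<sigma> n \<ominus>\<^bsub>?C\<^esub> completion_map V (v n)))"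
        using C.nrm_diff_triangle[OF vC[of m] \<sigma>[of m] vC[of n]] C.nrm_diff_triangle[OF \<sigma>[of m] \<sigma>[of n] vC[of n]] by linarith
      finally show ?thesis using v(2)[of m] v(2)[of n] C.nrm_flip[OF \<sigma> vC, of n n] by linarith
    qed
    have one: "\<exists>n0. \<forall>m\<ge>n0. 1 / real (Suc m) < e" if "0 < e" for e
      using LIMSEQ_D[OF LIMSEQ_inverse_real_of_nat that] by (simp add: inverse_eq_divide)
    have cv: "v \<in> cauchy_seqs V"
    proof (rule cauchyI)
      fix e :: real assume e: "0 < e"
      obtain n0 where n0: "\<And>m. m \<ge> n0 \<Longrightarrow> 1 / real (Suc m) < e/3" using one[of "e/3"] e by auto
      obtain n1 where n1: "\<And>m n. m \<ge> n1 \<Longrightarrow> n \<ge> n1 \<Longrightarrow> nrm ?C (\<sigma> m \<ominus>\<^bsub>?C\<^esub> \<sigma> n) < e/3" using cau[of "e/3"] e by auto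
      have "nrm V (v m \<ominus> v n) < e" if "m \<ge> max n0 n1" "n \<ge> max n0 n1" for m n
        using vdiff[of m n] n0[of m] n0[of n] n1[of m n] that by simp
      then show "\<exists>n0. \<forall>m\<ge>n0. \<forall>n\<ge>n0. nrm V (v m \<ominus> v n) < e" by blast
    qed (rule v)
    have vC': "seq_class V v \<in> carrier ?C" using cv by (rule completion_carrierI)
    have "(\<lambda>n. nrm ?C (\<sigma> n \<ominus>\<^bsub>?C\<^esub> seq_class V v)) \<longlonglongrightarrow> 0"
    proof (rule LIMSEQ_I)
      fix e :: real assume e: "0 < e"
      then have e2: "0 < e/2" by simp
      obtain n0 where n0: "\<And>m. m \<ge> n0 \<Longrightarrow> 1 / real (Suc m) < e/2" using one[OF e2] by auto
      obtain n1 where n1: "\<And>m n. m \<ge> n1 \<Longrightarrow> n \<ge> n1 \<Longrightarrow> nrm V (v m \<ominus> v n) < e/2" using cauchyD[OF cv e2] by blast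
      have "norm (nrm ?C (\<sigma> n \<ominus>\<^bsub>?C\<^esub> seq_class V v) - 0) < e" if n: "n \<ge> max n0 n1" for n
      proof -
        have "nrm ?C (completion_map V (v n) \<ominus>\<^bsub>?C\<^esub> seq_class V v) \<le> e/2"
          by (rule diff[OF cv v(1), of n1]) (use n1 n in \<open>auto intro: less_imp_le\<close>)
        then show ?thesis
          using C.nrm_diff_triangle[OF \<sigma> vC vC', of n n] C.nrm_nonneg[OF C.diff_closed[OF \<sigma> vC'], of n]
            v(2)[of n] C.nrm_flip[OF \<sigma> vC, of n n] n0[of n] n by simp
      qed
      then show "\<exists>no. \<forall>n\<ge>no. norm (nrm ?C (\<sigma> n \<ominus>\<^bsub>?C\<^esub> seq_class V v) - 0) < e" by blast
    qed
    then show "\<exists>u\<in>carrier ?C. (\<lambda>n. nrm ?C (\<sigma> n \<ominus>\<^bsub>?C\<^esub> u)) \<longlonglongrightarrow> 0"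
      using vC' by blast
  qed
  then show ?thesis using C.normed_space_axioms normed_space_banach by blast
qed

text \<open>
  The values of a bounded functional along a Cauchy sequence converge, and the limit depends only
  on the class of the sequence.
\<close>

lemma functional_extends_to_completion:
  fixes l :: "'v \<Rightarrow> real"
  assumes add: "\<And>u v. u \<in> carrier V \<Longrightarrow> v \<in> carrier V \<Longrightarrow> l (u \<oplus> v) = l u + l v"
    and scale: "\<And>c u. u \<in> carrier V \<Longrightarrow> l (c \<odot> u) = c * l u"
    and bound: "\<And>u. u \<in> carrier V \<Longrightarrow> \<bar>l u\<bar> \<le> K * nrm V u"
  obtains L where "L \<in> topological_dual (completion V)" "\<And>u. u \<in> carrier V \<Longrightarrow> L (completion_map V u) = l u"
proof -
  let ?C = "completion V"
  interpret C: normed_space ?C by (rule completion_normed)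
  have lip: "\<bar>l u - l v\<bar> \<le> K * nrm V (u \<ominus> v)" if "u \<in> carrier V" "v \<in> carrier V" for u v
    using bound[of "u \<ominus> v"] linear_diff[of l u v, OF add scale] that by simp
  define L where "L = restrict (\<lambda>S. lim (\<lambda>n. l (seq_rep S n))) (carrier ?C)"
  have L: "(\<lambda>n. l (s n)) \<longlonglongrightarrow> L (seq_class V s)" if "s \<in> cauchy_seqs V" for s
    using lim_seq_rep[OF that lip] completion_carrierI[OF that] by (simp add: L_def)
  have Ladd: "L (S \<oplus>\<^bsub>?C\<^esub> T) = L S + L T" if "S \<in> carrier ?C" "T \<in> carrier ?C" for S T
  proof -
    note ST = that
    obtain s where s: "s \<in> cauchy_seqs V" "S = seq_class V s" using completion_carrierE[OF ST(1)] by blast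
    obtain t where t: "t \<in> cauchy_seqs V" "T = seq_class V t" using completion_carrierE[OF ST(2)] by blast
    have "(\<lambda>n. l (s n \<oplus> t n)) \<longlonglongrightarrow> L (S \<oplus>\<^bsub>?C\<^esub> T)"
      using L[OF cauchy_add[OF s(1) t(1)]] s t by (simp add: completion_add)
    moreover have "(\<lambda>n. l (s n \<oplus> t n)) \<longlonglongrightarrow> L S + L T"
      using tendsto_add[OF L[OF s(1)] L[OF t(1)]] s t cauchy_carrier[OF s(1)] cauchy_carrier[OF t(1)] by (simp add: add)
    ultimately show ?thesis by (rule LIMSEQ_unique)
  qed
  have Lscale: "L (c \<odot>\<^bsub>?C\<^esub> S) = c * L S" if "S \<in> carrier ?C" for c S
  proof -
    note S = that
    obtain s where s: "s \<in> cauchy_seqs V" "S = seq_class V s" using completion_carrierE[OF S] by blast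
    have "(\<lambda>n. l (c \<odot> s n)) \<longlonglongrightarrow> L (c \<odot>\<^bsub>?C\<^esub> S)"
      using L[OF cauchy_scale[OF s(1)]] s by (simp add: completion_scale)
    moreover have "(\<lambda>n. l (c \<odot> s n)) \<longlonglongrightarrow> c * L S"
      using tendsto_mult_left[OF L[OF s(1)], of c] s cauchy_carrier[OF s(1)] by (simp add: scale)
    ultimately show ?thesis by (rule LIMSEQ_unique)
  qed
  have Lbound: "\<bar>L S\<bar> \<le> K * nrm ?C S" if "S \<in> carrier ?C" for S
  proof -
    note S = that
    obtain s where s: "s \<in> cauchy_seqs V" "S = seq_class V s" using completion_carrierE[OF S] by blast
    show ?thesis
    proof (rule LIMSEQ_le)
      show "(\<lambda>n. \<bar>l (s n)\<bar>) \<longlonglongrightarrow> \<bar>L S\<bar>" using tendsto_rabs[OF L[OF s(1)]] s by simp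
      show "(\<lambda>n. K * nrm V (s n)) \<longlonglongrightarrow> K * nrm ?C S" using tendsto_mult_left[OF completion_nrm[OF s(1)], of K] s by simp
      show "\<exists>N. \<forall>n\<ge>N. \<bar>l (s n)\<bar> \<le> K * nrm V (s n)" using bound cauchy_carrier[OF s(1)] by blast
    qed
  qed
  have "L \<in> topological_dual ?C"
  proof -
    have "L \<in> extensional (carrier ?C)" by (simp add: L_def)
    then show ?thesis
      unfolding topological_dual_def using Ladd Lscale C.continuous_functional[OF Ladd Lscale Lbound] by blast
  qed
  moreover have "L (completion_map V u) = l u" if "u \<in> carrier V" for u
    using LIMSEQ_unique[OF L[OF cauchy_const[OF that]] tendsto_const] by (simp add: completion_map_def)
  ultimately show ?thesis by (rule that)
qed

end

section \<open>The space of integrable functions\<close>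

lemma Lp_space_simps [simp]:
  "carrier (Lp_space \<mu> p) = Lp_set \<mu> p" "\<zero>\<^bsub>Lp_space \<mu> p\<^esub> = ae_class \<mu> (\<lambda>_. 0)"
  "F \<oplus>\<^bsub>Lp_space \<mu> p\<^esub> G = ae_map2 \<mu> (+) F G"
  "nrm (Lp_space \<mu> p) = Lp_norm \<mu> p"
  by (auto simp: Lp_space_def)

lemma L1_obtain:
  assumes "F \<in> Lp_set \<mu> 1"
  obtains f where "integrable \<mu> f" "F = ae_class \<mu> f"
  using assms ae_class_ae_rep[of F \<mu>] that[of "ae_rep F"] by (auto simp: Lp1_set_iff)

lemma L1_smult_class:
  assumes "f \<in> borel_measurable \<mu>"
  shows "c \<odot>\<^bsub>Lp_space \<mu> p\<^esub> ae_class \<mu> f = ae_class \<mu> (\<lambda>x. c * f x)"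
  using AE_ae_rep_class[OF assms] by (auto simp: Lp_space_def intro!: ae_class_eqI elim: eventually_mono)

lemma L1_norm_class:
  assumes "f \<in> borel_measurable \<mu>"
  shows "Lp_norm \<mu> 1 (ae_class \<mu> f) = (LINT x|\<mu>. \<bar>f x\<bar>)"
  using Lp_norm_ae_class[OF assms, of 1] by simp

lemma L1_normed: "normed_space (Lp_space \<mu> 1)"
proof -
  let ?L = "Lp_space \<mu> 1"
  note cls = ae_map2_ae_class L1_smult_class ae_class_L1 L1_norm_class borel_measurable_integrable
  have neg: "\<exists>G\<in>carrier ?L. G \<oplus>\<^bsub>?L\<^esub> F = \<zero>\<^bsub>?L\<^esub>" if F: "F \<in> carrier ?L" for F
  proof -
    obtain f where "integrable \<mu> f" "F = ae_class \<mu> f" using F by (auto elim!: L1_obtain)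
    then show ?thesis by (intro bexI[of _ "ae_class \<mu> (\<lambda>x. - f x)"]) (auto simp: cls)
  qed
  have triangle: "nrm ?L (F \<oplus>\<^bsub>?L\<^esub> G) \<le> nrm ?L F + nrm ?L G" if FG: "F \<in> carrier ?L" "G \<in> carrier ?L" for F G
  proof -
    obtain f g where f: "integrable \<mu> f" "F = ae_class \<mu> f" and g: "integrable \<mu> g" "G = ae_class \<mu> g"
      using FG by (auto elim!: L1_obtain)
    have "(LINT x|\<mu>. \<bar>f x + g x\<bar>) \<le> (LINT x|\<mu>. \<bar>f x\<bar> + \<bar>g x\<bar>)"
      using f g by (intro integral_mono) auto
    then show ?thesis using f(1) g(1) by (simp add: f(2) g(2) cls)
  qed
  have definite: "F = \<zero>\<^bsub>?L\<^esub>" if F: "F \<in> carrier ?L" "nrm ?L F = 0" for F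
  proof -
    obtain f where f: "integrable \<mu> f" "F = ae_class \<mu> f" using F by (auto elim!: L1_obtain)
    have "(LINT x|\<mu>. \<bar>f x\<bar>) = 0" using F(2) f by (simp add: cls)
    then have "AE x in \<mu>. f x = 0"
      using integral_nonneg_eq_0_iff_AE[OF integrable_abs[OF f(1)]] by simp
    then show ?thesis unfolding f(2) Lp_space_simps by (rule ae_class_eqI)
  qed
  have "Module.module real_ring ?L"
    by (intro moduleI[OF cring_real_ring] abelian_groupI neg) (auto elim!: L1_obtain simp: cls algebra_simps)
  moreover have "nrm ?L (c \<odot>\<^bsub>?L\<^esub> F) \<le> \<bar>c\<bar> * nrm ?L F" if "F \<in> carrier ?L" for c F
    using that by (auto elim!: L1_obtain simp: cls abs_mult)
  ultimately show ?thesis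
    by (intro normed_space.intro seminormed_spaceI normed_space_axioms.intro triangle definite) (auto simp: Lp_norm_def)
qed

section \<open>Calculus in normed modules\<close>

abbreviation const_class :: "'x measure \<Rightarrow> real \<Rightarrow> ('x \<Rightarrow> real) set" where
  "const_class \<mu> c \<equiv> ae_class \<mu> (\<lambda>_. c)"

abbreviation set_class :: "'x measure \<Rightarrow> 'x set \<Rightarrow> ('x \<Rightarrow> real) set" where
  "set_class \<mu> E \<equiv> ae_class \<mu> (indicator E)"

lemma const_class_Linf [simp, intro]: "const_class \<mu> c \<in> carrier (Linf \<mu>)"
  by (rule ae_class_Linf[of _ _ "\<bar>c\<bar>"]) auto

lemma set_class_Linf [simp, intro]: "E \<in> sets \<mu> \<Longrightarrow> set_class \<mu> E \<in> carrier (Linf \<mu>)"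
  by (rule ae_class_Linf[of _ _ 1]) (auto simp: indicator_def)

lemma real_nspace_simps [simp]:
  "carrier (real_nspace \<mu> M) = carrier M" "\<zero>\<^bsub>real_nspace \<mu> M\<^esub> = \<zero>\<^bsub>M\<^esub>"
  "u \<oplus>\<^bsub>real_nspace \<mu> M\<^esub> v = u \<oplus>\<^bsub>M\<^esub> v"
  "c \<odot>\<^bsub>real_nspace \<mu> M\<^esub> u = const_class \<mu> c \<odot>\<^bsub>M\<^esub> u"
  "nrm (real_nspace \<mu> M) = nrm M"
  by (auto simp: real_nspace_def)

lemma real_nspace_minus [simp]: "u \<ominus>\<^bsub>real_nspace \<mu> M\<^esub> v = u \<ominus>\<^bsub>M\<^esub> v"
  by (simp add: a_minus_def a_inv_def m_inv_def)

lemma real_nspace_finsum [simp]: "finsum (real_nspace \<mu> M) f I = finsum M f I"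
  by (simp add: finsum_def finprod_def real_nspace_def)

locale Lp_module =
  fixes \<mu> :: "'x measure" and p :: real and M :: "('x, 'v) Lmodule" (structure)
  assumes Lp_normed: "Lp_normed_module \<mu> p M" and sf: "sigma_finite_measure \<mu>" and p: "1 < p"
begin

sublocale M: scalar_module "Linf \<mu>" M
  using Lp_normed by (simp add: Lp_normed_module_def scalar_module_def)

sublocale N: normed_space "real_nspace \<mu> M"
  using Lp_normed by (simp add: Lp_normed_module_def normed_space_banach)

definition pn :: "'v \<Rightarrow> 'x \<Rightarrow> real" where "pn v = ae_rep (pnorm M v)"

lemma pnorm_classes: "v \<in> carrier M \<Longrightarrow> pnorm M v \<in> ae_classes \<mu>"
  using Lp_normed Lp_set_ae_classes by (auto simp: Lp_normed_module_def)

lemma pn_measurable [measurable (raw), simp]: "v \<in> carrier M \<Longrightarrow> pn v \<in> borel_measurable \<mu>"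
  unfolding pn_def by (intro ae_rep_measurable pnorm_classes)

lemma pn_nonneg: "v \<in> carrier M \<Longrightarrow> AE x in \<mu>. 0 \<le> pn v x"
  using Lp_normed by (auto simp: Lp_normed_module_def pn_def)

lemma pn_integrable: "v \<in> carrier M \<Longrightarrow> integrable \<mu> (\<lambda>x. pn v x powr p)"
proof -
  assume v: "v \<in> carrier M"
  then have "integrable \<mu> (\<lambda>x. \<bar>pn v x\<bar> powr p)"
    using Lp_normed by (auto simp: Lp_normed_module_def Lp_set_iff pn_def)
  then show ?thesis
    by (rule integrable_cong_AE_imp) (use v pn_nonneg[OF v] in \<open>auto elim: eventually_mono\<close>)
qed

lemma nrm_eq:
  assumes v: "v \<in> carrier M"
  shows "nrm M v = (LINT x|\<mu>. pn v x powr p) powr (1 / p)"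
proof -
  have "nrm M v = (LINT x|\<mu>. \<bar>pn v x\<bar> powr p) powr (1 / p)"
    using Lp_normed v by (auto simp: Lp_normed_module_def Lp_norm_def pn_def)
  also have "(LINT x|\<mu>. \<bar>pn v x\<bar> powr p) = (LINT x|\<mu>. pn v x powr p)"
    using v pn_nonneg[OF v] by (intro integral_cong_AE) (auto elim: eventually_mono)
  finally show ?thesis .
qed

lemma nrm_powr:
  assumes v: "v \<in> carrier M"
  shows "nrm M v powr p = (LINT x|\<mu>. pn v x powr p)"
  using p by (simp add: nrm_eq[OF v] powr_powr)

lemma pn_smult:
  assumes "F \<in> carrier (Linf \<mu>)" "v \<in> carrier M"
  shows "AE x in \<mu>. pn (F \<odot> v) x = \<bar>ae_rep F x\<bar> * pn v x"
  using Lp_normed assms ae_map2_classes(6)[OF Linf_ae_classes[OF assms(1)] pnorm_classes[OF assms(2)]]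
  by (auto simp: Lp_normed_module_def pn_def)

lemma pn_smult_class:
  assumes "f \<in> borel_measurable \<mu>" "AE x in \<mu>. \<bar>f x\<bar> \<le> c" "v \<in> carrier M"
  shows "AE x in \<mu>. pn (ae_class \<mu> f \<odot> v) x = \<bar>f x\<bar> * pn v x"
  using pn_smult[OF ae_class_Linf[OF assms(1,2)] assms(3)] AE_ae_rep_class[OF assms(1)]
  by eventually_elim auto

lemma pn_const: "v \<in> carrier M \<Longrightarrow> AE x in \<mu>. pn (const_class \<mu> c \<odot> v) x = \<bar>c\<bar> * pn v x"
  by (rule pn_smult_class[of _ "\<bar>c\<bar>"]) auto

lemma pn_set:
  "E \<in> sets \<mu> \<Longrightarrow> v \<in> carrier M \<Longrightarrow> AE x in \<mu>. pn (set_class \<mu> E \<odot> v) x = indicator E x * pn v x"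
  using pn_smult_class[of "indicator E" 1 v] by auto

lemma pn_zero: "AE x in \<mu>. pn \<zero> x = 0"
  using pn_const[of "\<zero>" 0] N.smult_simps(5)[of "\<zero>"] by simp

lemma eq_zero_iff: "v \<in> carrier M \<Longrightarrow> v = \<zero> \<longleftrightarrow> (AE x in \<mu>. pn v x = 0)"
proof
  assume v: "v \<in> carrier M" and ae: "AE x in \<mu>. pn v x = 0"
  have "(LINT x|\<mu>. pn v x powr p) = (LINT x|\<mu>. 0)"
    using ae v by (intro integral_cong_AE) (auto elim: eventually_mono)
  then have "nrm M v = 0" using v by (simp add: nrm_eq)
  then show "v = \<zero>" using N.nrm_zero_imp[of v] v by simp
qed (use pn_zero in auto)

text \<open>
  Localisation: the norm of \<open>1\<^sub>E v\<close> only sees the pointwise norm on \<open>E\<close>, which is how statements about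
  the norm become statements almost everywhere.
\<close>

lemma nrm_set:
  assumes E: "E \<in> sets \<mu>" and v: "v \<in> carrier M"
  shows "nrm M (set_class \<mu> E \<odot> v) = (LINT x:E|\<mu>. pn v x powr p) powr (1 / p)"
proof -
  have "(LINT x|\<mu>. pn (set_class \<mu> E \<odot> v) x powr p) = (LINT x|\<mu>. indicator E x * pn v x powr p)"
    using E v pn_set[OF E v]
    by (intro integral_cong_AE) (auto elim!: eventually_mono simp: indicator_def)
  then show ?thesis using E v by (simp add: nrm_eq set_lebesgue_integral_def)
qed

lemma set_integrable_pn: "E \<in> sets \<mu> \<Longrightarrow> v \<in> carrier M \<Longrightarrow> set_integrable \<mu> E (\<lambda>x. pn v x powr p)"
  unfolding set_integrable_def by (intro integrable_mult_indicator pn_integrable)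

text \<open>
  The triangle inequality of the norm, applied on a set \<open>E\<close> of positive measure where
  \<open>|u| < a\<close>, \<open>|v| < b\<close> and \<open>|u + v| > c\<close>, forces \<open>c \<le> a + b\<close>.
\<close>

lemma pn_triangle:
  assumes u: "u \<in> carrier M" and v: "v \<in> carrier M"
  shows "AE x in \<mu>. pn (u \<oplus> v) x \<le> pn u x + pn v x"
proof -
  interpret sigma_finite_measure \<mu> by (rule sf)
  have w: "u \<oplus> v \<in> carrier M" using u v by simp
  note [measurable] = pn_measurable[OF u] pn_measurable[OF v] pn_measurable[OF w]
  obtain B :: "nat \<Rightarrow> 'x set" where B: "range B \<subseteq> sets \<mu>" "(\<Union>i. B i) = space \<mu>" "\<And>i. emeasure \<mu> (B i) \<noteq> \<infinity>"
    using sigma_finite by metis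
  define E where "E a b c i = {x \<in> space \<mu>. pn u x < a \<and> pn v x < b \<and> c < pn (u \<oplus> v) x \<and> 0 \<le> pn u x \<and> 0 \<le> pn v x} \<inter> B i" for a b c i
  have Em[measurable]: "E a b c i \<in> sets \<mu>" for a b c i unfolding E_def using B by auto
  have "AE x in \<mu>. x \<notin> E a b c i" if ab: "0 < a" "0 < b" "a + b < c" for a b c i
  proof -
    let ?E = "E a b c i"
    have fin: "emeasure \<mu> ?E < \<infinity>"
      using emeasure_mono[of ?E "B i" \<mu>] B by (auto simp: E_def less_top[symmetric] top_unique)
    have cint: "set_integrable \<mu> ?E (\<lambda>_. k)" for k :: real
      using fin unfolding set_integrable_def by simp
    have cLINT: "(LINT x:?E|\<mu>. k) = measure \<mu> ?E * k" for k :: real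
      using fin unfolding set_lebesgue_integral_def by simp
    have up: "nrm M (set_class \<mu> ?E \<odot> z) \<le> d * measure \<mu> ?E powr (1/p)"
      if z: "z \<in> carrier M" and d: "0 < d" "\<And>x. x \<in> ?E \<Longrightarrow> 0 \<le> pn z x \<and> pn z x \<le> d" for z d
    proof -
      have "(LINT x:?E|\<mu>. pn z x powr p) \<le> (LINT x:?E|\<mu>. d powr p)"
        using d p by (intro set_integral_mono set_integrable_pn cint z) (auto intro!: powr_mono2)
      then have "nrm M (set_class \<mu> ?E \<odot> z) \<le> (measure \<mu> ?E * d powr p) powr (1/p)"
        unfolding nrm_set[OF Em z] cLINT using p
        by (intro powr_mono2) (auto simp: set_lebesgue_integral_def intro!: integral_nonneg_AE)
      then show ?thesis using d p by (simp add: powr_mult powr_powr mult.commute)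
    qed
    have low: "c * measure \<mu> ?E powr (1/p) \<le> nrm M (set_class \<mu> ?E \<odot> (u \<oplus> v))"
    proof -
      have "(LINT x:?E|\<mu>. c powr p) \<le> (LINT x:?E|\<mu>. pn (u \<oplus> v) x powr p)"
      proof (rule set_integral_mono[OF cint set_integrable_pn[OF Em w]])
        fix x assume "x \<in> ?E"
        then have "c \<le> pn (u \<oplus> v) x" by (simp add: E_def)
        then show "c powr p \<le> pn (u \<oplus> v) x powr p" using ab p by (intro powr_mono2) auto
      qed
      then have "(measure \<mu> ?E * c powr p) powr (1/p) \<le> nrm M (set_class \<mu> ?E \<odot> (u \<oplus> v))"
        unfolding nrm_set[OF Em w] cLINT using p by (intro powr_mono2) auto
      then show ?thesis using ab p by (simp add: powr_mult powr_powr mult.commute)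
    qed
    have "nrm M (set_class \<mu> ?E \<odot> (u \<oplus> v)) \<le> nrm M (set_class \<mu> ?E \<odot> u) + nrm M (set_class \<mu> ?E \<odot> v)"
      using N.nrm_triangle[of "set_class \<mu> ?E \<odot> u" "set_class \<mu> ?E \<odot> v"] u v
      by (simp add: M.smult_r_distr)
    also have "\<dots> \<le> a * measure \<mu> ?E powr (1/p) + b * measure \<mu> ?E powr (1/p)"
      using ab by (intro add_mono up u v) (auto simp: E_def)
    finally have "(c - (a + b)) * measure \<mu> ?E powr (1/p) \<le> 0" using low by (simp add: algebra_simps)
    then have "measure \<mu> ?E powr (1/p) \<le> 0" using ab by (simp add: mult_le_0_iff)
    then have "measure \<mu> ?E = 0" by simp
    then have "emeasure \<mu> ?E = 0" using fin by (auto simp: measure_def enn2real_eq_0_iff)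
    then have "?E \<in> null_sets \<mu>" by auto
    then show ?thesis by (rule AE_not_in)
  qed
  then have "AE x in \<mu>. \<forall>a\<in>\<rat>. \<forall>b\<in>\<rat>. \<forall>c\<in>\<rat>. \<forall>i. 0 < a \<longrightarrow> 0 < b \<longrightarrow> a + b < c \<longrightarrow> x \<notin> E a b c i"
    by (intro AE_ball_countable' AE_all_countable[THEN iffD2] allI) (auto simp: countable_rat)
  with pn_nonneg[OF u] pn_nonneg[OF v] AE_space show ?thesis
  proof eventually_elim
    case (elim x)
    show ?case
    proof (rule ccontr)
      assume "\<not> ?thesis"
      then have d: "pn u x + pn v x < pn (u \<oplus> v) x" by simp
      let ?d = "(pn (u \<oplus> v) x - (pn u x + pn v x)) / 3"
      obtain a where a: "a \<in> \<rat>" "pn u x < a" "a < pn u x + ?d" using Rats_dense_in_real[of "pn u x" "pn u x + ?d"] d by auto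
      obtain b where b: "b \<in> \<rat>" "pn v x < b" "b < pn v x + ?d" using Rats_dense_in_real[of "pn v x" "pn v x + ?d"] d by auto
      have "a + b < pn (u \<oplus> v) x" using a b d by (simp add: field_simps)
      then obtain c where c: "c \<in> \<rat>" "a + b < c" "c < pn (u \<oplus> v) x" using Rats_dense_in_real by blast
      obtain i where "x \<in> B i" using elim B(2) by blast
      then have "x \<in> E a b c i" using a b c elim by (auto simp: E_def)
      moreover have "0 < a" "0 < b" using a b elim by auto
      ultimately show False using elim a b c by blast
    qed
  qed
qed

lemma diff_conv: "u \<in> carrier M \<Longrightarrow> v \<in> carrier M \<Longrightarrow> u \<ominus> v = u \<oplus> const_class \<mu> (-1) \<odot> v"
  using N.smult_simps(6)[of v] N.V.minus_eq[of u v] by simp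

lemma pn_diff_flip:
  assumes "u \<in> carrier M" "v \<in> carrier M"
  shows "AE x in \<mu>. pn (u \<ominus> v) x = pn (v \<ominus> u) x"
proof -
  have c: "v \<ominus> u \<in> carrier M" using assms by simp
  have "u \<ominus> v = const_class \<mu> (-1) \<odot> (v \<ominus> u)"
    using N.diff_flip[of v u] N.smult_simps(6)[of "v \<ominus> u"] assms c by simp
  then show ?thesis using pn_const[OF c, of "-1"] by simp
qed

lemma pn_reverse_triangle:
  assumes u: "u \<in> carrier M" and v: "v \<in> carrier M"
  shows "AE x in \<mu>. \<bar>pn u x - pn v x\<bar> \<le> pn (u \<ominus> v) x"
proof -
  have c: "v \<ominus> u \<in> carrier M" "u \<ominus> v \<in> carrier M" using assms by auto
  have "u = v \<oplus> (u \<ominus> v)" "v = u \<oplus> (v \<ominus> u)"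
    using N.add_diff[of u v] N.add_diff[of v u] assms by auto
  with pn_triangle[OF v c(2)] pn_triangle[OF u c(1)] pn_diff_flip[OF u v]
  show ?thesis by (auto elim!: eventually_elim2)
qed

lemma pn_finsum_triangle_set:
  assumes E: "E \<in> sets \<mu>" and u: "\<And>i. i < (n::nat) \<Longrightarrow> u i \<in> carrier M"
  shows "(LINT x:E|\<mu>. pn (\<Oplus>i\<in>{..<n}. u i) x powr p) powr (1/p)
    \<le> (\<Sum>i<n. (LINT x:E|\<mu>. pn (u i) x powr p) powr (1/p))"
proof -
  have "set_class \<mu> E \<odot> (\<Oplus>i\<in>{..<n}. u i) = (\<Oplus>i\<in>{..<n}. set_class \<mu> E \<odot> u i)"
    using E u by (intro M.finsum_smult_ldistr) auto
  then have "nrm M (set_class \<mu> E \<odot> (\<Oplus>i\<in>{..<n}. u i)) \<le> (\<Sum>i<n. nrm M (set_class \<mu> E \<odot> u i))"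
    using N.nrm_finsum[of n "\<lambda>i. set_class \<mu> E \<odot> u i"] E u by simp
  moreover have "(\<Oplus>i\<in>{..<n}. u i) \<in> carrier M" using u by (intro M.finsum_closed) auto
  ultimately show ?thesis using E u by (simp add: nrm_set)
qed

lemma nrm_smult_le:
  assumes F: "F \<in> ae_classes \<mu>" "AE x in \<mu>. \<bar>ae_rep F x\<bar> \<le> c" and v: "v \<in> carrier M"
  shows "nrm M (F \<odot> v) \<le> \<bar>c\<bar> * nrm M v"
proof -
  have FL: "F \<in> carrier (Linf \<mu>)" using F Linf_carrier_iff by blast
  have Fv: "F \<odot> v \<in> carrier M" using FL v by simp
  have "(LINT x|\<mu>. pn (F \<odot> v) x powr p) \<le> (LINT x|\<mu>. \<bar>c\<bar> powr p * pn v x powr p)"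
  proof (rule integral_mono_AE)
    show "AE x in \<mu>. pn (F \<odot> v) x powr p \<le> \<bar>c\<bar> powr p * pn v x powr p"
      using pn_smult[OF FL v] F(2) pn_nonneg[OF v]
    proof eventually_elim
      case (elim x)
      have "(\<bar>ae_rep F x\<bar> * pn v x) powr p \<le> (\<bar>c\<bar> * pn v x) powr p"
        using elim p by (intro powr_mono2 mult_right_mono) auto
      then show ?case using elim by (simp add: powr_mult)
    qed
  qed (use Fv v pn_integrable in auto)
  also have "\<dots> = (\<bar>c\<bar> * nrm M v) powr p"
    using v N.nrm_nonneg[of v] by (simp add: powr_mult nrm_powr)
  finally have "(LINT x|\<mu>. pn (F \<odot> v) x powr p) powr (1/p) \<le> ((\<bar>c\<bar> * nrm M v) powr p) powr (1/p)"
    using p by (intro powr_mono2) (auto intro!: integral_nonneg_AE)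
  then show ?thesis using v Fv p N.nrm_nonneg[of v] by (simp add: nrm_eq[OF Fv] powr_powr)
qed

lemma pn_limit_AE_subseq:
  assumes s: "\<And>n. s n \<in> carrier M" and v: "v \<in> carrier M"
    and lim: "(\<lambda>n. nrm M (s n \<ominus> v)) \<longlonglongrightarrow> 0"
  obtains r where "strict_mono (r :: nat \<Rightarrow> nat)" "AE x in \<mu>. (\<lambda>n. pn (s (r n) \<ominus> v) x) \<longlonglongrightarrow> 0"
proof -
  have c: "s n \<ominus> v \<in> carrier M" for n using s v by simp
  have "(\<lambda>n. nrm M (s n \<ominus> v) powr p) \<longlonglongrightarrow> 0 powr p"
    using p lim by (intro tendsto_powr2) (auto intro!: always_eventually N.nrm_nonneg[simplified] c)
  then have l: "(\<lambda>n. LINT x|\<mu>. \<bar>pn (s n \<ominus> v) x powr p\<bar>) \<longlonglongrightarrow> 0"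
    using p by (simp add: nrm_powr[OF c])
  obtain r where r: "strict_mono (r :: nat \<Rightarrow> nat)" "AE x in \<mu>. (\<lambda>n. pn (s (r n) \<ominus> v) x powr p) \<longlonglongrightarrow> 0"
    using L1_limit_AE_subseq[OF pn_integrable[OF c] l] by blast
  have "AE x in \<mu>. \<forall>n. 0 \<le> pn (s n \<ominus> v) x" using pn_nonneg[OF c] by (simp add: AE_all_countable)
  with r(2) have "AE x in \<mu>. (\<lambda>n. pn (s (r n) \<ominus> v) x) \<longlonglongrightarrow> 0"
  proof eventually_elim
    case (elim x)
    have "(\<lambda>n. (pn (s (r n) \<ominus> v) x powr p) powr (1/p)) \<longlonglongrightarrow> 0 powr (1/p)"
      using elim p by (intro tendsto_powr2) auto
    then show ?case using elim p by (simp add: powr_powr)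
  qed
  with r(1) show ?thesis by (rule that)
qed

end

section \<open>Fibres of a normed module\<close>

lemma (in abelian_monoid) finsum_append:
  assumes "\<And>i. i < n \<Longrightarrow> f i \<in> carrier G" "\<And>i. i < m \<Longrightarrow> g i \<in> carrier G"
  shows "(\<Oplus>i\<in>{..<n + m::nat}. if i < n then f i else g (i - n)) = (\<Oplus>i\<in>{..<n}. f i) \<oplus> (\<Oplus>i\<in>{..<m}. g i)"
  using assms(2)
proof (induction m)
  case 0
  have "(\<Oplus>i\<in>{..<n}. if i < n then f i else g (i - n)) = (\<Oplus>i\<in>{..<n}. f i)"
    using assms(1) by (intro finsum_cong') auto
  moreover have "(\<Oplus>i\<in>{..<n}. f i) \<in> carrier G" using assms(1) by (intro finsum_closed) auto
  ultimately show ?case by simp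
next
  case (Suc m)
  let ?h = "\<lambda>i. if i < n then f i else g (i - n)"
  have h: "?h i \<in> carrier G" if "i < Suc (n + m)" for i
    using that assms(1)[of i] Suc.prems[of "i - n"] by (cases "i < n") (auto simp: less_diff_conv2)
  have "(\<Oplus>i\<in>{..<n + Suc m}. ?h i) = ?h (n + m) \<oplus> (\<Oplus>i\<in>{..<n + m}. ?h i)"
    unfolding add_Suc_right lessThan_Suc
  proof (rule finsum_insert)
    show "?h \<in> {..<n + m} \<rightarrow> carrier G" using h by (intro funcsetI) (simp only: lessThan_iff less_SucI)
    show "?h (n + m) \<in> carrier G" by (rule h) simp
  qed auto
  also have "\<dots> = g m \<oplus> ((\<Oplus>i\<in>{..<n}. f i) \<oplus> (\<Oplus>i\<in>{..<m}. g i))"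
    using Suc by simp
  also have "\<dots> = (\<Oplus>i\<in>{..<n}. f i) \<oplus> (g m \<oplus> (\<Oplus>i\<in>{..<m}. g i))"
    using assms(1) Suc.prems by (intro a_lcomm finsum_closed) auto
  also have "g m \<oplus> (\<Oplus>i\<in>{..<m}. g i) = (\<Oplus>i\<in>{..<Suc m}. g i)"
    using Suc.prems unfolding lessThan_Suc by (intro finsum_insert[symmetric]) auto
  finally show ?case .
qed

locale fibred_module = Lp_module \<mu> p M
  for \<mu> :: "'x measure" and p :: real and M :: "('x, 'v) Lmodule" (structure) +
  fixes A :: "nat \<Rightarrow> 'x set"
  assumes dense: "dense_sequence \<mu> A"
begin

lemma A: "range A \<subseteq> sets \<mu>"
  using dense by (simp add: dense_sequence_def)

abbreviation "LV x \<equiv> Leb_vectors \<mu> A p M x"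
abbreviation "PF x \<equiv> pre_fibre \<mu> A p M x"
abbreviation "FB x \<equiv> fibre \<mu> A p M x"
abbreviation "RV v x \<equiv> Rep_vector \<mu> A p M v x"
abbreviation "value_norm v x \<equiv> Rep_p \<mu> A p (pnorm M v) x"

lemma LV_iff: "v \<in> LV x \<longleftrightarrow> v \<in> carrier M \<and> x \<in> Leb \<mu> A (\<lambda>z. pn v z powr p)"
  by (simp add: Leb_vectors_def Leb_p_def pn_def)

lemma LV_carrier: "v \<in> LV x \<Longrightarrow> v \<in> carrier M"
  by (simp add: LV_iff)

lemma LV_sub: "LV x \<subseteq> carrier M" using LV_carrier by auto

lemma LV_space: "v \<in> LV x \<Longrightarrow> x \<in> space \<mu>"
  by (simp add: LV_iff Leb_def)

definition avg_norm :: "nat \<Rightarrow> 'v \<Rightarrow> 'x \<Rightarrow> real" where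
  "avg_norm k v x = cell_avg \<mu> A k (\<lambda>z. pn v z powr p) x powr (1/p)"

lemma cell_avg_nonneg:
  assumes "x \<in> space \<mu>" "AE z in \<mu>. 0 \<le> f z"
  shows "0 \<le> cell_avg \<mu> A k f x"
  using assms(2) unfolding cell_avg_eq[OF A assms(1)] set_lebesgue_integral_def
  by (intro mult_nonneg_nonneg integral_nonneg_AE) (auto elim: eventually_mono)

lemma avg_norm_eq:
  assumes "x \<in> space \<mu>"
  shows "avg_norm k v x = (1 / measure \<mu> (atom \<mu> A k x)) powr (1/p) *
    (LINT z:atom \<mu> A k x|\<mu>. pn v z powr p) powr (1/p)"
  unfolding avg_norm_def cell_avg_eq[OF A assms] set_lebesgue_integral_def
  by (rule powr_mult)

lemma avg_norm_finsum:
  assumes x: "x \<in> space \<mu>" and u: "\<And>i. i < (n::nat) \<Longrightarrow> u i \<in> carrier M"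
  shows "avg_norm k (\<Oplus>i\<in>{..<n}. u i) x \<le> (\<Sum>i<n. avg_norm k (u i) x)"
  unfolding avg_norm_eq[OF x] sum_distrib_left[symmetric]
  using A u by (intro mult_left_mono pn_finsum_triangle_set) auto

lemma avg_norm_tendsto:
  assumes "v \<in> LV x"
  shows "(\<lambda>k. avg_norm k v x) \<longlonglongrightarrow> value_norm v x"
proof -
  have x: "x \<in> space \<mu>" and L: "x \<in> Leb \<mu> A (\<lambda>z. pn v z powr p)" using assms LV_space LV_iff by auto
  then have "(\<lambda>k. cell_avg \<mu> A k (\<lambda>z. pn v z powr p) x) \<longlonglongrightarrow> Rep \<mu> A (\<lambda>z. pn v z powr p) x"
    by (simp add: Leb_def Rep_def convergent_LIMSEQ_iff)
  then show ?thesis unfolding avg_norm_def Rep_p_def pn_def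
    using p x by (intro tendsto_powr2) (auto intro!: always_eventually cell_avg_nonneg)
qed

lemma value_norm_nonneg: "0 \<le> value_norm v x"
  by (simp add: Rep_p_def)

text \<open>
  Scaling a vector scales all the averages of its pointwise norm.
\<close>

lemma LV_scale:
  assumes v: "v \<in> LV x"
  shows "const_class \<mu> c \<odot> v \<in> LV x" "value_norm (const_class \<mu> c \<odot> v) x = \<bar>c\<bar> * value_norm v x"
proof -
  have vc: "v \<in> carrier M" and x: "x \<in> space \<mu>" using v LV_carrier LV_space by auto
  have cv: "const_class \<mu> c \<odot> v \<in> carrier M" using vc by simp
  have eq: "cell_avg \<mu> A k (\<lambda>z. pn (const_class \<mu> c \<odot> v) z powr p) x =
    \<bar>c\<bar> powr p * cell_avg \<mu> A k (\<lambda>z. pn v z powr p) x" for k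
  proof -
    have "(LINT z:atom \<mu> A k x|\<mu>. pn (const_class \<mu> c \<odot> v) z powr p) =
      (LINT z:atom \<mu> A k x|\<mu>. \<bar>c\<bar> powr p * pn v z powr p)"
      unfolding set_lebesgue_integral_def
    proof (rule integral_cong_AE)
      show "AE z in \<mu>. indicator (atom \<mu> A k x) z *\<^sub>R pn (const_class \<mu> c \<odot> v) z powr p =
        indicator (atom \<mu> A k x) z *\<^sub>R (\<bar>c\<bar> powr p * pn v z powr p)"
        using pn_const[OF vc, of c] pn_nonneg[OF vc]
        by eventually_elim (simp add: powr_mult)
    qed (use A vc cv in measurable)
    then show ?thesis unfolding cell_avg_eq[OF A x] by simp
  qed
  have lim: "(\<lambda>k. cell_avg \<mu> A k (\<lambda>z. pn v z powr p) x) \<longlonglongrightarrow> Rep \<mu> A (\<lambda>z. pn v z powr p) x"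
    using v by (simp add: LV_iff Leb_def Rep_def convergent_LIMSEQ_iff)
  then have lim': "(\<lambda>k. cell_avg \<mu> A k (\<lambda>z. pn (const_class \<mu> c \<odot> v) z powr p) x) \<longlonglongrightarrow>
    \<bar>c\<bar> powr p * Rep \<mu> A (\<lambda>z. pn v z powr p) x"
    unfolding eq by (rule tendsto_mult_left)
  then show L: "const_class \<mu> c \<odot> v \<in> LV x"
    using cv x by (auto simp: LV_iff Leb_def convergent_def)
  have "Rep \<mu> A (\<lambda>z. pn (const_class \<mu> c \<odot> v) z powr p) x = \<bar>c\<bar> powr p * Rep \<mu> A (\<lambda>z. pn v z powr p) x"
    using limI[OF lim'] L by (simp add: Rep_def LV_iff)
  moreover have "0 \<le> Rep \<mu> A (\<lambda>z. pn v z powr p) x"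
    using x by (intro LIMSEQ_le_const[OF lim] exI[of _ 0]) (auto intro!: cell_avg_nonneg)
  ultimately show "value_norm (const_class \<mu> c \<odot> v) x = \<bar>c\<bar> * value_norm v x"
    using p by (simp add: Rep_p_def pn_def powr_mult powr_powr)
qed

text \<open>The sums over which the fibre seminorm takes the infimum.\<close>

definition decomp_sums :: "'x \<Rightarrow> 'v \<Rightarrow> real set" where
  "decomp_sums x v = {(\<Sum>i<n. value_norm (u i) x) | (n::nat) u.
     u \<in> {..<n} \<rightarrow> LV x \<and> v = (\<Oplus>i\<in>{..<n}. u i)}"

lemma seminorm_eq: "fibre_seminorm \<mu> A p M x v = Inf (decomp_sums x v)"
  by (simp add: fibre_seminorm_def decomp_sums_def)

lemma decomp_sums_nonneg: "a \<in> decomp_sums x v \<Longrightarrow> 0 \<le> a"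
  by (auto simp: decomp_sums_def intro!: sum_nonneg value_norm_nonneg)

lemma decomp_sums_bdd: "bdd_below (decomp_sums x v)"
  using decomp_sums_nonneg by (intro bdd_belowI)

lemma decomp_sums_zero: "0 \<in> decomp_sums x \<zero>"
  unfolding decomp_sums_def by (intro CollectI exI[of _ 0] exI[of _ "\<lambda>_. \<zero>"]) auto

lemma decomp_sums_single: "v \<in> LV x \<Longrightarrow> value_norm v x \<in> decomp_sums x v"
proof -
  assume v: "v \<in> LV x"
  then have "(\<Oplus>i\<in>{..<Suc 0}. v) = v" using LV_carrier by (subst M.finsum_lessThan_Suc) auto
  then show ?thesis unfolding decomp_sums_def using v by (intro CollectI exI[of _ "Suc 0"] exI[of _ "\<lambda>_. v"]) auto
qed

lemma decomp_sums_add: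
  assumes "a \<in> decomp_sums x v" "b \<in> decomp_sums x w"
  shows "a + b \<in> decomp_sums x (v \<oplus> w)"
proof -
  obtain n f where f: "a = (\<Sum>i<n. value_norm (f i) x)" "f \<in> {..<n::nat} \<rightarrow> LV x" "v = (\<Oplus>i\<in>{..<n}. f i)"
    using assms(1) by (auto simp: decomp_sums_def)
  obtain m g where g: "b = (\<Sum>i<m. value_norm (g i) x)" "g \<in> {..<m::nat} \<rightarrow> LV x" "w = (\<Oplus>i\<in>{..<m}. g i)"
    using assms(2) by (auto simp: decomp_sums_def)
  let ?h = "\<lambda>i. if i < n then f i else g (i - n)"
  have fg: "i < n \<Longrightarrow> f i \<in> LV x" "i < m \<Longrightarrow> g i \<in> LV x" for i using f g by auto
  have "v \<oplus> w = (\<Oplus>i\<in>{..<n + m}. ?h i)"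
    unfolding f(3) g(3) using fg LV_carrier by (subst M.M.finsum_append) auto
  moreover have "?h \<in> {..<n + m} \<rightarrow> LV x" using fg by auto
  moreover have "a + b = (\<Sum>i<n + m. value_norm (?h i) x)"
  proof -
    have "{..<n + m} = {..<n} \<union> {n..<n + m}" by auto
    then have "(\<Sum>i<n + m. value_norm (?h i) x) = (\<Sum>i<n. value_norm (?h i) x) + (\<Sum>i=n..<n+m. value_norm (?h i) x)"
      by (metis (no_types, lifting) sum.union_disjoint finite_lessThan finite_atLeastLessThan ivl_disj_int_one(2))
    moreover have "(\<Sum>i=n..<n+m. value_norm (?h i) x) = (\<Sum>i<m. value_norm (g i) x)"
      by (rule sum.reindex_bij_witness[of _ "\<lambda>i. i + n" "\<lambda>i. i - n"]) auto
    ultimately show ?thesis by (simp add: f(1) g(1))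
  qed
  ultimately show ?thesis unfolding decomp_sums_def
    by (intro CollectI exI[of _ "n + m"] exI[of _ ?h]) simp
qed

lemma decomp_sums_scale:
  assumes "a \<in> decomp_sums x v"
  shows "\<bar>c\<bar> * a \<in> decomp_sums x (const_class \<mu> c \<odot> v)"
proof -
  obtain n f where f: "a = (\<Sum>i<n. value_norm (f i) x)" "f \<in> {..<n::nat} \<rightarrow> LV x" "v = (\<Oplus>i\<in>{..<n}. f i)"
    using assms(1) by (auto simp: decomp_sums_def)
  have fx: "i < n \<Longrightarrow> f i \<in> LV x" for i using f by auto
  have "const_class \<mu> c \<odot> v = (\<Oplus>i\<in>{..<n}. const_class \<mu> c \<odot> f i)"
    unfolding f(3) using fx LV_carrier by (intro M.finsum_smult_ldistr) auto
  moreover have "(\<lambda>i. const_class \<mu> c \<odot> f i) \<in> {..<n} \<rightarrow> LV x" using fx LV_scale by auto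
  moreover have "\<bar>c\<bar> * a = (\<Sum>i<n. value_norm (const_class \<mu> c \<odot> f i) x)"
    using fx LV_scale(2) by (simp add: f(1) sum_distrib_left)
  ultimately show ?thesis unfolding decomp_sums_def
    by (intro CollectI exI[of _ n] exI[of _ "\<lambda>i. const_class \<mu> c \<odot> f i"]) simp
qed

abbreviation "span_LV x \<equiv> lin_span real_ring (real_nspace \<mu> M) (LV x)"

lemma span_LV_decomp: "v \<in> span_LV x \<Longrightarrow> decomp_sums x v \<noteq> {}"
proof -
  have "span_LV x \<subseteq> {v. decomp_sums x v \<noteq> {}}"
  proof (rule N.V.lin_span_least)
    show "LV x \<subseteq> carrier (real_nspace \<mu> M)" using LV_sub by simp
    show "\<zero>\<^bsub>real_nspace \<mu> M\<^esub> \<in> {v. decomp_sums x v \<noteq> {}}" using decomp_sums_zero[of x] by auto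
    fix u v and c :: real
    show "u \<oplus>\<^bsub>real_nspace \<mu> M\<^esub> v \<in> {v. decomp_sums x v \<noteq> {}}"
      if "u \<in> {v. decomp_sums x v \<noteq> {}}" "v \<in> {v. decomp_sums x v \<noteq> {}}"
      using that decomp_sums_add[of _ x u _ v] by fastforce
    show "c \<odot>\<^bsub>real_nspace \<mu> M\<^esub> u \<in> {v. decomp_sums x v \<noteq> {}}" if "u \<in> LV x"
      using decomp_sums_single[OF LV_scale(1)[OF that, of c]] by auto
  qed
  then show "v \<in> span_LV x \<Longrightarrow> decomp_sums x v \<noteq> {}" by blast
qed

lemma PF_simps [simp]:
  "carrier (PF x) = span_LV x" "\<zero>\<^bsub>PF x\<^esub> = \<zero>" "u \<oplus>\<^bsub>PF x\<^esub> v = u \<oplus> v"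
  "c \<odot>\<^bsub>PF x\<^esub> u = const_class \<mu> c \<odot> u" "nrm (PF x) = fibre_seminorm \<mu> A p M x"
  by (auto simp: pre_fibre_def real_nspace_def)

lemma span_LV_carrier: "v \<in> span_LV x \<Longrightarrow> v \<in> carrier M"
  using N.V.lin_span_carrier[of "LV x"] LV_sub by auto

lemma LV_span: "v \<in> LV x \<Longrightarrow> v \<in> span_LV x"
  using N.V.lin_span_incl[of "LV x" v] LV_sub by auto

lemma span_LV_closed:
  "\<zero> \<in> span_LV x" "u \<in> span_LV x \<Longrightarrow> v \<in> span_LV x \<Longrightarrow> u \<oplus> v \<in> span_LV x"
  "u \<in> span_LV x \<Longrightarrow> const_class \<mu> c \<odot> u \<in> span_LV x"
  using N.V.lin_span_zero[of "LV x"] N.V.lin_span_add[of "LV x" u v] N.V.lin_span_smult[of "LV x" c u] LV_sub by auto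

text \<open>
  The infimum runs over a nonempty set because every vector of the span is a finite sum of vectors
  that have \<open>x\<close> as a Lebesgue point; scalars are absorbed into the summands.
\<close>

lemma PF_seminormed: "seminormed_space (PF x)"
proof (intro seminormed_spaceI moduleI[OF cring_real_ring] abelian_groupI)
  note sp = span_LV_closed span_LV_carrier
  note ac = N.V.a_assoc N.V.a_comm
  show "\<zero>\<^bsub>PF x\<^esub> \<in> carrier (PF x)" using sp by simp
  fix u assume "u \<in> carrier (PF x)"
  then have u: "u \<in> span_LV x" by simp
  then have uc: "u \<in> carrier M" by (rule sp)
  show "\<zero>\<^bsub>PF x\<^esub> \<oplus>\<^bsub>PF x\<^esub> u = u" using uc by simp
  show "\<exists>v\<in>carrier (PF x). v \<oplus>\<^bsub>PF x\<^esub> u = \<zero>\<^bsub>PF x\<^esub>"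
    using sp(3)[OF u, of "-1"] N.smult_simps(6)[of u] N.V.l_neg[of u] uc by (intro bexI[of _ "const_class \<mu> (-1) \<odot> u"]) auto
  show "\<one>\<^bsub>real_ring\<^esub> \<odot>\<^bsub>PF x\<^esub> u = u" using N.smult_simps(4)[of u] uc by simp
  show "a \<odot>\<^bsub>PF x\<^esub> u \<in> carrier (PF x)" for a using sp u by simp
  show "(a \<oplus>\<^bsub>real_ring\<^esub> b) \<odot>\<^bsub>PF x\<^esub> u = a \<odot>\<^bsub>PF x\<^esub> u \<oplus>\<^bsub>PF x\<^esub> b \<odot>\<^bsub>PF x\<^esub> u" for a b
    using N.smult_simps(1)[of u a b] uc by simp
  show "(a \<otimes>\<^bsub>real_ring\<^esub> b) \<odot>\<^bsub>PF x\<^esub> u = a \<odot>\<^bsub>PF x\<^esub> (b \<odot>\<^bsub>PF x\<^esub> u)" for a b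
    using N.smult_simps(3)[of u a b] uc by simp
  show nn: "0 \<le> nrm (PF x) u"
    using span_LV_decomp[OF u] decomp_sums_nonneg by (auto simp: seminorm_eq intro!: cInf_greatest)
  show "nrm (PF x) (c \<odot>\<^bsub>PF x\<^esub> u) \<le> \<bar>c\<bar> * nrm (PF x) u" for c
  proof (cases "c = 0")
    case True
    have z: "const_class \<mu> 0 \<odot> u = \<zero>" using N.smult_simps(5)[of u] uc by simp
    have "Inf (decomp_sums x \<zero>) \<le> 0" using decomp_sums_zero decomp_sums_bdd by (rule cInf_lower)
    then show ?thesis using True z by (simp add: seminorm_eq)
  next
    case False
    have "Inf (decomp_sums x (const_class \<mu> c \<odot> u)) / \<bar>c\<bar> \<le> Inf (decomp_sums x u)"
      using False span_LV_decomp[OF u] cInf_lower[OF decomp_sums_scale decomp_sums_bdd]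
      by (intro cInf_greatest) (auto simp: field_simps)
    then show ?thesis using False by (simp add: seminorm_eq field_simps)
  qed
  fix v assume "v \<in> carrier (PF x)"
  then have v: "v \<in> span_LV x" by simp
  then have vc: "v \<in> carrier M" by (rule sp)
  show "u \<oplus>\<^bsub>PF x\<^esub> v \<in> carrier (PF x)" using sp u v by simp
  show "u \<oplus>\<^bsub>PF x\<^esub> v = v \<oplus>\<^bsub>PF x\<^esub> u" using N.V.a_comm[of u v] uc vc by simp
  show "a \<odot>\<^bsub>PF x\<^esub> (u \<oplus>\<^bsub>PF x\<^esub> v) = a \<odot>\<^bsub>PF x\<^esub> u \<oplus>\<^bsub>PF x\<^esub> a \<odot>\<^bsub>PF x\<^esub> v" for a
    using N.smult_simps(2)[of u v a] uc vc by simp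
  show "nrm (PF x) (u \<oplus>\<^bsub>PF x\<^esub> v) \<le> nrm (PF x) u + nrm (PF x) v"
  proof -
    have 1: "Inf (decomp_sums x (u \<oplus> v)) \<le> a + b" if "a \<in> decomp_sums x u" "b \<in> decomp_sums x v" for a b
      using that by (intro cInf_lower decomp_sums_add decomp_sums_bdd)
    have "Inf (decomp_sums x (u \<oplus> v)) - b \<le> Inf (decomp_sums x u)" if "b \<in> decomp_sums x v" for b
      using 1 that span_LV_decomp[OF u] by (intro cInf_greatest) (auto simp: algebra_simps)
    then have "Inf (decomp_sums x (u \<oplus> v)) - Inf (decomp_sums x u) \<le> Inf (decomp_sums x v)"
      using span_LV_decomp[OF v] by (intro cInf_greatest) (auto simp: algebra_simps)
    then show ?thesis by (simp add: seminorm_eq)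
  qed
  fix w assume "w \<in> carrier (PF x)"
  then show "u \<oplus>\<^bsub>PF x\<^esub> v \<oplus>\<^bsub>PF x\<^esub> w = u \<oplus>\<^bsub>PF x\<^esub> (v \<oplus>\<^bsub>PF x\<^esub> w)"
    using N.V.a_assoc[of u v w] uc vc sp by simp
qed

text \<open>
  The triangle inequality for the averages over a cell passes to the limit along the cells, so
  that a decomposition cannot beat a vector at one of its own Lebesgue points.
\<close>

lemma avg_norm_limsup:
  assumes v: "v \<in> span_LV x" and x: "x \<in> space \<mu>" and e: "0 < e"
  shows "eventually (\<lambda>k. avg_norm k v x \<le> fibre_seminorm \<mu> A p M x v + e) sequentially"
proof -
  have "Inf (decomp_sums x v) < Inf (decomp_sums x v) + e/2" using e by simp
  then obtain a where a: "a \<in> decomp_sums x v" "a < Inf (decomp_sums x v) + e/2"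
    using cInf_lessD[OF span_LV_decomp[OF v]] by blast
  obtain n f where f: "a = (\<Sum>i<n. value_norm (f i) x)" "f \<in> {..<n::nat} \<rightarrow> LV x" "v = (\<Oplus>i\<in>{..<n}. f i)"
    using a(1) by (auto simp: decomp_sums_def)
  have "(\<lambda>k. \<Sum>i<n. avg_norm k (f i) x) \<longlonglongrightarrow> a"
    unfolding f(1) using f(2) by (intro tendsto_sum avg_norm_tendsto) auto
  then have "eventually (\<lambda>k. (\<Sum>i<n. avg_norm k (f i) x) < a + e/2) sequentially"
    using e by (intro order_tendstoD(2)) auto
  then show ?thesis
  proof eventually_elim
    case (elim k)
    have "avg_norm k v x \<le> (\<Sum>i<n. avg_norm k (f i) x)"
      unfolding f(3) using x f(2) LV_carrier by (intro avg_norm_finsum) auto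
    then show ?case using elim a by (simp add: seminorm_eq)
  qed
qed

lemma seminorm_Leb:
  assumes v: "v \<in> LV x"
  shows "fibre_seminorm \<mu> A p M x v = value_norm v x"
proof (rule antisym)
  show "fibre_seminorm \<mu> A p M x v \<le> value_norm v x"
    unfolding seminorm_eq using v by (intro cInf_lower decomp_sums_single decomp_sums_bdd)
  show "value_norm v x \<le> fibre_seminorm \<mu> A p M x v"
  proof (rule field_le_epsilon)
    fix e :: real assume e: "0 < e"
    have "eventually (\<lambda>k. avg_norm k v x \<le> fibre_seminorm \<mu> A p M x v + e) sequentially"
      using v LV_space e by (intro avg_norm_limsup LV_span) auto
    then show "value_norm v x \<le> fibre_seminorm \<mu> A p M x v + e"
      using avg_norm_tendsto[OF v] by (intro tendsto_upperbound[OF _ _ sequentially_bot])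
  qed
qed

sublocale PF: seminormed_space "PF x" for x by (rule PF_seminormed)

lemma FB_banach: "banach_space (FB x)"
  unfolding fibre_def by (rule PF.completion_banach)

sublocale FB: normed_space "FB x" for x
  using FB_banach normed_space_banach by blast

lemma RV_eq: "v \<in> LV x \<Longrightarrow> RV v x = completion_map (PF x) v"
  by (simp add: Rep_vector_def LV_iff Leb_p_def pn_def)

lemma RV_zero: "v \<in> carrier M \<Longrightarrow> v \<notin> LV x \<Longrightarrow> RV v x = \<zero>\<^bsub>FB x\<^esub>"
  by (simp add: Rep_vector_def LV_iff Leb_p_def pn_def)

lemma RV_carrier: "v \<in> carrier M \<Longrightarrow> RV v x \<in> carrier (FB x)"
  using PF.completion_map_carrier[of v x] LV_span[of v x]
  by (cases "v \<in> LV x") (auto simp: RV_eq RV_zero fibre_def[symmetric])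

lemma RV_nrm: "v \<in> LV x \<Longrightarrow> nrm (FB x) (RV v x) = value_norm v x"
  using PF.completion_map_nrm[of v x] LV_span[of v x] by (simp add: RV_eq fibre_def seminorm_Leb)

lemma AE_LV:
  assumes v: "v \<in> carrier M"
  shows "AE x in \<mu>. v \<in> LV x \<and> value_norm v x = pn v x"
  using AE_Leb_Rep[OF dense pn_integrable[OF v]] pn_nonneg[OF v]
proof eventually_elim
  case (elim x)
  then show ?case using v p by (auto simp: LV_iff Rep_p_def pn_def[symmetric] powr_powr)
qed

lemma AE_RV_nrm:
  assumes v: "v \<in> carrier M"
  shows "AE x in \<mu>. nrm (FB x) (RV v x) = pn v x"
  using AE_LV[OF v] by eventually_elim (auto simp: RV_nrm)

text \<open>
  Almost every point is a Lebesgue point of \<open>u\<close>, \<open>v\<close> and \<open>u + v\<close> at the same time, and there the map into the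
  completion is linear.
\<close>

lemma AE_RV_add:
  assumes u: "u \<in> carrier M" and v: "v \<in> carrier M"
  shows "AE x in \<mu>. RV (u \<oplus> v) x = RV u x \<oplus>\<^bsub>FB x\<^esub> RV v x"
proof -
  have "u \<oplus> v \<in> carrier M" using u v by simp
  from AE_LV[OF u] AE_LV[OF v] AE_LV[OF this] show ?thesis
  proof eventually_elim
    case (elim x)
    then show ?case using PF.completion_map_add[of u x v] LV_span[of u x] LV_span[of v x] by (simp add: RV_eq fibre_def)
  qed
qed

lemma RV_scale:
  assumes u: "u \<in> LV x"
  shows "RV (const_class \<mu> c \<odot> u) x = c \<odot>\<^bsub>FB x\<^esub> RV u x"
  using PF.completion_map_scale[of u x c] LV_span[OF u] LV_scale[OF u] u by (simp add: RV_eq fibre_def)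

lemma AE_RV_scale:
  assumes u: "u \<in> carrier M"
  shows "AE x in \<mu>. \<forall>c. RV (const_class \<mu> c \<odot> u) x = c \<odot>\<^bsub>FB x\<^esub> RV u x"
  using AE_LV[OF u] by eventually_elim (auto simp: RV_scale)

end

section \<open>Norm convergence\<close>

context normed_space
begin

definition nconv :: "(nat \<Rightarrow> 'v) \<Rightarrow> 'v \<Rightarrow> bool" where
  "nconv s a \<longleftrightarrow> (\<lambda>n. nrm V (s n \<ominus> a)) \<longlonglongrightarrow> 0"

lemma nconv_unique:
  assumes "nconv s a" "nconv s b" and c: "\<And>n. s n \<in> carrier V" "a \<in> carrier V" "b \<in> carrier V"
  shows "a = b"
proof -
  have "(\<lambda>n. nrm V (s n \<ominus> a) + nrm V (s n \<ominus> b)) \<longlonglongrightarrow> 0 + 0"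
    using assms unfolding nconv_def by (intro tendsto_add)
  moreover have "nrm V (a \<ominus> b) \<le> nrm V (s n \<ominus> a) + nrm V (s n \<ominus> b)" for n
    using nrm_diff_triangle[of a "s n" b] nrm_flip[of a "s n"] c by simp
  ultimately have "nrm V (a \<ominus> b) \<le> 0" using LIMSEQ_le_const by force
  then have "a \<ominus> b = \<zero>" using nrm_nonneg[of "a \<ominus> b"] c by (intro nrm_zero_imp) auto
  then show ?thesis using c diff_zero_eq by blast
qed

lemma nconv_add:
  assumes "nconv s a" "nconv t b"
    and c: "\<And>n. s n \<in> carrier V" "\<And>n. t n \<in> carrier V" "a \<in> carrier V" "b \<in> carrier V"
  shows "nconv (\<lambda>n. s n \<oplus> t n) (a \<oplus> b)"
  unfolding nconv_def
proof (rule null_by_bound)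
  have "(\<lambda>n. nrm V (s n \<ominus> a) + nrm V (t n \<ominus> b)) \<longlonglongrightarrow> 0 + 0"
    using assms unfolding nconv_def by (intro tendsto_add)
  then show "(\<lambda>n. nrm V (s n \<ominus> a) + nrm V (t n \<ominus> b)) \<longlonglongrightarrow> 0" by simp
qed (use c in \<open>auto simp: diff_add intro!: nrm_nonneg nrm_triangle\<close>)

lemma nconv_bound:
  assumes "nconv s a" "\<And>n. nrm V (s n) \<le> K" and c: "\<And>n. s n \<in> carrier V" "a \<in> carrier V"
  shows "nrm V a \<le> K"
proof -
  have "nrm V a - K \<le> nrm V (s n \<ominus> a)" for n
    using nrm_reverse_triangle[of "s n" a] c assms(2)[of n] by auto
  then have "nrm V a - K \<le> 0" using assms(1) LIMSEQ_le_const unfolding nconv_def by blast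
  then show ?thesis by simp
qed

lemma nconv_cauchy:
  assumes "nconv s a" and c: "\<And>n. s n \<in> carrier V" "a \<in> carrier V" and "0 < e"
  shows "\<exists>n0. \<forall>m\<ge>n0. \<forall>n\<ge>n0. nrm V (s m \<ominus> s n) < e"
proof -
  have e2: "0 < e / 2" using \<open>0 < e\<close> by simp
  obtain n0 where n0: "\<And>n. n \<ge> n0 \<Longrightarrow> nrm V (s n \<ominus> a) < e/2"
    using LIMSEQ_D[OF assms(1)[unfolded nconv_def] e2] c by (auto simp: nrm_nonneg)
  have "nrm V (s m \<ominus> s n) < e" if "m \<ge> n0" "n \<ge> n0" for m n
    using nrm_diff_triangle[of "s m" a "s n"] nrm_flip[of a "s n"] n0[OF that(1)] n0[OF that(2)] c by simp
  then show ?thesis by blast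
qed

end

lemma ae_rep_L1_diff:
  assumes "F \<in> Lp_set \<mu> 1" "G \<in> Lp_set \<mu> 1"
  shows "AE x in \<mu>. ae_rep (F \<ominus>\<^bsub>Lp_space \<mu> 1\<^esub> G) x = ae_rep F x - ae_rep G x"
    "nrm (Lp_space \<mu> 1) (F \<ominus>\<^bsub>Lp_space \<mu> 1\<^esub> G) = (LINT x|\<mu>. \<bar>ae_rep F x - ae_rep G x\<bar>)"
proof -
  interpret L: normed_space "Lp_space \<mu> 1" by (rule L1_normed)
  have [measurable]: "ae_rep F \<in> borel_measurable \<mu>" "ae_rep G \<in> borel_measurable \<mu>"
    using assms by (auto simp: Lp_set_iff)
  have "F \<ominus>\<^bsub>Lp_space \<mu> 1\<^esub> G = ae_class \<mu> (ae_rep F) \<oplus>\<^bsub>Lp_space \<mu> 1\<^esub> (-1) \<odot>\<^bsub>Lp_space \<mu> 1\<^esub> ae_class \<mu> (ae_rep G)"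
    using assms L.smult_simps(6)[of G] by (simp add: a_minus_def ae_class_ae_rep Lp_set_ae_classes)
  also have "\<dots> = ae_class \<mu> (\<lambda>x. ae_rep F x - ae_rep G x)"
    by (subst L1_smult_class) (simp_all add: ae_map2_ae_class)
  finally have eq: "F \<ominus>\<^bsub>Lp_space \<mu> 1\<^esub> G = ae_class \<mu> (\<lambda>x. ae_rep F x - ae_rep G x)" .
  show "AE x in \<mu>. ae_rep (F \<ominus>\<^bsub>Lp_space \<mu> 1\<^esub> G) x = ae_rep F x - ae_rep G x"
    unfolding eq by (rule AE_ae_rep_class) simp
  show "nrm (Lp_space \<mu> 1) (F \<ominus>\<^bsub>Lp_space \<mu> 1\<^esub> G) = (LINT x|\<mu>. \<bar>ae_rep F x - ae_rep G x\<bar>)"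
    unfolding eq by (simp add: L1_norm_class)
qed

abbreviation L1_conv :: "'a measure \<Rightarrow> (nat \<Rightarrow> ('a \<Rightarrow> real) set) \<Rightarrow> ('a \<Rightarrow> real) set \<Rightarrow> bool" where
  "L1_conv \<mu> \<equiv> normed_space.nconv (Lp_space \<mu> 1)"

lemma L1_conv_iff:
  assumes "\<And>n. s n \<in> Lp_set \<mu> 1" "F \<in> Lp_set \<mu> 1"
  shows "L1_conv \<mu> s F \<longleftrightarrow> (\<lambda>n. LINT x|\<mu>. \<bar>ae_rep (s n) x - ae_rep F x\<bar>) \<longlonglongrightarrow> 0"
  unfolding normed_space.nconv_def[OF L1_normed] by (subst ae_rep_L1_diff(2)) (use assms in auto)

lemma L1_cauchy_limit:
  assumes s: "\<And>n. s n \<in> Lp_set \<mu> 1"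
    and cau: "\<And>e. 0 < e \<Longrightarrow> \<exists>n0. \<forall>m\<ge>n0. \<forall>n\<ge>n0. nrm (Lp_space \<mu> 1) (s m \<ominus>\<^bsub>Lp_space \<mu> 1\<^esub> s n) < e"
  obtains F where "F \<in> Lp_set \<mu> 1" "L1_conv \<mu> s F"
proof -
  have int: "integrable \<mu> (ae_rep (s n))" for n using s by (auto simp: Lp1_set_iff)
  obtain g where g: "integrable \<mu> g" "(\<lambda>n. LINT x|\<mu>. \<bar>ae_rep (s n) x - g x\<bar>) \<longlonglongrightarrow> 0"
    by (rule L1_complete[OF int cau[unfolded ae_rep_L1_diff(2)[OF s s]]])
  have gm: "g \<in> borel_measurable \<mu>" using g by auto
  have "(LINT x|\<mu>. \<bar>ae_rep (s n) x - ae_rep (ae_class \<mu> g) x\<bar>) = (LINT x|\<mu>. \<bar>ae_rep (s n) x - g x\<bar>)" for n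
    using AE_ae_rep_class[OF gm] int[of n] gm
    by (intro integral_cong_AE) (auto intro!: borel_measurable_diff elim: eventually_mono)
  then have "L1_conv \<mu> s (ae_class \<mu> g)"
    using g s ae_class_L1[OF g(1)] by (subst L1_conv_iff) auto
  with ae_class_L1[OF g(1)] show ?thesis by (rule that)
qed

lemma L1_conv_AE_subseq:
  assumes s: "\<And>n. s n \<in> Lp_set \<mu> 1" and F: "F \<in> Lp_set \<mu> 1" and "L1_conv \<mu> s F"
  obtains r where "strict_mono (r :: nat \<Rightarrow> nat)" "AE x in \<mu>. (\<lambda>n. ae_rep (s (r n)) x) \<longlonglongrightarrow> ae_rep F x"
proof -
  have int: "integrable \<mu> (\<lambda>x. ae_rep (s n) x - ae_rep F x)" for n using s F by (auto simp: Lp1_set_iff)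
  have "(\<lambda>n. LINT x|\<mu>. \<bar>ae_rep (s n) x - ae_rep F x\<bar>) \<longlonglongrightarrow> 0"
    using assms(3) unfolding L1_conv_iff[OF s F] .
  then obtain r where r: "strict_mono (r :: nat \<Rightarrow> nat)" "AE x in \<mu>. (\<lambda>n. ae_rep (s (r n)) x - ae_rep F x) \<longlonglongrightarrow> 0"
    by (rule L1_limit_AE_subseq[OF int])
  from r(2) have "AE x in \<mu>. (\<lambda>n. ae_rep (s (r n)) x) \<longlonglongrightarrow> ae_rep F x"
    by eventually_elim (simp add: LIM_zero_iff)
  with r(1) show ?thesis by (rule that)
qed

lemma Linf_L1_closed:
  "F \<in> carrier (Linf \<mu>) \<Longrightarrow> G \<in> Lp_set \<mu> 1 \<Longrightarrow> ae_map2 \<mu> (*) F G \<in> Lp_set \<mu> 1"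
  by (rule Lp_set_scale) auto

lemma Linf_L1_norm:
  assumes F: "F \<in> ae_classes \<mu>" "AE x in \<mu>. \<bar>ae_rep F x\<bar> \<le> c" and G: "G \<in> Lp_set \<mu> 1"
  shows "Lp_norm \<mu> 1 (ae_map2 \<mu> (*) F G) \<le> c * Lp_norm \<mu> 1 G"
proof -
  have FL: "F \<in> carrier (Linf \<mu>)" using F Linf_carrier_iff by blast
  have Gc: "G \<in> ae_classes \<mu>" using G Lp_set_ae_classes by blast
  have "Lp_norm \<mu> 1 (ae_map2 \<mu> (*) F G) = (LINT x|\<mu>. \<bar>ae_rep F x * ae_rep G x\<bar>)"
    unfolding ae_map2_def using F(1) Gc by (intro L1_norm_class) auto
  also have "\<dots> \<le> (LINT x|\<mu>. c * \<bar>ae_rep G x\<bar>)"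
  proof (rule integral_mono_AE)
    have "integrable \<mu> (ae_rep (ae_map2 \<mu> (*) F G))"
      using Linf_L1_closed[OF FL G] by (simp add: Lp1_set_iff)
    then have "integrable \<mu> (\<lambda>x. ae_rep F x * ae_rep G x)"
      by (rule integrable_cong_AE_imp) (use F(1) Gc ae_map2_classes(5)[OF F(1) Gc] in \<open>auto elim: eventually_mono\<close>)
    then show "integrable \<mu> (\<lambda>x. \<bar>ae_rep F x * ae_rep G x\<bar>)" by simp
    show "integrable \<mu> (\<lambda>x. c * \<bar>ae_rep G x\<bar>)" using G by (auto simp: Lp1_set_iff)
    show "AE x in \<mu>. \<bar>ae_rep F x * ae_rep G x\<bar> \<le> c * \<bar>ae_rep G x\<bar>"
      using F(2) by eventually_elim (auto simp: abs_mult intro: mult_right_mono)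
  qed
  finally show ?thesis by (simp add: Lp1_norm)
qed

lemma ae_mult_laws:
  assumes "F \<in> ae_classes \<mu>" "F' \<in> ae_classes \<mu>" "G \<in> ae_classes \<mu>" "G' \<in> ae_classes \<mu>"
  shows "ae_map2 \<mu> (*) F (ae_map2 \<mu> (+) G G') = ae_map2 \<mu> (+) (ae_map2 \<mu> (*) F G) (ae_map2 \<mu> (*) F G')"
    "ae_map2 \<mu> (*) (ae_map2 \<mu> (+) F F') G = ae_map2 \<mu> (+) (ae_map2 \<mu> (*) F G) (ae_map2 \<mu> (*) F' G)"
    "ae_map2 \<mu> (*) (ae_map2 \<mu> (*) F F') G = ae_map2 \<mu> (*) F (ae_map2 \<mu> (*) F' G)"
    "ae_map2 \<mu> (*) (const_class \<mu> 1) G = G"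
    "ae_map2 \<mu> (*) F (ae_map2 \<mu> (*) F' G) = ae_map2 \<mu> (*) F' (ae_map2 \<mu> (*) F G)"
    "ae_map2 \<mu> (*) F (const_class \<mu> 0) = const_class \<mu> 0"
proof -
  obtain f f' g g' where [measurable]: "f \<in> borel_measurable \<mu>" "f' \<in> borel_measurable \<mu>" "g \<in> borel_measurable \<mu>" "g' \<in> borel_measurable \<mu>"
    and eq: "F = ae_class \<mu> f" "F' = ae_class \<mu> f'" "G = ae_class \<mu> g" "G' = ae_class \<mu> g'"
    using assms by (auto simp: ae_classes_def)
  note cl = ae_map2_ae_class[of _ \<mu>]
  show "ae_map2 \<mu> (*) F (ae_map2 \<mu> (+) G G') = ae_map2 \<mu> (+) (ae_map2 \<mu> (*) F G) (ae_map2 \<mu> (*) F G')"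
    "ae_map2 \<mu> (*) (ae_map2 \<mu> (+) F F') G = ae_map2 \<mu> (+) (ae_map2 \<mu> (*) F G) (ae_map2 \<mu> (*) F' G)"
    "ae_map2 \<mu> (*) (ae_map2 \<mu> (*) F F') G = ae_map2 \<mu> (*) F (ae_map2 \<mu> (*) F' G)"
    "ae_map2 \<mu> (*) (const_class \<mu> 1) G = G"
    "ae_map2 \<mu> (*) F (ae_map2 \<mu> (*) F' G) = ae_map2 \<mu> (*) F' (ae_map2 \<mu> (*) F G)"
    "ae_map2 \<mu> (*) F (const_class \<mu> 0) = const_class \<mu> 0"
    unfolding eq by (simp_all add: cl algebra_simps)
qed

lemma ae_add_swap:
  assumes "F \<in> ae_classes \<mu>" "F' \<in> ae_classes \<mu>" "G \<in> ae_classes \<mu>" "G' \<in> ae_classes \<mu>"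
  shows "ae_map2 \<mu> (+) (ae_map2 \<mu> (+) F F') (ae_map2 \<mu> (+) G G') =
    ae_map2 \<mu> (+) (ae_map2 \<mu> (+) F G) (ae_map2 \<mu> (+) F' G')"
  using assms unfolding ae_classes_def by (auto simp: ae_map2_ae_class add_ac)

lemma Linf_simps [simp]:
  "F \<oplus>\<^bsub>Linf \<mu>\<^esub> G = ae_map2 \<mu> (+) F G" "F \<otimes>\<^bsub>Linf \<mu>\<^esub> G = ae_map2 \<mu> (*) F G"
  "\<one>\<^bsub>Linf \<mu>\<^esub> = const_class \<mu> 1" "\<zero>\<^bsub>Linf \<mu>\<^esub> = const_class \<mu> 0"
  by (auto simp: Linf_def)

lemma real_nspace_module:
  assumes "Module.module (Linf \<mu>) M"
  shows "Module.module real_ring (real_nspace \<mu> M)"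
proof -
  interpret M: Module.module "Linf \<mu>" M by fact
  have add: "const_class \<mu> (a + b) = const_class \<mu> a \<oplus>\<^bsub>Linf \<mu>\<^esub> const_class \<mu> b" for a b by (simp add: ae_map2_ae_class)
  have mult: "const_class \<mu> (a * b) = const_class \<mu> a \<otimes>\<^bsub>Linf \<mu>\<^esub> const_class \<mu> b" for a b by (simp add: ae_map2_ae_class)
  show ?thesis
  proof (rule moduleI[OF cring_real_ring])
    show "abelian_group (real_nspace \<mu> M)"
    proof (rule abelian_groupI)
      show "\<exists>y\<in>carrier (real_nspace \<mu> M). y \<oplus>\<^bsub>real_nspace \<mu> M\<^esub> x = \<zero>\<^bsub>real_nspace \<mu> M\<^esub>"
        if "x \<in> carrier (real_nspace \<mu> M)" for x
        using that M.M.l_neg[of x] by (intro bexI[of _ "\<ominus>\<^bsub>M\<^esub> x"]) auto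
    qed (auto simp: M.M.a_ac)
    fix a b :: real and x assume "x \<in> carrier (real_nspace \<mu> M)"
    then have x: "x \<in> carrier M" by simp
    show "(a \<oplus>\<^bsub>real_ring\<^esub> b) \<odot>\<^bsub>real_nspace \<mu> M\<^esub> x = a \<odot>\<^bsub>real_nspace \<mu> M\<^esub> x \<oplus>\<^bsub>real_nspace \<mu> M\<^esub> b \<odot>\<^bsub>real_nspace \<mu> M\<^esub> x"
      using M.smult_l_distr[of "const_class \<mu> a" "const_class \<mu> b" x] x by (simp add: ae_map2_ae_class)
    show "(a \<otimes>\<^bsub>real_ring\<^esub> b) \<odot>\<^bsub>real_nspace \<mu> M\<^esub> x = a \<odot>\<^bsub>real_nspace \<mu> M\<^esub> (b \<odot>\<^bsub>real_nspace \<mu> M\<^esub> x)"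
      using M.smult_assoc1[of "const_class \<mu> a" "const_class \<mu> b" x] x by (simp add: ae_map2_ae_class)
  qed (use M.smult_r_distr M.smult_one in auto)
qed

section \<open>The dual of a normed module\<close>

locale dual_module = Lp_module \<mu> p M
  for \<mu> :: "'x measure" and p :: real and M :: "('x, 'v) Lmodule" (structure) +
  fixes q :: real
  assumes q: "1 < q" and pq: "1 / p + 1 / q = 1"
begin

abbreviation "DM \<equiv> module_dual \<mu> M"

sublocale L1: normed_space "Lp_space \<mu> 1" by (rule L1_normed)

lemma DM_simps [simp]:
  "\<zero>\<^bsub>DM\<^esub> = (\<lambda>v\<in>carrier M. const_class \<mu> 0)"
  "L1 \<oplus>\<^bsub>DM\<^esub> L2 = (\<lambda>v\<in>carrier M. ae_map2 \<mu> (+) (L1 v) (L2 v))"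
  "F \<odot>\<^bsub>DM\<^esub> L1 = (\<lambda>v\<in>carrier M. ae_map2 \<mu> (*) F (L1 v))"
  by (auto simp: module_dual_def)

lemma DM_linear:
  assumes "L \<in> carrier DM" "u \<in> carrier M" "v \<in> carrier M"
  shows "L u \<in> Lp_set \<mu> 1" "L (u \<oplus> v) = ae_map2 \<mu> (+) (L u) (L v)"
    "F \<in> carrier (Linf \<mu>) \<Longrightarrow> L (F \<odot> u) = ae_map2 \<mu> (*) F (L u)"
  using assms by (auto simp: module_dual_def)

lemma smult_L1: "F \<in> ae_classes \<mu> \<Longrightarrow> c \<odot>\<^bsub>Lp_space \<mu> 1\<^esub> F = ae_map2 \<mu> (*) (const_class \<mu> c) F"
proof -
  assume F: "F \<in> ae_classes \<mu>"
  have Fm: "ae_rep F \<in> borel_measurable \<mu>" using F by simp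
  show ?thesis
    using L1_smult_class[OF Fm, where c=c] ae_map2_ae_class(2)[OF measurable_const Fm, of "c"] F by (simp add: ae_class_ae_rep)
qed

text \<open>
  A module homomorphism is in particular real linear, so that continuity means boundedness.
\<close>

lemma DM_iff_bounded:
  assumes L: "L \<in> carrier M \<rightarrow>\<^sub>E Lp_set \<mu> 1"
    and add: "\<And>u v. u \<in> carrier M \<Longrightarrow> v \<in> carrier M \<Longrightarrow> L (u \<oplus> v) = ae_map2 \<mu> (+) (L u) (L v)"
    and smult: "\<And>F v. F \<in> carrier (Linf \<mu>) \<Longrightarrow> v \<in> carrier M \<Longrightarrow> L (F \<odot> v) = ae_map2 \<mu> (*) F (L v)"
  shows "L \<in> carrier DM \<longleftrightarrow> (\<exists>K. \<forall>v\<in>carrier M. Lp_norm \<mu> 1 (L v) \<le> K * nrm M v)"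
proof -
  have Lc: "L v \<in> Lp_set \<mu> 1" if "v \<in> carrier M" for v using L that by auto
  have "continuous_map (ntopology (real_nspace \<mu> M)) (ntopology (Lp_space \<mu> 1)) L \<longleftrightarrow>
    (\<exists>K. \<forall>u\<in>carrier (real_nspace \<mu> M). nrm (Lp_space \<mu> 1) (L u) \<le> K * nrm (real_nspace \<mu> M) u)"
  proof (rule N.continuous_linear_bounded[OF L1_normed])
    show "L (c \<odot>\<^bsub>real_nspace \<mu> M\<^esub> u) = c \<odot>\<^bsub>Lp_space \<mu> 1\<^esub> L u" if "u \<in> carrier (real_nspace \<mu> M)" for c u
      using that smult_L1[OF Lp_set_ae_classes[OF Lc[of u]]] by (simp add: smult)
  qed (use Lc add in auto)
  then show ?thesis using assms by (auto simp: module_dual_def)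
qed

lemma DM_bounded:
  assumes "L \<in> carrier DM"
  obtains K where "0 \<le> K" "\<And>v. v \<in> carrier M \<Longrightarrow> Lp_norm \<mu> 1 (L v) \<le> K * nrm M v"
proof -
  have "\<exists>K. \<forall>v\<in>carrier M. Lp_norm \<mu> 1 (L v) \<le> K * nrm M v"
    using assms by (subst DM_iff_bounded[symmetric]) (auto simp: module_dual_def)
  then obtain K where K: "\<And>v. v \<in> carrier M \<Longrightarrow> Lp_norm \<mu> 1 (L v) \<le> K * nrm M v" by blast
  have "Lp_norm \<mu> 1 (L v) \<le> \<bar>K\<bar> * nrm M v" if "v \<in> carrier M" for v
    using K[OF that] N.nrm_nonneg[of v] that mult_right_mono[of K "\<bar>K\<bar>" "nrm M v"] abs_ge_self[of K] by simp
  then show ?thesis by (intro that[of "\<bar>K\<bar>"]) auto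
qed

lemma DM_eqI:
  assumes "L \<in> carrier DM" "L' \<in> carrier DM" "\<And>v. v \<in> carrier M \<Longrightarrow> L v = L' v"
  shows "L = L'"
  using assms by (intro PiE_ext[of L "carrier M" "\<lambda>_. Lp_set \<mu> 1" L']) (auto simp: module_dual_def)

lemma DM_nrm_le:
  assumes "\<And>v. v \<in> carrier M \<Longrightarrow> Lp_norm \<mu> 1 (L v) \<le> K * nrm M v" "0 \<le> K"
  shows "nrm DM L \<le> K"
proof -
  have "(SUP v\<in>{v \<in> carrier M. nrm M v \<le> 1}. Lp_norm \<mu> 1 (L v)) \<le> K"
  proof (rule cSUP_least)
    have "\<zero> \<in> {v \<in> carrier M. nrm M v \<le> 1}" using N.nrm_zero by simp
    then show "{v \<in> carrier M. nrm M v \<le> 1} \<noteq> {}" by blast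
    fix v assume "v \<in> {v \<in> carrier M. nrm M v \<le> 1}"
    then show "Lp_norm \<mu> 1 (L v) \<le> K"
      using assms(1)[of v] mult_left_le[of "nrm M v" K] assms(2) by auto
  qed
  then show ?thesis by (simp add: module_dual_def)
qed

lemma DM_nrm:
  assumes L: "L \<in> carrier DM"
  shows "0 \<le> nrm DM L" "v \<in> carrier M \<Longrightarrow> Lp_norm \<mu> 1 (L v) \<le> nrm DM L * nrm M v"
proof -
  obtain K where K: "0 \<le> K" "\<And>v. v \<in> carrier M \<Longrightarrow> Lp_norm \<mu> 1 (L v) \<le> K * nrm M v" using DM_bounded[OF L] by blast
  have bdd: "bdd_above ((\<lambda>v. Lp_norm \<mu> 1 (L v)) ` {v \<in> carrier M. nrm M v \<le> 1})"
  proof (rule bdd_aboveI2)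
    fix v assume "v \<in> {v \<in> carrier M. nrm M v \<le> 1}"
    then show "Lp_norm \<mu> 1 (L v) \<le> K" using K(2)[of v] mult_left_le[of "nrm M v" K] K(1) by auto
  qed
  have up: "Lp_norm \<mu> 1 (L v) \<le> nrm DM L" if "v \<in> carrier M" "nrm M v \<le> 1" for v
    using cSUP_upper[OF _ bdd, of v] that by (simp add: module_dual_def)
  have "0 \<le> Lp_norm \<mu> 1 (L \<zero>)" by (simp add: Lp_norm_def)
  then show nn: "0 \<le> nrm DM L" using up[of "\<zero>"] N.nrm_zero by simp
  assume v: "v \<in> carrier M"
  show "Lp_norm \<mu> 1 (L v) \<le> nrm DM L * nrm M v"
  proof (cases "nrm M v = 0")
    case True
    then show ?thesis using K(2)[OF v] by simp
  next
    case False
    then have pos: "0 < nrm M v" using N.nrm_nonneg[of v] v by simp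
    let ?u = "const_class \<mu> (1 / nrm M v) \<odot> v"
    have u: "?u \<in> carrier M" using v by simp
    have "nrm M ?u = 1" using N.nrm_scale[of v "1 / nrm M v"] v pos by simp
    then have "Lp_norm \<mu> 1 (L ?u) \<le> nrm DM L" using up u by simp
    moreover have "L ?u = (1 / nrm M v) \<odot>\<^bsub>Lp_space \<mu> 1\<^esub> L v"
      using DM_linear(3)[OF L v v, of "const_class \<mu> (1 / nrm M v)"] smult_L1[OF Lp_set_ae_classes[OF DM_linear(1)[OF L v v]]] by simp
    ultimately have "(1 / nrm M v) * Lp_norm \<mu> 1 (L v) \<le> nrm DM L"
      using L1.nrm_scale[of "L v" "1 / nrm M v"] DM_linear(1)[OF L v v] pos by simp
    then show ?thesis using pos by (simp add: field_simps)
  qed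
qed

lemma DM_closed:
  assumes L: "L \<in> carrier DM"
  shows "L' \<in> carrier DM \<Longrightarrow> L \<oplus>\<^bsub>DM\<^esub> L' \<in> carrier DM" "F \<in> carrier (Linf \<mu>) \<Longrightarrow> F \<odot>\<^bsub>DM\<^esub> L \<in> carrier DM"
proof -
  note lin = DM_linear[OF L]
  note cl = Lp_set_ae_classes[of _ \<mu> 1]
  {
    assume L': "L' \<in> carrier DM"
    note lin' = DM_linear[OF L']
    show "L \<oplus>\<^bsub>DM\<^esub> L' \<in> carrier DM"
    proof (subst DM_iff_bounded)
      show "L \<oplus>\<^bsub>DM\<^esub> L' \<in> carrier M \<rightarrow>\<^sub>E Lp_set \<mu> 1"
        using L1.V.a_closed[of "L _" "L' _"] lin lin' by auto
      have "Lp_norm \<mu> 1 ((L \<oplus>\<^bsub>DM\<^esub> L') v) \<le> (nrm DM L + nrm DM L') * nrm M v" if v: "v \<in> carrier M" for v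
        using L1.nrm_triangle[of "L v" "L' v"] DM_nrm(2)[OF L v] DM_nrm(2)[OF L' v] lin[OF v v] lin'[OF v v] v
        by (simp add: distrib_right)
      then show "\<exists>K. \<forall>v\<in>carrier M. Lp_norm \<mu> 1 ((L \<oplus>\<^bsub>DM\<^esub> L') v) \<le> K * nrm M v" by blast
      show "(L \<oplus>\<^bsub>DM\<^esub> L') (F \<odot> v) = ae_map2 \<mu> (*) F ((L \<oplus>\<^bsub>DM\<^esub> L') v)"
        if "F \<in> carrier (Linf \<mu>)" "v \<in> carrier M" for F v
        using that lin[of v v] lin'[of v v] Linf_ae_classes[OF that(1)] cl by (simp add: ae_mult_laws)
      fix u v assume u: "u \<in> carrier M" and v: "v \<in> carrier M"
      note c = lin(1)[OF u u] lin(1)[OF v v] lin'(1)[OF u u] lin'(1)[OF v v]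
      show "(L \<oplus>\<^bsub>DM\<^esub> L') (u \<oplus> v) = ae_map2 \<mu> (+) ((L \<oplus>\<^bsub>DM\<^esub> L') u) ((L \<oplus>\<^bsub>DM\<^esub> L') v)"
        using u v lin(2)[OF u v] lin'(2)[OF u v] c ae_add_swap[of "L u" \<mu> "L v" "L' u" "L' v"] cl by simp
    qed
  }
  assume F: "F \<in> carrier (Linf \<mu>)"
  then obtain c where c: "AE x in \<mu>. \<bar>ae_rep F x\<bar> \<le> c" by (auto simp: Linf_carrier_iff)
  have c': "AE x in \<mu>. \<bar>ae_rep F x\<bar> \<le> \<bar>c\<bar>" using c by eventually_elim auto
  have Fc: "F \<in> ae_classes \<mu>" using F Linf_ae_classes by blast
  show "F \<odot>\<^bsub>DM\<^esub> L \<in> carrier DM"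
  proof (subst DM_iff_bounded)
    show "F \<odot>\<^bsub>DM\<^esub> L \<in> carrier M \<rightarrow>\<^sub>E Lp_set \<mu> 1"
      using Linf_L1_closed[OF F] lin by auto
    have "Lp_norm \<mu> 1 ((F \<odot>\<^bsub>DM\<^esub> L) v) \<le> (\<bar>c\<bar> * nrm DM L) * nrm M v" if v: "v \<in> carrier M" for v
    proof -
      have "Lp_norm \<mu> 1 ((F \<odot>\<^bsub>DM\<^esub> L) v) \<le> \<bar>c\<bar> * Lp_norm \<mu> 1 (L v)"
        using v Linf_L1_norm[OF Fc c' lin(1)[OF v v]] by simp
      also have "\<dots> \<le> \<bar>c\<bar> * (nrm DM L * nrm M v)" using DM_nrm(2)[OF L v] by (intro mult_left_mono) auto
      finally show ?thesis by (simp add: mult.assoc)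
    qed
    then show "\<exists>K. \<forall>v\<in>carrier M. Lp_norm \<mu> 1 ((F \<odot>\<^bsub>DM\<^esub> L) v) \<le> K * nrm M v" by blast
    show "(F \<odot>\<^bsub>DM\<^esub> L) (G \<odot> v) = ae_map2 \<mu> (*) G ((F \<odot>\<^bsub>DM\<^esub> L) v)"
      if "G \<in> carrier (Linf \<mu>)" "v \<in> carrier M" for G v
      using that lin[of v v] Fc Linf_ae_classes[OF that(1)] cl ae_mult_laws(5)[of F \<mu> G "L v"] by simp
    show "(F \<odot>\<^bsub>DM\<^esub> L) (u \<oplus> v) = ae_map2 \<mu> (+) ((F \<odot>\<^bsub>DM\<^esub> L) u) ((F \<odot>\<^bsub>DM\<^esub> L) v)"
      if "u \<in> carrier M" "v \<in> carrier M" for u v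
      using that lin[of u v] lin(1)[of v v] Fc cl ae_mult_laws(1)[of F \<mu> F "L u" "L v"] by simp
  qed
qed

lemma DM_zero: "\<zero>\<^bsub>DM\<^esub> \<in> carrier DM"
proof (subst DM_iff_bounded)
  show "\<exists>K. \<forall>v\<in>carrier M. Lp_norm \<mu> 1 (\<zero>\<^bsub>DM\<^esub> v) \<le> K * nrm M v"
    using L1.nrm_zero by (intro exI[of _ 0]) simp
  show "\<zero>\<^bsub>DM\<^esub> (F \<odot> v) = ae_map2 \<mu> (*) F (\<zero>\<^bsub>DM\<^esub> v)" if "F \<in> carrier (Linf \<mu>)" "v \<in> carrier M" for F v
    using that ae_mult_laws(6)[of F \<mu> F F F] Linf_ae_classes[OF that(1)] by simp
qed (auto simp: ae_class_L1 ae_map2_ae_class)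

lemma DM_module: "Module.module (Linf \<mu>) DM"
proof (rule moduleI[OF M.R.cring_axioms])
  note cl = Lp_set_ae_classes[of _ \<mu> 1]
  show "abelian_group DM"
  proof (rule abelian_groupI)
    show "\<zero>\<^bsub>DM\<^esub> \<in> carrier DM" by (rule DM_zero)
    fix L assume L: "L \<in> carrier DM"
    note lin = DM_linear(1)[OF L]
    show "\<zero>\<^bsub>DM\<^esub> \<oplus>\<^bsub>DM\<^esub> L = L"
    proof (rule DM_eqI[OF DM_closed(1)[OF DM_zero L] L])
      show "(\<zero>\<^bsub>DM\<^esub> \<oplus>\<^bsub>DM\<^esub> L) v = L v" if "v \<in> carrier M" for v
        using that lin[of v v] L1.V.l_zero[of "L v"] by simp
    qed
    show "\<exists>K\<in>carrier DM. K \<oplus>\<^bsub>DM\<^esub> L = \<zero>\<^bsub>DM\<^esub>"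
    proof (rule bexI[of _ "const_class \<mu> (-1) \<odot>\<^bsub>DM\<^esub> L"])
      show neg: "const_class \<mu> (-1) \<odot>\<^bsub>DM\<^esub> L \<in> carrier DM" using L by (intro DM_closed) auto
      have "ae_map2 \<mu> (+) (ae_map2 \<mu> (*) (const_class \<mu> (-1)) (L v)) (L v) = const_class \<mu> 0" if "v \<in> carrier M" for v
        using L1.smult_simps(6)[of "L v"] L1.V.l_neg[of "L v"] lin[of v v] that smult_L1[OF cl, of "L v" "-1"] by simp
      then show "const_class \<mu> (-1) \<odot>\<^bsub>DM\<^esub> L \<oplus>\<^bsub>DM\<^esub> L = \<zero>\<^bsub>DM\<^esub>"
        by (simp add: fun_eq_iff restrict_def)
    qed
    fix L' assume L': "L' \<in> carrier DM"
    note lin' = DM_linear(1)[OF L']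
    show "L \<oplus>\<^bsub>DM\<^esub> L' \<in> carrier DM" using L L' by (rule DM_closed)
    show "L \<oplus>\<^bsub>DM\<^esub> L' = L' \<oplus>\<^bsub>DM\<^esub> L"
    proof -
      have "ae_map2 \<mu> (+) (L v) (L' v) = ae_map2 \<mu> (+) (L' v) (L v)" if "v \<in> carrier M" for v
        using lin[of v v] lin'[of v v] that L1.V.a_comm[of "L v" "L' v"] by simp
      then show ?thesis by (simp add: fun_eq_iff restrict_def)
    qed
    fix L'' assume L'': "L'' \<in> carrier DM"
    note lin'' = DM_linear(1)[OF L'']
    show "L \<oplus>\<^bsub>DM\<^esub> L' \<oplus>\<^bsub>DM\<^esub> L'' = L \<oplus>\<^bsub>DM\<^esub> (L' \<oplus>\<^bsub>DM\<^esub> L'')"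
    proof -
      have "ae_map2 \<mu> (+) (ae_map2 \<mu> (+) (L v) (L' v)) (L'' v) = ae_map2 \<mu> (+) (L v) (ae_map2 \<mu> (+) (L' v) (L'' v))"
        if "v \<in> carrier M" for v
        using lin[of v v] lin'[of v v] lin''[of v v] that L1.V.a_assoc[of "L v" "L' v" "L'' v"] by simp
      then show ?thesis by (simp add: fun_eq_iff restrict_def)
    qed
  qed
  fix L assume L: "L \<in> carrier DM"
  note lin = DM_linear(1)[OF L]
  show "\<one>\<^bsub>Linf \<mu>\<^esub> \<odot>\<^bsub>DM\<^esub> L = L"
  proof (rule DM_eqI[OF DM_closed(2)[OF L] L])
    fix v assume v: "v \<in> carrier M"
    note c = cl[OF lin[OF v v]]
    show "(\<one>\<^bsub>Linf \<mu>\<^esub> \<odot>\<^bsub>DM\<^esub> L) v = L v"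
      using v ae_mult_laws(4)[OF c c c c] by simp
  qed simp
  fix F assume F: "F \<in> carrier (Linf \<mu>)"
  show "F \<odot>\<^bsub>DM\<^esub> L \<in> carrier DM" using L F by (rule DM_closed)
  fix G assume G: "G \<in> carrier (Linf \<mu>)"
  note Fc = Linf_ae_classes[OF F] and Gc = Linf_ae_classes[OF G]
  show "(F \<oplus>\<^bsub>Linf \<mu>\<^esub> G) \<odot>\<^bsub>DM\<^esub> L = F \<odot>\<^bsub>DM\<^esub> L \<oplus>\<^bsub>DM\<^esub> G \<odot>\<^bsub>DM\<^esub> L"
    using lin cl Fc Gc by (auto simp: fun_eq_iff restrict_def ae_mult_laws)
  show "(F \<otimes>\<^bsub>Linf \<mu>\<^esub> G) \<odot>\<^bsub>DM\<^esub> L = F \<odot>\<^bsub>DM\<^esub> (G \<odot>\<^bsub>DM\<^esub> L)"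
    using lin cl Fc Gc by (auto simp: fun_eq_iff restrict_def ae_mult_laws)
next
  fix F L L' assume F: "F \<in> carrier (Linf \<mu>)" and L: "L \<in> carrier DM" and L': "L' \<in> carrier DM"
  show "F \<odot>\<^bsub>DM\<^esub> (L \<oplus>\<^bsub>DM\<^esub> L') = F \<odot>\<^bsub>DM\<^esub> L \<oplus>\<^bsub>DM\<^esub> F \<odot>\<^bsub>DM\<^esub> L'"
    using DM_linear(1)[OF L] DM_linear(1)[OF L'] Lp_set_ae_classes[of _ \<mu> 1] Linf_ae_classes[OF F]
    by (auto simp: fun_eq_iff restrict_def ae_mult_laws)
qed

lemma DM_normed: "normed_space (real_nspace \<mu> DM)"
proof (intro normed_space.intro seminormed_spaceI normed_space_axioms.intro real_nspace_module DM_module)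
  note cl = Lp_set_ae_classes[of _ \<mu> 1]
  fix L assume "L \<in> carrier (real_nspace \<mu> DM)"
  then have L: "L \<in> carrier DM" by simp
  note lin = DM_linear(1)[OF L]
  show "0 \<le> nrm (real_nspace \<mu> DM) L" using DM_nrm(1)[OF L] by simp
  have "nrm DM (const_class \<mu> c \<odot>\<^bsub>DM\<^esub> L) \<le> \<bar>c\<bar> * nrm DM L" for c
  proof (rule DM_nrm_le)
    fix v assume v: "v \<in> carrier M"
    have "Lp_norm \<mu> 1 ((const_class \<mu> c \<odot>\<^bsub>DM\<^esub> L) v) = \<bar>c\<bar> * Lp_norm \<mu> 1 (L v)"
      using L1.nrm_scale[of "L v" c] lin[OF v v] smult_L1[OF cl] v by simp
    also have "\<dots> \<le> \<bar>c\<bar> * (nrm DM L * nrm M v)" using DM_nrm(2)[OF L v] by (intro mult_left_mono) auto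
    finally show "Lp_norm \<mu> 1 ((const_class \<mu> c \<odot>\<^bsub>DM\<^esub> L) v) \<le> (\<bar>c\<bar> * nrm DM L) * nrm M v" by (simp add: mult.assoc)
  qed (use DM_nrm(1)[OF L] in auto)
  then show "nrm (real_nspace \<mu> DM) (c \<odot>\<^bsub>real_nspace \<mu> DM\<^esub> L) \<le> \<bar>c\<bar> * nrm (real_nspace \<mu> DM) L" for c by simp
  show "L = \<zero>\<^bsub>real_nspace \<mu> DM\<^esub>" if "nrm (real_nspace \<mu> DM) L = 0"
  proof -
    have "L v = const_class \<mu> 0" if v: "v \<in> carrier M" for v
      using DM_nrm(2)[OF L v] \<open>nrm (real_nspace \<mu> DM) L = 0\<close> L1.nrm_nonneg[of "L v"] L1.nrm_zero_imp[of "L v"] lin[OF v v]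
      by simp
    then have "L = \<zero>\<^bsub>DM\<^esub>" by (intro DM_eqI[OF L DM_zero]) simp
    then show ?thesis by simp
  qed
  fix L' assume "L' \<in> carrier (real_nspace \<mu> DM)"
  then have L': "L' \<in> carrier DM" by simp
  have "nrm DM (L \<oplus>\<^bsub>DM\<^esub> L') \<le> nrm DM L + nrm DM L'"
  proof (rule DM_nrm_le)
    show "Lp_norm \<mu> 1 ((L \<oplus>\<^bsub>DM\<^esub> L') v) \<le> (nrm DM L + nrm DM L') * nrm M v" if v: "v \<in> carrier M" for v
      using L1.nrm_triangle[of "L v" "L' v"] DM_nrm(2)[OF L v] DM_nrm(2)[OF L' v] lin[OF v v] DM_linear(1)[OF L' v v] v
      by (simp add: distrib_right)
  qed (use DM_nrm(1)[OF L] DM_nrm(1)[OF L'] in auto)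
  then show "nrm (real_nspace \<mu> DM) (L \<oplus>\<^bsub>real_nspace \<mu> DM\<^esub> L') \<le> nrm (real_nspace \<mu> DM) L + nrm (real_nspace \<mu> DM) L'" by simp
qed

sublocale D: normed_space "real_nspace \<mu> DM" by (rule DM_normed)

lemma DM_diff:
  assumes "L \<in> carrier DM" "L' \<in> carrier DM" "v \<in> carrier M"
  shows "(L \<ominus>\<^bsub>DM\<^esub> L') v = L v \<ominus>\<^bsub>Lp_space \<mu> 1\<^esub> L' v"
proof -
  have "L \<ominus>\<^bsub>DM\<^esub> L' = L \<oplus>\<^bsub>DM\<^esub> const_class \<mu> (-1) \<odot>\<^bsub>DM\<^esub> L'"
    using D.smult_simps(6)[of L'] D.V.minus_eq[of L L'] assms by (simp del: DM_simps)
  then show ?thesis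
    using L1.smult_simps(6)[of "L' v"] L1.V.minus_eq[of "L v" "L' v"] assms DM_linear(1)[OF assms(2) assms(3) assms(3)]
      DM_linear(1)[OF assms(1) assms(3) assms(3)] smult_L1[OF Lp_set_ae_classes[of _ \<mu> 1]] by simp
qed

lemma L1_conv_mult:
  assumes F: "F \<in> carrier (Linf \<mu>)" and s: "\<And>n. s n \<in> Lp_set \<mu> 1" and G: "G \<in> Lp_set \<mu> 1" and conv: "L1.nconv s G"
  shows "L1.nconv (\<lambda>n. ae_map2 \<mu> (*) F (s n)) (ae_map2 \<mu> (*) F G)"
proof -
  obtain c where c: "AE x in \<mu>. \<bar>ae_rep F x\<bar> \<le> c" using F by (auto simp: Linf_carrier_iff)
  have Fc: "F \<in> ae_classes \<mu>" using F Linf_ae_classes by blast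
  note cl = Lp_set_ae_classes[of _ \<mu> 1]
  have d: "s n \<ominus>\<^bsub>Lp_space \<mu> 1\<^esub> G \<in> Lp_set \<mu> 1" for n using L1.diff_closed[of "s n" G] s G by simp
  have "ae_map2 \<mu> (*) F (s n) \<ominus>\<^bsub>Lp_space \<mu> 1\<^esub> ae_map2 \<mu> (*) F G = ae_map2 \<mu> (*) F (s n \<ominus>\<^bsub>Lp_space \<mu> 1\<^esub> G)" for n
  proof (rule ae_classes_eqI[of _ \<mu>])
    have 1: "ae_map2 \<mu> (*) F (s n) \<in> Lp_set \<mu> 1" "ae_map2 \<mu> (*) F G \<in> Lp_set \<mu> 1" using Linf_L1_closed[OF F] s G by auto
    show "ae_map2 \<mu> (*) F (s n) \<ominus>\<^bsub>Lp_space \<mu> 1\<^esub> ae_map2 \<mu> (*) F G \<in> ae_classes \<mu>"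
      using L1.diff_closed 1 cl by simp
    show "ae_map2 \<mu> (*) F (s n \<ominus>\<^bsub>Lp_space \<mu> 1\<^esub> G) \<in> ae_classes \<mu>" using Fc cl[OF d] by (intro ae_map2_classes)
    show "AE x in \<mu>. ae_rep (ae_map2 \<mu> (*) F (s n) \<ominus>\<^bsub>Lp_space \<mu> 1\<^esub> ae_map2 \<mu> (*) F G) x = ae_rep (ae_map2 \<mu> (*) F (s n \<ominus>\<^bsub>Lp_space \<mu> 1\<^esub> G)) x"
      using ae_rep_L1_diff(1)[OF 1] ae_map2_classes(5)[OF Fc cl[OF d[of n]]] ae_map2_classes(5)[OF Fc cl[OF s[of n]]]
        ae_map2_classes(5)[OF Fc cl[OF G]] ae_rep_L1_diff(1)[OF s[of n] G]
      by eventually_elim (simp add: right_diff_distrib)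
  qed
  then have le: "nrm (Lp_space \<mu> 1) (ae_map2 \<mu> (*) F (s n) \<ominus>\<^bsub>Lp_space \<mu> 1\<^esub> ae_map2 \<mu> (*) F G) \<le> c * nrm (Lp_space \<mu> 1) (s n \<ominus>\<^bsub>Lp_space \<mu> 1\<^esub> G)" for n
    using Linf_L1_norm[OF Fc c d[of n]] by simp
  show ?thesis unfolding L1.nconv_def
  proof (rule L1.null_by_bound[OF _ le])
    show "(\<lambda>n. c * nrm (Lp_space \<mu> 1) (s n \<ominus>\<^bsub>Lp_space \<mu> 1\<^esub> G)) \<longlonglongrightarrow> 0"
      using tendsto_mult_left[OF conv[unfolded L1.nconv_def], of c] by simp
    show "0 \<le> nrm (Lp_space \<mu> 1) (ae_map2 \<mu> (*) F (s n) \<ominus>\<^bsub>Lp_space \<mu> 1\<^esub> ae_map2 \<mu> (*) F G)" for n by (simp add: Lp_norm_def)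
  qed
qed

text \<open>
  A Cauchy sequence of functionals converges pointwise in \<open>L\<^sup>1\<close>, uniformly on bounded sets; the limit
  inherits linearity over the bounded functions because multiplication by them is continuous.
\<close>

lemma DM_banach: "banach_space (real_nspace \<mu> DM)"
proof -
  have "D.metric.mcomplete"
  proof (rule D.mcompleteI)
    fix S :: "nat \<Rightarrow> 'v \<Rightarrow> ('x \<Rightarrow> real) set"
    assume "\<And>n. S n \<in> carrier (real_nspace \<mu> DM)"
      and "\<And>e. 0 < e \<Longrightarrow> \<exists>n0. \<forall>m\<ge>n0. \<forall>n\<ge>n0. nrm (real_nspace \<mu> DM) (S m \<ominus>\<^bsub>real_nspace \<mu> DM\<^esub> S n) < e"
    then have S: "\<And>n. S n \<in> carrier DM" and cau: "\<And>e. 0 < e \<Longrightarrow> \<exists>n0. \<forall>m\<ge>n0. \<forall>n\<ge>n0. nrm DM (S m \<ominus>\<^bsub>DM\<^esub> S n) < e"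
      by simp_all
    note lin = DM_linear[OF S]
    have Sd: "S m \<ominus>\<^bsub>DM\<^esub> S n \<in> carrier DM" for m n using D.diff_closed[of "S m" "S n"] S by simp
    have dist: "nrm (Lp_space \<mu> 1) (S m v \<ominus>\<^bsub>Lp_space \<mu> 1\<^esub> S n v) \<le> nrm DM (S m \<ominus>\<^bsub>DM\<^esub> S n) * nrm M v" if "v \<in> carrier M" for m n v
      using DM_nrm(2)[OF Sd[of m n] that] DM_diff[OF S[of m] S[of n] that] by simp
    have "\<exists>F. F \<in> Lp_set \<mu> 1 \<and> L1.nconv (\<lambda>n. S n v) F" if v: "v \<in> carrier M" for v
    proof -
      have "\<exists>n0. \<forall>m\<ge>n0. \<forall>n\<ge>n0. nrm (Lp_space \<mu> 1) (S m v \<ominus>\<^bsub>Lp_space \<mu> 1\<^esub> S n v) < e" if e: "0 < e" for e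
      proof -
        have nn: "0 \<le> nrm M v" using N.nrm_nonneg[of v] v by simp
        obtain n0 where n0: "\<And>m n. m \<ge> n0 \<Longrightarrow> n \<ge> n0 \<Longrightarrow> nrm DM (S m \<ominus>\<^bsub>DM\<^esub> S n) < e / (nrm M v + 1)"
          using cau[of "e / (nrm M v + 1)"] e nn by auto
        have "nrm (Lp_space \<mu> 1) (S m v \<ominus>\<^bsub>Lp_space \<mu> 1\<^esub> S n v) < e" if "m \<ge> n0" "n \<ge> n0" for m n
        proof -
          have "nrm DM (S m \<ominus>\<^bsub>DM\<^esub> S n) * nrm M v \<le> nrm DM (S m \<ominus>\<^bsub>DM\<^esub> S n) * (nrm M v + 1)"
            using DM_nrm(1)[OF Sd] by (intro mult_left_mono) auto
          also have "\<dots> < e" using n0[OF that] nn by (simp add: field_simps)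
          finally show ?thesis using dist[OF v, of m n] by simp
        qed
        then show ?thesis by blast
      qed
      then obtain F where "F \<in> Lp_set \<mu> 1" "L1.nconv (\<lambda>n. S n v) F"
        by (rule L1_cauchy_limit[of "\<lambda>n. S n v" \<mu>, OF lin(1)[OF v v]])
      then show ?thesis by blast
    qed
    then have "\<forall>v. \<exists>F. v \<in> carrier M \<longrightarrow> F \<in> Lp_set \<mu> 1 \<and> L1.nconv (\<lambda>n. S n v) F" by blast
    from choice[OF this] obtain L0 where L0: "\<forall>v. v \<in> carrier M \<longrightarrow> L0 v \<in> Lp_set \<mu> 1 \<and> L1.nconv (\<lambda>n. S n v) (L0 v)" ..
    define L where "L = restrict L0 (carrier M)"
    have Lc: "L v \<in> Lp_set \<mu> 1" and conv: "L1.nconv (\<lambda>n. S n v) (L v)" if "v \<in> carrier M" for v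
      using L0 that by (auto simp: L_def)
    have add: "L (u \<oplus> v) = ae_map2 \<mu> (+) (L u) (L v)" if u: "u \<in> carrier M" and v: "v \<in> carrier M" for u v
    proof -
      have "L1.nconv (\<lambda>n. S n (u \<oplus> v)) (ae_map2 \<mu> (+) (L u) (L v))"
        using L1.nconv_add[OF conv[OF u] conv[OF v]] lin(1)[OF u u] lin(1)[OF v v] lin(2)[OF u v] Lc u v by simp
      then show ?thesis
        using L1.nconv_unique[OF conv[of "u \<oplus> v"], of "ae_map2 \<mu> (+) (L u) (L v)"] u v Lc lin(1)[of "u \<oplus> v" "u \<oplus> v"]
          L1.V.a_closed[of "L u" "L v"] by simp
    qed
    have smult: "L (F \<odot> v) = ae_map2 \<mu> (*) F (L v)" if F: "F \<in> carrier (Linf \<mu>)" and v: "v \<in> carrier M" for F v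
    proof -
      have Fv: "F \<odot> v \<in> carrier M" using F v by simp
      have "L1.nconv (\<lambda>n. S n (F \<odot> v)) (ae_map2 \<mu> (*) F (L v))"
        using L1_conv_mult[OF F _ Lc[OF v] conv[OF v]] lin(1)[OF v v] lin(3)[OF v v F] by simp
      then show ?thesis
        using L1.nconv_unique[OF conv[OF Fv], of "ae_map2 \<mu> (*) F (L v)"] Fv Lc lin(1)[OF Fv Fv]
          Linf_L1_closed[OF F Lc[OF v]] by simp
    qed
    have near: "nrm (Lp_space \<mu> 1) (L v \<ominus>\<^bsub>Lp_space \<mu> 1\<^esub> S n v) \<le> e * nrm M v"
      if v: "v \<in> carrier M" and e: "\<And>m. m \<ge> n \<Longrightarrow> nrm DM (S m \<ominus>\<^bsub>DM\<^esub> S n) \<le> e" for v n e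
    proof (rule L1.nconv_bound)
      note c = lin(1)[OF v v] Lc[OF v]
      show "nrm (Lp_space \<mu> 1) (S (m + n) v \<ominus>\<^bsub>Lp_space \<mu> 1\<^esub> S n v) \<le> e * nrm M v" for m
        using dist[OF v, of "m + n" n] mult_right_mono[OF e[of "m + n"], of "nrm M v"] N.nrm_nonneg[of v] v by simp
      have "L1.nconv (\<lambda>m. S (m + n) v) (L v)"
        using LIMSEQ_ignore_initial_segment[OF conv[OF v, unfolded L1.nconv_def], of n] unfolding L1.nconv_def .
      moreover have "(S (m + n) v \<ominus>\<^bsub>Lp_space \<mu> 1\<^esub> S n v) \<ominus>\<^bsub>Lp_space \<mu> 1\<^esub> (L v \<ominus>\<^bsub>Lp_space \<mu> 1\<^esub> S n v) = S (m + n) v \<ominus>\<^bsub>Lp_space \<mu> 1\<^esub> L v" for m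
        using L1.diff_trans[of "S (m+n) v" "S n v" "L v"] L1.diff_flip[of "L v" "S n v"] c
        by (simp add: L1.V.minus_eq[of _ "L v \<ominus>\<^bsub>Lp_space \<mu> 1\<^esub> S n v"] L1.diff_closed[simplified])
      ultimately show "L1.nconv (\<lambda>m. S (m + n) v \<ominus>\<^bsub>Lp_space \<mu> 1\<^esub> S n v) (L v \<ominus>\<^bsub>Lp_space \<mu> 1\<^esub> S n v)"
        unfolding L1.nconv_def by simp
      show "S (m + n) v \<ominus>\<^bsub>Lp_space \<mu> 1\<^esub> S n v \<in> carrier (Lp_space \<mu> 1)" for m using c by (intro L1.diff_closed) auto
      show "L v \<ominus>\<^bsub>Lp_space \<mu> 1\<^esub> S n v \<in> carrier (Lp_space \<mu> 1)" using c by (intro L1.diff_closed) auto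
    qed
    have LD: "L \<in> carrier DM"
    proof (subst DM_iff_bounded[OF _ add smult])
      show "L \<in> carrier M \<rightarrow>\<^sub>E Lp_set \<mu> 1" using Lc by (auto simp: L_def)
      obtain n where n: "\<And>m. m \<ge> n \<Longrightarrow> nrm DM (S m \<ominus>\<^bsub>DM\<^esub> S n) \<le> 1" using cau[of 1] by (auto intro: less_imp_le)
      have "Lp_norm \<mu> 1 (L v) \<le> (1 + nrm DM (S n)) * nrm M v" if v: "v \<in> carrier M" for v
        using near[OF v n] DM_nrm(2)[OF S[of n] v] L1.nrm_reverse_triangle[of "L v" "S n v"] Lc[OF v] lin(1)[OF v v, of n]
        by (simp add: distrib_right)
      then show "\<exists>K. \<forall>v\<in>carrier M. Lp_norm \<mu> 1 (L v) \<le> K * nrm M v" by blast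
    qed auto
    have "(\<lambda>n. nrm DM (S n \<ominus>\<^bsub>DM\<^esub> L)) \<longlonglongrightarrow> 0"
    proof (rule LIMSEQ_I)
      fix e :: real assume e: "0 < e"
      then obtain n0 where n0: "\<And>m n. m \<ge> n0 \<Longrightarrow> n \<ge> n0 \<Longrightarrow> nrm DM (S m \<ominus>\<^bsub>DM\<^esub> S n) < e/2" using cau[of "e/2"] by auto
      have "norm (nrm DM (S n \<ominus>\<^bsub>DM\<^esub> L) - 0) < e" if n: "n \<ge> n0" for n
      proof -
        have c: "L \<ominus>\<^bsub>DM\<^esub> S n \<in> carrier DM" using D.diff_closed[of L "S n"] LD S by simp
        have "nrm DM (L \<ominus>\<^bsub>DM\<^esub> S n) \<le> e/2"
        proof (rule DM_nrm_le)
          show "Lp_norm \<mu> 1 ((L \<ominus>\<^bsub>DM\<^esub> S n) v) \<le> e/2 * nrm M v" if v: "v \<in> carrier M" for v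
            using near[OF v, of n "e/2"] n0 n DM_diff[OF LD S v, of n] by (force intro: less_imp_le)
        qed (use e in simp)
        then show ?thesis using D.nrm_flip[of L "S n"] DM_nrm(1)[OF c] LD S e by simp
      qed
      then show "\<exists>no. \<forall>n\<ge>no. norm (nrm DM (S n \<ominus>\<^bsub>DM\<^esub> L) - 0) < e" by blast
    qed
    then show "\<exists>u\<in>carrier (real_nspace \<mu> DM). (\<lambda>n. nrm (real_nspace \<mu> DM) (S n \<ominus>\<^bsub>real_nspace \<mu> DM\<^esub> u)) \<longlonglongrightarrow> 0"
      using LD by (intro bexI[of _ L]) auto
  qed
  then show ?thesis using DM_normed normed_space_banach by blast
qed

end

lemma is_ess_sup_unique:
  assumes "is_ess_sup \<mu> \<F> g" "is_ess_sup \<mu> \<F> h"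
  shows "AE x in \<mu>. g x = h x"
proof -
  have "AE x in \<mu>. g x \<le> h x" "AE x in \<mu>. h x \<le> g x" using assms by (auto simp: is_ess_sup_def)
  then show ?thesis by eventually_elim auto
qed

context dual_module
begin

definition dual_family :: "('v \<Rightarrow> ('x \<Rightarrow> real) set) \<Rightarrow> ('x \<Rightarrow> real) set" where
  "dual_family L = {ae_rep (L v) | v. v \<in> carrier M \<and> (AE x in \<mu>. pn v x \<le> 1)}"

definition dual_value :: "('v \<Rightarrow> ('x \<Rightarrow> real) set) \<Rightarrow> 'x \<Rightarrow> real" where
  "dual_value L x = real_of_ereal (ess_sup \<mu> (dual_family L) x)"

lemma pnorm_DM: "pnorm DM L = ae_class \<mu> (dual_value L)"
  by (simp add: module_dual_def dual_value_def[abs_def] dual_family_def pn_def)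

context
  fixes L assumes L: "L \<in> carrier DM"
begin

lemma L_measurable [measurable]: "v \<in> carrier M \<Longrightarrow> ae_rep (L v) \<in> borel_measurable \<mu>"
  using DM_linear(1)[OF L] Lp_set_ae_classes by blast

lemma L_integrable: "v \<in> carrier M \<Longrightarrow> integrable \<mu> (ae_rep (L v))"
  using DM_linear(1)[OF L] Lp1_set_iff by blast

lemma AE_L_add:
  assumes "u \<in> carrier M" "v \<in> carrier M"
  shows "AE x in \<mu>. ae_rep (L (u \<oplus> v)) x = ae_rep (L u) x + ae_rep (L v) x"
  using ae_map2_classes(4)[OF Lp_set_ae_classes Lp_set_ae_classes, OF DM_linear(1)[OF L assms(1) assms(1)] DM_linear(1)[OF L assms(2) assms(2)]]
    DM_linear(2)[OF L assms] by simp

lemma AE_L_smult: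
  assumes "f \<in> borel_measurable \<mu>" "AE x in \<mu>. \<bar>f x\<bar> \<le> c" "v \<in> carrier M"
  shows "AE x in \<mu>. ae_rep (L (ae_class \<mu> f \<odot> v)) x = f x * ae_rep (L v) x"
proof -
  have F: "ae_class \<mu> f \<in> carrier (Linf \<mu>)" using assms by (intro ae_class_Linf)
  from ae_map2_classes(5)[OF Linf_ae_classes[OF F] Lp_set_ae_classes[OF DM_linear(1)[OF L assms(3) assms(3)]]]
    AE_ae_rep_class[OF assms(1)] DM_linear(3)[OF L assms(3,3) F]
  show ?thesis by (auto elim: eventually_elim2)
qed

lemma AE_L_zero: "AE x in \<mu>. ae_rep (L \<zero>) x = 0"
  using AE_L_smult[of "\<lambda>_. 0" 0 "\<zero>"] N.smult_simps(5)[of "\<zero>"] by simp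

lemma dual_family_ess_sup: "is_ess_sup \<mu> (dual_family L) (ess_sup \<mu> (dual_family L))"
  by (rule ess_sup_countable[OF sf, of "dual_family L"]) (use L_measurable in \<open>auto simp: dual_family_def\<close>)

text \<open>
  The family is directed upwards: gluing two of its arguments along the set where the second
  value is larger realises the maximum. Hence its essential supremum is the limit of an
  increasing sequence of members.
\<close>

lemma dual_family_sequence:
  obtains u :: "nat \<Rightarrow> 'v" where "\<And>n. u n \<in> carrier M" "\<And>n. AE x in \<mu>. pn (u n) x \<le> 1"
    "AE x in \<mu>. \<forall>n. 0 \<le> ae_rep (L (u n)) x \<and> ae_rep (L (u n)) x \<le> ae_rep (L (u (Suc n))) x"
    "AE x in \<mu>. ess_sup \<mu> (dual_family L) x = (SUP n. ereal (ae_rep (L (u n)) x))"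
proof -
  obtain S where S: "countable S" "S \<subseteq> dual_family L"
    "AE x in \<mu>. ess_sup \<mu> (dual_family L) x = (SUP f\<in>S. ereal (f x))"
    by (rule ess_sup_countable[OF sf, of "dual_family L"]) (use L_measurable in \<open>auto simp: dual_family_def\<close>)
  have zero: "ae_rep (L \<zero>) \<in> dual_family L"
    unfolding dual_family_def using pn_zero by (intro CollectI exI[of _ "\<zero>"]) (auto elim: eventually_mono)
  define S' where "S' = insert (ae_rep (L \<zero>)) S"
  have S': "countable S'" "S' \<noteq> {}" "S' \<subseteq> dual_family L" using S zero by (auto simp: S'_def)
  have "\<forall>k. \<exists>w. w \<in> carrier M \<and> (AE x in \<mu>. pn w x \<le> 1) \<and> from_nat_into S' k = ae_rep (L w)"
  proof
    fix k
    have "from_nat_into S' k \<in> dual_family L" using from_nat_into[OF S'(2), of k] S'(3) by (rule subsetD[rotated])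
    then show "\<exists>w. w \<in> carrier M \<and> (AE x in \<mu>. pn w x \<le> 1) \<and> from_nat_into S' k = ae_rep (L w)"
      by (auto simp: dual_family_def)
  qed
  from choice[OF this] obtain w where w0: "\<forall>k. w k \<in> carrier M \<and> (AE x in \<mu>. pn (w k) x \<le> 1) \<and> from_nat_into S' k = ae_rep (L (w k))" ..
  then have w: "\<And>k. w k \<in> carrier M" "\<And>k. AE x in \<mu>. pn (w k) x \<le> 1" "\<And>k. from_nat_into S' k = ae_rep (L (w k))" by blast+
  define E where "E v n = {x \<in> space \<mu>. ae_rep (L v) x < ae_rep (L (w n)) x}" for v n
  define u where "u = rec_nat \<zero> (\<lambda>n v. set_class \<mu> (E v n) \<odot> w n \<oplus> set_class \<mu> (space \<mu> - E v n) \<odot> v)"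
  have u0: "u 0 = \<zero>" by (simp add: u_def)
  have uS: "u (Suc n) = set_class \<mu> (E (u n) n) \<odot> w n \<oplus> set_class \<mu> (space \<mu> - E (u n) n) \<odot> u n" for n
    by (simp add: u_def)
  have E: "E v n \<in> sets \<mu>" if "v \<in> carrier M" for v n
    using L_measurable[OF that] L_measurable[OF w(1)[of n]] by (simp add: E_def)
  have uc: "u n \<in> carrier M" for n
  proof (induction n)
    case (Suc n)
    have "E (u n) n \<in> sets \<mu>" "space \<mu> - E (u n) n \<in> sets \<mu>" using E[OF Suc, of n] by auto
    then have "set_class \<mu> (E (u n) n) \<in> carrier (Linf \<mu>)" "set_class \<mu> (space \<mu> - E (u n) n) \<in> carrier (Linf \<mu>)"
      by (auto intro: set_class_Linf)
    then show ?case unfolding uS using Suc w by simp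
  qed (simp add: u0)
  have pu: "AE x in \<mu>. pn (u n) x \<le> 1" for n
  proof (induction n)
    case 0
    show ?case using pn_zero by (auto simp: u0 elim: eventually_mono)
  next
    case (Suc n)
    have c: "set_class \<mu> (E (u n) n) \<odot> w n \<in> carrier M" "set_class \<mu> (space \<mu> - E (u n) n) \<odot> u n \<in> carrier M"
      using E uc w by auto
    show ?case unfolding uS
      using pn_triangle[OF c] pn_set[OF E[OF uc[of n]] w(1), of n n] pn_set[OF _ uc[of n], of "space \<mu> - E (u n) n"] E[OF uc[of n], of n]
        Suc w(2)[of n] AE_space
      by (auto elim!: eventually_elim2 simp: indicator_def split: if_splits)
  qed
  have Lmax: "AE x in \<mu>. ae_rep (L (u (Suc n))) x = max (ae_rep (L (u n)) x) (ae_rep (L (w n)) x)" for n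
  proof -
    have c: "set_class \<mu> (E (u n) n) \<odot> w n \<in> carrier M" "set_class \<mu> (space \<mu> - E (u n) n) \<odot> u n \<in> carrier M"
      using E uc w by auto
    have i: "indicator (E (u n) n) \<in> borel_measurable \<mu>" "indicator (space \<mu> - E (u n) n) \<in> borel_measurable \<mu>"
      using E[OF uc[of n], of n] by auto
    have "AE x in \<mu>. ae_rep (L (set_class \<mu> (E (u n) n) \<odot> w n)) x = indicator (E (u n) n) x * ae_rep (L (w n)) x"
      by (rule AE_L_smult[OF i(1) _ w(1), of 1]) (auto simp: indicator_def)
    moreover have "AE x in \<mu>. ae_rep (L (set_class \<mu> (space \<mu> - E (u n) n) \<odot> u n)) x = indicator (space \<mu> - E (u n) n) x * ae_rep (L (u n)) x"
      by (rule AE_L_smult[OF i(2) _ uc, of 1]) (auto simp: indicator_def)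
    ultimately show ?thesis using AE_L_add[OF c] AE_space unfolding uS
      by eventually_elim (auto simp: E_def indicator_def)
  qed
  have all: "AE x in \<mu>. \<forall>n. ae_rep (L (u (Suc n))) x = max (ae_rep (L (u n)) x) (ae_rep (L (w n)) x)"
    using Lmax by (simp add: AE_all_countable)
  have mono: "AE x in \<mu>. \<forall>n. 0 \<le> ae_rep (L (u n)) x \<and> ae_rep (L (u n)) x \<le> ae_rep (L (u (Suc n))) x"
    using all AE_L_zero
  proof eventually_elim
    case (elim x)
    have "0 \<le> ae_rep (L (u n)) x" for n
      by (induction n) (use elim in \<open>auto simp: u0\<close>)
    then show ?case using elim by simp
  qed
  have "AE x in \<mu>. \<forall>n. ereal (ae_rep (L (u n)) x) \<le> ess_sup \<mu> (dual_family L) x"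
  proof (subst AE_all_countable, rule allI)
    fix n
    have "ae_rep (L (u n)) \<in> dual_family L" unfolding dual_family_def using uc pu by blast
    then show "AE x in \<mu>. ereal (ae_rep (L (u n)) x) \<le> ess_sup \<mu> (dual_family L) x"
      using dual_family_ess_sup by (auto simp: is_ess_sup_def)
  qed
  with all S(3) have "AE x in \<mu>. ess_sup \<mu> (dual_family L) x = (SUP n. ereal (ae_rep (L (u n)) x))"
  proof eventually_elim
    case (elim x)
    show ?case
    proof (rule antisym)
      show "(SUP n. ereal (ae_rep (L (u n)) x)) \<le> ess_sup \<mu> (dual_family L) x"
        using elim by (intro SUP_least) auto
      have "(SUP f\<in>S. ereal (f x)) \<le> (SUP n. ereal (ae_rep (L (u n)) x))"
      proof (rule SUP_least)
        fix f assume "f \<in> S"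
        then have "f \<in> range (from_nat_into S')" using range_from_nat_into[OF S'(2,1)] by (simp add: S'_def)
        then obtain k where "f = ae_rep (L (w k))" using w(3) by auto
        then have "ereal (f x) \<le> ereal (ae_rep (L (u (Suc k))) x)" using elim by simp
        then show "ereal (f x) \<le> (SUP n. ereal (ae_rep (L (u n)) x))" by (rule SUP_upper2[OF UNIV_I])
      qed
      then show "ess_sup \<mu> (dual_family L) x \<le> (SUP n. ereal (ae_rep (L (u n)) x))" using elim by simp
    qed
  qed
  with uc pu mono show ?thesis by (rule that)
qed

text \<open>
  Testing the bound of \<open>L\<close> against \<open>h\<^bsup>q-1\<^esup> u n\<close> for truncations \<open>h\<close> of \<open>L (u n)\<close> gives
  \<open>\<parallel>h\<parallel>\<^sub>q \<le> K\<close>; monotone convergence removes the truncation, and finiteness of the resulting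
  integral makes the essential supremum finite.
\<close>

lemma dual_value_Lq:
  assumes K: "0 \<le> K" "\<And>v. v \<in> carrier M \<Longrightarrow> Lp_norm \<mu> 1 (L v) \<le> K * nrm M v"
  shows "AE x in \<mu>. ess_sup \<mu> (dual_family L) x = ereal (dual_value L x)" "AE x in \<mu>. 0 \<le> dual_value L x"
    "dual_value L \<in> borel_measurable \<mu>"
    "integrable \<mu> (\<lambda>x. dual_value L x powr q)" "(LINT x|\<mu>. dual_value L x powr q) powr (1/q) \<le> K"
proof -
  interpret sigma_finite_measure \<mu> by (rule sf)
  obtain u :: "nat \<Rightarrow> 'v" where u: "\<And>n. u n \<in> carrier M" "\<And>n. AE x in \<mu>. pn (u n) x \<le> 1"
    "AE x in \<mu>. \<forall>n. 0 \<le> ae_rep (L (u n)) x \<and> ae_rep (L (u n)) x \<le> ae_rep (L (u (Suc n))) x"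
    "AE x in \<mu>. ess_sup \<mu> (dual_family L) x = (SUP n. ereal (ae_rep (L (u n)) x))"
    using dual_family_sequence by blast
  obtain B :: "nat \<Rightarrow> 'x set" where B: "range B \<subseteq> sets \<mu>" "(\<Union>i. B i) = space \<mu>" "\<And>i. emeasure \<mu> (B i) \<noteq> \<infinity>" "incseq B"
    using sigma_finite_incseq by metis
  have [measurable]: "B n \<in> sets \<mu>" for n using B by auto
  define g where "g n = ae_rep (L (u n))" for n
  have [measurable]: "g n \<in> borel_measurable \<mu>" for n unfolding g_def using u(1) by (rule L_measurable)
  define h where "h n x = max 0 (min (g n x) (real n)) * indicator (B n) x" for n x
  have [measurable]: "h n \<in> borel_measurable \<mu>" for n unfolding h_def[abs_def] by measurable
  have h0: "0 \<le> h n x" "h n x \<le> real n" "h n x \<le> real n * indicator (B n) x" for n x by (auto simp: h_def indicator_def)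
  have qp: "(q - 1) * p = q" using pq p q by (simp add: field_simps)
  have hint: "integrable \<mu> (\<lambda>x. h n x powr q)" for n
  proof (rule Bochner_Integration.integrable_bound)
    show "integrable \<mu> (\<lambda>x. real n powr q * indicator (B n) x)" using B(3)[of n] by (simp add: less_top[symmetric])
    show "AE x in \<mu>. norm (h n x powr q) \<le> norm (real n powr q * indicator (B n) x)"
    proof (rule AE_I2)
      fix x
      show "norm (h n x powr q) \<le> norm (real n powr q * indicator (B n) x)"
        using q powr_mono2[OF _ h0(1) h0(2), of q n x] by (cases "x \<in> B n") (auto simp: h_def)
    qed
  qed simp
  have bound: "(LINT x|\<mu>. h n x powr q) \<le> K powr q" for n
  proof -
    define I where "I = (LINT x|\<mu>. h n x powr q)"
    define F where "F x = h n x powr (q - 1)" for x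
    have Fm[measurable]: "F \<in> borel_measurable \<mu>" unfolding F_def[abs_def] by measurable
    have Fb: "AE x in \<mu>. \<bar>F x\<bar> \<le> real n powr (q - 1)" unfolding F_def using h0 q by (intro AE_I2) (auto intro: powr_mono2)
    have Fu: "ae_class \<mu> F \<odot> u n \<in> carrier M" using ae_class_Linf[OF _ Fb] u(1) by simp
    have I0: "0 \<le> I" by (simp add: I_def)
    have "I \<le> (LINT x|\<mu>. \<bar>ae_rep (L (ae_class \<mu> F \<odot> u n)) x\<bar>)"
      unfolding I_def
    proof (rule integral_mono_AE[OF hint])
      show "integrable \<mu> (\<lambda>x. \<bar>ae_rep (L (ae_class \<mu> F \<odot> u n)) x\<bar>)" using L_integrable[OF Fu] by simp
      show "AE x in \<mu>. h n x powr q \<le> \<bar>ae_rep (L (ae_class \<mu> F \<odot> u n)) x\<bar>"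
        using u(3) AE_L_smult[OF Fm Fb u(1)[of n]]
      proof eventually_elim
        case a: (elim x)
        have "0 \<le> g n x" using a(1) by (simp add: g_def)
        then have hg: "h n x \<le> g n x" by (auto simp: h_def g_def indicator_def)
        have "h n x powr q = F x * h n x"
        proof (cases "h n x = 0")
          case False
          then show ?thesis using h0(1)[of n x] powr_add[of "h n x" "q - 1" 1] by (simp add: F_def)
        qed (use q in \<open>simp add: F_def\<close>)
        also have "\<dots> \<le> F x * g n x" using hg by (intro mult_left_mono) (simp_all add: F_def)
        finally show ?case using a(2) by (simp add: g_def)
      qed
    qed
    also have "\<dots> \<le> K * nrm M (ae_class \<mu> F \<odot> u n)" using K(2)[OF Fu] by (simp add: Lp1_norm)
    also have "\<dots> \<le> K * I powr (1/p)"
    proof (rule mult_left_mono[OF _ K(1)])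
      have "(LINT x|\<mu>. pn (ae_class \<mu> F \<odot> u n) x powr p) \<le> I"
        unfolding I_def
      proof (rule integral_mono_AE[OF pn_integrable[OF Fu] hint])
        show "AE x in \<mu>. pn (ae_class \<mu> F \<odot> u n) x powr p \<le> h n x powr q"
          using pn_nonneg[OF u(1)[of n]] u(2)[of n] pn_smult_class[OF Fm Fb u(1)[of n]]
        proof eventually_elim
          case a: (elim x)
          have F0: "0 \<le> F x" by (simp add: F_def)
          have "pn (ae_class \<mu> F \<odot> u n) x powr p \<le> F x powr p"
            using a p F0 by (intro powr_mono2) (auto intro: mult_left_le)
          also have "\<dots> = h n x powr q" by (simp add: F_def powr_powr qp)
          finally show ?case .
        qed
      qed
      then show "nrm M (ae_class \<mu> F \<odot> u n) \<le> I powr (1/p)"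
        unfolding nrm_eq[OF Fu] using p by (intro powr_mono2) (auto intro!: integral_nonneg_AE)
    qed
    finally have le: "I \<le> K * I powr (1/p)" .
    have "I \<le> K powr q"
    proof (cases "I = 0")
      case False
      then have pos: "0 < I" using I0 by simp
      have "I = I powr (1/q) * I powr (1/p)" using pos pq by (simp add: powr_add[symmetric] add.commute)
      then have "I powr (1/q) \<le> K" using le pos by (metis mult_le_cancel_right_pos powr_gt_zero less_irrefl)
      then have "(I powr (1/q)) powr q \<le> K powr q" using q by (intro powr_mono2) auto
      then show ?thesis using q pos by (simp add: powr_powr)
    qed simp
    then show ?thesis by (simp add: I_def)
  qed
  define H where "H x = (SUP n. ennreal (h n x powr q))" for x
  have [measurable]: "H \<in> borel_measurable \<mu>" unfolding H_def[abs_def] by measurable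
  have Hle: "(\<integral>\<^sup>+x. H x \<partial>\<mu>) \<le> ennreal (K powr q)"
  proof -
    have "AE x in \<mu>. ennreal (h n x powr q) \<le> ennreal (h (Suc n) x powr q)" for n
      using u(3)
    proof eventually_elim
      case (elim x)
      have "g n x \<le> g (Suc n) x" "x \<in> B n \<Longrightarrow> x \<in> B (Suc n)" using elim B(4) by (auto simp: g_def incseq_Suc_iff)
      then have "h n x \<le> h (Suc n) x" by (auto simp: h_def indicator_def)
      then show ?case using q h0 by (intro ennreal_leI powr_mono2) auto
    qed
    then have "(\<integral>\<^sup>+x. H x \<partial>\<mu>) = (SUP n. \<integral>\<^sup>+x. ennreal (h n x powr q) \<partial>\<mu>)"
      unfolding H_def by (intro nn_integral_monotone_convergence_SUP_AE) auto
    also have "\<dots> \<le> ennreal (K powr q)"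
      using bound hint by (intro SUP_least) (subst nn_integral_eq_integral, auto intro: ennreal_leI)
    finally show ?thesis .
  qed
  then have Hfin: "AE x in \<mu>. H x \<noteq> \<infinity>" by (intro nn_integral_PInf_AE) (auto simp: top_unique)
  have main: "AE x in \<mu>. ess_sup \<mu> (dual_family L) x = ereal (dual_value L x) \<and> 0 \<le> dual_value L x \<and>
    ennreal (dual_value L x powr q) \<le> H x"
    using u(3,4) Hfin AE_space
  proof eventually_elim
    case (elim x)
    obtain c where c: "0 \<le> c" "H x = ennreal c" using elim(3) by (cases "H x") auto
    define s where "s = c powr (1/q)"
    have gs: "g n x \<le> s" for n
    proof -
      obtain i where i: "x \<in> B i" using elim(4) B(2) by blast
      obtain m0 where m0: "s < real m0" using reals_Archimedean2 by blast
      let ?m = "max n (max i m0)"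
      have xB: "x \<in> B ?m" using i incseqD[OF B(4), of i ?m] max.coboundedI2[of i "max i m0" n] by auto
      have "incseq (\<lambda>n. g n x)" using elim(1) by (intro incseq_SucI) (simp add: g_def)
      then have gm: "g n x \<le> g ?m x" by (simp add: incseq_def)
      have "ennreal (h ?m x powr q) \<le> ennreal c" unfolding c(2)[symmetric] H_def by (rule SUP_upper) simp
      then have "(h ?m x powr q) powr (1/q) \<le> s" unfolding s_def using c(1) q by (intro powr_mono2) auto
      then have "h ?m x \<le> s" using q h0(1)[of ?m x] by (simp add: powr_powr)
      then show ?thesis using gm m0 xB elim(1) by (auto simp: h_def g_def min_def split: if_splits)
    qed
    let ?e = "SUP n. ereal (g n x)"
    have "0 \<le> ereal (g 0 x)" using elim(1) by (simp add: g_def)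
    then have "0 \<le> ?e" by (rule SUP_upper2[OF UNIV_I])
    moreover have "?e \<le> ereal s" using gs by (intro SUP_least) simp
    ultimately obtain r where r: "?e = ereal r" "0 \<le> r" "r \<le> s" by (cases ?e) auto
    have "r powr q \<le> s powr q" using r q by (intro powr_mono2) auto
    also have "\<dots> = c" using c q by (simp add: s_def powr_powr)
    finally show ?case using r c elim(2) by (simp add: g_def dual_value_def)
  qed
  show 1: "AE x in \<mu>. ess_sup \<mu> (dual_family L) x = ereal (dual_value L x)" "AE x in \<mu>. 0 \<le> dual_value L x"
    using main by (auto elim: eventually_mono)
  have em: "ess_sup \<mu> (dual_family L) \<in> borel_measurable \<mu>" using dual_family_ess_sup by (simp add: is_ess_sup_def)
  then show [measurable]: "dual_value L \<in> borel_measurable \<mu>" unfolding dual_value_def[abs_def] by measurable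
  have "(\<integral>\<^sup>+x. ennreal (dual_value L x powr q) \<partial>\<mu>) \<le> (\<integral>\<^sup>+x. H x \<partial>\<mu>)"
    using main by (intro nn_integral_mono_AE) (auto elim: eventually_mono)
  then have le: "(\<integral>\<^sup>+x. ennreal (dual_value L x powr q) \<partial>\<mu>) \<le> ennreal (K powr q)" using Hle by (rule order_trans)
  show int: "integrable \<mu> (\<lambda>x. dual_value L x powr q)"
    using le by (intro integrableI_bounded) (auto intro: le_less_trans[OF _ ennreal_less_top])
  have "(LINT x|\<mu>. dual_value L x powr q) \<le> K powr q"
    using le int by (simp add: nn_integral_eq_integral)
  then have "(LINT x|\<mu>. dual_value L x powr q) powr (1/q) \<le> (K powr q) powr (1/q)"
    using q by (intro powr_mono2) auto
  then show "(LINT x|\<mu>. dual_value L x powr q) powr (1/q) \<le> K" using q K by (simp add: powr_powr)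
qed

lemma dual_value_facts:
  "AE x in \<mu>. ess_sup \<mu> (dual_family L) x = ereal (dual_value L x)" "AE x in \<mu>. 0 \<le> dual_value L x"
  "dual_value L \<in> borel_measurable \<mu>" "integrable \<mu> (\<lambda>x. dual_value L x powr q)"
proof -
  obtain K where K: "0 \<le> K" "\<And>v. v \<in> carrier M \<Longrightarrow> Lp_norm \<mu> 1 (L v) \<le> K * nrm M v"
    using DM_bounded[OF L] by blast
  show "AE x in \<mu>. ess_sup \<mu> (dual_family L) x = ereal (dual_value L x)" "AE x in \<mu>. 0 \<le> dual_value L x"
    "dual_value L \<in> borel_measurable \<mu>" "integrable \<mu> (\<lambda>x. dual_value L x powr q)"
    using dual_value_Lq[OF K] by auto
qed

text \<open>Normalise \<open>v\<close> where its pointwise norm is at least \<open>1 / m\<close>, and use locality where it vanishes.\<close>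

lemma dual_value_bound_upper:
  assumes v: "v \<in> carrier M"
  shows "AE x in \<mu>. ae_rep (L v) x \<le> dual_value L x * pn v x"
proof -
  note [measurable] = pn_measurable[OF v]
  define G where "G m x = (if 1 / real (Suc m) < pn v x then 1 / pn v x else 0)" for m x
  have [measurable]: "G m \<in> borel_measurable \<mu>" for m unfolding G_def[abs_def] by measurable
  have Gb: "AE x in \<mu>. \<bar>G m x\<bar> \<le> real (Suc m)" for m
  proof (rule AE_I2)
    fix x
    show "\<bar>G m x\<bar> \<le> real (Suc m)"
    proof (cases "1 / real (Suc m) < pn v x")
      case True
      moreover have "0 < 1 / real (Suc m)" by simp
      ultimately have "0 < pn v x" by (rule less_trans[rotated])
      then show ?thesis using True by (simp add: G_def field_simps)
    qed (simp add: G_def)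
  qed
  have "AE x in \<mu>. G m x * ae_rep (L v) x \<le> dual_value L x" for m
  proof -
    let ?u = "ae_class \<mu> (G m) \<odot> v"
    have u: "?u \<in> carrier M" using ae_class_Linf[OF _ Gb] v by simp
    have "AE x in \<mu>. pn ?u x \<le> 1"
      using pn_smult_class[OF \<open>G m \<in> borel_measurable \<mu>\<close> Gb v]
    proof eventually_elim
      case (elim x)
      have "0 < pn v x" if "1 / real (Suc m) < pn v x" by (rule less_trans[OF _ that]) simp
      then have "\<bar>G m x\<bar> * pn v x \<le> 1"
        by (cases "1 / real (Suc m) < pn v x") (auto simp: G_def)
      then show ?case using elim by (simp only:)
    qed
    then have "ae_rep (L ?u) \<in> dual_family L" using u by (auto simp: dual_family_def)
    then have "AE x in \<mu>. ereal (ae_rep (L ?u) x) \<le> ess_sup \<mu> (dual_family L) x"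
      using dual_family_ess_sup by (auto simp: is_ess_sup_def)
    then show ?thesis using dual_value_facts(1) AE_L_smult[OF \<open>G m \<in> borel_measurable \<mu>\<close> Gb v]
      by eventually_elim simp
  qed
  then have 1: "AE x in \<mu>. \<forall>m. G m x * ae_rep (L v) x \<le> dual_value L x" by (simp add: AE_all_countable)
  define Z where "Z = {x \<in> space \<mu>. pn v x = 0}"
  have Zm: "Z \<in> sets \<mu>" unfolding Z_def by measurable
  have Zi: "indicator Z \<in> borel_measurable \<mu>" using Zm by simp
  have "set_class \<mu> Z \<odot> v = \<zero>"
    using pn_set[OF Zm v] Zm v AE_space by (subst eq_zero_iff) (auto elim!: eventually_elim2 simp: Z_def indicator_def)
  then have "AE x in \<mu>. indicator Z x * ae_rep (L v) x = 0"
    using AE_L_smult[OF Zi _ v, of 1] AE_L_zero by (auto simp: indicator_def elim: eventually_elim2)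
  with 1 pn_nonneg[OF v] AE_space show ?thesis
  proof eventually_elim
    case (elim x)
    show ?case
    proof (cases "pn v x = 0")
      case True
      then show ?thesis using elim by (simp add: Z_def)
    next
      case False
      then have pos: "0 < pn v x" using elim by simp
      then obtain m where "inverse (real (Suc m)) < pn v x" using reals_Archimedean by blast
      then have "ae_rep (L v) x / pn v x \<le> dual_value L x"
        using elim(1)[rule_format, of m] by (simp add: G_def inverse_eq_divide)
      then show ?thesis using pos by (simp add: field_simps)
    qed
  qed
qed

lemma dual_value_bound:
  assumes v: "v \<in> carrier M"
  shows "AE x in \<mu>. \<bar>ae_rep (L v) x\<bar> \<le> dual_value L x * pn v x"
proof -
  have c: "const_class \<mu> (-1) \<odot> v \<in> carrier M" using v by simp
  show ?thesis
    using dual_value_bound_upper[OF v] dual_value_bound_upper[OF c] pn_const[OF v, of "-1"]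
      AE_L_smult[OF _ _ v, of "\<lambda>_. -1" 1]
    by (auto elim!: eventually_elim2 simp: abs_le_iff)
qed

text \<open>
  One inequality is the bound for the \<open>L\<^sup>q\<close> norm of the pointwise norm by any operator bound; the other
  is Hoelder's inequality applied to \<open>|L v| \<le> |L| |v|\<close>.
\<close>

lemma DM_nrm_eq: "nrm DM L = (LINT x|\<mu>. dual_value L x powr q) powr (1/q)"
proof (rule antisym)
  show "(LINT x|\<mu>. dual_value L x powr q) powr (1/q) \<le> nrm DM L"
    using DM_nrm[OF L] by (rule dual_value_Lq)
  show "nrm DM L \<le> (LINT x|\<mu>. dual_value L x powr q) powr (1/q)"
  proof (rule DM_nrm_le)
    fix v assume v: "v \<in> carrier M"
    have ap: "AE x in \<mu>. \<bar>pn v x\<bar> powr p = pn v x powr p" using pn_nonneg[OF v] by eventually_elim simp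
    have aq: "AE x in \<mu>. \<bar>dual_value L x\<bar> powr q = dual_value L x powr q" using dual_value_facts(2) by eventually_elim simp
    note [measurable] = dual_value_facts(3) pn_measurable[OF v] L_measurable[OF v]
    have ip: "integrable \<mu> (\<lambda>x. \<bar>pn v x\<bar> powr p)" "(LINT x|\<mu>. \<bar>pn v x\<bar> powr p) = (LINT x|\<mu>. pn v x powr p)"
      using integrable_cong_AE[OF _ _ ap] pn_integrable[OF v] integral_cong_AE[OF _ _ ap] by simp_all
    have iq: "integrable \<mu> (\<lambda>x. \<bar>dual_value L x\<bar> powr q)" "(LINT x|\<mu>. \<bar>dual_value L x\<bar> powr q) = (LINT x|\<mu>. dual_value L x powr q)"
      using integrable_cong_AE[OF _ _ aq] dual_value_facts(4) integral_cong_AE[OF _ _ aq] by simp_all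
    have pq': "1 / q + 1 / p = 1" using pq by simp
    note H = Hoelder[OF q p pq' dual_value_facts(3) pn_measurable[OF v] iq(1) ip(1)]
    have "(LINT x|\<mu>. \<bar>ae_rep (L v) x\<bar>) \<le> (LINT x|\<mu>. \<bar>dual_value L x * pn v x\<bar>)"
      using dual_value_bound[OF v] L_integrable[OF v] H(1) by (intro integral_mono_AE) (auto elim: eventually_mono)
    then show "Lp_norm \<mu> 1 (L v) \<le> (LINT x|\<mu>. dual_value L x powr q) powr (1/q) * nrm M v"
      using H(2) by (simp add: Lp1_norm nrm_eq[OF v] ip iq)
  qed simp
qed

end

lemma dual_value_least:
  assumes L: "L \<in> carrier DM" and [measurable]: "h \<in> borel_measurable \<mu>"
    and h: "\<And>v. v \<in> carrier M \<Longrightarrow> AE x in \<mu>. pn v x \<le> 1 \<Longrightarrow> AE x in \<mu>. ae_rep (L v) x \<le> h x"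
  shows "AE x in \<mu>. dual_value L x \<le> h x"
proof -
  have "\<forall>f\<in>dual_family L. AE x in \<mu>. ereal (f x) \<le> ereal (h x)"
    unfolding dual_family_def ereal_less_eq using h by blast
  then have "AE x in \<mu>. ess_sup \<mu> (dual_family L) x \<le> ereal (h x)"
    using dual_family_ess_sup[OF L] unfolding is_ess_sup_def by simp
  with dual_value_facts(1)[OF L] show ?thesis by eventually_elim simp
qed

text \<open>
  Where \<open>F\<close> does not vanish, \<open>|F L v| \<le> |F L|\<close> can be divided by \<open>|F|\<close>; where it vanishes, both sides do.
\<close>

lemma DM_pnorm_smult:
  assumes F: "F \<in> carrier (Linf \<mu>)" and L: "L \<in> carrier DM"
  shows "AE x in \<mu>. dual_value (F \<odot>\<^bsub>DM\<^esub> L) x = \<bar>ae_rep F x\<bar> * dual_value L x"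
proof -
  let ?FL = "F \<odot>\<^bsub>DM\<^esub> L"
  have Fc: "F \<in> ae_classes \<mu>" using F Linf_ae_classes by blast
  have FL: "?FL \<in> carrier DM" using L F by (rule DM_closed)
  note [measurable] = dual_value_facts(3)[OF L] dual_value_facts(3)[OF FL] ae_rep_measurable[OF Fc]
  have val: "AE x in \<mu>. ae_rep (?FL v) x = ae_rep F x * ae_rep (L v) x" if "v \<in> carrier M" for v
    using ae_map2_classes(5)[OF Fc Lp_set_ae_classes[OF DM_linear(1)[OF L that that]]] that by simp
  have "AE x in \<mu>. dual_value ?FL x \<le> \<bar>ae_rep F x\<bar> * dual_value L x"
  proof (rule dual_value_least[OF FL])
    fix v assume v: "v \<in> carrier M" "AE x in \<mu>. pn v x \<le> 1"
    from val[OF v(1)] dual_value_bound[OF L v(1)] v(2) dual_value_facts(2)[OF L]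
    show "AE x in \<mu>. ae_rep (?FL v) x \<le> \<bar>ae_rep F x\<bar> * dual_value L x"
    proof eventually_elim
      case (elim x)
      have "ae_rep F x * ae_rep (L v) x \<le> \<bar>ae_rep F x\<bar> * \<bar>ae_rep (L v) x\<bar>" by (metis abs_ge_self abs_mult)
      also have "\<dots> \<le> \<bar>ae_rep F x\<bar> * (dual_value L x * 1)"
        using elim by (intro mult_left_mono order_trans[OF elim(2)]) auto
      finally show ?case using elim by simp
    qed
  qed measurable
  moreover have "AE x in \<mu>. dual_value L x \<le> (if ae_rep F x = 0 then dual_value L x else dual_value ?FL x / \<bar>ae_rep F x\<bar>)"
  proof (rule dual_value_least[OF L])
    fix v assume v: "v \<in> carrier M" "AE x in \<mu>. pn v x \<le> 1"
    from val[OF v(1)] dual_value_bound[OF L v(1)] dual_value_bound[OF FL v(1)] v(2) dual_value_facts(2)[OF L] dual_value_facts(2)[OF FL]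
    show "AE x in \<mu>. ae_rep (L v) x \<le> (if ae_rep F x = 0 then dual_value L x else dual_value ?FL x / \<bar>ae_rep F x\<bar>)"
    proof eventually_elim
      case (elim x)
      have "dual_value L x * pn v x \<le> dual_value L x * 1" "dual_value ?FL x * pn v x \<le> dual_value ?FL x * 1"
        using elim by (auto intro: mult_left_mono simp del: mult_1_right DM_simps)
      then have "ae_rep (L v) x \<le> dual_value L x" "\<bar>ae_rep F x\<bar> * \<bar>ae_rep (L v) x\<bar> \<le> dual_value ?FL x"
        using elim(1-3) by (auto simp: abs_mult[symmetric] simp del: DM_simps)
      moreover have "\<bar>ae_rep F x\<bar> * ae_rep (L v) x \<le> \<bar>ae_rep F x\<bar> * \<bar>ae_rep (L v) x\<bar>" by (intro mult_left_mono) auto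
      ultimately show ?case by (auto simp: field_simps simp del: DM_simps)
    qed
  qed measurable
  ultimately show ?thesis using dual_value_facts(2)[OF FL]
    by eventually_elim (auto simp: field_simps simp del: DM_simps split: if_splits intro: antisym)
qed

theorem DM_Lp_normed: "Lp_normed_module \<mu> q DM"
  unfolding Lp_normed_module_def
proof (intro conjI ballI)
  show "Module.module (Linf \<mu>) DM" by (rule DM_module)
  show "banach_space (real_nspace \<mu> DM)" by (rule DM_banach)
  fix L assume L: "L \<in> carrier DM"
  note f = dual_value_facts[OF L]
  have aq: "AE x in \<mu>. \<bar>dual_value L x\<bar> powr q = dual_value L x powr q" using f(2) by eventually_elim simp
  show "pnorm DM L \<in> Lp_set \<mu> q"
    unfolding pnorm_DM using integrable_cong_AE[OF _ _ aq] f by (intro Lp_setI) simp_all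
  show "AE x in \<mu>. 0 \<le> ae_rep (pnorm DM L) x"
    unfolding pnorm_DM using AE_ae_rep_class[OF f(3)] f(2) by eventually_elim simp
  show "nrm DM L = Lp_norm \<mu> q (pnorm DM L)"
    unfolding pnorm_DM using f DM_nrm_eq[OF L] integral_cong_AE[OF _ _ aq] by (simp add: Lp_norm_ae_class)
  fix F assume F: "F \<in> carrier (Linf \<mu>)"
  have Fm: "ae_rep F \<in> borel_measurable \<mu>" using Linf_ae_classes[OF F] by simp
  have "pnorm DM (F \<odot>\<^bsub>DM\<^esub> L) = ae_class \<mu> (\<lambda>x. \<bar>ae_rep F x\<bar> * dual_value L x)"
    unfolding pnorm_DM using DM_pnorm_smult[OF F L] by (rule ae_class_eqI)
  also have "\<dots> = ae_map2 \<mu> (\<lambda>a b. \<bar>a\<bar> * b) (ae_class \<mu> (ae_rep F)) (pnorm DM L)"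
    unfolding pnorm_DM using Fm f(3) by (simp add: ae_map2_ae_class)
  finally show "pnorm DM (F \<odot>\<^bsub>DM\<^esub> L) = ae_map2 \<mu> (\<lambda>a b. \<bar>a\<bar> * b) F (pnorm DM L)"
    using Linf_ae_classes[OF F] by (simp add: ae_class_ae_rep)
qed

end

section \<open>Generalised limits\<close>

text \<open>
  The evaluations \<open>s \<mapsto> s n\<close> of bounded sequences live in a product of compact intervals, hence
  they cluster at some functional. Linear relations, inequalities and limits that hold eventually
  along the evaluations are inherited by the cluster point.
\<close>

lemma generalised_limit:
  obtains glim :: "(nat \<Rightarrow> real) \<Rightarrow> real" where
    "\<And>s t a b. Bseq s \<Longrightarrow> Bseq t \<Longrightarrow> glim (\<lambda>n. a * s n + b * t n) = a * glim s + b * glim t"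
    "\<And>s c. Bseq s \<Longrightarrow> (\<And>e. 0 < e \<Longrightarrow> eventually (\<lambda>n. \<bar>s n\<bar> \<le> c + e) sequentially) \<Longrightarrow> \<bar>glim s\<bar> \<le> c"
    "\<And>s l. s \<longlonglongrightarrow> l \<Longrightarrow> glim s = l"
proof -
  define C where "C s = (if Bseq s then (SUP n. \<bar>s n\<bar>) else 0)" for s :: "nat \<Rightarrow> real"
  define ev where "ev n s = (if Bseq s then s n else 0)" for n :: nat and s :: "nat \<Rightarrow> real"
  define K where "K = PiE (UNIV :: (nat \<Rightarrow> real) set) (\<lambda>s. {- C s..C s})"
  have "compactin (product_topology (\<lambda>_. euclidean) UNIV) K"
    unfolding K_def compactin_PiE by (auto simp: compactin_euclidean_iff)
  then have K: "compact K" by (simp add: euclidean_product_topology compactin_euclidean_iff)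
  have evK: "ev n \<in> K" for n
  proof -
    have "\<bar>s n\<bar> \<le> C s" if "Bseq s" for s
    proof -
      have "bdd_above (range (\<lambda>n. \<bar>s n\<bar>))" using that by (auto simp: Bseq_def bdd_above_def)
      then show ?thesis using that by (auto simp: C_def intro: cSUP_upper)
    qed
    then show ?thesis by (auto simp: K_def ev_def C_def abs_le_iff minus_le_iff)
  qed
  define F where "F = filtermap ev sequentially"
  have "F \<noteq> bot" "eventually (\<lambda>x. x \<in> K) F"
    using evK by (auto simp: F_def filtermap_bot_iff eventually_filtermap)
  with K obtain l where l: "inf (nhds l) F \<noteq> bot" unfolding compact_filter by blast
  define G where "G = inf (nhds l) F"
  have GF: "G \<le> F" and Gn: "G \<le> nhds l" and G: "G \<noteq> bot" using l by (auto simp: G_def)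
  have coord: "((\<lambda>f. f s) \<longlongrightarrow> l s) G" for s
  proof -
    have "((\<lambda>f. f s) \<longlongrightarrow> l s) (nhds l)"
    proof (rule topological_tendstoI)
      fix U :: "real set" assume U: "open U" "l s \<in> U"
      then have "open ((\<lambda>f. f s) -` U)" by (intro open_vimage continuous_on_product_coordinates)
      then show "\<forall>\<^sub>F f in nhds l. f s \<in> U" using U by (auto simp: eventually_nhds)
    qed
    then show ?thesis using Gn by (rule tendsto_mono[rotated])
  qed
  have evG: "eventually (\<lambda>f. P f) G" if "eventually (\<lambda>n. P (ev n)) sequentially" for P
    using that GF by (auto simp: F_def le_filter_def eventually_filtermap)
  show ?thesis
  proof (rule that[of l])
    fix s t :: "nat \<Rightarrow> real" and a b assume st: "Bseq s" "Bseq t"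
    have B: "Bseq (\<lambda>n. a * s n + b * t n)"
    proof -
      obtain k where k: "\<And>n. \<bar>s n\<bar> \<le> k" using st(1) by (auto simp: Bseq_def)
      obtain k' where k': "\<And>n. \<bar>t n\<bar> \<le> k'" using st(2) by (auto simp: Bseq_def)
      have "\<bar>a * s n + b * t n\<bar> \<le> \<bar>a\<bar> * k + \<bar>b\<bar> * k'" for n
      proof -
        have "\<bar>a * s n + b * t n\<bar> \<le> \<bar>a\<bar> * \<bar>s n\<bar> + \<bar>b\<bar> * \<bar>t n\<bar>" by (metis abs_mult abs_triangle_ineq)
        also have "\<dots> \<le> \<bar>a\<bar> * k + \<bar>b\<bar> * k'" using k k' by (intro add_mono mult_left_mono) auto
        finally show ?thesis .
      qed
      then show ?thesis by (intro BseqI'[of _ "\<bar>a\<bar> * k + \<bar>b\<bar> * k'"]) auto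
    qed
    have "((\<lambda>f. f (\<lambda>n. a * s n + b * t n)) \<longlongrightarrow> a * l s + b * l t) G"
    proof (rule Lim_transform_eventually)
      show "((\<lambda>f. a * f s + b * f t) \<longlongrightarrow> a * l s + b * l t) G" by (intro tendsto_intros coord)
      show "\<forall>\<^sub>F f in G. a * f s + b * f t = f (\<lambda>n. a * s n + b * t n)"
        by (rule evG) (simp add: ev_def st B)
    qed
    then show "l (\<lambda>n. a * s n + b * t n) = a * l s + b * l t" using tendsto_unique[OF G coord] by blast
  next
    fix s :: "nat \<Rightarrow> real" and c assume B: "Bseq s" and ev: "\<And>e. 0 < e \<Longrightarrow> eventually (\<lambda>n. \<bar>s n\<bar> \<le> c + e) sequentially"
    show "\<bar>l s\<bar> \<le> c"
    proof (rule field_le_epsilon)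
      fix e :: real assume "0 < e"
      show "\<bar>l s\<bar> \<le> c + e"
      proof (rule tendsto_upperbound[OF tendsto_rabs[OF coord] _ G])
        show "\<forall>\<^sub>F f in G. \<bar>f s\<bar> \<le> c + e" by (rule evG) (use ev[OF \<open>0 < e\<close>] in \<open>simp add: ev_def B\<close>)
      qed
    qed
  next
    fix s :: "nat \<Rightarrow> real" and a assume s: "s \<longlonglongrightarrow> a"
    then have B: "Bseq s" using convergent_imp_Bseq convergentI by blast
    have "((\<lambda>f. f s) \<longlongrightarrow> a) F"
      unfolding F_def filterlim_filtermap using s by (simp add: ev_def B)
    then have "((\<lambda>f. f s) \<longlongrightarrow> a) G" using GF by (rule tendsto_mono[rotated])
    then show "l s = a" using tendsto_unique[OF G coord] by blast
  qed
qed

section \<open>A linear lifting over a measure preserving map\<close>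

locale measure_preserving =
  fixes X :: "'x measure" and Y :: "'y measure" and A :: "nat \<Rightarrow> 'x set" and B :: "nat \<Rightarrow> 'y set"
    and \<phi> :: "'y \<Rightarrow> 'x"
  assumes sfX: "sigma_finite_measure X" and sfY: "sigma_finite_measure Y"
    and denseA: "dense_sequence X A" and denseB: "dense_sequence Y B"
    and \<phi>[measurable]: "\<phi> \<in> measurable Y X" and distr: "distr Y X \<phi> = X"
begin

sublocale X: sigma_finite_measure X by (rule sfX)
sublocale Y: sigma_finite_measure Y by (rule sfY)

lemma A_sets [measurable]: "range A \<subseteq> sets X" using denseA by (simp add: dense_sequence_def)

lemma B_sets [measurable]: "B n \<in> sets Y" using denseB by (auto simp: dense_sequence_def)

lemma \<phi>_space: "y \<in> space Y \<Longrightarrow> \<phi> y \<in> space X" using \<phi> by (rule measurable_space)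

lemma AE_pull: "AE x in X. P x \<Longrightarrow> AE y in Y. P (\<phi> y)"
  using AE_distrD[OF \<phi>, of P] unfolding distr .

lemma nn_integral_pull: "f \<in> borel_measurable X \<Longrightarrow> (\<integral>\<^sup>+y. f (\<phi> y) \<partial>Y) = (\<integral>\<^sup>+x. f x \<partial>X)"
  using nn_integral_distr[OF \<phi>, of f] distr by simp

text \<open>The density of the image under \<open>\<phi>\<close> of the measure with density \<open>\<psi>\<close>.\<close>

definition marginal :: "('y \<Rightarrow> ennreal) \<Rightarrow> 'x \<Rightarrow> ennreal" where
  "marginal \<psi> = RN_deriv X (distr (density Y \<psi>) X \<phi>)"

lemma marginal_measurable [measurable]: "marginal \<psi> \<in> borel_measurable X"
  by (simp add: marginal_def)

text \<open>
  The image measure is absolutely continuous because \<open>\<phi>\<close> pulls null sets back to null sets.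
\<close>

lemma marginal_integral:
  assumes [measurable]: "\<psi> \<in> borel_measurable Y" "f \<in> borel_measurable X"
  shows "(\<integral>\<^sup>+y. \<psi> y * f (\<phi> y) \<partial>Y) = (\<integral>\<^sup>+x. marginal \<psi> x * f x \<partial>X)"
proof -
  let ?N = "distr (density Y \<psi>) X \<phi>"
  have m: "\<phi> \<in> measurable (density Y \<psi>) X" by simp
  have "absolutely_continuous X ?N"
    unfolding absolutely_continuous_def
  proof
    fix E assume E: "E \<in> null_sets X"
    then have Em[measurable]: "E \<in> sets X" by auto
    have "AE y in Y. \<phi> y \<notin> E" using AE_pull[OF AE_not_in[OF E]] .
    then have "(\<integral>\<^sup>+y. \<psi> y * indicator (\<phi> -` E \<inter> space Y) y \<partial>Y) = (\<integral>\<^sup>+y. 0 \<partial>Y)"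
      by (intro nn_integral_cong_AE) (auto elim!: eventually_mono simp: indicator_def)
    then have "emeasure ?N E = 0"
      by (simp add: emeasure_distr[OF m Em] emeasure_density)
    then show "E \<in> null_sets ?N" by auto
  qed
  then have dens: "density X (marginal \<psi>) = ?N"
    unfolding marginal_def by (intro X.density_RN_deriv) auto
  have "(\<integral>\<^sup>+x. marginal \<psi> x * f x \<partial>X) = (\<integral>\<^sup>+x. f x \<partial>?N)"
    by (subst dens[symmetric]) (simp add: nn_integral_density)
  also have "\<dots> = (\<integral>\<^sup>+y. f (\<phi> y) \<partial>density Y \<psi>)" by (subst nn_integral_distr[OF m]) auto
  also have "\<dots> = (\<integral>\<^sup>+y. \<psi> y * f (\<phi> y) \<partial>Y)" by (subst nn_integral_density) auto
  finally show ?thesis by simp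
qed

lemma marginal_indicator_finite:
  assumes [measurable]: "C \<in> sets Y"
  shows "AE x in X. marginal (indicator C) x \<noteq> \<infinity>"
proof -
  obtain S :: "nat \<Rightarrow> 'x set" where S: "range S \<subseteq> sets X" "(\<Union>i. S i) = space X" "\<And>i. emeasure X (S i) \<noteq> \<infinity>"
    using X.sigma_finite by metis
  have [measurable]: "S i \<in> sets X" for i using S by auto
  have "AE x in X. marginal (indicator C) x * indicator (S i) x \<noteq> \<infinity>" for i
  proof (rule nn_integral_PInf_AE)
    have "(\<integral>\<^sup>+x. marginal (indicator C) x * indicator (S i) x \<partial>X) = (\<integral>\<^sup>+y. indicator C y * indicator (S i) (\<phi> y) \<partial>Y)"
      by (subst marginal_integral) auto
    also have "\<dots> \<le> (\<integral>\<^sup>+y. indicator (S i) (\<phi> y) \<partial>Y)" by (intro nn_integral_mono) (auto simp: indicator_def)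
    also have "\<dots> = emeasure X (S i)" by (subst nn_integral_pull) auto
    finally show "(\<integral>\<^sup>+x. marginal (indicator C) x * indicator (S i) x \<partial>X) \<noteq> \<infinity>"
      using S(3)[of i] by (auto simp: top_unique)
  qed simp
  then have "AE x in X. \<forall>i. marginal (indicator C) x * indicator (S i) x \<noteq> \<infinity>" by (simp add: AE_all_countable)
  then show ?thesis using AE_space
  proof eventually_elim
    case (elim x)
    obtain i where i: "x \<in> S i" using elim(2) S(2) by blast
    show ?case using elim(1)[rule_format, of i] i by simp
  qed
qed

lemma marginal_indicator_pos:
  assumes [measurable]: "C \<in> sets Y"
  shows "AE y in Y. y \<in> C \<longrightarrow> 0 < marginal (indicator C) (\<phi> y)"
proof -
  have "(\<integral>\<^sup>+y. indicator C y * (if marginal (indicator C) (\<phi> y) = 0 then 1 else 0) \<partial>Y) =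
    (\<integral>\<^sup>+x. marginal (indicator C) x * (if marginal (indicator C) x = 0 then 1 else 0) \<partial>X)"
    by (rule marginal_integral) auto
  also have "\<dots> = (\<integral>\<^sup>+x. 0 \<partial>X)" by (intro nn_integral_cong) auto
  finally have "AE y in Y. indicator C y * (if marginal (indicator C) (\<phi> y) = 0 then 1 else 0) = (0::ennreal)"
    by (subst nn_integral_0_iff_AE[symmetric]) auto
  then show ?thesis by eventually_elim (auto simp: indicator_def zero_less_iff_neq_zero split: if_splits)
qed

text \<open>
  Multiplying by the weight of \<open>C\<close> turns the image of \<open>Y\<close> restricted to \<open>C\<close> into a restriction
  of \<open>X\<close>. This makes averages over \<open>C\<close> of functions dominated by some \<open>m \<circ> \<phi>\<close> comparable to
  averages of \<open>m\<close>, uniformly in \<open>C\<close>.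
\<close>

definition weight :: "'y set \<Rightarrow> 'x \<Rightarrow> real" where
  "weight C x = 1 / enn2real (marginal (indicator C) x)"

lemma weight_measurable [measurable]: "weight C \<in> borel_measurable X"
  unfolding weight_def[abs_def] by measurable

lemma weight_nonneg: "0 \<le> weight C x" by (simp add: weight_def)

lemma weight_cancel: "marginal (indicator C) x * ennreal (weight C x) \<le> 1"
  "marginal (indicator C) x \<noteq> 0 \<Longrightarrow> marginal (indicator C) x \<noteq> \<infinity> \<Longrightarrow> marginal (indicator C) x * ennreal (weight C x) = 1"
proof -
  show 1: "marginal (indicator C) x * ennreal (weight C x) = 1"
    if nz: "marginal (indicator C) x \<noteq> 0" "marginal (indicator C) x \<noteq> \<infinity>"
  proof -
    obtain r where r: "0 \<le> r" "marginal (indicator C) x = ennreal r"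
      using nz(2) by (cases "marginal (indicator C) x") auto
    then have "0 < r" using nz by (cases "r = 0") auto
    then show ?thesis using r by (simp add: weight_def ennreal_mult[symmetric])
  qed
  show "marginal (indicator C) x * ennreal (weight C x) \<le> 1"
    using 1 by (cases "marginal (indicator C) x = 0 \<or> marginal (indicator C) x = \<infinity>") (auto simp: weight_def)
qed

definition weighted :: "'y set \<Rightarrow> ('y \<Rightarrow> real) \<Rightarrow> 'y \<Rightarrow> real" where
  "weighted C g y = indicator C y * (weight C (\<phi> y) * g y)"

text \<open>
  Local integrability of \<open>m\<close> suffices, as only averages over sets of finite measure are formed.
\<close>

definition dominated :: "('y \<Rightarrow> real) \<Rightarrow> ('x \<Rightarrow> real) \<Rightarrow> bool" where
  "dominated g m \<longleftrightarrow> g \<in> borel_measurable Y \<and> m \<in> borel_measurable X \<and> (AE x in X. 0 \<le> m x) \<and>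
    (AE y in Y. \<bar>g y\<bar> \<le> m (\<phi> y)) \<and> (\<forall>E\<in>sets X. emeasure X E < \<infinity> \<longrightarrow> set_integrable X E m)"

lemma weighted_bound:
  assumes [measurable]: "C \<in> sets Y" "E \<in> sets X" and d: "dominated g m"
  shows "(\<integral>\<^sup>+y. ennreal \<bar>weighted C g y\<bar> * indicator E (\<phi> y) \<partial>Y) \<le> (\<integral>\<^sup>+x. ennreal (m x) * indicator E x \<partial>X)"
proof -
  have [measurable]: "g \<in> borel_measurable Y" "m \<in> borel_measurable X" using d by (auto simp: dominated_def)
  have "(\<integral>\<^sup>+y. ennreal \<bar>weighted C g y\<bar> * indicator E (\<phi> y) \<partial>Y) \<le>
    (\<integral>\<^sup>+y. indicator C y * (ennreal (weight C (\<phi> y)) * ennreal (m (\<phi> y)) * indicator E (\<phi> y)) \<partial>Y)"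
  proof (rule nn_integral_mono_AE)
    show "AE y in Y. ennreal \<bar>weighted C g y\<bar> * indicator E (\<phi> y) \<le> indicator C y * (ennreal (weight C (\<phi> y)) * ennreal (m (\<phi> y)) * indicator E (\<phi> y))"
      using d unfolding dominated_def
    proof (elim conjE, elim eventually_mono)
      fix y assume "\<bar>g y\<bar> \<le> m (\<phi> y)"
      then have "ennreal (weight C (\<phi> y) * \<bar>g y\<bar>) \<le> ennreal (weight C (\<phi> y)) * ennreal (m (\<phi> y))"
        using weight_nonneg by (subst ennreal_mult[symmetric]) (auto intro!: ennreal_leI mult_left_mono)
      then show "ennreal \<bar>weighted C g y\<bar> * indicator E (\<phi> y) \<le> indicator C y * (ennreal (weight C (\<phi> y)) * ennreal (m (\<phi> y)) * indicator E (\<phi> y))"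
        using weight_nonneg by (auto simp: weighted_def abs_mult indicator_def)
    qed
  qed
  also have "\<dots> = (\<integral>\<^sup>+x. marginal (indicator C) x * (ennreal (weight C x) * ennreal (m x) * indicator E x) \<partial>X)"
    by (rule marginal_integral) auto
  also have "\<dots> \<le> (\<integral>\<^sup>+x. ennreal (m x) * indicator E x \<partial>X)"
  proof (rule nn_integral_mono)
    fix x
    have "marginal (indicator C) x * ennreal (weight C x) * (ennreal (m x) * indicator E x) \<le> 1 * (ennreal (m x) * indicator E x)"
      by (intro mult_right_mono weight_cancel) auto
    then show "marginal (indicator C) x * (ennreal (weight C x) * ennreal (m x) * indicator E x) \<le> ennreal (m x) * indicator E x"
      by (simp add: mult.assoc)
  qed
  finally show ?thesis .
qed

lemma weighted_measurable [measurable]: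
  assumes [measurable]: "C \<in> sets Y" "g \<in> borel_measurable Y"
  shows "weighted C g \<in> borel_measurable Y"
  unfolding weighted_def[abs_def] by measurable

lemma weighted_integrable:
  assumes C[measurable]: "C \<in> sets Y" and E[measurable]: "E \<in> sets X" "emeasure X E < \<infinity>" and d: "dominated g m"
  shows "integrable Y (\<lambda>y. weighted C g y * indicator E (\<phi> y))"
    "\<bar>LINT y|Y. weighted C g y * indicator E (\<phi> y)\<bar> \<le> (LINT x:E|X. m x)"
proof -
  have [measurable]: "g \<in> borel_measurable Y" "m \<in> borel_measurable X" using d by (auto simp: dominated_def)
  have mi: "set_integrable X E m" and m0: "AE x in X. 0 \<le> m x" using d E by (auto simp: dominated_def)
  have fin: "(\<integral>\<^sup>+x. ennreal (m x) * indicator E x \<partial>X) = ennreal (LINT x:E|X. m x)"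
  proof -
    have "(\<integral>\<^sup>+x. ennreal (m x) * indicator E x \<partial>X) = (\<integral>\<^sup>+x. ennreal (indicator E x *\<^sub>R m x) \<partial>X)"
      by (intro nn_integral_cong) (auto simp: indicator_def)
    also have "\<dots> = ennreal (LINT x:E|X. m x)"
      using mi m0 unfolding set_integrable_def set_lebesgue_integral_def
      by (intro nn_integral_eq_integral) (auto elim: eventually_mono)
    finally show ?thesis .
  qed
  have eq: "(\<integral>\<^sup>+y. ennreal (norm (weighted C g y * indicator E (\<phi> y))) \<partial>Y) = (\<integral>\<^sup>+y. ennreal \<bar>weighted C g y\<bar> * indicator E (\<phi> y) \<partial>Y)"
    by (intro nn_integral_cong) (auto simp: indicator_def)
  have le: "(\<integral>\<^sup>+y. ennreal (norm (weighted C g y * indicator E (\<phi> y))) \<partial>Y) \<le> ennreal (LINT x:E|X. m x)"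
    unfolding eq fin[symmetric] by (rule weighted_bound[OF C E(1) d])
  show int: "integrable Y (\<lambda>y. weighted C g y * indicator E (\<phi> y))"
    using le by (intro integrableI_bounded) (auto intro: le_less_trans[OF _ ennreal_less_top])
  have "ennreal \<bar>LINT y|Y. weighted C g y * indicator E (\<phi> y)\<bar> \<le> ennreal (LINT x:E|X. m x)"
    using integral_norm_bound_ennreal[OF int] le by simp
  moreover have "0 \<le> (LINT x:E|X. m x)"
    unfolding set_lebesgue_integral_def using m0 by (intro integral_nonneg_AE) (auto elim: eventually_mono)
  ultimately show "\<bar>LINT y|Y. weighted C g y * indicator E (\<phi> y)\<bar> \<le> (LINT x:E|X. m x)"
    by (simp add: ennreal_le_iff)
qed

definition pull_avg :: "'y set \<Rightarrow> nat \<Rightarrow> 'x \<Rightarrow> ('y \<Rightarrow> real) \<Rightarrow> real" where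
  "pull_avg C k x g = (1 / measure X (atom X A k x)) * (LINT y|Y. weighted C g y * indicator (atom X A k x) (\<phi> y))"

lemma atom_cases:
  obtains "measure X (atom X A k x) = 0" | "emeasure X (atom X A k x) < \<infinity>"
  by (cases "emeasure X (atom X A k x) = \<infinity>") (auto simp: measure_def less_top)

lemma pull_avg_bound:
  assumes C: "C \<in> sets Y" and x: "x \<in> space X" and d: "dominated g m"
  shows "\<bar>pull_avg C k x g\<bar> \<le> cell_avg X A k m x"
proof (cases rule: atom_cases[of k x])
  case 2
  show ?thesis unfolding pull_avg_def cell_avg_eq[OF A_sets x] abs_mult
    using weighted_integrable(2)[OF C atom_sets[OF A_sets] 2 d] by (intro mult_mono) auto
qed (use x in \<open>simp add: pull_avg_def cell_avg_eq[OF A_sets x]\<close>)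

lemma weighted_linear: "weighted C (\<lambda>y. a * g1 y + b * g2 y) y = a * weighted C g1 y + b * weighted C g2 y"
  by (simp add: weighted_def algebra_simps)

lemma pull_avg_linear:
  assumes C: "C \<in> sets Y" and d: "dominated g1 m1" "dominated g2 m2"
  shows "pull_avg C k x (\<lambda>y. a * g1 y + b * g2 y) = a * pull_avg C k x g1 + b * pull_avg C k x g2"
proof (cases rule: atom_cases[of k x])
  case 2
  note i = weighted_integrable(1)[OF C atom_sets[OF A_sets] 2]
  show ?thesis unfolding pull_avg_def weighted_linear using i[OF d(1)] i[OF d(2)]
    by (simp add: algebra_simps)
qed (simp add: pull_avg_def)

lemma pull_avg_cong:
  assumes C: "C \<in> sets Y" and g: "g1 \<in> borel_measurable Y" "g2 \<in> borel_measurable Y" "AE y in Y. g1 y = g2 y"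
  shows "pull_avg C k x g1 = pull_avg C k x g2"
proof -
  have [measurable]: "atom X A k x \<in> sets X" using A_sets by (rule atom_sets)
  have "(LINT y|Y. weighted C g1 y * indicator (atom X A k x) (\<phi> y)) = (LINT y|Y. weighted C g2 y * indicator (atom X A k x) (\<phi> y))"
    using g C by (intro integral_cong_AE) (auto elim!: eventually_mono simp: weighted_def)
  then show ?thesis by (simp add: pull_avg_def)
qed

text \<open>The conditional expectation, given \<open>\<phi>\<close>, of \<open>\<psi>\<close> on \<open>C\<close>, as a function on \<open>X\<close>.\<close>

definition cond_on :: "'y set \<Rightarrow> ('y \<Rightarrow> ennreal) \<Rightarrow> 'x \<Rightarrow> ennreal" where
  "cond_on C \<psi> x = ennreal (weight C x) * marginal (\<lambda>y. indicator C y * \<psi> y) x"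

lemma cond_on_measurable [measurable]: "cond_on C \<psi> \<in> borel_measurable X"
  unfolding cond_on_def[abs_def] by measurable

lemma cond_on_integral:
  assumes [measurable]: "C \<in> sets Y" "\<psi> \<in> borel_measurable Y" "f \<in> borel_measurable X"
  shows "(\<integral>\<^sup>+y. indicator C y * cond_on C \<psi> (\<phi> y) * f (\<phi> y) \<partial>Y) = (\<integral>\<^sup>+y. indicator C y * \<psi> y * f (\<phi> y) \<partial>Y)"
proof -
  have "(\<integral>\<^sup>+y. indicator C y * (cond_on C \<psi> (\<phi> y) * f (\<phi> y)) \<partial>Y) = (\<integral>\<^sup>+x. marginal (indicator C) x * (cond_on C \<psi> x * f x) \<partial>X)"
    by (rule marginal_integral) auto
  also have "\<dots> = (\<integral>\<^sup>+x. marginal (\<lambda>y. indicator C y * \<psi> y) x * (if marginal (indicator C) x = 0 then 0 else f x) \<partial>X)"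
  proof (rule nn_integral_cong_AE)
    show "AE x in X. marginal (indicator C) x * (cond_on C \<psi> x * f x) = marginal (\<lambda>y. indicator C y * \<psi> y) x * (if marginal (indicator C) x = 0 then 0 else f x)"
      using marginal_indicator_finite[OF \<open>C \<in> sets Y\<close>]
    proof eventually_elim
      case (elim x)
      show ?case
      proof (cases "marginal (indicator C) x = 0")
        case False
        have "marginal (indicator C) x * (cond_on C \<psi> x * f x) = (marginal (indicator C) x * ennreal (weight C x)) * (marginal (\<lambda>y. indicator C y * \<psi> y) x * f x)"
          by (simp add: cond_on_def mult_ac)
        then show ?thesis using weight_cancel(2)[OF False elim] False by simp
      qed simp
    qed
  qed
  also have "\<dots> = (\<integral>\<^sup>+y. indicator C y * \<psi> y * (if marginal (indicator C) (\<phi> y) = 0 then 0 else f (\<phi> y)) \<partial>Y)"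
    by (rule marginal_integral[symmetric]) auto
  also have "\<dots> = (\<integral>\<^sup>+y. indicator C y * \<psi> y * f (\<phi> y) \<partial>Y)"
    using marginal_indicator_pos[OF \<open>C \<in> sets Y\<close>]
    by (intro nn_integral_cong_AE) (auto elim!: eventually_mono simp: indicator_def)
  finally show ?thesis by (simp add: mult.assoc)
qed

lemma cond_on_weighted:
  assumes [measurable]: "C \<in> sets Y" "E \<in> sets X" "g \<in> borel_measurable Y"
  shows "(\<integral>\<^sup>+x. cond_on C (\<lambda>y. ennreal (g y)) x * indicator E x \<partial>X) = (\<integral>\<^sup>+y. ennreal (weighted C g y) * indicator E (\<phi> y) \<partial>Y)"
proof -
  have "(\<integral>\<^sup>+x. marginal (\<lambda>y. indicator C y * ennreal (g y)) x * (ennreal (weight C x) * indicator E x) \<partial>X) =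
    (\<integral>\<^sup>+y. indicator C y * ennreal (g y) * (ennreal (weight C (\<phi> y)) * indicator E (\<phi> y)) \<partial>Y)"
    by (rule marginal_integral[symmetric]) auto
  also have "\<dots> = (\<integral>\<^sup>+y. ennreal (weighted C g y) * indicator E (\<phi> y) \<partial>Y)"
    by (intro nn_integral_cong) (auto simp: weighted_def indicator_def ennreal_mult''[symmetric] weight_nonneg mult.commute)
  finally show ?thesis by (simp add: cond_on_def mult_ac)
qed

definition cond_real :: "'y set \<Rightarrow> ('y \<Rightarrow> real) \<Rightarrow> 'x \<Rightarrow> real" where
  "cond_real C g x = enn2real (cond_on C (\<lambda>y. ennreal (g y)) x) - enn2real (cond_on C (\<lambda>y. ennreal (- g y)) x)"

lemma cond_on_set_integrable:
  assumes C[measurable]: "C \<in> sets Y" and E[measurable]: "E \<in> sets X" "emeasure X E < \<infinity>" and d: "dominated g m"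
    and h: "h = g \<or> h = (\<lambda>y. - g y)"
  shows "set_integrable X E (\<lambda>x. enn2real (cond_on C (\<lambda>y. ennreal (h y)) x))"
    "(LINT x:E|X. enn2real (cond_on C (\<lambda>y. ennreal (h y)) x)) = enn2real (\<integral>\<^sup>+y. ennreal (weighted C h y) * indicator E (\<phi> y) \<partial>Y)"
proof -
  have [measurable]: "g \<in> borel_measurable Y" "m \<in> borel_measurable X" using d by (auto simp: dominated_def)
  have hm[measurable]: "h \<in> borel_measurable Y" using h by auto
  have eq: "(\<integral>\<^sup>+x. cond_on C (\<lambda>y. ennreal (h y)) x * indicator E x \<partial>X) = (\<integral>\<^sup>+y. ennreal (weighted C h y) * indicator E (\<phi> y) \<partial>Y)"
    by (rule cond_on_weighted) auto
  also have "\<dots> \<le> (\<integral>\<^sup>+y. ennreal \<bar>weighted C g y\<bar> * indicator E (\<phi> y) \<partial>Y)"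
    using h by (intro nn_integral_mono mult_right_mono ennreal_leI) (auto simp: weighted_def)
  also have "\<dots> < \<infinity>"
  proof -
    have "(\<integral>\<^sup>+y. ennreal \<bar>weighted C g y\<bar> * indicator E (\<phi> y) \<partial>Y) = (\<integral>\<^sup>+y. ennreal (norm (weighted C g y * indicator E (\<phi> y))) \<partial>Y)"
      by (intro nn_integral_cong) (auto simp: indicator_def)
    then show ?thesis using weighted_integrable(1)[OF C E d] by (simp add: integrable_iff_bounded)
  qed
  finally have fin: "(\<integral>\<^sup>+x. cond_on C (\<lambda>y. ennreal (h y)) x * indicator E x \<partial>X) < \<infinity>" .
  have ae: "AE x in X. cond_on C (\<lambda>y. ennreal (h y)) x * indicator E x \<noteq> \<infinity>"
    using fin by (intro nn_integral_PInf_AE) auto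
  have eq2: "(\<integral>\<^sup>+x. ennreal (indicator E x *\<^sub>R enn2real (cond_on C (\<lambda>y. ennreal (h y)) x)) \<partial>X) =
    (\<integral>\<^sup>+x. cond_on C (\<lambda>y. ennreal (h y)) x * indicator E x \<partial>X)"
    using ae by (intro nn_integral_cong_AE) (auto elim!: eventually_mono simp: indicator_def less_top split: if_splits)
  show "set_integrable X E (\<lambda>x. enn2real (cond_on C (\<lambda>y. ennreal (h y)) x))"
    unfolding set_integrable_def using fin eq2 by (intro integrableI_nonneg) auto
  show "(LINT x:E|X. enn2real (cond_on C (\<lambda>y. ennreal (h y)) x)) = enn2real (\<integral>\<^sup>+y. ennreal (weighted C h y) * indicator E (\<phi> y) \<partial>Y)"
  proof -
    have "(LINT x:E|X. enn2real (cond_on C (\<lambda>y. ennreal (h y)) x)) =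
      enn2real (\<integral>\<^sup>+x. ennreal (indicator E x *\<^sub>R enn2real (cond_on C (\<lambda>y. ennreal (h y)) x)) \<partial>X)"
      unfolding set_lebesgue_integral_def by (rule integral_eq_nn_integral) auto
    then show ?thesis by (simp only: eq2 eq)
  qed
qed

text \<open>
  The averages are those of the function \<open>cond_real C g\<close> over the cells in \<open>X\<close>, to which differentiation
  on \<open>X\<close> applies.
\<close>

lemma pull_avg_tendsto:
  assumes C[measurable]: "C \<in> sets Y" and d: "dominated g m"
  shows "AE x in X. (\<lambda>k. pull_avg C k x g) \<longlonglongrightarrow> cond_real C g x"
proof -
  note si = cond_on_set_integrable[OF C _ _ d]
  have gm[measurable]: "g \<in> borel_measurable Y" using d by (auto simp: dominated_def)
  have "AE x in X. (\<lambda>k. cell_avg X A k (cond_real C g) x) \<longlonglongrightarrow> cond_real C g x"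
    unfolding cond_real_def[abs_def]
    by (intro Lebesgue_differentiation_local[OF sfX denseA] set_integral_diff(1) si) auto
  then show ?thesis using AE_space
  proof eventually_elim
    case (elim x)
    have "pull_avg C k x g = cell_avg X A k (cond_real C g) x" for k
    proof (cases rule: atom_cases[of k x])
      case 2
      let ?E = "atom X A k x"
      have E[measurable]: "?E \<in> sets X" using A_sets by (rule atom_sets)
      have neg: "weighted C (\<lambda>y. - g y) y = - weighted C g y" for y by (simp add: weighted_def)
      have "(LINT y|Y. weighted C g y * indicator ?E (\<phi> y)) =
        enn2real (\<integral>\<^sup>+y. ennreal (weighted C g y * indicator ?E (\<phi> y)) \<partial>Y) - enn2real (\<integral>\<^sup>+y. ennreal (- (weighted C g y * indicator ?E (\<phi> y))) \<partial>Y)"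
        using weighted_integrable(1)[OF C E 2 d] by (rule real_lebesgue_integral_def)
      also have "\<dots> = (LINT x:?E|X. enn2real (cond_on C (\<lambda>y. ennreal (g y)) x)) - (LINT x:?E|X. enn2real (cond_on C (\<lambda>y. ennreal (- g y)) x))"
        unfolding si(2)[OF E 2 disjI1[OF refl]] si(2)[OF E 2 disjI2[OF refl]] neg
        by (intro arg_cong2[where f="(-)"] arg_cong[where f=enn2real] nn_integral_cong) (auto simp: indicator_def)
      also have "\<dots> = (LINT x:?E|X. cond_real C g x)"
        unfolding cond_real_def by (rule set_integral_diff(2)[symmetric]) (intro si E 2; simp)+
      finally show ?thesis using elim(2) by (simp add: pull_avg_def cell_avg_eq[OF A_sets])
    qed (use elim(2) in \<open>simp add: pull_avg_def cell_avg_eq[OF A_sets]\<close>)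
    then show ?case using elim(1) by simp
  qed
qed

end

lemma measurable_pair_count_space:
  fixes f :: "'c::countable \<Rightarrow> 'a \<Rightarrow> 'b"
  assumes "\<And>c. f c \<in> measurable M K"
  shows "(\<lambda>(x, c). f c x) \<in> measurable (M \<Otimes>\<^sub>M count_space UNIV) K"
proof -
  have "(\<lambda>p. f (snd p) (fst p)) \<in> measurable (M \<Otimes>\<^sub>M count_space UNIV) K"
    using assms by (intro measurable_compose_countable[of "\<lambda>c p. f c (fst p)" _ K snd]) auto
  then show ?thesis by (simp add: case_prod_unfold)
qed

context measure_preserving
begin

text \<open>
  The \<open>\<sigma>\<close>-algebra generated by \<open>\<phi>\<close> and the first \<open>j\<close> sets of the sequence on \<open>Y\<close>; \<open>code j y\<close>
  records which of these sets contain \<open>y\<close>.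
\<close>

definition code :: "nat \<Rightarrow> 'y \<Rightarrow> bool list" where
  "code j y = map (\<lambda>i. y \<in> B i) [0..<j]"

definition code_set :: "nat \<Rightarrow> bool list \<Rightarrow> 'y set" where
  "code_set j c = {y \<in> space Y. code j y = c}"

definition F :: "nat \<Rightarrow> 'y measure" where
  "F j = vimage_algebra (space Y) (\<lambda>y. (\<phi> y, code j y)) (X \<Otimes>\<^sub>M count_space UNIV)"

lemma code_set_sets [measurable]: "code_set j c \<in> sets Y"
proof (cases "length c = j")
  case True
  have "code_set j c = {y \<in> space Y. \<forall>i\<in>{..<j}. (y \<in> B i) = c ! i}"
    using True by (auto simp: code_set_def code_def list_eq_iff_nth_eq)
  also have "\<dots> \<in> sets Y" by measurable
  finally show ?thesis .
next
  case False
  then have "code_set j c = {}" by (auto simp: code_set_def code_def)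
  then show ?thesis by simp
qed

lemma code_measurable [measurable]: "code j \<in> measurable Y (count_space UNIV)"
  unfolding measurable_count_space_eq2_countable
proof (intro conjI ballI)
  show "code j -` {c} \<inter> space Y \<in> sets Y" for c
    using code_set_sets[of j c] by (simp add: code_set_def vimage_def Int_def conj_commute)
qed simp

lemma pair_measurable [measurable]: "(\<lambda>y. (\<phi> y, code j y)) \<in> measurable Y (X \<Otimes>\<^sub>M count_space UNIV)"
  by measurable

lemma space_F [simp]: "space (F j) = space Y" by (simp add: F_def)

lemma sets_F: "sets (F j) = {(\<lambda>y. (\<phi> y, code j y)) -` T \<inter> space Y | T. T \<in> sets (X \<Otimes>\<^sub>M count_space UNIV)}"
  unfolding F_def by (rule sets_vimage_algebra2) (auto simp: space_pair_measure \<phi>_space)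

lemma F_subalgebra: "subalgebra Y (F j)"
  unfolding subalgebra_def using measurable_sets[OF pair_measurable] by (auto simp: sets_F)

lemma pair_F: "(\<lambda>y. (\<phi> y, code j y)) \<in> measurable (F j) (X \<Otimes>\<^sub>M count_space UNIV)"
  unfolding F_def by (rule measurable_vimage_algebra1) (auto simp: space_pair_measure \<phi>_space)

lemma F_mono: "i \<le> j \<Longrightarrow> sets (F i) \<subseteq> sets (F j)"
proof
  fix S assume ij: "i \<le> j" and "S \<in> sets (F i)"
  then obtain T where T: "T \<in> sets (X \<Otimes>\<^sub>M count_space UNIV)" "S = (\<lambda>y. (\<phi> y, code i y)) -` T \<inter> space Y"
    by (auto simp: sets_F)
  have "code i y = take i (code j y)" for y using ij by (simp add: code_def take_map)
  then have "(\<lambda>y. (\<phi> y, code i y)) = (\<lambda>(x, c). (x, take i c)) \<circ> (\<lambda>y. (\<phi> y, code j y))" by (auto simp: fun_eq_iff)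
  moreover have "(\<lambda>(x, c). (x, take i c)) \<in> measurable (X \<Otimes>\<^sub>M count_space UNIV) (X \<Otimes>\<^sub>M count_space (UNIV :: bool list set))"
    by measurable
  ultimately have "(\<lambda>y. (\<phi> y, code i y)) \<in> measurable (F j) (X \<Otimes>\<^sub>M count_space UNIV)"
    using pair_F[of j] by (simp add: measurable_comp)
  from measurable_sets[OF this T(1)] T(2) show "S \<in> sets (F j)" by simp
qed

lemma F_sigma_finite: "sigma_finite_subalgebra Y (F j)"
  unfolding sigma_finite_subalgebra_def
proof (intro conjI F_subalgebra)
  obtain S :: "nat \<Rightarrow> 'x set" where S: "range S \<subseteq> sets X" "(\<Union>i. S i) = space X" "\<And>i. emeasure X (S i) \<noteq> \<infinity>"
    using X.sigma_finite by metis
  have \<phi>F: "\<phi> \<in> measurable (F j) X" using measurable_compose[OF pair_F measurable_fst] by simp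
  have SF: "\<phi> -` S i \<inter> space Y \<in> sets (F j)" for i using measurable_sets[OF \<phi>F, of "S i"] S by auto
  show "sigma_finite_measure (restr_to_subalg Y (F j))"
  proof
    show "\<exists>C. countable C \<and> C \<subseteq> sets (restr_to_subalg Y (F j)) \<and> \<Union>C = space (restr_to_subalg Y (F j)) \<and>
      (\<forall>a\<in>C. emeasure (restr_to_subalg Y (F j)) a \<noteq> \<infinity>)"
    proof (intro exI[of _ "range (\<lambda>i. \<phi> -` S i \<inter> space Y)"] conjI ballI)
      show "range (\<lambda>i. \<phi> -` S i \<inter> space Y) \<subseteq> sets (restr_to_subalg Y (F j))"
        using SF by (auto simp: sets_restr_to_subalg[OF F_subalgebra])
      show "\<Union>(range (\<lambda>i. \<phi> -` S i \<inter> space Y)) = space (restr_to_subalg Y (F j))"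
      proof -
        have "\<exists>i. \<phi> y \<in> S i" if "y \<in> space Y" for y using \<phi>_space[OF that] unfolding S(2)[symmetric] by simp
        then show ?thesis by (auto simp: space_restr_to_subalg)
      qed
      fix a assume "a \<in> range (\<lambda>i. \<phi> -` S i \<inter> space Y)"
      then obtain i where i: "a = \<phi> -` S i \<inter> space Y" by auto
      have "emeasure Y a = emeasure X (S i)"
        using emeasure_distr[OF \<phi>, of "S i"] S i by (auto simp: distr)
      then show "emeasure (restr_to_subalg Y (F j)) a \<noteq> \<infinity>"
        using S(3)[of i] SF[of i] i by (simp add: emeasure_restr_to_subalg[OF F_subalgebra])
    qed auto
  qed
qed

text \<open>
  On each of the finitely many sets of constant code, conditioning on \<open>F j\<close> is conditioning
  on \<open>\<phi>\<close>.
\<close>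

lemma cond_exp_eq_cond_on:
  assumes [measurable]: "\<psi> \<in> borel_measurable Y"
  shows "AE y in Y. nn_cond_exp Y (F j) \<psi> y = cond_on (code_set j (code j y)) \<psi> (\<phi> y)"
proof -
  interpret sigma_finite_subalgebra Y "F j" by (rule F_sigma_finite)
  define V where "V y = cond_on (code_set j (code j y)) \<psi> (\<phi> y)" for y
  have "(\<lambda>(x, c). cond_on (code_set j c) \<psi> x) \<in> borel_measurable (X \<Otimes>\<^sub>M count_space UNIV)"
    by (rule measurable_pair_count_space) auto
  from measurable_compose[OF pair_F this] have VF: "V \<in> borel_measurable (F j)" by (simp add: V_def[abs_def])
  have [measurable]: "V \<in> borel_measurable Y" using measurable_from_subalg[OF F_subalgebra VF] .
  have fin: "finite {c :: bool list. length c = j}" using finite_lists_length_eq[of "UNIV :: bool set" j] by simp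
  have one: "(\<Sum>c\<in>{c. length c = j}. indicator (code_set j c) y) = (1::ennreal)" if "y \<in> space Y" for y
  proof -
    have "indicator (code_set j c) y = (if c = code j y then 1 else 0 :: ennreal)" for c
      using that by (auto simp: code_set_def indicator_def)
    then show ?thesis using fin by (simp add: code_def)
  qed
  have "AE y in Y. V y = nn_cond_exp Y (F j) \<psi> y"
  proof (rule nn_cond_exp_charact[OF _ assms VF])
    fix S assume "S \<in> sets (F j)"
    then obtain T where T: "T \<in> sets (X \<Otimes>\<^sub>M count_space UNIV)" "S = (\<lambda>y. (\<phi> y, code j y)) -` T \<inter> space Y"
      by (auto simp: sets_F)
    define Tc where "Tc c = {x. (x, c) \<in> T}" for c
    have Tc[measurable]: "Tc c \<in> sets X" for c
      using sets_Pair2[OF T(1), of c] by (simp add: Tc_def vimage_def)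
    have ST: "indicator S y = (indicator (Tc (code j y)) (\<phi> y) :: ennreal)" if "y \<in> space Y" for y
      using that by (auto simp: T(2) Tc_def indicator_def)
    have split: "(\<integral>\<^sup>+y. g y * indicator S y \<partial>Y) = (\<Sum>c\<in>{c. length c = j}. \<integral>\<^sup>+y. indicator (code_set j c) y * g y * indicator (Tc c) (\<phi> y) \<partial>Y)"
      if [measurable]: "g \<in> borel_measurable Y" for g
    proof -
      have "(\<integral>\<^sup>+y. g y * indicator S y \<partial>Y) = (\<integral>\<^sup>+y. (\<Sum>c\<in>{c. length c = j}. indicator (code_set j c) y * g y * indicator (Tc c) (\<phi> y)) \<partial>Y)"
      proof (rule nn_integral_cong)
        fix y assume y: "y \<in> space Y"
        have "(\<Sum>c\<in>{c. length c = j}. indicator (code_set j c) y * g y * indicator (Tc c) (\<phi> y)) =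
          (\<Sum>c\<in>{c. length c = j}. indicator (code_set j c) y * (g y * indicator S y))"
          using ST[OF y] by (intro sum.cong) (auto simp: code_set_def indicator_def)
        then show "g y * indicator S y = (\<Sum>c\<in>{c. length c = j}. indicator (code_set j c) y * g y * indicator (Tc c) (\<phi> y))"
          using one[OF y] by (simp add: sum_distrib_right[symmetric])
      qed
      also have "\<dots> = (\<Sum>c\<in>{c. length c = j}. \<integral>\<^sup>+y. indicator (code_set j c) y * g y * indicator (Tc c) (\<phi> y) \<partial>Y)"
        by (rule nn_integral_sum) auto
      finally show ?thesis .
    qed
    have "(\<integral>\<^sup>+y. indicator (code_set j c) y * V y * indicator (Tc c) (\<phi> y) \<partial>Y) =
      (\<integral>\<^sup>+y. indicator (code_set j c) y * \<psi> y * indicator (Tc c) (\<phi> y) \<partial>Y)" for c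
    proof -
      have "(\<integral>\<^sup>+y. indicator (code_set j c) y * V y * indicator (Tc c) (\<phi> y) \<partial>Y) =
        (\<integral>\<^sup>+y. indicator (code_set j c) y * cond_on (code_set j c) \<psi> (\<phi> y) * indicator (Tc c) (\<phi> y) \<partial>Y)"
        by (intro nn_integral_cong) (auto simp: indicator_def V_def code_set_def)
      also have "\<dots> = (\<integral>\<^sup>+y. indicator (code_set j c) y * \<psi> y * indicator (Tc c) (\<phi> y) \<partial>Y)"
        by (rule cond_on_integral) auto
      finally show ?thesis .
    qed
    then show "(\<integral>\<^sup>+y\<in>S. \<psi> y \<partial>Y) = (\<integral>\<^sup>+y\<in>S. V y \<partial>Y)" by (simp add: split)
  qed
  then show ?thesis by eventually_elim (simp add: V_def)
qed

lemma real_cond_exp_eq: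
  assumes [measurable]: "g \<in> borel_measurable Y"
  shows "AE y in Y. real_cond_exp Y (F j) g y = cond_real (code_set j (code j y)) g (\<phi> y)"
  using cond_exp_eq_cond_on[of "\<lambda>y. ennreal (g y)" j] cond_exp_eq_cond_on[of "\<lambda>y. ennreal (- g y)" j]
  by (auto simp: real_cond_exp_def cond_real_def elim!: eventually_elim2)

text \<open>
  On the set where the conditional expectation of index \<open>k\<close> is the first large one, which belongs to
  \<open>F k\<close>, integrating the conditional expectation of \<open>|f|\<close> gives back the integral of \<open>|f|\<close>. The set \<open>B n\<close> belongs to
  \<open>F j\<close> for all \<open>j > n\<close> and is then reproduced almost everywhere.
\<close>

lemma averaging_cond_exp: "averaging Y B (\<lambda>j. real_cond_exp Y (F j))"
proof
  show "dense_sequence Y B" by (rule denseB)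
  show "real_cond_exp Y (F j) f \<in> borel_measurable Y" for j f by simp
  show "AE y in Y. real_cond_exp Y (F j) (\<lambda>y. a * f y + b * g y) y = a * real_cond_exp Y (F j) f y + b * real_cond_exp Y (F j) g y"
    if f: "integrable Y f" and g: "integrable Y g" for f g a b j
  proof -
    interpret sigma_finite_subalgebra Y "F j" by (rule F_sigma_finite)
    have "integrable Y (\<lambda>y. a * f y)" "integrable Y (\<lambda>y. b * g y)" using f g by auto
    from real_cond_exp_add[OF this] real_cond_exp_cmult[OF f, of a] real_cond_exp_cmult[OF g, of b]
    show ?thesis by eventually_elim simp
  qed
  show "AE y in Y. (\<lambda>j. real_cond_exp Y (F j) (indicator (B n)) y) \<longlonglongrightarrow> indicator (B n) y" if "emeasure Y (B n) < \<infinity>" for n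
  proof -
    have "AE y in Y. n < j \<longrightarrow> real_cond_exp Y (F j) (indicator (B n)) y = indicator (B n) y" for j
    proof (cases "n < j")
      case True
      interpret sigma_finite_subalgebra Y "F j" by (rule F_sigma_finite)
      have "(\<lambda>(x, c). if c ! n then 1 else 0 :: real) \<in> borel_measurable (X \<Otimes>\<^sub>M count_space (UNIV :: bool list set))"
        by (rule measurable_pair_count_space) auto
      from measurable_compose[OF pair_F this] have "(\<lambda>y. if code j y ! n then 1 else 0 :: real) \<in> borel_measurable (F j)" by simp
      moreover have "(\<lambda>y. if code j y ! n then 1 else 0 :: real) = indicator (B n)" using True by (auto simp: code_def indicator_def fun_eq_iff)
      ultimately have "AE y in Y. real_cond_exp Y (F j) (indicator (B n)) y = indicator (B n) y"
        using that by (intro real_cond_exp_F_meas) auto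
      then show ?thesis by eventually_elim simp
    qed simp
    then have "AE y in Y. \<forall>j. n < j \<longrightarrow> real_cond_exp Y (F j) (indicator (B n)) y = indicator (B n) y" by (simp add: AE_all_countable)
    then show ?thesis
      by eventually_elim (intro tendsto_eventually, auto simp: eventually_sequentially intro!: exI[of _ "Suc n"])
  qed
  fix f :: "'y \<Rightarrow> real" and l :: real assume f: "integrable Y f" and l: "0 < l"
  then have [measurable]: "f \<in> borel_measurable Y" by auto
  show "ennreal l * emeasure Y (\<Union>k. {y \<in> space Y. l < \<bar>real_cond_exp Y (F k) f y\<bar>}) \<le> (\<integral>\<^sup>+y. ennreal \<bar>f y\<bar> \<partial>Y)"
  proof (rule maximal_inequality[OF refl])
    fix k
    interpret sigma_finite_subalgebra Y "F k" by (rule F_sigma_finite)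
    let ?G = "\<lambda>k. {y \<in> space Y. l < \<bar>real_cond_exp Y (F k) f y\<bar>}"
    let ?D = "disjointed ?G k"
    have GF: "?G i \<in> sets (F k)" if "i \<le> k" for i
    proof -
      have "{y \<in> space (F i). l < \<bar>real_cond_exp Y (F i) f y\<bar>} \<in> sets (F i)" by measurable
      then show ?thesis using F_mono[OF that] by auto
    qed
    have D: "?D \<in> sets (F k)"
      unfolding disjointed_def by (intro sets.Diff sets.finite_UN GF) auto
    have DY[measurable]: "?D \<in> sets Y" using D F_subalgebra by (auto simp: subalgebra_def)
    have "ennreal l * emeasure Y ?D = (\<integral>\<^sup>+y. ennreal l * indicator ?D y \<partial>Y)" by (simp add: nn_integral_cmult)
    also have "\<dots> \<le> (\<integral>\<^sup>+y. indicator ?D y * nn_cond_exp Y (F k) (\<lambda>y. ennreal \<bar>f y\<bar>) y \<partial>Y)"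
    proof (rule nn_integral_mono_AE)
      show "AE y in Y. ennreal l * indicator ?D y \<le> indicator ?D y * nn_cond_exp Y (F k) (\<lambda>y. ennreal \<bar>f y\<bar>) y"
        using real_cond_exp_abs[OF \<open>f \<in> borel_measurable Y\<close>]
      proof eventually_elim
        case (elim y)
        show ?case
        proof (cases "y \<in> ?D")
          case True
          then have "ennreal l \<le> ennreal \<bar>real_cond_exp Y (F k) f y\<bar>" by (auto simp: disjointed_def intro!: ennreal_leI)
          also note elim
          finally show ?thesis using True by simp
        qed simp
      qed
    qed
    also have "\<dots> = (\<integral>\<^sup>+y. indicator ?D y * ennreal \<bar>f y\<bar> \<partial>Y)"
      using D by (intro nn_cond_exp_intg) auto
    also have "\<dots> = emeasure (density Y (\<lambda>y. ennreal \<bar>f y\<bar>)) ?D"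
      by (subst emeasure_density) (auto simp: mult.commute)
    finally show "ennreal l * emeasure Y ?D \<le> emeasure (density Y (\<lambda>y. ennreal \<bar>f y\<bar>)) ?D" .
  qed auto
qed

text \<open>
  The iterated generalised limit, first along the cells around \<open>\<phi> y\<close> and then along the sets of
  constant code around \<open>y\<close>: the inner one converges almost everywhere to the conditional
  expectation given \<open>F j\<close>, which converges to \<open>g\<close>; and it is linear and dominated at every
  single point.
\<close>

theorem linear_lifting:
  obtains \<Lambda> :: "'y \<Rightarrow> ('y \<Rightarrow> real) \<Rightarrow> real" where
    "\<And>y g1 g2 m1 m2 a b. y \<in> space Y \<Longrightarrow> dominated g1 m1 \<Longrightarrow> dominated g2 m2 \<Longrightarrow>
      Bseq (\<lambda>k. cell_avg X A k m1 (\<phi> y)) \<Longrightarrow> Bseq (\<lambda>k. cell_avg X A k m2 (\<phi> y)) \<Longrightarrow>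
      \<Lambda> y (\<lambda>z. a * g1 z + b * g2 z) = a * \<Lambda> y g1 + b * \<Lambda> y g2"
    "\<And>y g m c. y \<in> space Y \<Longrightarrow> dominated g m \<Longrightarrow> Bseq (\<lambda>k. cell_avg X A k m (\<phi> y)) \<Longrightarrow>
      (\<And>e. 0 < e \<Longrightarrow> eventually (\<lambda>k. cell_avg X A k m (\<phi> y) \<le> c + e) sequentially) \<Longrightarrow> \<bar>\<Lambda> y g\<bar> \<le> c"
    "\<And>y g1 g2. g1 \<in> borel_measurable Y \<Longrightarrow> g2 \<in> borel_measurable Y \<Longrightarrow> AE z in Y. g1 z = g2 z \<Longrightarrow> \<Lambda> y g1 = \<Lambda> y g2"
    "\<And>g m. integrable Y g \<Longrightarrow> dominated g m \<Longrightarrow> AE y in Y. \<Lambda> y g = g y"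
proof -
  obtain glim :: "(nat \<Rightarrow> real) \<Rightarrow> real" where
    lin: "\<And>s t a b. Bseq s \<Longrightarrow> Bseq t \<Longrightarrow> glim (\<lambda>n. a * s n + b * t n) = a * glim s + b * glim t"
    and bnd: "\<And>s c. Bseq s \<Longrightarrow> (\<And>e. 0 < e \<Longrightarrow> eventually (\<lambda>n. \<bar>s n\<bar> \<le> c + e) sequentially) \<Longrightarrow> \<bar>glim s\<bar> \<le> c"
    and lim: "\<And>s l. s \<longlonglongrightarrow> l \<Longrightarrow> glim s = l"
    using generalised_limit by blast
  define C where "C j y = code_set j (code j y)" for j y
  have C: "C j y \<in> sets Y" for j y by (simp add: C_def)
  \<comment> \<open>Boundedness of the averages of \<open>m\<close> around \<open>\<phi> y\<close> is all that the generalised limits need; it is a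
    condition at the single point \<open>y\<close>.\<close>
  define inner where "inner j y g = glim (\<lambda>k. pull_avg (C j y) k (\<phi> y) g)" for j y g
  define \<Lambda> where "\<Lambda> y g = glim (\<lambda>j. inner j y g)" for y g
  have le: "\<bar>pull_avg (C j y) k (\<phi> y) g\<bar> \<le> cell_avg X A k m (\<phi> y)" if "y \<in> space Y" "dominated g m" for j y k g m
    using that C \<phi>_space by (intro pull_avg_bound)
  have B1: "Bseq (\<lambda>k. pull_avg (C j y) k (\<phi> y) g)" if y: "y \<in> space Y" and d: "dominated g m" and B: "Bseq (\<lambda>k. cell_avg X A k m (\<phi> y))" for j y g m
  proof -
    obtain K where K: "\<And>k. \<bar>cell_avg X A k m (\<phi> y)\<bar> \<le> K" using B by (auto simp: Bseq_def)
    have "\<bar>pull_avg (C j y) k (\<phi> y) g\<bar> \<le> K" for k using le[OF y d, of j k] K[of k] by linarith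
    then show ?thesis by (intro BseqI'[of _ K]) simp
  qed
  have ib: "\<bar>inner j y g\<bar> \<le> c" if y: "y \<in> space Y" and d: "dominated g m" and B: "Bseq (\<lambda>k. cell_avg X A k m (\<phi> y))"
    and ev: "\<And>e. 0 < e \<Longrightarrow> eventually (\<lambda>k. cell_avg X A k m (\<phi> y) \<le> c + e) sequentially" for j y g m c
    unfolding inner_def
  proof (rule bnd[OF B1[OF y d B]])
    fix e :: real assume "0 < e"
    from ev[OF this] show "\<forall>\<^sub>F k in sequentially. \<bar>pull_avg (C j y) k (\<phi> y) g\<bar> \<le> c + e"
      by eventually_elim (use le[OF y d] in \<open>auto intro: order_trans\<close>)
  qed
  have B2: "Bseq (\<lambda>j. inner j y g)" if y: "y \<in> space Y" and d: "dominated g m" and B: "Bseq (\<lambda>k. cell_avg X A k m (\<phi> y))" for y g m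
  proof -
    obtain K where K: "\<And>k. \<bar>cell_avg X A k m (\<phi> y)\<bar> \<le> K" using B by (auto simp: Bseq_def)
    have "\<bar>inner j y g\<bar> \<le> K" for j
    proof (rule ib[OF y d B], rule always_eventually, rule allI)
      show "cell_avg X A k m (\<phi> y) \<le> K + e" if "0 < e" for k e using K[of k] that by linarith
    qed
    then show ?thesis by (intro BseqI'[of _ K]) simp
  qed
  show ?thesis
  proof (rule that[of \<Lambda>])
    fix y g1 g2 m1 m2 a b
    assume y: "y \<in> space Y" and d: "dominated g1 m1" "dominated g2 m2"
      and B: "Bseq (\<lambda>k. cell_avg X A k m1 (\<phi> y))" "Bseq (\<lambda>k. cell_avg X A k m2 (\<phi> y))"
    have "inner j y (\<lambda>z. a * g1 z + b * g2 z) = a * inner j y g1 + b * inner j y g2" for j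
      unfolding inner_def pull_avg_linear[OF C d] by (rule lin[OF B1[OF y d(1) B(1)] B1[OF y d(2) B(2)]])
    then show "\<Lambda> y (\<lambda>z. a * g1 z + b * g2 z) = a * \<Lambda> y g1 + b * \<Lambda> y g2"
      unfolding \<Lambda>_def by (simp add: lin[OF B2[OF y d(1) B(1)] B2[OF y d(2) B(2)]])
  next
    fix y g m c
    assume y: "y \<in> space Y" and d: "dominated g m" and B: "Bseq (\<lambda>k. cell_avg X A k m (\<phi> y))"
      and ev: "\<And>e. 0 < e \<Longrightarrow> eventually (\<lambda>k. cell_avg X A k m (\<phi> y) \<le> c + e) sequentially"
    show "\<bar>\<Lambda> y g\<bar> \<le> c"
      unfolding \<Lambda>_def
    proof (rule bnd[OF B2[OF y d B]])
      fix e :: real assume "0 < e"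
      then show "\<forall>\<^sub>F j in sequentially. \<bar>inner j y g\<bar> \<le> c + e"
        using ib[OF y d B ev] by (intro always_eventually allI) (simp add: add_increasing2)
    qed
  next
    fix y and g1 g2 :: "'y \<Rightarrow> real"
    assume "g1 \<in> borel_measurable Y" "g2 \<in> borel_measurable Y" "AE z in Y. g1 z = g2 z"
    from pull_avg_cong[OF C this] show "\<Lambda> y g1 = \<Lambda> y g2" by (simp add: \<Lambda>_def inner_def)
  next
    fix g m assume g: "integrable Y g" and d: "dominated g m"
    interpret averaging Y B "\<lambda>j. real_cond_exp Y (F j)" by (rule averaging_cond_exp)
    have gm: "g \<in> borel_measurable Y" using g by auto
    have "AE x in X. \<forall>c. (\<lambda>k. pull_avg (code_set j c) k x g) \<longlonglongrightarrow> cond_real (code_set j c) g x" for j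
      using pull_avg_tendsto[OF code_set_sets d] by (simp add: AE_all_countable)
    from AE_pull[OF this] have "AE y in Y. \<forall>j c. (\<lambda>k. pull_avg (code_set j c) k (\<phi> y) g) \<longlonglongrightarrow> cond_real (code_set j c) g (\<phi> y)"
      by (subst AE_all_countable) blast
    moreover have "AE y in Y. \<forall>j. real_cond_exp Y (F j) g y = cond_real (code_set j (code j y)) g (\<phi> y)"
      using real_cond_exp_eq[OF gm] by (simp add: AE_all_countable)
    ultimately show "AE y in Y. \<Lambda> y g = g y"
      using converges[OF g]
    proof eventually_elim
      case (elim y)
      have "inner j y g = real_cond_exp Y (F j) g y" for j
        unfolding inner_def C_def using elim(1,2) by (intro lim) auto
      then show ?case unfolding \<Lambda>_def using elim(3) by (simp add: lim)
    qed
  qed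
qed

end

section \<open>Extension of bounded functionals from a dense graph\<close>

context dual_module
begin

lemma DM_minus:
  assumes L: "L \<in> carrier DM" and "u \<in> carrier M" "v \<in> carrier M"
  shows "L (u \<ominus> v) = L u \<ominus>\<^bsub>Lp_space \<mu> 1\<^esub> L v"
proof -
  note lu = DM_linear[OF L assms(2) assms(2)] and lv = DM_linear[OF L assms(3) assms(3)]
  have "L (u \<ominus> v) = ae_map2 \<mu> (+) (L u) (ae_map2 \<mu> (*) (const_class \<mu> (-1)) (L v))"
    using assms DM_linear(2)[OF L assms(2), of "const_class \<mu> (-1) \<odot> v"] lv(3)[of "const_class \<mu> (-1)"] by (simp add: diff_conv)
  then show ?thesis
    using L1.smult_simps(6)[of "L v"] L1.V.minus_eq[of "L u" "L v"] lu lv smult_L1[OF Lp_set_ae_classes[OF lv(1)]] by simp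
qed

lemma DM_continuous:
  assumes L: "L \<in> carrier DM" and s: "\<And>n. s n \<in> carrier M" and z: "z \<in> carrier M" and "N.nconv s z"
  shows "L1.nconv (\<lambda>n. L (s n)) (L z)"
  unfolding L1.nconv_def
proof (rule L1.null_by_bound)
  show "0 \<le> nrm (Lp_space \<mu> 1) (L (s n) \<ominus>\<^bsub>Lp_space \<mu> 1\<^esub> L z)" for n by (simp add: Lp_norm_def)
  show "nrm (Lp_space \<mu> 1) (L (s n) \<ominus>\<^bsub>Lp_space \<mu> 1\<^esub> L z) \<le> nrm DM L * nrm M (s n \<ominus> z)" for n
    using DM_nrm(2)[OF L, of "s n \<ominus> z"] s z by (simp add: DM_minus[OF L s z])
  show "(\<lambda>n. nrm DM L * nrm M (s n \<ominus> z)) \<longlonglongrightarrow> 0"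
    using tendsto_mult_left[OF assms(4)[unfolded N.nconv_def], of "nrm DM L"] by simp
qed

lemma smult_nconv:
  assumes F: "F \<in> carrier (Linf \<mu>)" and s: "\<And>n. s n \<in> carrier M" and z: "z \<in> carrier M" and conv: "N.nconv s z"
  shows "N.nconv (\<lambda>n. F \<odot> s n) (F \<odot> z)"
proof -
  obtain c where c: "AE x in \<mu>. \<bar>ae_rep F x\<bar> \<le> c" using F by (auto simp: Linf_carrier_iff)
  have eq: "F \<odot> s n \<ominus> F \<odot> z = F \<odot> (s n \<ominus> z)" for n
    using F s z by (simp add: a_minus_def M.smult_r_distr M.smult_r_minus)
  show ?thesis unfolding N.nconv_def
  proof (rule N.null_by_bound)
    show "nrm (real_nspace \<mu> M) (F \<odot> s n \<ominus>\<^bsub>real_nspace \<mu> M\<^esub> F \<odot> z) \<le> \<bar>c\<bar> * nrm M (s n \<ominus> z)" for n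
      using nrm_smult_le[OF Linf_ae_classes[OF F] c, of "s n \<ominus> z"] s z by (simp add: eq)
    show "(\<lambda>n. \<bar>c\<bar> * nrm M (s n \<ominus> z)) \<longlonglongrightarrow> 0"
      using tendsto_mult_left[OF conv[unfolded N.nconv_def], of "\<bar>c\<bar>"] by simp
    show "0 \<le> nrm (real_nspace \<mu> M) (F \<odot> s n \<ominus>\<^bsub>real_nspace \<mu> M\<^esub> F \<odot> z)" for n
      using F s z by (intro N.nrm_nonneg) simp
  qed
qed

text \<open>
  The functional is obtained by closing a graph that is a submodule and carries a norm bound;
  the bound makes the closure single valued.
\<close>

lemma DM_extend:
  assumes \<Gamma>: "\<And>s G. (s, G) \<in> \<Gamma> \<Longrightarrow> s \<in> carrier M \<and> G \<in> Lp_set \<mu> 1"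
    and add: "\<And>s G s' G'. (s, G) \<in> \<Gamma> \<Longrightarrow> (s', G') \<in> \<Gamma> \<Longrightarrow> (s \<oplus> s', ae_map2 \<mu> (+) G G') \<in> \<Gamma>"
    and smult: "\<And>F s G. F \<in> carrier (Linf \<mu>) \<Longrightarrow> (s, G) \<in> \<Gamma> \<Longrightarrow> (F \<odot> s, ae_map2 \<mu> (*) F G) \<in> \<Gamma>"
    and bound: "\<And>s G. (s, G) \<in> \<Gamma> \<Longrightarrow> Lp_norm \<mu> 1 G \<le> K * nrm M s" and K: "0 \<le> K"
    and dense: "\<And>z. z \<in> carrier M \<Longrightarrow> \<exists>s. (\<forall>k. s k \<in> Domain \<Gamma>) \<and> N.nconv s z"
  obtains L where "L \<in> carrier DM" "\<And>s G. (s, G) \<in> \<Gamma> \<Longrightarrow> L s = G"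
proof -
  define app where "app z G \<longleftrightarrow> G \<in> Lp_set \<mu> 1 \<and> (\<exists>s g. (\<forall>k. (s k, g k) \<in> \<Gamma>) \<and> N.nconv s z \<and> L1.nconv g G)" for z G
  have ex: "\<exists>G. app z G" if z: "z \<in> carrier M" for z
  proof -
    obtain s where s: "\<And>k. s k \<in> Domain \<Gamma>" "N.nconv s z" using dense[OF z] by blast
    have "\<forall>k. \<exists>g. (s k, g) \<in> \<Gamma>" using s(1) by blast
    from choice[OF this] obtain g where g0: "\<forall>k. (s k, g k) \<in> \<Gamma>" ..
    then have g: "\<And>k. (s k, g k) \<in> \<Gamma>" by blast
    have c: "\<And>k. s k \<in> carrier M" "\<And>k. g k \<in> Lp_set \<mu> 1" using \<Gamma>[OF g] by auto
    have le: "nrm (Lp_space \<mu> 1) (g m \<ominus>\<^bsub>Lp_space \<mu> 1\<^esub> g n) \<le> K * nrm M (s m \<ominus> s n)" for m n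
    proof -
      have "(s m \<oplus> const_class \<mu> (-1) \<odot> s n, ae_map2 \<mu> (+) (g m) (ae_map2 \<mu> (*) (const_class \<mu> (-1)) (g n))) \<in> \<Gamma>"
        by (intro add smult g) simp
      moreover have "ae_map2 \<mu> (+) (g m) (ae_map2 \<mu> (*) (const_class \<mu> (-1)) (g n)) = g m \<ominus>\<^bsub>Lp_space \<mu> 1\<^esub> g n"
        using L1.smult_simps(6)[of "g n"] L1.V.minus_eq[of "g m" "g n"] c(2) smult_L1[OF Lp_set_ae_classes[OF c(2)[of n]]] by simp
      ultimately show ?thesis using bound c(1) by (simp add: diff_conv)
    qed
    have "\<exists>n0. \<forall>m\<ge>n0. \<forall>n\<ge>n0. nrm (Lp_space \<mu> 1) (g m \<ominus>\<^bsub>Lp_space \<mu> 1\<^esub> g n) < e" if e: "0 < e" for e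
    proof -
      have "0 < e / (K + 1)" using e K by simp
      then have "\<exists>n0. \<forall>m\<ge>n0. \<forall>n\<ge>n0. nrm M (s m \<ominus> s n) < e / (K + 1)"
        using N.nconv_cauchy[OF s(2), of "e / (K + 1)"] c z by simp
      then obtain n0 where n0: "\<And>m n. m \<ge> n0 \<Longrightarrow> n \<ge> n0 \<Longrightarrow> nrm M (s m \<ominus> s n) < e / (K + 1)" by blast
      have "nrm (Lp_space \<mu> 1) (g m \<ominus>\<^bsub>Lp_space \<mu> 1\<^esub> g n) < e" if "m \<ge> n0" "n \<ge> n0" for m n
      proof -
        have nn: "0 \<le> nrm M (s m \<ominus> s n)" using N.nrm_nonneg[of "s m \<ominus> s n"] c by simp
        have "K * nrm M (s m \<ominus> s n) \<le> (K + 1) * nrm M (s m \<ominus> s n)" using nn by (intro mult_right_mono) auto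
        also have "\<dots> < e" using n0[OF that] K by (simp add: field_simps)
        finally show ?thesis using le[of m n] by simp
      qed
      then show ?thesis by blast
    qed
    then obtain G where "G \<in> Lp_set \<mu> 1" "L1.nconv g G" by (rule L1_cauchy_limit[OF c(2)])
    then show ?thesis using g s(2) unfolding app_def by blast
  qed
  have app_add: "app (z \<oplus> z') (ae_map2 \<mu> (+) G G')" if a: "app z G" "app z' G'" and z: "z \<in> carrier M" "z' \<in> carrier M" for z z' G G'
  proof -
    obtain s g where s: "\<And>k. (s k, g k) \<in> \<Gamma>" "N.nconv s z" "L1.nconv g G" and G: "G \<in> Lp_set \<mu> 1" using a(1) unfolding app_def by blast
    obtain s' g' where s': "\<And>k. (s' k, g' k) \<in> \<Gamma>" "N.nconv s' z'" "L1.nconv g' G'" and G': "G' \<in> Lp_set \<mu> 1" using a(2) unfolding app_def by blast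
    have "N.nconv (\<lambda>k. s k \<oplus> s' k) (z \<oplus> z')"
      using N.nconv_add[OF s(2) s'(2)] \<Gamma>[OF s(1)] \<Gamma>[OF s'(1)] z by simp
    moreover have "L1.nconv (\<lambda>k. ae_map2 \<mu> (+) (g k) (g' k)) (ae_map2 \<mu> (+) G G')"
      using L1.nconv_add[OF s(3) s'(3)] \<Gamma>[OF s(1)] \<Gamma>[OF s'(1)] G G' by simp
    ultimately show ?thesis unfolding app_def using add[OF s(1) s'(1)] L1.V.a_closed[of G G'] G G'
      by (intro conjI exI[of _ "\<lambda>k. s k \<oplus> s' k"] exI[of _ "\<lambda>k. ae_map2 \<mu> (+) (g k) (g' k)"]) auto
  qed
  have app_smult: "app (F \<odot> z) (ae_map2 \<mu> (*) F G)" if a: "app z G" and F: "F \<in> carrier (Linf \<mu>)" and z: "z \<in> carrier M" for z F G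
  proof -
    obtain s g where s: "\<And>k. (s k, g k) \<in> \<Gamma>" "N.nconv s z" "L1.nconv g G" and G: "G \<in> Lp_set \<mu> 1" using a(1) unfolding app_def by blast
    have c: "\<And>k. s k \<in> carrier M" "\<And>k. g k \<in> Lp_set \<mu> 1" using \<Gamma>[OF s(1)] by auto
    show ?thesis unfolding app_def using smult[OF F s(1)] smult_nconv[OF F c(1) z s(2)] L1_conv_mult[OF F c(2) G s(3)] Linf_L1_closed[OF F G]
      by (intro conjI exI[of _ "\<lambda>k. F \<odot> s k"] exI[of _ "\<lambda>k. ae_map2 \<mu> (*) F (g k)"]) auto
  qed
  have app_bound: "Lp_norm \<mu> 1 G \<le> K * nrm M z" if a: "app z G" and z: "z \<in> carrier M" for z G
  proof -
    obtain s g where s: "\<And>k. (s k, g k) \<in> \<Gamma>" "N.nconv s z" "L1.nconv g G" and G: "G \<in> Lp_set \<mu> 1" using a(1) unfolding app_def by blast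
    have c: "\<And>k. s k \<in> carrier M" "\<And>k. g k \<in> Lp_set \<mu> 1" using \<Gamma>[OF s(1)] by auto
    have "Lp_norm \<mu> 1 G - K * nrm M z \<le> nrm (Lp_space \<mu> 1) (g k \<ominus>\<^bsub>Lp_space \<mu> 1\<^esub> G) + K * nrm M (s k \<ominus> z)" for k
    proof -
      have "K * nrm M (s k) \<le> K * (nrm M z + nrm M (s k \<ominus> z))"
        using N.nrm_reverse_triangle[of "s k" z] c z K by (intro mult_left_mono) auto
      then show ?thesis
        using L1.nrm_reverse_triangle[of "g k" G] bound[OF s(1)[of k]] c G by (simp add: distrib_left)
    qed
    moreover have "(\<lambda>k. nrm (Lp_space \<mu> 1) (g k \<ominus>\<^bsub>Lp_space \<mu> 1\<^esub> G) + K * nrm M (s k \<ominus> z)) \<longlonglongrightarrow> 0 + K * 0"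
      using s(2,3) unfolding N.nconv_def L1.nconv_def by (intro tendsto_intros) auto
    ultimately have "Lp_norm \<mu> 1 G - K * nrm M z \<le> 0 + K * 0" by (rule LIMSEQ_le_const[rotated, OF exI, OF allI, OF impI])
    then show ?thesis by simp
  qed
  have uniq: "G = G'" if a: "app z G" "app z G'" and z: "z \<in> carrier M" for z G G'
  proof -
    have G: "G \<in> Lp_set \<mu> 1" "G' \<in> Lp_set \<mu> 1" using a by (auto simp: app_def)
    have "app (z \<oplus> const_class \<mu> (-1) \<odot> z) (ae_map2 \<mu> (+) G (ae_map2 \<mu> (*) (const_class \<mu> (-1)) G'))"
      using a z by (intro app_add app_smult) auto
    moreover have "ae_map2 \<mu> (+) G (ae_map2 \<mu> (*) (const_class \<mu> (-1)) G') = G \<ominus>\<^bsub>Lp_space \<mu> 1\<^esub> G'"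
      using L1.smult_simps(6)[of G'] L1.V.minus_eq[of G G'] G smult_L1[OF Lp_set_ae_classes[OF G(2)]] by simp
    moreover have "z \<oplus> const_class \<mu> (-1) \<odot> z = \<zero>" using diff_conv[OF z z] N.diff_self[of z] z by simp
    ultimately have "app \<zero> (G \<ominus>\<^bsub>Lp_space \<mu> 1\<^esub> G')" by simp
    from app_bound[OF this] have "nrm (Lp_space \<mu> 1) (G \<ominus>\<^bsub>Lp_space \<mu> 1\<^esub> G') \<le> 0" using N.nrm_zero by simp
    then have "G \<ominus>\<^bsub>Lp_space \<mu> 1\<^esub> G' = \<zero>\<^bsub>Lp_space \<mu> 1\<^esub>"
      using L1.nrm_nonneg[of "G \<ominus>\<^bsub>Lp_space \<mu> 1\<^esub> G'"] G L1.diff_closed[of G G'] by (intro L1.nrm_zero_imp) auto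
    then show ?thesis using L1.diff_zero_eq[of G G'] G by simp
  qed
  define L where "L = (\<lambda>z\<in>carrier M. SOME G. app z G)"
  have Lapp: "app z (L z)" if "z \<in> carrier M" for z
    using someI_ex[OF ex[OF that]] that by (simp add: L_def)
  have Leq: "L z = G" if "app z G" "z \<in> carrier M" for z G using uniq[OF Lapp that(1)] that by simp
  have Ladd: "L (u \<oplus> v) = ae_map2 \<mu> (+) (L u) (L v)" if "u \<in> carrier M" "v \<in> carrier M" for u v
    using that by (intro Leq app_add Lapp) auto
  have Lsm: "L (F \<odot> v) = ae_map2 \<mu> (*) F (L v)" if "F \<in> carrier (Linf \<mu>)" "v \<in> carrier M" for F v
    using that by (intro Leq app_smult Lapp) auto
  have "L \<in> carrier DM"
  proof (subst DM_iff_bounded[OF _ Ladd Lsm])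
    show "L \<in> carrier M \<rightarrow>\<^sub>E Lp_set \<mu> 1" using Lapp by (auto simp: app_def L_def)
    show "\<exists>K. \<forall>v\<in>carrier M. Lp_norm \<mu> 1 (L v) \<le> K * nrm M v" using app_bound[OF Lapp] by blast
  qed auto
  moreover have "L s = G" if sG: "(s, G) \<in> \<Gamma>" for s G
  proof (rule Leq)
    have "N.nconv (\<lambda>_. s) s" "L1.nconv (\<lambda>_. G) G"
      using \<Gamma>[OF sG] N.diff_self[of s] N.nrm_zero L1.diff_self[of G] L1.nrm_zero by (auto simp: N.nconv_def L1.nconv_def)
    then show "app s G" unfolding app_def using sG \<Gamma>[OF sG] by (intro conjI exI[of _ "\<lambda>_. s"] exI[of _ "\<lambda>_. G"]) auto
  qed (use \<Gamma>[OF sG] in simp)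
  ultimately show ?thesis by (rule that)
qed

end

section \<open>Norms of combinations in the pullback and in the fibres\<close>

locale pullback_module = fibred_module X p M A + mp: measure_preserving X Y A B \<phi> + D: dual_module Y p P q
  for X :: "'x measure" and Y :: "'y measure" and p q :: real and M :: "('x, 'v) Lmodule" (structure) and A B and \<phi> :: "'y \<Rightarrow> 'x"
    and P :: "('y, 'w) Lmodule" +
  fixes \<phi>s :: "'v \<Rightarrow> 'w"
  assumes pullback: "is_pullback X Y \<phi> p M P \<phi>s"
begin

lemma \<phi>s_closed [simp, intro]: "v \<in> carrier M \<Longrightarrow> \<phi>s v \<in> carrier P"
  using pullback by (auto simp: is_pullback_def)

lemma \<phi>s_add: "u \<in> carrier M \<Longrightarrow> v \<in> carrier M \<Longrightarrow> \<phi>s (u \<oplus> v) = \<phi>s u \<oplus>\<^bsub>P\<^esub> \<phi>s v"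
  using pullback by (auto simp: is_pullback_def)

lemma \<phi>s_const: "v \<in> carrier M \<Longrightarrow> \<phi>s (const_class X c \<odot> v) = const_class Y c \<odot>\<^bsub>P\<^esub> \<phi>s v"
  using pullback by (auto simp: is_pullback_def)

lemma pn_\<phi>s: "v \<in> carrier M \<Longrightarrow> AE y in Y. D.pn (\<phi>s v) y = pn v (\<phi> y)"
proof -
  assume v: "v \<in> carrier M"
  have "(\<lambda>y. pn v (\<phi> y)) \<in> borel_measurable Y"
    using measurable_compose[OF mp.\<phi> pn_measurable[OF v]] .
  then have "AE y in Y. ae_rep (ae_class Y (\<lambda>y. pn v (\<phi> y))) y = pn v (\<phi> y)" by (rule AE_ae_rep_class)
  moreover have "pnorm P (\<phi>s v) = ae_class Y (\<lambda>y. pn v (\<phi> y))"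
    using pullback v by (simp add: is_pullback_def pn_def)
  ultimately show ?thesis by (simp add: D.pn_def)
qed

lemma \<phi>s_zero: "\<phi>s \<zero> = \<zero>\<^bsub>P\<^esub>"
  using \<phi>s_const[of "\<zero>" 0] N.smult_simps(5)[of "\<zero>"] D.N.smult_simps(5)[of "\<phi>s \<zero>"] by simp

abbreviation "fib y \<equiv> FB (\<phi> y)"
abbreviation "TV v y \<equiv> RV v (\<phi> y)"

lemma AE_TV_nrm:
  assumes v: "v \<in> carrier M"
  shows "AE y in Y. nrm (fib y) (TV v y) = pn v (\<phi> y)"
  using mp.AE_pull[OF AE_RV_nrm[OF v]] .

lemma AE_TV_zero: "AE y in Y. TV \<zero> y = \<zero>\<^bsub>fib y\<^esub>"
  using AE_TV_nrm[OF M.M.zero_closed] mp.AE_pull[OF pn_zero]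
  by eventually_elim (auto intro!: FB.nrm_zero_imp RV_carrier)

text \<open>
  \<open>t\<close> represents \<open>s\<close> if both have the same norms after every translation by a vector of \<open>M\<close>.
  Quantifying over the translations makes the notion stable under adding \<open>f \<phi>\<^sup>*u\<close>: replace
  \<open>f y\<close> by rational constants \<open>c\<close>, for which \<open>c u\<close> is absorbed into the translation.
\<close>

definition represents :: "('y \<Rightarrow> (nat \<Rightarrow> 'v) set) \<Rightarrow> 'w \<Rightarrow> bool" where
  "represents t s \<longleftrightarrow> s \<in> carrier P \<and> (\<forall>y. t y \<in> carrier (fib y)) \<and>
    (\<forall>v\<in>carrier M. AE y in Y. D.pn (s \<oplus>\<^bsub>P\<^esub> \<phi>s v) y = nrm (fib y) (t y \<oplus>\<^bsub>fib y\<^esub> TV v y))"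

lemma represents_zero: "represents (\<lambda>y. \<zero>\<^bsub>fib y\<^esub>) \<zero>\<^bsub>P\<^esub>"
  unfolding represents_def
proof (intro conjI ballI allI)
  fix v assume v: "v \<in> carrier M"
  show "AE y in Y. D.pn (\<zero>\<^bsub>P\<^esub> \<oplus>\<^bsub>P\<^esub> \<phi>s v) y = nrm (fib y) (\<zero>\<^bsub>fib y\<^esub> \<oplus>\<^bsub>fib y\<^esub> TV v y)"
    using pn_\<phi>s[OF v] AE_TV_nrm[OF v] by eventually_elim (use v in \<open>simp add: RV_carrier\<close>)
qed auto

text \<open>
  For a constant \<open>c\<close> in place of \<open>f\<close> the claim is the assumption for the translation by \<open>c u + v\<close>. On both
  sides the replacement costs at most \<open>|f y - c| |u|(\<phi> y)\<close>, and countably many constants come as close to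
  \<open>f y\<close> as desired.
\<close>

lemma represents_add:
  assumes r: "represents t s" and u: "u \<in> carrier M"
    and f: "f \<in> borel_measurable Y" "AE y in Y. \<bar>f y\<bar> \<le> c0"
  shows "represents (\<lambda>y. f y \<odot>\<^bsub>fib y\<^esub> TV u y \<oplus>\<^bsub>fib y\<^esub> t y) (ae_class Y f \<odot>\<^bsub>P\<^esub> \<phi>s u \<oplus>\<^bsub>P\<^esub> s)"
proof -
  have s: "s \<in> carrier P" and t: "t y \<in> carrier (fib y)" for y using r by (auto simp: represents_def)
  have F: "ae_class Y f \<in> carrier (Linf Y)" using f by (rule ae_class_Linf)
  have Fu: "ae_class Y f \<odot>\<^bsub>P\<^esub> \<phi>s u \<in> carrier P" using F u by simp
  let ?s = "ae_class Y f \<odot>\<^bsub>P\<^esub> \<phi>s u \<oplus>\<^bsub>P\<^esub> s" and ?t = "\<lambda>y. f y \<odot>\<^bsub>fib y\<^esub> TV u y \<oplus>\<^bsub>fib y\<^esub> t y"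
  have "AE y in Y. D.pn (?s \<oplus>\<^bsub>P\<^esub> \<phi>s v) y = nrm (fib y) (?t y \<oplus>\<^bsub>fib y\<^esub> TV v y)" if v: "v \<in> carrier M" for v
  proof -
    let ?v = "\<lambda>c. const_class X c \<odot> u \<oplus> v"
    have vc: "?v c \<in> carrier M" for c using u v by simp
    have cu: "const_class X c \<odot> u \<in> carrier M" for c using u by simp
    have 1: "AE y in Y. D.pn (s \<oplus>\<^bsub>P\<^esub> \<phi>s (?v c)) y = nrm (fib y) (t y \<oplus>\<^bsub>fib y\<^esub> (c \<odot>\<^bsub>fib y\<^esub> TV u y \<oplus>\<^bsub>fib y\<^esub> TV v y))" for c
    proof -
      have "AE y in Y. D.pn (s \<oplus>\<^bsub>P\<^esub> \<phi>s (?v c)) y = nrm (fib y) (t y \<oplus>\<^bsub>fib y\<^esub> TV (?v c) y)"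
        using r vc by (auto simp: represents_def)
      then show ?thesis using mp.AE_pull[OF AE_RV_add[OF cu[of c] v]] mp.AE_pull[OF AE_RV_scale[OF u]]
        by eventually_elim simp
    qed
    have 2: "AE y in Y. \<bar>D.pn (?s \<oplus>\<^bsub>P\<^esub> \<phi>s v) y - D.pn (s \<oplus>\<^bsub>P\<^esub> \<phi>s (?v c)) y\<bar> \<le> \<bar>f y - c\<bar> * pn u (\<phi> y)" for c
    proof -
      let ?a = "ae_class Y f \<odot>\<^bsub>P\<^esub> \<phi>s u" and ?b = "const_class Y c \<odot>\<^bsub>P\<^esub> \<phi>s u" and ?w = "s \<oplus>\<^bsub>P\<^esub> \<phi>s v"
      have c: "?b \<in> carrier P" "?w \<in> carrier P" "\<phi>s v \<in> carrier P" using u v s by auto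
      have e1: "?s \<oplus>\<^bsub>P\<^esub> \<phi>s v = ?a \<oplus>\<^bsub>P\<^esub> ?w" using D.M.M.a_assoc[OF Fu s c(3)] .
      have e2: "s \<oplus>\<^bsub>P\<^esub> \<phi>s (?v c) = ?b \<oplus>\<^bsub>P\<^esub> ?w"
        using u v cu D.M.M.a_lcomm[OF s c(1) c(3)] by (simp add: \<phi>s_add \<phi>s_const)
      have "(?a \<oplus>\<^bsub>P\<^esub> ?w) \<ominus>\<^bsub>P\<^esub> (?b \<oplus>\<^bsub>P\<^esub> ?w) = (?a \<ominus>\<^bsub>P\<^esub> ?b) \<oplus>\<^bsub>P\<^esub> (?w \<ominus>\<^bsub>P\<^esub> ?w)"
        using D.N.diff_add[of ?a ?w ?b ?w] Fu c by simp
      also have "\<dots> = ?a \<ominus>\<^bsub>P\<^esub> ?b" using D.N.diff_self[of ?w] Fu c by simp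
      also have "\<dots> = ?a \<oplus>\<^bsub>P\<^esub> const_class Y (-c) \<odot>\<^bsub>P\<^esub> \<phi>s u"
        using D.diff_conv[OF Fu c(1)] D.N.smult_simps(3)[of "\<phi>s u" "-1" c] u by simp
      also have "\<dots> = ae_class Y (\<lambda>y. f y - c) \<odot>\<^bsub>P\<^esub> \<phi>s u"
        using D.M.smult_l_distr[OF F, of "const_class Y (-c)" "\<phi>s u"] f(1) u by (simp add: ae_map2_ae_class)
      finally have e3: "(?s \<oplus>\<^bsub>P\<^esub> \<phi>s v) \<ominus>\<^bsub>P\<^esub> (s \<oplus>\<^bsub>P\<^esub> \<phi>s (?v c)) = ae_class Y (\<lambda>y. f y - c) \<odot>\<^bsub>P\<^esub> \<phi>s u"
        unfolding e1 e2 .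
      have "AE y in Y. \<bar>f y - c\<bar> \<le> c0 + \<bar>c\<bar>" using f(2) by eventually_elim auto
      from D.pn_smult_class[OF _ this, of "\<phi>s u"] f(1) u
      have "AE y in Y. D.pn (ae_class Y (\<lambda>y. f y - c) \<odot>\<^bsub>P\<^esub> \<phi>s u) y = \<bar>f y - c\<bar> * D.pn (\<phi>s u) y" by simp
      moreover have "AE y in Y. \<bar>D.pn (?s \<oplus>\<^bsub>P\<^esub> \<phi>s v) y - D.pn (s \<oplus>\<^bsub>P\<^esub> \<phi>s (?v c)) y\<bar> \<le> D.pn ((?s \<oplus>\<^bsub>P\<^esub> \<phi>s v) \<ominus>\<^bsub>P\<^esub> (s \<oplus>\<^bsub>P\<^esub> \<phi>s (?v c))) y"
        using Fu s v vc by (intro D.pn_reverse_triangle) auto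
      ultimately show ?thesis using pn_\<phi>s[OF u] unfolding e3 by eventually_elim simp
    qed
    have "AE y in Y. \<forall>c\<in>\<rat>. D.pn (s \<oplus>\<^bsub>P\<^esub> \<phi>s (?v c)) y = nrm (fib y) (t y \<oplus>\<^bsub>fib y\<^esub> (c \<odot>\<^bsub>fib y\<^esub> TV u y \<oplus>\<^bsub>fib y\<^esub> TV v y)) \<and>
      \<bar>D.pn (?s \<oplus>\<^bsub>P\<^esub> \<phi>s v) y - D.pn (s \<oplus>\<^bsub>P\<^esub> \<phi>s (?v c)) y\<bar> \<le> \<bar>f y - c\<bar> * pn u (\<phi> y)"
      using 1 2 by (intro AE_ball_countable' eventually_conj) (auto simp: countable_rat)
    then show ?thesis using AE_TV_nrm[OF u]
    proof eventually_elim
      case (elim y)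
      have tv: "TV u y \<in> carrier (fib y)" "TV v y \<in> carrier (fib y)" using u v RV_carrier by auto
      have fibre: "\<bar>nrm (fib y) (?t y \<oplus>\<^bsub>fib y\<^esub> TV v y) - nrm (fib y) (t y \<oplus>\<^bsub>fib y\<^esub> (c \<odot>\<^bsub>fib y\<^esub> TV u y \<oplus>\<^bsub>fib y\<^esub> TV v y))\<bar> \<le> \<bar>f y - c\<bar> * pn u (\<phi> y)" for c
      proof -
        let ?a = "f y \<odot>\<^bsub>fib y\<^esub> TV u y" and ?b = "c \<odot>\<^bsub>fib y\<^esub> TV u y" and ?w = "t y \<oplus>\<^bsub>fib y\<^esub> TV v y"
        have c: "?a \<in> carrier (fib y)" "?b \<in> carrier (fib y)" "?w \<in> carrier (fib y)" using tv t by auto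
        have e1: "?t y \<oplus>\<^bsub>fib y\<^esub> TV v y = ?a \<oplus>\<^bsub>fib y\<^esub> ?w" using FB.V.a_assoc[OF c(1) t tv(2)] .
        have e2: "t y \<oplus>\<^bsub>fib y\<^esub> (?b \<oplus>\<^bsub>fib y\<^esub> TV v y) = ?b \<oplus>\<^bsub>fib y\<^esub> ?w" using FB.V.a_lcomm[OF t c(2) tv(2)] .
        have "(?a \<oplus>\<^bsub>fib y\<^esub> ?w) \<ominus>\<^bsub>fib y\<^esub> (?b \<oplus>\<^bsub>fib y\<^esub> ?w) = (f y - c) \<odot>\<^bsub>fib y\<^esub> TV u y"
          using FB.diff_add[OF c(1,3) c(2,3)] FB.diff_self[OF c(3)] FB.diff_scale_left[OF tv(1)] tv by simp
        then show ?thesis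
          using FB.nrm_reverse_triangle[of "?a \<oplus>\<^bsub>fib y\<^esub> ?w" "\<phi> y" "?b \<oplus>\<^bsub>fib y\<^esub> ?w"] c tv elim(2) unfolding e1 e2
          by (simp add: FB.nrm_scale)
      qed
      let ?d = "\<bar>D.pn (?s \<oplus>\<^bsub>P\<^esub> \<phi>s v) y - nrm (fib y) (?t y \<oplus>\<^bsub>fib y\<^esub> TV v y)\<bar>"
      have le: "?d \<le> 2 * (\<bar>f y - c\<bar> * pn u (\<phi> y))" if "c \<in> \<rat>" for c
        using elim(1)[rule_format, OF that] fibre[of c] by linarith
      have pn0: "0 \<le> pn u (\<phi> y)" using elim(2) FB.nrm_nonneg[OF tv(1)] by simp
      have "?d \<le> 0"
      proof (rule field_le_epsilon)
        fix e :: real assume e: "0 < e"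
        let ?r = "e / (2 * (pn u (\<phi> y) + 1))"
        have r: "0 < ?r" using e pn0 by simp
        then obtain c where c: "c \<in> \<rat>" "f y < c" "c < f y + ?r" using Rats_dense_in_real[of "f y" "f y + ?r"] by auto
        have "?d \<le> 2 * (?r * pn u (\<phi> y))"
          using le[OF c(1)] c pn0 mult_right_mono[of "\<bar>f y - c\<bar>" ?r "pn u (\<phi> y)"] by linarith
        also have "\<dots> \<le> e" using e pn0 by (simp add: field_simps)
        finally show "?d \<le> 0 + e" by simp
      qed
      then show ?case by simp
    qed
  qed
  then show ?thesis unfolding represents_def using s Fu t u by (auto intro!: FB.V.a_closed FB.smult_closed' RV_carrier)
qed

lemma represents_nrm:
  assumes r: "represents t s"
  shows "AE y in Y. D.pn s y = nrm (fib y) (t y)"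
proof -
  have s: "s \<in> carrier P" and t: "t y \<in> carrier (fib y)" for y using r by (auto simp: represents_def)
  have "AE y in Y. D.pn (s \<oplus>\<^bsub>P\<^esub> \<phi>s \<zero>) y = nrm (fib y) (t y \<oplus>\<^bsub>fib y\<^esub> TV \<zero> y)"
    using r by (auto simp: represents_def)
  then show ?thesis using AE_TV_zero by eventually_elim (use s t in \<open>simp add: \<phi>s_zero\<close>)
qed

definition fcomb :: "nat \<Rightarrow> (nat \<Rightarrow> 'y \<Rightarrow> real) \<Rightarrow> (nat \<Rightarrow> 'v) \<Rightarrow> 'y \<Rightarrow> (nat \<Rightarrow> 'v) set" where
  "fcomb n f u y = (\<Oplus>\<^bsub>fib y\<^esub>i\<in>{..<n}. f i y \<odot>\<^bsub>fib y\<^esub> TV (u i) y)"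

definition pcomb :: "nat \<Rightarrow> (nat \<Rightarrow> 'y \<Rightarrow> real) \<Rightarrow> (nat \<Rightarrow> 'v) \<Rightarrow> 'w" where
  "pcomb n f u = (\<Oplus>\<^bsub>P\<^esub>i\<in>{..<n}. ae_class Y (f i) \<odot>\<^bsub>P\<^esub> \<phi>s (u i))"

definition coeffs :: "nat \<Rightarrow> (nat \<Rightarrow> 'y \<Rightarrow> real) \<Rightarrow> (nat \<Rightarrow> 'v) \<Rightarrow> bool" where
  "coeffs n f u \<longleftrightarrow> (\<forall>i<n. f i \<in> borel_measurable Y \<and> u i \<in> carrier M)"

text \<open>
  Only bounded coefficients act on the pullback; test combinations admit arbitrary measurable ones.
\<close>

definition bounded_coeffs :: "nat \<Rightarrow> (nat \<Rightarrow> 'y \<Rightarrow> real) \<Rightarrow> (nat \<Rightarrow> 'v) \<Rightarrow> bool" where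
  "bounded_coeffs n f u \<longleftrightarrow> coeffs n f u \<and> (\<forall>i<n. \<exists>c. AE y in Y. \<bar>f i y\<bar> \<le> c)"

lemma bounded_coeffs_Linf: "bounded_coeffs n f u \<Longrightarrow> i < n \<Longrightarrow> ae_class Y (f i) \<in> carrier (Linf Y)"
  by (auto simp: bounded_coeffs_def coeffs_def Linf_def)

lemma bounded_coeffsD: "bounded_coeffs n f u \<Longrightarrow> i < n \<Longrightarrow> f i \<in> borel_measurable Y \<and> u i \<in> carrier M"
  by (auto simp: bounded_coeffs_def coeffs_def)

lemma fcomb_Suc:
  "coeffs (Suc n) f u \<Longrightarrow> fcomb (Suc n) f u y = f n y \<odot>\<^bsub>fib y\<^esub> TV (u n) y \<oplus>\<^bsub>fib y\<^esub> fcomb n f u y"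
  unfolding fcomb_def by (rule FB.V.finsum_lessThan_Suc) (auto simp: coeffs_def RV_carrier)

lemma pcomb_Suc:
  "bounded_coeffs (Suc n) f u \<Longrightarrow> pcomb (Suc n) f u = ae_class Y (f n) \<odot>\<^bsub>P\<^esub> \<phi>s (u n) \<oplus>\<^bsub>P\<^esub> pcomb n f u"
  unfolding pcomb_def
proof (rule D.M.finsum_lessThan_Suc)
  fix i assume b: "bounded_coeffs (Suc n) f u" "i < Suc n"
  then show "ae_class Y (f i) \<odot>\<^bsub>P\<^esub> \<phi>s (u i) \<in> carrier P"
    using bounded_coeffs_Linf[OF b] bounded_coeffsD[OF b] by simp
qed

lemma fcomb_carrier: "coeffs n f u \<Longrightarrow> fcomb n f u y \<in> carrier (fib y)"
  unfolding fcomb_def by (rule FB.V.finsum_closed) (auto simp: coeffs_def RV_carrier)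

lemma represents_comb: "bounded_coeffs n f u \<Longrightarrow> represents (fcomb n f u) (pcomb n f u)"
proof (induction n)
  case 0
  have "fcomb 0 f u = (\<lambda>y. \<zero>\<^bsub>fib y\<^esub>)" "pcomb 0 f u = \<zero>\<^bsub>P\<^esub>" by (auto simp: fcomb_def pcomb_def)
  then show ?case using represents_zero by simp
next
  case (Suc n)
  then obtain c where c: "AE y in Y. \<bar>f n y\<bar> \<le> c" by (auto simp: bounded_coeffs_def)
  have "bounded_coeffs n f u" using Suc by (auto simp: bounded_coeffs_def coeffs_def)
  then have "represents (fcomb n f u) (pcomb n f u)" by (rule Suc)
  from represents_add[OF this _ _ c, of "u n"] Suc.prems
  have "represents (\<lambda>y. f n y \<odot>\<^bsub>fib y\<^esub> TV (u n) y \<oplus>\<^bsub>fib y\<^esub> fcomb n f u y) (pcomb (Suc n) f u)"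
    by (simp add: pcomb_Suc bounded_coeffs_def coeffs_def)
  moreover have "fcomb (Suc n) f u = (\<lambda>y. f n y \<odot>\<^bsub>fib y\<^esub> TV (u n) y \<oplus>\<^bsub>fib y\<^esub> fcomb n f u y)"
    using Suc.prems by (auto simp: fcomb_Suc bounded_coeffs_def fun_eq_iff)
  ultimately show ?case by simp
qed

lemma pcomb_carrier: "bounded_coeffs n f u \<Longrightarrow> pcomb n f u \<in> carrier P"
  using represents_comb by (auto simp: represents_def)

lemma AE_pcomb_nrm: "bounded_coeffs n f u \<Longrightarrow> AE y in Y. D.pn (pcomb n f u) y = nrm (fib y) (fcomb n f u y)"
  by (rule represents_nrm[OF represents_comb])

lemma pcomb_append:
  assumes b: "bounded_coeffs n f u" "bounded_coeffs m g v"
  defines "h \<equiv> \<lambda>i. if i < n then f i else g (i - n)" and "w \<equiv> \<lambda>i. if i < n then u i else v (i - n)"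
  shows "bounded_coeffs (n + m) h w" "pcomb (n + m) h w = pcomb n f u \<oplus>\<^bsub>P\<^esub> pcomb m g v"
    "fcomb (n + m) h w y = fcomb n f u y \<oplus>\<^bsub>fib y\<^esub> fcomb m g v y"
proof -
  have lt: "i - n < m" if "i < n + m" "\<not> i < n" for i using that by auto
  show "bounded_coeffs (n + m) h w"
    using b lt unfolding bounded_coeffs_def coeffs_def h_def w_def by (auto split: if_splits)
  have cl: "ae_class Y (f i) \<odot>\<^bsub>P\<^esub> \<phi>s (u i) \<in> carrier P" if "bounded_coeffs n f u" "i < n" for n f u i
    using bounded_coeffs_Linf[OF that] bounded_coeffsD[OF that] by simp
  have "pcomb (n + m) h w = (\<Oplus>\<^bsub>P\<^esub>i\<in>{..<n + m}. if i < n then ae_class Y (f i) \<odot>\<^bsub>P\<^esub> \<phi>s (u i) else ae_class Y (g (i - n)) \<odot>\<^bsub>P\<^esub> \<phi>s (v (i - n)))"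
    unfolding pcomb_def using cl b lt by (intro D.M.M.finsum_cong') (auto simp: h_def w_def)
  then show "pcomb (n + m) h w = pcomb n f u \<oplus>\<^bsub>P\<^esub> pcomb m g v"
    unfolding pcomb_def using cl b by (subst (asm) D.M.M.finsum_append) auto
  have cl': "f i y \<odot>\<^bsub>fib y\<^esub> TV (u i) y \<in> carrier (fib y)" if "bounded_coeffs n f u" "i < n" for n f u i
    using that by (auto simp: bounded_coeffs_def coeffs_def RV_carrier)
  have "fcomb (n + m) h w y = (\<Oplus>\<^bsub>fib y\<^esub>i\<in>{..<n + m}. if i < n then f i y \<odot>\<^bsub>fib y\<^esub> TV (u i) y else g (i - n) y \<odot>\<^bsub>fib y\<^esub> TV (v (i - n)) y)"
    unfolding fcomb_def using cl' b lt by (intro FB.V.finsum_cong') (auto simp: h_def w_def)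
  then show "fcomb (n + m) h w y = fcomb n f u y \<oplus>\<^bsub>fib y\<^esub> fcomb m g v y"
    unfolding fcomb_def using cl' b by (subst (asm) FB.V.finsum_append) auto
qed

lemma fcomb_scale:
  assumes "coeffs n f u"
  shows "fcomb n (\<lambda>i y. g y * f i y) u y = g y \<odot>\<^bsub>fib y\<^esub> fcomb n f u y"
proof -
  have tv: "i < n \<Longrightarrow> TV (u i) y \<in> carrier (fib y)" for i using assms by (auto simp: coeffs_def RV_carrier)
  have "g y \<odot>\<^bsub>fib y\<^esub> fcomb n f u y = (\<Oplus>\<^bsub>fib y\<^esub>i\<in>{..<n}. g y \<odot>\<^bsub>fib y\<^esub> (f i y \<odot>\<^bsub>fib y\<^esub> TV (u i) y))"
    unfolding fcomb_def using tv by (intro FB.V.finsum_smult_ldistr) auto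
  also have "\<dots> = fcomb n (\<lambda>i y. g y * f i y) u y"
    unfolding fcomb_def using tv by (intro FB.V.finsum_cong') (auto simp: FB.smult_simps)
  finally show ?thesis by simp
qed

lemma pcomb_smult:
  assumes b: "bounded_coeffs n f u" and G: "G \<in> carrier (Linf Y)"
  shows "bounded_coeffs n (\<lambda>i y. ae_rep G y * f i y) u" "pcomb n (\<lambda>i y. ae_rep G y * f i y) u = G \<odot>\<^bsub>P\<^esub> pcomb n f u"
proof -
  have Gc: "G \<in> ae_classes Y" using G by (rule Linf_ae_classes)
  obtain c where c: "AE y in Y. \<bar>ae_rep G y\<bar> \<le> c" using G by (auto simp: Linf_carrier_iff)
  have fi: "f i \<in> borel_measurable Y" "u i \<in> carrier M" "\<exists>c. AE y in Y. \<bar>f i y\<bar> \<le> c" if "i < n" for i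
    using that b by (auto simp: bounded_coeffs_def coeffs_def)
  show b': "bounded_coeffs n (\<lambda>i y. ae_rep G y * f i y) u"
    unfolding bounded_coeffs_def coeffs_def
  proof (intro conjI allI impI)
    fix i assume i: "i < n"
    show "(\<lambda>y. ae_rep G y * f i y) \<in> borel_measurable Y" "u i \<in> carrier M" using fi[OF i] Gc by auto
    obtain c' where "AE y in Y. \<bar>f i y\<bar> \<le> c'" using fi[OF i] by blast
    with c have "AE y in Y. \<bar>ae_rep G y * f i y\<bar> \<le> \<bar>c\<bar> * c'"
      by eventually_elim (auto simp: abs_mult intro!: mult_mono)
    then show "\<exists>c. AE y in Y. \<bar>ae_rep G y * f i y\<bar> \<le> c" by blast
  qed
  have FL: "ae_class Y (f i) \<in> carrier (Linf Y)" if "i < n" for i using fi[OF that] by (auto intro: ae_class_Linf)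
  have "G \<odot>\<^bsub>P\<^esub> pcomb n f u = (\<Oplus>\<^bsub>P\<^esub>i\<in>{..<n}. G \<odot>\<^bsub>P\<^esub> (ae_class Y (f i) \<odot>\<^bsub>P\<^esub> \<phi>s (u i)))"
    unfolding pcomb_def using FL fi G by (intro D.M.finsum_smult_ldistr) auto
  also have "\<dots> = pcomb n (\<lambda>i y. ae_rep G y * f i y) u"
    unfolding pcomb_def
  proof (rule D.M.M.finsum_cong')
    fix i assume "i \<in> {..<n}"
    then have i: "i < n" by simp
    have "ae_class Y (\<lambda>y. ae_rep G y * f i y) = G \<otimes>\<^bsub>Linf Y\<^esub> ae_class Y (f i)"
      using ae_map2_ae_class(2)[of "ae_rep G" Y "f i"] Gc fi[OF i] by (simp add: ae_class_ae_rep)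
    then show "G \<odot>\<^bsub>P\<^esub> (ae_class Y (f i) \<odot>\<^bsub>P\<^esub> \<phi>s (u i)) = ae_class Y (\<lambda>y. ae_rep G y * f i y) \<odot>\<^bsub>P\<^esub> \<phi>s (u i)"
      using D.M.smult_assoc1[OF G FL[OF i], of "\<phi>s (u i)"] fi[OF i] by simp
  next
    show "(\<lambda>i. ae_class Y (\<lambda>y. ae_rep G y * f i y) \<odot>\<^bsub>P\<^esub> \<phi>s (u i)) \<in> {..<n} \<rightarrow> carrier P"
      using bounded_coeffs_Linf[OF b'] bounded_coeffsD[OF b'] by auto
  qed simp
  finally show "pcomb n (\<lambda>i y. ae_rep G y * f i y) u = G \<odot>\<^bsub>P\<^esub> pcomb n f u" by simp
qed

lemma pcomb_single:
  assumes "G \<in> carrier (Linf Y)" "v \<in> carrier M"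
  shows "bounded_coeffs 1 (\<lambda>_. ae_rep G) (\<lambda>_. v)" "pcomb 1 (\<lambda>_. ae_rep G) (\<lambda>_. v) = G \<odot>\<^bsub>P\<^esub> \<phi>s v"
proof -
  show b: "bounded_coeffs 1 (\<lambda>_. ae_rep G) (\<lambda>_. v)" using assms by (auto simp: bounded_coeffs_def coeffs_def Linf_carrier_iff)
  show "pcomb 1 (\<lambda>_. ae_rep G) (\<lambda>_. v) = G \<odot>\<^bsub>P\<^esub> \<phi>s v"
    using pcomb_Suc[of 0 "\<lambda>_. ae_rep G" "\<lambda>_. v"] b assms Linf_ae_classes[of G] by (simp add: ae_class_ae_rep pcomb_def)
qed

lemma span_pcomb: "z \<in> lin_span (Linf Y) P (\<phi>s ` carrier M) \<Longrightarrow> \<exists>n f u. bounded_coeffs n f u \<and> z = pcomb n f u"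
proof -
  have "lin_span (Linf Y) P (\<phi>s ` carrier M) \<subseteq> {z. \<exists>n f u. bounded_coeffs n f u \<and> z = pcomb n f u}"
  proof (rule D.M.lin_span_least)
    show "\<zero>\<^bsub>P\<^esub> \<in> {z. \<exists>n f u. bounded_coeffs n f u \<and> z = pcomb n f u}"
      by (auto simp: bounded_coeffs_def coeffs_def pcomb_def intro!: exI[of _ 0])
    show "G \<odot>\<^bsub>P\<^esub> z \<in> {z. \<exists>n f u. bounded_coeffs n f u \<and> z = pcomb n f u}" if "G \<in> carrier (Linf Y)" "z \<in> \<phi>s ` carrier M" for G z
      using that pcomb_single by fastforce
    show "x \<oplus>\<^bsub>P\<^esub> y \<in> {z. \<exists>n f u. bounded_coeffs n f u \<and> z = pcomb n f u}"
      if xy: "x \<in> {z. \<exists>n f u. bounded_coeffs n f u \<and> z = pcomb n f u}" "y \<in> {z. \<exists>n f u. bounded_coeffs n f u \<and> z = pcomb n f u}" for x y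
    proof -
      obtain n f u m g v where "bounded_coeffs n f u" "x = pcomb n f u" "bounded_coeffs m g v" "y = pcomb m g v"
        using xy by auto
      then show ?thesis using pcomb_append(1,2)[of n f u m g v] by (intro CollectI) (metis (no_types, lifting))
    qed
  qed auto
  then show "z \<in> lin_span (Linf Y) P (\<phi>s ` carrier M) \<Longrightarrow> \<exists>n f u. bounded_coeffs n f u \<and> z = pcomb n f u" by blast
qed

lemma pcomb_dense:
  assumes z: "z \<in> carrier P"
  obtains s where "\<And>k. \<exists>n f u. bounded_coeffs n f u \<and> s k = pcomb n f u" "D.N.nconv s z"
proof -
  have sub: "\<phi>s ` carrier M \<subseteq> carrier P" by auto
  have "z \<in> ntopology (real_nspace Y P) closure_of lin_span (Linf Y) P (\<phi>s ` carrier M)"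
    using pullback z by (simp add: is_pullback_def generates_def)
  moreover have "lin_span (Linf Y) P (\<phi>s ` carrier M) \<subseteq> carrier (real_nspace Y P)" using D.M.lin_span_carrier[OF sub] by simp
  ultimately obtain s where s: "\<And>k. s k \<in> lin_span (Linf Y) P (\<phi>s ` carrier M)" "(\<lambda>k. nrm (real_nspace Y P) (s k \<ominus>\<^bsub>real_nspace Y P\<^esub> z)) \<longlonglongrightarrow> 0"
    by (rule D.N.closure_of_sequence) blast
  show ?thesis by (rule that[of s]) (use s span_pcomb in \<open>auto simp: D.N.nconv_def\<close>)
qed

end

section \<open>Weak sections of the bundle\<close>

lemma null_sets_iff_AE: "(\<exists>N\<in>null_sets \<mu>. \<forall>x\<in>space \<mu> - N. Q x) \<longleftrightarrow> (AE x in \<mu>. Q x)"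
  unfolding eventually_ae_filter by blast

text \<open>
  Pairings of sections with test vectors are measurable only after removal of a null set.
\<close>

definition ae_measurable :: "'a measure \<Rightarrow> ('a \<Rightarrow> real) \<Rightarrow> bool" where
  "ae_measurable \<mu> h \<longleftrightarrow> (\<exists>g\<in>borel_measurable \<mu>. AE x in \<mu>. g x = h x)"

lemma ae_measurable_restrict:
  "(\<exists>N\<in>null_sets \<mu>. h \<in> borel_measurable (restrict_space \<mu> (space \<mu> - N))) \<longleftrightarrow> ae_measurable \<mu> h"
proof
  assume "\<exists>N\<in>null_sets \<mu>. h \<in> borel_measurable (restrict_space \<mu> (space \<mu> - N))"
  then obtain N where N: "N \<in> null_sets \<mu>" "h \<in> borel_measurable (restrict_space \<mu> (space \<mu> - N))" by blast
  have "space \<mu> - N \<in> sets \<mu>" using N(1) by (intro sets.Diff sets.top null_setsD2)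
  then have "(space \<mu> - N) \<inter> space \<mu> \<in> sets \<mu>" by (rule sets.Int) (rule sets.top)
  from borel_measurable_restrict_space_iff[OF this, of h] N(2)
  have "(\<lambda>x. indicator (space \<mu> - N) x *\<^sub>R h x) \<in> borel_measurable \<mu>" by simp
  moreover have "AE x in \<mu>. indicator (space \<mu> - N) x *\<^sub>R h x = h x"
    using AE_space AE_not_in[OF N(1)] by eventually_elim (simp add: indicator_def)
  ultimately show "ae_measurable \<mu> h" unfolding ae_measurable_def by (intro bexI[of _ "\<lambda>x. indicator (space \<mu> - N) x *\<^sub>R h x"])
next
  assume "ae_measurable \<mu> h"
  then obtain g where g: "g \<in> borel_measurable \<mu>" "AE x in \<mu>. g x = h x" by (auto simp: ae_measurable_def)
  then obtain N where N: "N \<in> null_sets \<mu>" "\<forall>x\<in>space \<mu> - N. g x = h x" unfolding null_sets_iff_AE[symmetric] by blast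
  have "h \<in> borel_measurable (restrict_space \<mu> (space \<mu> - N)) \<longleftrightarrow> g \<in> borel_measurable (restrict_space \<mu> (space \<mu> - N))"
    using N(2) by (intro measurable_cong) (auto simp: space_restrict_space)
  then show "\<exists>N\<in>null_sets \<mu>. h \<in> borel_measurable (restrict_space \<mu> (space \<mu> - N))"
    using N(1) measurable_restrict_space1[OF g(1)] by blast
qed

lemma ae_measurable_borel: "h \<in> borel_measurable \<mu> \<Longrightarrow> ae_measurable \<mu> h"
  unfolding ae_measurable_def by (intro bexI[of _ h]) auto

lemma ae_measurable_cong: "ae_measurable \<mu> h \<Longrightarrow> AE x in \<mu>. h x = k x \<Longrightarrow> ae_measurable \<mu> k"
proof -
  assume "ae_measurable \<mu> h" and hk: "AE x in \<mu>. h x = k x"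
  then obtain g where g: "g \<in> borel_measurable \<mu>" "AE x in \<mu>. g x = h x" by (auto simp: ae_measurable_def)
  from g(2) hk have "AE x in \<mu>. g x = k x" by eventually_elim simp
  with g(1) show ?thesis by (auto simp: ae_measurable_def)
qed

lemma ae_measurable_comb:
  assumes "ae_measurable \<mu> h" "ae_measurable \<mu> k"
  shows "ae_measurable \<mu> (\<lambda>x. h x + k x)" "ae_measurable \<mu> (\<lambda>x. h x * k x)"
proof -
  obtain g where g: "g \<in> borel_measurable \<mu>" "AE x in \<mu>. g x = h x" using assms(1) by (auto simp: ae_measurable_def)
  obtain g' where g': "g' \<in> borel_measurable \<mu>" "AE x in \<mu>. g' x = k x" using assms(2) by (auto simp: ae_measurable_def)
  note [measurable] = g(1) g'(1)
  from g(2) g'(2) have "AE x in \<mu>. g x + g' x = h x + k x" "AE x in \<mu>. g x * g' x = h x * k x"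
    by (eventually_elim, simp)+
  then show "ae_measurable \<mu> (\<lambda>x. h x + k x)" "ae_measurable \<mu> (\<lambda>x. h x * k x)"
    by (auto intro!: ae_measurable_cong[OF ae_measurable_borel])
qed

lemma ae_measurable_sum: "(\<And>i. i < n \<Longrightarrow> ae_measurable \<mu> (h i)) \<Longrightarrow> ae_measurable \<mu> (\<lambda>x. \<Sum>i<(n::nat). h i x)"
  by (induction n) (auto simp: ae_measurable_borel intro: ae_measurable_comb(1))

lemma ae_measurable_class:
  assumes "ae_measurable \<mu> h"
  shows "ae_class \<mu> h \<in> ae_classes \<mu>" "AE x in \<mu>. ae_rep (ae_class \<mu> h) x = h x"
proof -
  obtain g where g: "g \<in> borel_measurable \<mu>" "AE x in \<mu>. g x = h x" using assms by (auto simp: ae_measurable_def)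
  have eq: "ae_class \<mu> h = ae_class \<mu> g" using g(2) by (intro ae_class_eqI) (auto elim: eventually_mono)
  show "ae_class \<mu> h \<in> ae_classes \<mu>" unfolding eq using g(1) by simp
  show "AE x in \<mu>. ae_rep (ae_class \<mu> h) x = h x" unfolding eq using AE_ae_rep_class[OF g(1)] g(2) by eventually_elim simp
qed

lemma (in normed_space) topological_dual_comb:
  assumes l: "l \<in> topological_dual V" and m: "m \<in> topological_dual V"
  shows "(\<lambda>b\<in>carrier V. l b + m b) \<in> topological_dual V" "(\<lambda>b\<in>carrier V. c * l b) \<in> topological_dual V"
proof -
  have ts: "topspace (ntopology V) = carrier V" by (simp add: ntopology_def)
  have cl: "continuous_map (ntopology V) euclideanreal l" "continuous_map (ntopology V) euclideanreal m"
    using l m by (auto simp: topological_dual_def)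
  have "continuous_map (ntopology V) euclideanreal (\<lambda>b\<in>carrier V. l b + m b)"
    by (rule continuous_map_eq[OF continuous_map_add[OF cl]]) (simp add: ts)
  moreover have "continuous_map (ntopology V) euclideanreal (\<lambda>b\<in>carrier V. c * l b)"
    by (rule continuous_map_eq[OF continuous_map_real_mult_left[OF cl(1), of c]]) (simp add: ts)
  ultimately show "(\<lambda>b\<in>carrier V. l b + m b) \<in> topological_dual V" "(\<lambda>b\<in>carrier V. c * l b) \<in> topological_dual V"
    using l m by (auto simp: topological_dual_def algebra_simps)
qed

context pullback_module
begin

abbreviation "V \<equiv> pb_fibre X A p M \<phi>"
abbreviation "Test \<equiv> pb_test X A p M Y \<phi>"
abbreviation "WS \<equiv> weak_sections Y V Test"

lemma V_eq [simp]: "V y = fib y" by (simp add: pb_fibre_def)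

lemma TV_carrier [simp]: "v \<in> carrier M \<Longrightarrow> TV v y \<in> carrier (fib y)" by (rule RV_carrier)

lemma sf_Y: "sigma_finite_measure Y" by (rule mp.sfY)

theorem weak_bundle: "weak_banach_bundle Y V Test"
  unfolding weak_banach_bundle_def
proof (intro conjI ballI allI)
  show "sigma_finite_measure Y" by (rule sf_Y)
  show "banach_space (V y)" for y by (simp add: FB_banach)
  show "Test \<subseteq> (\<Pi>\<^sub>E y\<in>space Y. carrier (V y))" by (auto simp: pb_test_def)
  fix v1 v2 and a1 a2 :: real
  assume "v1 \<in> Test" "v2 \<in> Test"
  then obtain u1 u2 where u: "u1 \<in> carrier M" "u2 \<in> carrier M" "v1 = (\<lambda>y\<in>space Y. TV u1 y)" "v2 = (\<lambda>y\<in>space Y. TV u2 y)"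
    by (auto simp: pb_test_def)
  let ?a = "\<lambda>c u. const_class X c \<odot> u"
  have c: "?a a1 u1 \<in> carrier M" "?a a2 u2 \<in> carrier M" using u by auto
  let ?v = "\<lambda>y\<in>space Y. TV (?a a1 u1 \<oplus> ?a a2 u2) y"
  have "AE y in Y. TV (?a a1 u1 \<oplus> ?a a2 u2) y = a1 \<odot>\<^bsub>fib y\<^esub> TV u1 y \<oplus>\<^bsub>fib y\<^esub> a2 \<odot>\<^bsub>fib y\<^esub> TV u2 y"
    using mp.AE_pull[OF AE_RV_add[OF c]] mp.AE_pull[OF AE_RV_scale[OF u(1)]] mp.AE_pull[OF AE_RV_scale[OF u(2)]]
    by eventually_elim simp
  with AE_space have "AE y in Y. a1 \<odot>\<^bsub>V y\<^esub> v1 y \<oplus>\<^bsub>V y\<^esub> a2 \<odot>\<^bsub>V y\<^esub> v2 y = ?v y"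
    by eventually_elim (simp add: u)
  moreover have "?v \<in> Test" using c by (auto simp: pb_test_def)
  ultimately show "\<exists>v\<in>Test. \<exists>N\<in>null_sets Y. \<forall>y\<in>space Y - N. a1 \<odot>\<^bsub>V y\<^esub> v1 y \<oplus>\<^bsub>V y\<^esub> a2 \<odot>\<^bsub>V y\<^esub> v2 y = v y"
    unfolding null_sets_iff_AE by blast
qed

lemma Test_ball: "(\<forall>t\<in>Test. Q t) \<longleftrightarrow> (\<forall>v\<in>carrier M. Q (\<lambda>y\<in>space Y. TV v y))"
  by (auto simp: pb_test_def)

text \<open>
  The null sets of the definition turn into equality almost everywhere with a measurable function.
\<close>

lemma WS_iff: "w \<in> WS \<longleftrightarrow> w \<in> (\<Pi>\<^sub>E y\<in>space Y. topological_dual (fib y)) \<and> (\<forall>v\<in>carrier M. ae_measurable Y (\<lambda>y. w y (TV v y)))"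
proof -
  have "ae_measurable Y (\<lambda>y. w y ((\<lambda>y\<in>space Y. TV v y) y)) \<longleftrightarrow> ae_measurable Y (\<lambda>y. w y (TV v y))" for v
  proof -
    have "AE y in Y. w y ((\<lambda>y\<in>space Y. TV v y) y) = w y (TV v y)" "AE y in Y. w y (TV v y) = w y ((\<lambda>y\<in>space Y. TV v y) y)"
      using AE_space by (eventually_elim, simp)+
    then show ?thesis using ae_measurable_cong[of Y "\<lambda>y. w y ((\<lambda>y\<in>space Y. TV v y) y)" "\<lambda>y. w y (TV v y)"]
      ae_measurable_cong[of Y "\<lambda>y. w y (TV v y)" "\<lambda>y. w y ((\<lambda>y\<in>space Y. TV v y) y)"] by blast
  qed
  then show ?thesis unfolding weak_sections_def ae_measurable_restrict Test_ball by simp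
qed

context
  fixes w assumes w: "w \<in> WS"
begin

lemma WS_linear:
  assumes "y \<in> space Y"
  shows "a \<in> carrier (fib y) \<Longrightarrow> b \<in> carrier (fib y) \<Longrightarrow> w y (a \<oplus>\<^bsub>fib y\<^esub> b) = w y a + w y b"
    "a \<in> carrier (fib y) \<Longrightarrow> w y (c \<odot>\<^bsub>fib y\<^esub> a) = c * w y a" "w y \<zero>\<^bsub>fib y\<^esub> = 0"
proof -
  have d: "w y \<in> topological_dual (fib y)" using w assms by (auto simp: WS_iff)
  show "a \<in> carrier (fib y) \<Longrightarrow> b \<in> carrier (fib y) \<Longrightarrow> w y (a \<oplus>\<^bsub>fib y\<^esub> b) = w y a + w y b"
    using d by (simp add: topological_dual_def)
  show sc: "a \<in> carrier (fib y) \<Longrightarrow> w y (c \<odot>\<^bsub>fib y\<^esub> a) = c * w y a" for a c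
    using d by (simp add: topological_dual_def)
  show "w y \<zero>\<^bsub>fib y\<^esub> = 0"
    using sc[of "\<zero>\<^bsub>fib y\<^esub>" 0] FB.smult_simps(5)[of "\<zero>\<^bsub>fib y\<^esub>" "\<phi> y"] by simp
qed

lemma WS_measurable: "v \<in> carrier M \<Longrightarrow> ae_measurable Y (\<lambda>y. w y (TV v y))"
  using w by (simp add: WS_iff)

lemma WS_fcomb:
  assumes y: "y \<in> space Y" and c: "coeffs n f u"
  shows "w y (fcomb n f u y) = (\<Sum>i<n. f i y * w y (TV (u i) y))"
  using c
proof (induction n)
  case 0
  then show ?case using WS_linear(3)[OF y] by (simp add: fcomb_def)
next
  case (Suc n)
  have c': "coeffs n f u" using Suc.prems by (simp add: coeffs_def)
  have "u n \<in> carrier M" using Suc.prems by (simp add: coeffs_def)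
  then show ?case unfolding fcomb_Suc[OF Suc.prems]
    using fcomb_carrier[OF c', of y] Suc.IH[OF c'] by (simp add: WS_linear[OF y])
qed

lemma WS_fcomb_measurable:
  assumes c: "coeffs n f u"
  shows "ae_measurable Y (\<lambda>y. w y (fcomb n f u y))"
proof (rule ae_measurable_cong)
  show "ae_measurable Y (\<lambda>y. \<Sum>i<n. f i y * w y (TV (u i) y))"
    using c by (intro ae_measurable_sum ae_measurable_comb(2) WS_measurable ae_measurable_borel) (auto simp: coeffs_def)
  show "AE y in Y. (\<Sum>i<n. f i y * w y (TV (u i) y)) = w y (fcomb n f u y)"
    using AE_space by eventually_elim (use WS_fcomb[OF _ c] in simp)
qed

end

lemma test_combinations_eq:
  "test_combinations Y V Test = {restrict (fcomb n f u) (space Y) | n f u. coeffs n f u}"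
proof (intro equalityI subsetI)
  fix t assume "t \<in> test_combinations Y V Test"
  then obtain n f v where t: "t = (\<lambda>y\<in>space Y. \<Oplus>\<^bsub>V y\<^esub>i\<in>{..<n::nat}. f i y \<odot>\<^bsub>V y\<^esub> v i y)"
    "f \<in> {..<n} \<rightarrow> borel_measurable Y" "v \<in> {..<n} \<rightarrow> Test"
    unfolding test_combinations_def by blast
  have "\<forall>i. \<exists>u. i < n \<longrightarrow> u \<in> carrier M \<and> v i = (\<lambda>y\<in>space Y. TV u y)"
    using t(3) by (auto simp: pb_test_def Pi_iff)
  from choice[OF this] obtain u where u: "\<And>i. i < n \<Longrightarrow> u i \<in> carrier M \<and> v i = (\<lambda>y\<in>space Y. TV (u i) y)" by blast
  have "t = restrict (fcomb n f u) (space Y)"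
    unfolding t(1) fcomb_def
  proof (rule restrict_ext)
    fix y assume y: "y \<in> space Y"
    show "(\<Oplus>\<^bsub>V y\<^esub>i\<in>{..<n}. f i y \<odot>\<^bsub>V y\<^esub> v i y) = (\<Oplus>\<^bsub>fib y\<^esub>i\<in>{..<n}. f i y \<odot>\<^bsub>fib y\<^esub> TV (u i) y)"
      unfolding V_eq by (rule FB.V.finsum_cong') (use u y in \<open>auto simp del: set_eq_iff\<close>)
  qed
  moreover have "coeffs n f u" using u t(2) by (auto simp: coeffs_def)
  ultimately show "t \<in> {restrict (fcomb n f u) (space Y) | n f u. coeffs n f u}" by blast
next
  fix t assume "t \<in> {restrict (fcomb n f u) (space Y) | n f u. coeffs n f u}"
  then obtain n f u where t: "t = restrict (fcomb n f u) (space Y)" "coeffs n f u" by blast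
  have "t = (\<lambda>y\<in>space Y. \<Oplus>\<^bsub>V y\<^esub>i\<in>{..<n}. f i y \<odot>\<^bsub>V y\<^esub> (\<lambda>i. \<lambda>y\<in>space Y. TV (u i) y) i y)"
    unfolding t(1) fcomb_def by (rule restrict_ext) simp
  then show "t \<in> test_combinations Y V Test" unfolding test_combinations_def
    using t(2) by (intro CollectI exI[of _ n] exI[of _ f] exI[of _ "\<lambda>i. \<lambda>y\<in>space Y. TV (u i) y"]) (auto simp: coeffs_def pb_test_def)
qed

abbreviation "wn w \<equiv> weak_pnorm Y V Test w"

text \<open>
  The members of the family over which the weak norm is the essential supremum agree almost
  everywhere with measurable functions, hence the essential supremum exists and has its
  characteristic property.
\<close>

lemma weak_pnorm_ess_sup:
  assumes w: "w \<in> WS"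
  shows "wn w \<in> borel_measurable Y"
    "coeffs n f u \<Longrightarrow> (\<And>y. y \<in> space Y \<Longrightarrow> nrm (fib y) (fcomb n f u y) \<le> 1) \<Longrightarrow> AE y in Y. ereal (w y (fcomb n f u y)) \<le> wn w y"
    "h \<in> borel_measurable Y \<Longrightarrow>
      (\<And>n f u. coeffs n f u \<Longrightarrow> (\<And>y. y \<in> space Y \<Longrightarrow> nrm (fib y) (fcomb n f u y) \<le> 1) \<Longrightarrow> AE y in Y. ereal (w y (fcomb n f u y)) \<le> h y) \<Longrightarrow>
      AE y in Y. wn w y \<le> h y"
proof -
  let ?T = "{(\<lambda>y. w y (v y)) | v. v \<in> test_combinations Y V Test \<and> (\<forall>y\<in>space Y. nrm (V y) (v y) \<le> 1)}"
  have sw: "AE y in Y. w y (restrict (fcomb n f u) (space Y) y) = w y (fcomb n f u y)" for n f u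
    using AE_space by eventually_elim simp
  have T: "\<exists>n f u. coeffs n f u \<and> (\<forall>y\<in>space Y. nrm (fib y) (fcomb n f u y) \<le> 1) \<and> g = (\<lambda>y. w y (restrict (fcomb n f u) (space Y) y))" if g: "g \<in> ?T" for g
  proof -
    from g obtain v where v: "g = (\<lambda>y. w y (v y))" "v \<in> test_combinations Y V Test" "\<forall>y\<in>space Y. nrm (V y) (v y) \<le> 1" by blast
    then obtain n f u where f: "v = restrict (fcomb n f u) (space Y)" "coeffs n f u" unfolding test_combinations_eq by blast
    show ?thesis using v f by (intro exI[of _ n] exI[of _ f] exI[of _ u]) auto
  qed
  have "\<exists>g'\<in>borel_measurable Y. AE y in Y. g' y = g y" if g: "g \<in> ?T" for g
  proof -
    obtain n f u where gg: "coeffs n f u" "g = (\<lambda>y. w y (restrict (fcomb n f u) (space Y) y))" using T[OF g] by blast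
    have "AE y in Y. w y (fcomb n f u y) = g y" unfolding gg(2) using sw[of n f u] by eventually_elim simp
    from ae_measurable_cong[OF WS_fcomb_measurable[OF w gg(1)] this] show ?thesis unfolding ae_measurable_def .
  qed
  then have sup: "is_ess_sup Y ?T (wn w)" unfolding weak_pnorm_def
    by (rule ess_sup_countable[OF sf_Y, of ?T]) blast+
  then show "wn w \<in> borel_measurable Y" by (simp add: is_ess_sup_def)
  show "AE y in Y. ereal (w y (fcomb n f u y)) \<le> wn w y"
    if c: "coeffs n f u" and n: "\<And>y. y \<in> space Y \<Longrightarrow> nrm (fib y) (fcomb n f u y) \<le> 1"
  proof -
    have "restrict (fcomb n f u) (space Y) \<in> test_combinations Y V Test" unfolding test_combinations_eq using c by blast
    then have "(\<lambda>y. w y (restrict (fcomb n f u) (space Y) y)) \<in> ?T" using n by (intro CollectI exI[of _ "restrict (fcomb n f u) (space Y)"]) auto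
    with sup have "AE y in Y. ereal (w y (restrict (fcomb n f u) (space Y) y)) \<le> wn w y"
      unfolding is_ess_sup_def by (elim conjE) (drule (1) bspec)
    with AE_space show ?thesis by eventually_elim simp
  qed
  show "AE y in Y. wn w y \<le> h y" if h: "h \<in> borel_measurable Y"
    and b: "\<And>n f u. coeffs n f u \<Longrightarrow> (\<And>y. y \<in> space Y \<Longrightarrow> nrm (fib y) (fcomb n f u y) \<le> 1) \<Longrightarrow> AE y in Y. ereal (w y (fcomb n f u y)) \<le> h y"
  proof -
    have "AE y in Y. ereal (g y) \<le> h y" if g: "g \<in> ?T" for g
    proof -
      obtain n f u where gg: "coeffs n f u" "\<forall>y\<in>space Y. nrm (fib y) (fcomb n f u y) \<le> 1" "g = (\<lambda>y. w y (restrict (fcomb n f u) (space Y) y))" using T[OF g] by blast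
      have "AE y in Y. ereal (w y (fcomb n f u y)) \<le> h y" using b[OF gg(1)] gg(2) by blast
      with AE_space show ?thesis unfolding gg(3) by eventually_elim simp
    qed
    then show ?thesis using sup h unfolding is_ess_sup_def by blast
  qed
qed

lemma fcomb_zero: "fcomb 0 f u y = \<zero>\<^bsub>fib y\<^esub>" by (simp add: fcomb_def)

lemma weak_pnorm_nonneg:
  assumes w: "w \<in> WS"
  shows "AE y in Y. 0 \<le> wn w y"
proof -
  have "AE y in Y. ereal (w y (fcomb 0 (\<lambda>_ _. 0) (\<lambda>_. \<zero>) y)) \<le> wn w y"
    by (rule weak_pnorm_ess_sup(2)[OF w]) (auto simp: coeffs_def fcomb_zero)
  with AE_space show ?thesis by eventually_elim (use WS_linear(3)[OF w] in \<open>simp add: fcomb_zero zero_ereal_def\<close>)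
qed

abbreviation "wr w y \<equiv> real_of_ereal (wn w y)"

text \<open>
  A combination is normalised by the measurable function that is a.e. the reciprocal of its norm,
  set to \<open>0\<close> on a null set so that the norm is at most \<open>1\<close> at every point.
\<close>

lemma weak_pnorm_bound:
  assumes w: "w \<in> WS" and fin: "AE y in Y. \<bar>wn w y\<bar> \<noteq> \<infinity>" and b: "bounded_coeffs n f u"
  shows "AE y in Y. \<bar>w y (fcomb n f u y)\<bar> \<le> wr w y * D.pn (pcomb n f u) y"
proof -
  have c: "coeffs n f u" using b by (simp add: bounded_coeffs_def)
  define m where "m = D.pn (pcomb n f u)"
  have m[measurable]: "m \<in> borel_measurable Y" unfolding m_def using pcomb_carrier[OF b] by simp
  obtain Z where Z: "Z \<in> null_sets Y" "\<forall>y\<in>space Y - Z. m y = nrm (fib y) (fcomb n f u y)"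
    using AE_pcomb_nrm[OF b] unfolding null_sets_iff_AE[symmetric] m_def by blast
  have [measurable]: "Z \<in> sets Y" using Z(1) by auto
  define g where "g s y = (if y \<in> Z \<or> m y \<le> 0 then 0 else s / m y)" for s y
  have [measurable]: "g s \<in> borel_measurable Y" for s unfolding g_def by measurable
  have nn: "0 \<le> nrm (fib y) (fcomb n f u y)" for y using fcomb_carrier[OF c] by (rule FB.nrm_nonneg)
  have g: "AE y in Y. ereal (g s y * w y (fcomb n f u y)) \<le> wn w y" if s: "\<bar>s\<bar> = 1" for s
  proof -
    have c': "coeffs n (\<lambda>i y. g s y * f i y) u" using c by (auto simp: coeffs_def)
    have "nrm (fib y) (fcomb n (\<lambda>i y. g s y * f i y) u y) \<le> 1" if y: "y \<in> space Y" for y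
      unfolding fcomb_scale[OF c] using fcomb_carrier[OF c, of y] Z(2) y s
      by (auto simp: FB.nrm_scale g_def abs_mult)
    from weak_pnorm_ess_sup(2)[OF w c' this]
    have "AE y in Y. ereal (w y (fcomb n (\<lambda>i y. g s y * f i y) u y)) \<le> wn w y" .
    with AE_space show ?thesis
      by eventually_elim (use WS_linear(2)[OF w] fcomb_carrier[OF c] in \<open>simp add: fcomb_scale[OF c]\<close>)
  qed
  have "AE y in Y. y \<notin> Z" by (subst null_sets_iff_AE[symmetric]) (use Z(1) in auto)
  with AE_space g[of 1, simplified] g[of "-1", simplified] fin show ?thesis
  proof eventually_elim
    case (elim y)
    obtain r where r: "wn w y = ereal r" using elim(4) by (cases "wn w y") auto
    have my: "m y = nrm (fib y) (fcomb n f u y)" using Z(2) elim by blast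
    show ?case
    proof (cases "m y = 0")
      case True
      then have "fcomb n f u y = \<zero>\<^bsub>fib y\<^esub>" using my fcomb_carrier[OF c, of y] by (intro FB.nrm_zero_imp) auto
      then show ?thesis using WS_linear(3)[OF w elim(1)] True by (simp add: m_def)
    next
      case False
      then have mp: "0 < m y" using nn[of y] my by simp
      let ?x = "w y (fcomb n f u y)"
      have "?x / m y \<le> r" "- (?x / m y) \<le> r" using elim(2,3,5) mp r by (auto simp: g_def)
      then have "\<bar>?x\<bar> / m y \<le> r" using mp by (auto simp: abs_if field_simps)
      then show ?thesis using mp r by (simp add: m_def[symmetric] field_simps)
    qed
  qed
qed

end

section \<open>Sections and functionals that correspond to each other\<close>

context pullback_module
begin

text \<open>
  The relation that is to become the isomorphism: \<open>w\<close> and \<open>L\<close> have the same values on the vectors that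
  come from \<open>M\<close>.
\<close>

definition corr :: "('y \<Rightarrow> (nat \<Rightarrow> 'v) set \<Rightarrow> real) \<Rightarrow> ('w \<Rightarrow> ('y \<Rightarrow> real) set) \<Rightarrow> bool" where
  "corr w L \<longleftrightarrow> w \<in> WS \<and> L \<in> carrier D.DM \<and> (\<forall>v\<in>carrier M. L (\<phi>s v) = ae_class Y (\<lambda>y. w y (TV v y)))"

lemma corr_iff_AE:
  assumes "w \<in> WS" and L: "L \<in> carrier D.DM"
  shows "corr w L \<longleftrightarrow> (\<forall>v\<in>carrier M. AE y in Y. ae_rep (L (\<phi>s v)) y = w y (TV v y))"
proof -
  have "L (\<phi>s v) = ae_class Y (\<lambda>y. w y (TV v y)) \<longleftrightarrow> (AE y in Y. ae_rep (L (\<phi>s v)) y = w y (TV v y))" if v: "v \<in> carrier M" for v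
  proof -
    note m = ae_measurable_class[OF WS_measurable[OF assms(1) v]]
    have Lc: "L (\<phi>s v) \<in> ae_classes Y" using D.DM_linear(1)[OF L, of "\<phi>s v" "\<phi>s v"] v by (intro Lp_set_ae_classes[of _ Y 1]) auto
    have "(AE y in Y. ae_rep (L (\<phi>s v)) y = ae_rep (ae_class Y (\<lambda>y. w y (TV v y))) y) \<longleftrightarrow> (AE y in Y. ae_rep (L (\<phi>s v)) y = w y (TV v y))"
      by (rule eventually_subst) (use m(2) in \<open>auto elim: eventually_mono\<close>)
    then show ?thesis unfolding ae_classes_eq_iff[OF Lc m(1)] .
  qed
  then show ?thesis using assms by (simp add: corr_def)
qed

lemma corrD:
  assumes "corr w L"
  shows "w \<in> WS" "L \<in> carrier D.DM" "v \<in> carrier M \<Longrightarrow> AE y in Y. ae_rep (L (\<phi>s v)) y = w y (TV v y)"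
  using assms corr_iff_AE[of w L] by (auto simp: corr_def)

text \<open>
  Both sides are linear over the coefficients, which on the side of \<open>w\<close> act pointwise.
\<close>

lemma corr_comb:
  assumes r: "corr w L" and b: "bounded_coeffs n f u"
  shows "AE y in Y. ae_rep (L (pcomb n f u)) y = w y (fcomb n f u y)"
  using b
proof (induction n)
  case 0
  have "pcomb 0 f u = \<zero>\<^bsub>P\<^esub>" by (simp add: pcomb_def)
  show ?case unfolding \<open>pcomb 0 f u = \<zero>\<^bsub>P\<^esub>\<close> fcomb_zero using D.AE_L_zero[OF corrD(2)[OF r]] AE_space
    by eventually_elim (use WS_linear(3)[OF corrD(1)[OF r]] in simp)
next
  case (Suc n)
  have b': "bounded_coeffs n f u" and c: "coeffs (Suc n) f u" using Suc.prems by (auto simp: bounded_coeffs_def coeffs_def)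
  have fn: "f n \<in> borel_measurable Y" "u n \<in> carrier M" using bounded_coeffsD[OF Suc.prems, of n] by auto
  obtain k where k: "AE y in Y. \<bar>f n y\<bar> \<le> k" using Suc.prems by (auto simp: bounded_coeffs_def)
  note L = corrD(2)[OF r]
  have "ae_class Y (f n) \<odot>\<^bsub>P\<^esub> \<phi>s (u n) \<in> carrier P" using bounded_coeffs_Linf[OF Suc.prems, of n] fn by simp
  from D.AE_L_add[OF L this pcomb_carrier[OF b']] D.AE_L_smult[OF L fn(1) k \<phi>s_closed[OF fn(2)]] corrD(3)[OF r fn(2)] Suc.IH[OF b'] AE_space
  show ?case unfolding pcomb_Suc[OF Suc.prems]
    by eventually_elim (use WS_linear(1,2)[OF corrD(1)[OF r]] fn fcomb_carrier b' in \<open>simp add: fcomb_Suc[OF c] bounded_coeffs_def\<close>)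
qed

text \<open>
  A test combination of norm at most \<open>1\<close> has unbounded coefficients in general. Restricting it to the
  set where all coefficients are at most \<open>m\<close> gives a vector of the pullback of norm at most \<open>1\<close>, and these
  sets exhaust \<open>Y\<close>.
\<close>

lemma corr_weak_pnorm_le:
  assumes r: "corr w L"
  shows "AE y in Y. wn w y \<le> ereal (D.dual_value L y)"
proof (rule weak_pnorm_ess_sup(3))
  show w: "w \<in> WS" by (rule corrD(1)[OF r])
  have L: "L \<in> carrier D.DM" by (rule corrD(2)[OF r])
  show "(\<lambda>y. ereal (D.dual_value L y)) \<in> borel_measurable Y" using D.dual_value_facts(3)[OF L] by simp
  fix n f u assume c: "coeffs n f u" and n: "\<And>y. y \<in> space Y \<Longrightarrow> nrm (fib y) (fcomb n f u y) \<le> 1"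
  have fm: "i < n \<Longrightarrow> f i \<in> borel_measurable Y" for i using c by (auto simp: coeffs_def)
  define g :: "nat \<Rightarrow> 'y \<Rightarrow> real" where "g m y = (if \<forall>i\<in>{..<n}. \<bar>f i y\<bar> \<le> real m then 1 else 0)" for m y
  have gm: "g m \<in> borel_measurable Y" for m
  proof -
    have "{y \<in> space Y. \<forall>i\<in>{..<n}. \<bar>f i y\<bar> \<le> real m} \<in> sets Y"
      by (rule sets.sets_Collect_finite_All) (use fm in \<open>auto intro!: borel_measurable_le borel_measurable_abs\<close>)
    then show ?thesis unfolding g_def[abs_def] by (rule measurable_If[rotated 2]) (rule borel_measurable_const)+
  qed
  have "AE y in Y. g m y * w y (fcomb n f u y) \<le> D.dual_value L y" for m
  proof -
    let ?f = "\<lambda>i y. g m y * f i y"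
    have b: "bounded_coeffs n ?f u"
      unfolding bounded_coeffs_def
    proof (intro conjI allI impI)
      show "coeffs n ?f u" using c gm[of m] by (auto simp: coeffs_def)
      show "\<exists>c. AE y in Y. \<bar>g m y * f i y\<bar> \<le> c" if "i < n" for i
        using that by (intro exI[of _ "real m"] AE_I2) (auto simp: g_def)
    qed
    from corr_comb[OF r b] D.dual_value_bound[OF L pcomb_carrier[OF b]] AE_pcomb_nrm[OF b] D.dual_value_facts(2)[OF L] AE_space
    show ?thesis
    proof eventually_elim
      case (elim y)
      have "nrm (fib y) (fcomb n ?f u y) \<le> 1"
        unfolding fcomb_scale[OF c] using n[OF elim(5)] fcomb_carrier[OF c, of y] by (auto simp: FB.nrm_scale g_def)
      then have "D.dual_value L y * D.pn (pcomb n ?f u) y \<le> D.dual_value L y * 1"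
        using elim(3,4) by (intro mult_left_mono) auto
      moreover have "w y (fcomb n ?f u y) = g m y * w y (fcomb n f u y)"
        unfolding fcomb_scale[OF c] using WS_linear(2)[OF w elim(5)] fcomb_carrier[OF c] by simp
      ultimately show ?case using elim(1,2) by simp
    qed
  qed
  then have "AE y in Y. \<forall>m. g m y * w y (fcomb n f u y) \<le> D.dual_value L y" by (simp add: AE_all_countable)
  then show "AE y in Y. ereal (w y (fcomb n f u y)) \<le> ereal (D.dual_value L y)"
  proof eventually_elim
    case (elim y)
    obtain m where "(\<Sum>i<n. \<bar>f i y\<bar>) \<le> real m" using real_arch_simple by blast
    then have "\<bar>f i y\<bar> \<le> real m" if "i \<in> {..<n}" for i
      using member_le_sum[OF that, of "\<lambda>i. \<bar>f i y\<bar>"] by simp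
    then have "g m y = 1" by (simp add: g_def)
    then show ?case using elim[rule_format, of m] by simp
  qed
qed

lemma corr_finite:
  assumes r: "corr w L"
  shows "AE y in Y. \<bar>wn w y\<bar> \<noteq> \<infinity>"
  using corr_weak_pnorm_le[OF r] weak_pnorm_nonneg[OF corrD(1)[OF r]]
  by eventually_elim auto

lemma L1_conv_pcomb:
  assumes L: "L \<in> carrier D.DM" and z: "z \<in> carrier P"
  obtains s where "\<And>k. \<exists>n f u. bounded_coeffs n f u \<and> s k = pcomb n f u" "\<And>k. s k \<in> carrier P" "D.N.nconv s z"
    "D.L1.nconv (\<lambda>k. L (s k)) (L z)"
proof -
  obtain s where s: "\<And>k. \<exists>n f u. bounded_coeffs n f u \<and> s k = pcomb n f u" "D.N.nconv s z"
    by (rule pcomb_dense[OF z]) blast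
  have c: "s k \<in> carrier P" for k using s(1)[of k] pcomb_carrier by auto
  show ?thesis by (rule that[OF s(1) c s(2) D.DM_continuous[OF L c z s(2)]])
qed

text \<open>
  By density, a pointwise bound of a functional by the weak norm passes from combinations to all
  vectors, so that the pointwise dual norm cannot exceed the weak norm.
\<close>

lemma corr_weak_pnorm:
  assumes r: "corr w L"
  shows "AE y in Y. wn w y = ereal (D.dual_value L y)"
proof -
  have w: "w \<in> WS" and L: "L \<in> carrier D.DM" using corrD[OF r] by auto
  note fin = corr_finite[OF r]
  have wr: "(\<lambda>y. wn w y) \<in> borel_measurable Y" by (rule weak_pnorm_ess_sup(1)[OF w])
  have b: "AE y in Y. \<bar>ae_rep (L z) y\<bar> \<le> wr w y * D.pn z y" if z: "z \<in> carrier P" for z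
  proof -
    obtain s where s: "\<And>k. \<exists>n f u. bounded_coeffs n f u \<and> s k = pcomb n f u" "\<And>k. s k \<in> carrier P" "D.N.nconv s z"
      "D.L1.nconv (\<lambda>k. L (s k)) (L z)" by (rule L1_conv_pcomb[OF L z]) blast
    have Lc: "L v \<in> Lp_set Y 1" if "v \<in> carrier P" for v using D.DM_linear(1)[OF L that that] .
    obtain r1 where r1: "strict_mono (r1 :: nat \<Rightarrow> nat)" "AE y in Y. (\<lambda>n. ae_rep (L (s (r1 n))) y) \<longlonglongrightarrow> ae_rep (L z) y"
      by (rule L1_conv_AE_subseq[OF Lc[OF s(2)] Lc[OF z] s(4)]) blast
    have "(\<lambda>n. nrm P (s n \<ominus>\<^bsub>P\<^esub> z)) \<longlonglongrightarrow> 0" using s(3) by (simp add: D.N.nconv_def)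
    then have "(\<lambda>n. nrm P (s (r1 n) \<ominus>\<^bsub>P\<^esub> z)) \<longlonglongrightarrow> 0" using LIMSEQ_subseq_LIMSEQ[OF _ r1(1)] by (simp add: o_def)
    then obtain r2 where r2: "strict_mono (r2 :: nat \<Rightarrow> nat)" "AE y in Y. (\<lambda>n. D.pn (s (r1 (r2 n)) \<ominus>\<^bsub>P\<^esub> z) y) \<longlonglongrightarrow> 0"
      by (rule D.pn_limit_AE_subseq[OF s(2) z, of r1]) blast
    let ?t = "\<lambda>n. s (r1 (r2 n))"
    have "AE y in Y. \<bar>ae_rep (L (?t n)) y\<bar> \<le> wr w y * D.pn (?t n) y" for n
    proof -
      obtain m f u where m: "bounded_coeffs m f u" "?t n = pcomb m f u" using s(1) by blast
      from weak_pnorm_bound[OF w fin m(1)] corr_comb[OF r m(1)] show ?thesis unfolding m(2) by eventually_elim simp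
    qed
    then have "AE y in Y. \<forall>n. \<bar>ae_rep (L (?t n)) y\<bar> \<le> wr w y * D.pn (?t n) y" by (simp add: AE_all_countable)
    moreover have "AE y in Y. \<forall>n. \<bar>D.pn (?t n) y - D.pn z y\<bar> \<le> D.pn (?t n \<ominus>\<^bsub>P\<^esub> z) y"
      unfolding AE_all_countable using D.pn_reverse_triangle[OF s(2) z] by blast
    ultimately show ?thesis using r1(2) r2(2)
    proof eventually_elim
      case (elim y)
      have "(\<lambda>n. ae_rep (L (?t n)) y) \<longlonglongrightarrow> ae_rep (L z) y" using LIMSEQ_subseq_LIMSEQ[OF elim(3) r2(1)] by (simp add: o_def)
      then have 1: "(\<lambda>n. \<bar>ae_rep (L (?t n)) y\<bar>) \<longlonglongrightarrow> \<bar>ae_rep (L z) y\<bar>" by (rule tendsto_rabs)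
      have "(\<lambda>n. D.pn (?t n) y - D.pn z y) \<longlonglongrightarrow> 0"
        by (rule Lim_null_comparison[OF _ elim(4)]) (use elim(2) in auto)
      then have "(\<lambda>n. D.pn (?t n) y) \<longlonglongrightarrow> D.pn z y" by (simp add: LIM_zero_iff)
      then have 2: "(\<lambda>n. wr w y * D.pn (?t n) y) \<longlonglongrightarrow> wr w y * D.pn z y" by (rule tendsto_mult_left)
      show ?case by (rule LIMSEQ_le[OF 1 2]) (use elim(1) in auto)
    qed
  qed
  have "AE y in Y. ess_sup Y (D.dual_family L) y \<le> wn w y"
  proof -
    have "AE y in Y. ereal (g y) \<le> wn w y" if g: "g \<in> D.dual_family L" for g
    proof -
      obtain z where z: "g = ae_rep (L z)" "z \<in> carrier P" "AE y in Y. D.pn z y \<le> 1" using g by (auto simp: D.dual_family_def)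
      from b[OF z(2)] z(3) fin weak_pnorm_nonneg[OF w] show ?thesis unfolding z(1)
      proof eventually_elim
        case (elim y)
        then obtain x where x: "wn w y = ereal x" "0 \<le> x" by (cases "wn w y") auto
        have "x * D.pn z y \<le> x * 1" using x elim(2) by (intro mult_left_mono) auto
        then show ?case using elim(1) x by simp
      qed
    qed
    then show ?thesis using D.dual_family_ess_sup[OF L] wr unfolding is_ess_sup_def by blast
  qed
  with corr_weak_pnorm_le[OF r] D.dual_value_facts(1)[OF L] show ?thesis
    by eventually_elim (auto intro: antisym)
qed

text \<open>
  Functionals that agree on the vectors from \<open>M\<close> agree on combinations, and these are dense.
\<close>

lemma corr_unique:
  assumes r: "corr w L" and L': "L' \<in> carrier D.DM" and eq: "\<And>v. v \<in> carrier M \<Longrightarrow> L' (\<phi>s v) = L (\<phi>s v)"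
  shows "L' = L"
proof (rule D.DM_eqI[OF L'])
  show L: "L \<in> carrier D.DM" by (rule corrD(2)[OF r])
  have r': "corr w L'" using r L' eq by (simp add: corr_def)
  have Lc: "L v \<in> Lp_set Y 1" "L' v \<in> Lp_set Y 1" if "v \<in> carrier P" for v
    using D.DM_linear(1)[OF L that that] D.DM_linear(1)[OF L' that that] by auto
  have comb: "L' (pcomb n f u) = L (pcomb n f u)" if b: "bounded_coeffs n f u" for n f u
  proof (rule ae_classes_eqI)
    show "L' (pcomb n f u) \<in> ae_classes Y" "L (pcomb n f u) \<in> ae_classes Y"
      using Lc[OF pcomb_carrier[OF b]] Lp_set_ae_classes by auto
    show "AE y in Y. ae_rep (L' (pcomb n f u)) y = ae_rep (L (pcomb n f u)) y"
      using corr_comb[OF r b] corr_comb[OF r' b] by eventually_elim simp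
  qed
  fix z assume z: "z \<in> carrier P"
  obtain s where s: "\<And>k. \<exists>n f u. bounded_coeffs n f u \<and> s k = pcomb n f u" "\<And>k. s k \<in> carrier P" "D.N.nconv s z"
    "D.L1.nconv (\<lambda>k. L (s k)) (L z)" by (rule L1_conv_pcomb[OF L z]) blast
  have "L' (s k) = L (s k)" for k using s(1)[of k] comb by auto
  then have "D.L1.nconv (\<lambda>k. L (s k)) (L' z)" using D.DM_continuous[OF L' s(2) z s(3)] by simp
  from D.L1.nconv_unique[OF this s(4)] show "L' z = L z" using Lc s(2) z by simp
qed

lemma pcomb_one:
  assumes "v \<in> carrier M"
  shows "bounded_coeffs 1 (\<lambda>_ _. 1) (\<lambda>_. v)" "pcomb 1 (\<lambda>_ _. 1) (\<lambda>_. v) = \<phi>s v" "fcomb 1 (\<lambda>_ _. 1) (\<lambda>_. v) y = TV v y"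
proof -
  show b: "bounded_coeffs 1 (\<lambda>_ _. 1) (\<lambda>_. v)" using assms by (auto simp: bounded_coeffs_def coeffs_def)
  show "pcomb 1 (\<lambda>_ _. 1) (\<lambda>_. v) = \<phi>s v"
    using pcomb_Suc[of 0 "\<lambda>_ _. 1" "\<lambda>_. v"] b assms D.M.smult_one[of "\<phi>s v"] by (simp add: pcomb_def)
  show "fcomb 1 (\<lambda>_ _. 1) (\<lambda>_. v) y = TV v y"
    using fcomb_Suc[of 0 "\<lambda>_ _. 1" "\<lambda>_. v" y] b assms FB.smult_simps(4)[of "TV v y" "\<phi> y"] by (simp add: fcomb_zero bounded_coeffs_def)
qed

text \<open>
  The prescription is made on combinations. It is bounded, by \<open>weak_pnorm_bound\<close> and Hoelder's
  inequality, which makes it independent of the way in which a combination is written and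
  extendable to their closure.
\<close>

lemma section_induces:
  assumes w: "w \<in> WS" and fin: "AE y in Y. \<bar>wn w y\<bar> \<noteq> \<infinity>" and Lq: "integrable Y (\<lambda>y. \<bar>wr w y\<bar> powr q)"
  obtains L where "corr w L"
proof -
  have wrm: "wr w \<in> borel_measurable Y" using weak_pnorm_ess_sup(1)[OF w] by simp
  define W where "W = (LINT y|Y. \<bar>wr w y\<bar> powr q) powr (1/q)"
  define \<Gamma> where "\<Gamma> = {(pcomb n f u, ae_class Y (\<lambda>y. w y (fcomb n f u y))) | n f u. bounded_coeffs n f u}"
  have cls: "ae_class Y (\<lambda>y. w y (fcomb n f u y)) \<in> ae_classes Y"
    "AE y in Y. ae_rep (ae_class Y (\<lambda>y. w y (fcomb n f u y))) y = w y (fcomb n f u y)" if b: "bounded_coeffs n f u" for n f u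
    using ae_measurable_class[OF WS_fcomb_measurable[OF w]] b by (auto simp: bounded_coeffs_def)
  have main: "ae_class Y (\<lambda>y. w y (fcomb n f u y)) \<in> Lp_set Y 1"
    "Lp_norm Y 1 (ae_class Y (\<lambda>y. w y (fcomb n f u y))) \<le> W * nrm P (pcomb n f u)" if b: "bounded_coeffs n f u" for n f u
  proof -
    let ?G = "ae_class Y (\<lambda>y. w y (fcomb n f u y))" and ?s = "pcomb n f u"
    have s: "?s \<in> carrier P" by (rule pcomb_carrier[OF b])
    note [measurable] = wrm D.pn_measurable[OF s]
    have Gm[measurable]: "ae_rep ?G \<in> borel_measurable Y" using cls(1)[OF b] by simp
    have pp: "integrable Y (\<lambda>y. \<bar>D.pn ?s y\<bar> powr p)" "(LINT y|Y. \<bar>D.pn ?s y\<bar> powr p) powr (1/p) = nrm P ?s"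
    proof -
      have eq: "AE y in Y. D.pn ?s y powr p = \<bar>D.pn ?s y\<bar> powr p" using D.pn_nonneg[OF s] by eventually_elim simp
      show "integrable Y (\<lambda>y. \<bar>D.pn ?s y\<bar> powr p)"
        using integrable_cong_AE_imp[OF D.pn_integrable[OF s] _ eq] by simp
      have "(LINT y|Y. D.pn ?s y powr p) = (LINT y|Y. \<bar>D.pn ?s y\<bar> powr p)" using eq by (intro integral_cong_AE) auto
      then show "(LINT y|Y. \<bar>D.pn ?s y\<bar> powr p) powr (1/p) = nrm P ?s" by (simp add: D.nrm_eq[OF s])
    qed
    note H = Hoelder[OF D.p D.q D.pq D.pn_measurable[OF s] wrm pp(1) Lq]
    have bd: "AE y in Y. \<bar>ae_rep ?G y\<bar> \<le> \<bar>D.pn ?s y * wr w y\<bar>"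
      using cls(2)[OF b] weak_pnorm_bound[OF w fin b] by eventually_elim (simp add: mult.commute)
    have int: "integrable Y (ae_rep ?G)"
      by (rule Bochner_Integration.integrable_bound[OF H(1) Gm]) (use bd in simp)
    then show "?G \<in> Lp_set Y 1" using cls(1)[OF b] by (simp add: Lp1_set_iff)
    have "Lp_norm Y 1 ?G \<le> (LINT y|Y. \<bar>D.pn ?s y * wr w y\<bar>)"
      unfolding Lp1_norm using int H(1) bd by (intro integral_mono_AE) auto
    also have "\<dots> \<le> W * nrm P ?s" using H(2) unfolding pp(2) W_def by (simp add: mult.commute)
    finally show "Lp_norm Y 1 ?G \<le> W * nrm P ?s" .
  qed
  obtain L where L: "L \<in> carrier D.DM" "\<And>s G. (s, G) \<in> \<Gamma> \<Longrightarrow> L s = G"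
  proof (rule D.DM_extend[of \<Gamma> W])
    show "s \<in> carrier P \<and> G \<in> Lp_set Y 1" if "(s, G) \<in> \<Gamma>" for s G
      using that main(1) pcomb_carrier by (auto simp: \<Gamma>_def)
    show "Lp_norm Y 1 G \<le> W * nrm P s" if "(s, G) \<in> \<Gamma>" for s G
      using that main(2) by (auto simp: \<Gamma>_def)
    show "0 \<le> W" by (simp add: W_def)
    show "(s \<oplus>\<^bsub>P\<^esub> s', ae_map2 Y (+) G G') \<in> \<Gamma>" if in1: "(s, G) \<in> \<Gamma>" and in2: "(s', G') \<in> \<Gamma>" for s G s' G'
    proof -
      obtain n f u where a: "bounded_coeffs n f u" "s = pcomb n f u" "G = ae_class Y (\<lambda>y. w y (fcomb n f u y))"
        using in1 by (auto simp: \<Gamma>_def)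
      obtain m g v where b: "bounded_coeffs m g v" "s' = pcomb m g v" "G' = ae_class Y (\<lambda>y. w y (fcomb m g v y))"
        using in2 by (auto simp: \<Gamma>_def)
      let ?h = "\<lambda>i. if i < n then f i else g (i - n)" and ?w = "\<lambda>i. if i < n then u i else v (i - n)"
      note ap = pcomb_append[OF a(1) b(1)]
      have "ae_map2 Y (+) G G' = ae_class Y (\<lambda>y. w y (fcomb (n + m) ?h ?w y))"
        unfolding ae_map2_def
      proof (rule ae_class_eqI)
        show "AE y in Y. ae_rep G y + ae_rep G' y = w y (fcomb (n + m) ?h ?w y)"
          using cls(2)[OF a(1)] cls(2)[OF b(1)] AE_space unfolding ap(3) a(3) b(3)
          by eventually_elim (use WS_linear(1)[OF w] fcomb_carrier a(1) b(1) in \<open>simp add: bounded_coeffs_def\<close>)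
      qed
      moreover have "s \<oplus>\<^bsub>P\<^esub> s' = pcomb (n + m) ?h ?w" using ap(2) a(2) b(2) by simp
      ultimately show ?thesis unfolding \<Gamma>_def using ap(1) by blast
    qed
    show "(F \<odot>\<^bsub>P\<^esub> s, ae_map2 Y (*) F G) \<in> \<Gamma>" if F: "F \<in> carrier (Linf Y)" and in1: "(s, G) \<in> \<Gamma>" for F s G
    proof -
      obtain n f u where a: "bounded_coeffs n f u" "s = pcomb n f u" "G = ae_class Y (\<lambda>y. w y (fcomb n f u y))"
        using in1 by (auto simp: \<Gamma>_def)
      note ps = pcomb_smult[OF a(1) F]
      have c: "coeffs n f u" using a(1) by (simp add: bounded_coeffs_def)
      have "ae_map2 Y (*) F G = ae_class Y (\<lambda>y. w y (fcomb n (\<lambda>i y. ae_rep F y * f i y) u y))"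
        unfolding ae_map2_def
      proof (rule ae_class_eqI)
        show "AE y in Y. ae_rep F y * ae_rep G y = w y (fcomb n (\<lambda>i y. ae_rep F y * f i y) u y)"
          using cls(2)[OF a(1)] AE_space unfolding fcomb_scale[OF c] a(3)
          by eventually_elim (use WS_linear(2)[OF w] fcomb_carrier[OF c] in simp)
      qed
      then show ?thesis unfolding \<Gamma>_def using ps a(2) by (intro CollectI exI[of _ n] exI[of _ "\<lambda>i y. ae_rep F y * f i y"] exI[of _ u]) simp
    qed
    show "\<exists>s. (\<forall>k. s k \<in> Domain \<Gamma>) \<and> D.N.nconv s z" if z: "z \<in> carrier P" for z
    proof -
      obtain s where s: "\<And>k. \<exists>n f u. bounded_coeffs n f u \<and> s k = pcomb n f u" "D.N.nconv s z"
        by (rule pcomb_dense[OF z]) blast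
      have "s k \<in> Domain \<Gamma>" for k using s(1)[of k] unfolding \<Gamma>_def by blast
      with s(2) show ?thesis by blast
    qed
  qed blast
  have "corr w L"
    unfolding corr_def
  proof (intro conjI ballI w L(1))
    fix v assume v: "v \<in> carrier M"
    have "(\<phi>s v, ae_class Y (\<lambda>y. w y (TV v y))) \<in> \<Gamma>"
      unfolding \<Gamma>_def using pcomb_one[OF v] by (intro CollectI exI[of _ 1] exI[of _ "\<lambda>_ _. 1"] exI[of _ "\<lambda>_. v"]) simp
    then show "L (\<phi>s v) = ae_class Y (\<lambda>y. w y (TV v y))" by (rule L(2))
  qed
  then show ?thesis by (rule that)
qed

end

section \<open>From functionals to sections\<close>

context fibred_module
begin

text \<open>
  Hoelder's inequality on a cell.
\<close>

lemma cell_avg_le_avg_norm: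
  assumes v: "v \<in> carrier M" and x: "x \<in> space \<mu>" and q: "1 < q" "1 / p + 1 / q = 1"
  shows "cell_avg \<mu> A k (pn v) x \<le> avg_norm k v x"
proof (cases "measure \<mu> (atom \<mu> A k x) = 0")
  case True
  then show ?thesis by (simp add: cell_avg_eq[OF A x] avg_norm_def)
next
  case False
  let ?E = "atom \<mu> A k x" and ?m = "measure \<mu> (atom \<mu> A k x)"
  have E[measurable]: "?E \<in> sets \<mu>" by (rule atom_sets[OF A])
  have m: "0 < ?m" using False measure_nonneg[of \<mu> ?E] by linarith
  then have fin: "emeasure \<mu> ?E < \<infinity>" using False by (auto simp: measure_def less_top[symmetric])
  note [measurable] = pn_measurable[OF v]
  define f where "f z = indicator ?E z * pn v z" for z
  have [measurable]: "f \<in> borel_measurable \<mu>" unfolding f_def by measurable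
  have fp: "AE z in \<mu>. indicator ?E z *\<^sub>R (pn v z powr p) = \<bar>f z\<bar> powr p"
    using pn_nonneg[OF v] by eventually_elim (auto simp: f_def indicator_def)
  have i1: "integrable \<mu> (\<lambda>z. \<bar>f z\<bar> powr p)"
    by (rule integrable_cong_AE_imp[OF set_integrable_pn[OF E v, unfolded set_integrable_def] _ fp]) simp
  have i2: "integrable \<mu> (\<lambda>z. \<bar>indicator ?E z :: real\<bar> powr q)"
  proof -
    have "(\<lambda>z. \<bar>indicator ?E z :: real\<bar> powr q) = indicator ?E" by (auto simp: indicator_def)
    then show ?thesis using fin by (simp add: integrable_real_indicator)
  qed
  note H = Hoelder[OF p q _ _ i1 i2, simplified]
  have "(LINT z:?E|\<mu>. pn v z) \<le> (LINT z|\<mu>. \<bar>f z * indicator ?E z\<bar>)"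
    unfolding set_lebesgue_integral_def
  proof (rule integral_mono_AE)
    have "integrable \<mu> (\<lambda>z. f z * indicator ?E z)" using H(1) by simp
    moreover have "(\<lambda>z. f z * indicator ?E z) = (\<lambda>z. indicator ?E z *\<^sub>R pn v z)" by (auto simp: f_def indicator_def)
    ultimately show "integrable \<mu> (\<lambda>z. indicator ?E z *\<^sub>R pn v z)" "integrable \<mu> (\<lambda>z. \<bar>f z * indicator ?E z\<bar>)"
      using integrable_abs by (auto simp del: real_scaleR_def)
  qed (auto simp: f_def indicator_def)
  also have "\<dots> \<le> (LINT z|\<mu>. \<bar>f z\<bar> powr p) powr (1/p) * (LINT z|\<mu>. \<bar>indicator ?E z :: real\<bar> powr q) powr (1/q)"
    using H(2) by simp
  also have "(LINT z|\<mu>. \<bar>f z\<bar> powr p) = (LINT z:?E|\<mu>. pn v z powr p)"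
    unfolding set_lebesgue_integral_def using fp by (intro integral_cong_AE) (auto elim: eventually_mono)
  also have "(LINT z|\<mu>. \<bar>indicator ?E z :: real\<bar> powr q) = ?m"
  proof -
    have "(\<lambda>z. \<bar>indicator ?E z :: real\<bar> powr q) = indicator ?E" by (auto simp: indicator_def)
    then show ?thesis using sets.sets_into_space[OF E] by (simp add: Int_absorb2)
  qed
  finally have le: "(LINT z:?E|\<mu>. pn v z) \<le> (LINT z:?E|\<mu>. pn v z powr p) powr (1/p) * ?m powr (1/q)" .
  have "1 / ?m * ?m powr (1/q) = ?m powr (-1) * ?m powr (1/q)" using m by (simp add: powr_minus_divide)
  also have "\<dots> = ?m powr (-(1/p))" using q(2) unfolding powr_add[symmetric] by (intro arg_cong[of _ _ "\<lambda>a. ?m powr a"]) linarith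
  also have "\<dots> = (1 / ?m) powr (1/p)" using m by (simp add: powr_minus_divide powr_divide)
  finally have e: "1 / ?m * ?m powr (1/q) = (1 / ?m) powr (1/p)" .
  have "cell_avg \<mu> A k (pn v) x \<le> 1 / ?m * ((LINT z:?E|\<mu>. pn v z powr p) powr (1/p) * ?m powr (1/q))"
    unfolding cell_avg_eq[OF A x] using le m by (intro mult_left_mono) auto
  also have "\<dots> = avg_norm k v x" unfolding avg_norm_eq[OF x] e[symmetric] by (simp add: mult_ac)
  finally show ?thesis .
qed

lemma set_integrable_pn_finite:
  assumes v: "v \<in> carrier M" and E[measurable]: "E \<in> sets \<mu>" "emeasure \<mu> E < \<infinity>" and q: "1 < q" "1 / p + 1 / q = 1"
  shows "set_integrable \<mu> E (pn v)"
proof -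
  note [measurable] = pn_measurable[OF v]
  have "(\<lambda>z. \<bar>indicator E z :: real\<bar> powr q) = indicator E" by (auto simp: indicator_def)
  then have i2: "integrable \<mu> (\<lambda>z. \<bar>indicator E z :: real\<bar> powr q)" using E by (simp add: integrable_real_indicator)
  have i1: "integrable \<mu> (\<lambda>z. \<bar>pn v z\<bar> powr p)"
    by (rule integrable_cong_AE_imp[OF pn_integrable[OF v]]) (use pn_nonneg[OF v] in \<open>auto elim: eventually_mono\<close>)
  have "integrable \<mu> (\<lambda>z. pn v z * indicator E z)" by (rule Hoelder(1)[OF p q _ _ i1 i2]) auto
  then show ?thesis unfolding set_integrable_def by (simp add: mult.commute)
qed

end

context pullback_module
begin

text \<open>
  After division by \<open>1 + |L|\<close> the functions \<open>L(\<phi>\<^sup>*v)\<close> are dominated by \<open>|v| \<circ> \<phi>\<close>, whose cell averages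
  are at most those of \<open>|v|\<^sup>p\<close> in the sense of \<open>p\<close>-means. The lifting therefore turns them into a linear
  functional on \<open>span {v. \<phi> y is a Lebesgue point of |v|\<^sup>p}\<close> that is bounded by the seminorm.
\<close>

theorem functional_induced:
  assumes L: "L \<in> carrier D.DM"
  obtains w where "corr w L"
proof -
  obtain \<Lambda> :: "'y \<Rightarrow> ('y \<Rightarrow> real) \<Rightarrow> real" where
    lin: "\<And>y g1 g2 m1 m2 a b. y \<in> space Y \<Longrightarrow> mp.dominated g1 m1 \<Longrightarrow> mp.dominated g2 m2 \<Longrightarrow>
      Bseq (\<lambda>k. cell_avg X A k m1 (\<phi> y)) \<Longrightarrow> Bseq (\<lambda>k. cell_avg X A k m2 (\<phi> y)) \<Longrightarrow>
      \<Lambda> y (\<lambda>z. a * g1 z + b * g2 z) = a * \<Lambda> y g1 + b * \<Lambda> y g2"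
    and bound: "\<And>y g m c. y \<in> space Y \<Longrightarrow> mp.dominated g m \<Longrightarrow> Bseq (\<lambda>k. cell_avg X A k m (\<phi> y)) \<Longrightarrow>
      (\<And>e. 0 < e \<Longrightarrow> eventually (\<lambda>k. cell_avg X A k m (\<phi> y) \<le> c + e) sequentially) \<Longrightarrow> \<bar>\<Lambda> y g\<bar> \<le> c"
    and cong: "\<And>y g1 g2. g1 \<in> borel_measurable Y \<Longrightarrow> g2 \<in> borel_measurable Y \<Longrightarrow> AE z in Y. g1 z = g2 z \<Longrightarrow> \<Lambda> y g1 = \<Lambda> y g2"
    and lift: "\<And>g m. integrable Y g \<Longrightarrow> mp.dominated g m \<Longrightarrow> AE y in Y. \<Lambda> y g = g y"
    by (rule mp.linear_lifting) blast
  \<comment> \<open>The added \<open>1\<close> keeps the quotients below \<open>|L (\<phi>\<^sup>*v)|\<close>, hence integrable; the lifted value at \<open>y\<close> is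
    multiplied by \<open>H y\<close> again.\<close>
  define H where "H y = 1 + \<bar>D.dual_value L y\<bar>" for y
  have H1: "1 \<le> H y" for y by (simp add: H_def)
  have [measurable]: "H \<in> borel_measurable Y" unfolding H_def[abs_def] using D.dual_value_facts(3)[OF L] by measurable
  define g where "g v y = ae_rep (L (\<phi>s v)) y / H y" for v y
  have Lm[measurable]: "ae_rep (L (\<phi>s v)) \<in> borel_measurable Y" if "v \<in> carrier M" for v using D.L_measurable[OF L] that by simp
  have gm[measurable]: "g v \<in> borel_measurable Y" if v: "v \<in> carrier M" for v
    unfolding g_def[abs_def] using Lm[OF v] by measurable
  have gi: "integrable Y (g v)" if v: "v \<in> carrier M" for v
  proof (rule Bochner_Integration.integrable_bound[OF D.L_integrable[OF L \<phi>s_closed[OF v]] gm[OF v]])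
    show "AE y in Y. norm (g v y) \<le> norm (ae_rep (L (\<phi>s v)) y)"
    proof (rule AE_I2)
      fix y
      have "\<bar>ae_rep (L (\<phi>s v)) y\<bar> * 1 \<le> \<bar>ae_rep (L (\<phi>s v)) y\<bar> * H y" using H1 by (intro mult_left_mono) auto
      then show "norm (g v y) \<le> norm (ae_rep (L (\<phi>s v)) y)" using H1[of y] by (simp add: g_def divide_le_eq)
    qed
  qed
  have dom: "mp.dominated (g v) (pn v)" if v: "v \<in> carrier M" for v
    unfolding mp.dominated_def
  proof (intro conjI ballI impI gm[OF v] pn_measurable[OF v] pn_nonneg[OF v])
    show "set_integrable X E (pn v)" if "E \<in> sets X" "emeasure X E < \<infinity>" for E
      by (rule set_integrable_pn_finite[OF v that D.q D.pq])
    show "AE y in Y. \<bar>g v y\<bar> \<le> pn v (\<phi> y)"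
      using D.dual_value_bound[OF L \<phi>s_closed[OF v]] pn_\<phi>s[OF v] mp.AE_pull[OF pn_nonneg[OF v]]
    proof eventually_elim
      case (elim y)
      have "\<bar>ae_rep (L (\<phi>s v)) y\<bar> \<le> H y * pn v (\<phi> y)"
        using elim(1,2) mult_right_mono[of "D.dual_value L y" "H y" "pn v (\<phi> y)", OF _ elim(3)] abs_ge_self[of "D.dual_value L y"]
        by (simp add: H_def)
      then show ?case using H1[of y] by (simp add: g_def divide_le_eq mult.commute)
    qed
  qed
  have avg: "eventually (\<lambda>k. cell_avg X A k (pn v) (\<phi> y) \<le> fibre_seminorm X A p M (\<phi> y) v + e) sequentially"
    if v: "v \<in> span_LV (\<phi> y)" and y: "y \<in> space Y" and e: "0 < e" for v y e
    using avg_norm_limsup[OF v mp.\<phi>_space[OF y] e]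
    by (rule eventually_mono) (rule order_trans[OF cell_avg_le_avg_norm[OF span_LV_carrier[OF v] mp.\<phi>_space[OF y] D.q D.pq]])
  have bs: "Bseq (\<lambda>k. cell_avg X A k (pn v) (\<phi> y))" if v: "v \<in> span_LV (\<phi> y)" and y: "y \<in> space Y" for v y
  proof (rule BfunI)
    show "eventually (\<lambda>k. norm (cell_avg X A k (pn v) (\<phi> y)) \<le> fibre_seminorm X A p M (\<phi> y) v + 1) sequentially"
      using avg[OF v y zero_less_one] cell_avg_nonneg[OF mp.\<phi>_space[OF y] pn_nonneg[OF span_LV_carrier[OF v]]]
      by (auto elim: eventually_mono)
  qed
  define lam where "lam y v = H y * \<Lambda> y (g v)" for y v
  have "\<exists>f. f \<in> topological_dual (fib y) \<and> (\<forall>u\<in>span_LV (\<phi> y). f (completion_map (PF (\<phi> y)) u) = lam y u)"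
    if y: "y \<in> space Y" for y
  proof -
    have add: "lam y (u \<oplus>\<^bsub>PF (\<phi> y)\<^esub> v) = lam y u + lam y v" if uv: "u \<in> carrier (PF (\<phi> y))" "v \<in> carrier (PF (\<phi> y))" for u v
    proof -
      have c: "u \<in> carrier M" "v \<in> carrier M" "u \<in> span_LV (\<phi> y)" "v \<in> span_LV (\<phi> y)" using uv span_LV_carrier by auto
      have "AE z in Y. g (u \<oplus> v) z = 1 * g u z + 1 * g v z"
        using D.AE_L_add[OF L \<phi>s_closed[OF c(1)] \<phi>s_closed[OF c(2)]]
        by eventually_elim (simp add: g_def \<phi>s_add[OF c(1,2)] add_divide_distrib)
      then have "\<Lambda> y (g (u \<oplus> v)) = \<Lambda> y (\<lambda>z. 1 * g u z + 1 * g v z)"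
        using c gm[of u] gm[of v] by (intro cong gm) auto
      also have "\<dots> = 1 * \<Lambda> y (g u) + 1 * \<Lambda> y (g v)"
        using c by (intro lin[OF y dom dom] bs y)
      finally show ?thesis by (simp add: lam_def distrib_left)
    qed
    have scale: "lam y (c \<odot>\<^bsub>PF (\<phi> y)\<^esub> u) = c * lam y u" if u: "u \<in> carrier (PF (\<phi> y))" for c u
    proof -
      have c: "u \<in> carrier M" "u \<in> span_LV (\<phi> y)" using u span_LV_carrier by auto
      have "AE z in Y. ae_rep (L (const_class Y c \<odot>\<^bsub>P\<^esub> \<phi>s u)) z = c * ae_rep (L (\<phi>s u)) z"
        by (rule D.AE_L_smult[OF L _ _ \<phi>s_closed[OF c(1)], of "\<lambda>_. c" "\<bar>c\<bar>"]) auto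
      then have "AE z in Y. g (const_class X c \<odot> u) z = c * g u z + 0 * g u z"
        by eventually_elim (simp add: g_def \<phi>s_const[OF c(1)])
      then have "\<Lambda> y (g (const_class X c \<odot> u)) = \<Lambda> y (\<lambda>z. c * g u z + 0 * g u z)"
        using c gm[of u] by (intro cong gm) auto
      also have "\<dots> = c * \<Lambda> y (g u) + 0 * \<Lambda> y (g u)"
        using c by (intro lin[OF y dom dom] bs y)
      finally show ?thesis by (simp add: lam_def)
    qed
    have bd: "\<bar>lam y u\<bar> \<le> H y * nrm (PF (\<phi> y)) u" if u: "u \<in> carrier (PF (\<phi> y))" for u
    proof -
      have c: "u \<in> carrier M" "u \<in> span_LV (\<phi> y)" using u span_LV_carrier by auto
      have "\<bar>\<Lambda> y (g u)\<bar> \<le> fibre_seminorm X A p M (\<phi> y) u"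
        by (rule bound[OF y dom[OF c(1)] bs[OF c(2) y]]) (rule avg[OF c(2) y])
      then show ?thesis using H1[of y] by (simp add: lam_def abs_mult mult_left_mono)
    qed
    obtain f where "f \<in> topological_dual (completion (PF (\<phi> y)))" "\<And>u. u \<in> carrier (PF (\<phi> y)) \<Longrightarrow> f (completion_map (PF (\<phi> y)) u) = lam y u"
      using PF.functional_extends_to_completion[of "\<phi> y" "lam y" "H y", OF add scale bd] by blast
    then show ?thesis by (intro exI[of _ f]) (auto simp: fibre_def)
  qed
  then have "\<forall>y. \<exists>f. y \<in> space Y \<longrightarrow> f \<in> topological_dual (fib y) \<and> (\<forall>u\<in>span_LV (\<phi> y). f (completion_map (PF (\<phi> y)) u) = lam y u)"
    by blast
  from choice[OF this] obtain w0 where w0: "\<And>y. y \<in> space Y \<Longrightarrow> w0 y \<in> topological_dual (fib y)"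
    "\<And>y u. y \<in> space Y \<Longrightarrow> u \<in> span_LV (\<phi> y) \<Longrightarrow> w0 y (completion_map (PF (\<phi> y)) u) = lam y u" by blast
  define w where "w = restrict w0 (space Y)"
  have AE_w: "AE y in Y. ae_rep (L (\<phi>s v)) y = w y (TV v y)" if v: "v \<in> carrier M" for v
    using mp.AE_pull[OF AE_LV[OF v]] lift[OF gi[OF v] dom[OF v]] AE_space
  proof eventually_elim
    case (elim y)
    have "w y (TV v y) = lam y v" using w0(2)[OF elim(3), of v] elim LV_span RV_eq by (simp add: w_def)
    also have "\<dots> = ae_rep (L (\<phi>s v)) y" using elim(2) H1[of y] by (simp add: lam_def g_def)
    finally show ?case by simp
  qed
  have "w \<in> WS" unfolding WS_iff
    using w0(1) ae_measurable_cong[OF ae_measurable_borel[OF Lm] AE_w] by (auto simp: w_def)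
  then have "corr w L" using AE_w by (simp add: corr_iff_AE[OF _ L])
  then show ?thesis by (rule that)
qed

end

section \<open>The isomorphism\<close>

lemma Lp_normed_module_transport:
  assumes N: "Lp_normed_module \<mu> p N" and S: "bij_betw S (carrier N) (carrier K)"
    and add: "\<And>u v. u \<in> carrier N \<Longrightarrow> v \<in> carrier N \<Longrightarrow> S u \<oplus>\<^bsub>K\<^esub> S v = S (u \<oplus>\<^bsub>N\<^esub> v)"
    and smult: "\<And>F u. F \<in> carrier (Linf \<mu>) \<Longrightarrow> u \<in> carrier N \<Longrightarrow> F \<odot>\<^bsub>K\<^esub> S u = S (F \<odot>\<^bsub>N\<^esub> u)"
    and zero: "\<zero>\<^bsub>K\<^esub> = S \<zero>\<^bsub>N\<^esub>"
    and pnorm: "\<And>u. u \<in> carrier N \<Longrightarrow> pnorm K (S u) = pnorm N u"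
    and nrm: "\<And>u. u \<in> carrier N \<Longrightarrow> nrm K (S u) = nrm N u"
  shows "Lp_normed_module \<mu> p K"
proof -
  interpret N: scalar_module "Linf \<mu>" N unfolding scalar_module_def using N by (simp add: Lp_normed_module_def)
  interpret RN: normed_space "real_nspace \<mu> N" using N by (simp add: Lp_normed_module_def normed_space_banach)
  have K: "carrier K = S ` carrier N" using S by (auto simp: bij_betw_def)
  have inj: "S u = S v \<longleftrightarrow> u = v" if "u \<in> carrier N" "v \<in> carrier N" for u v
    using S that by (auto simp: bij_betw_def inj_on_def)
  have group: "abelian_group K"
  proof (rule abelian_groupI)
    show "\<exists>y\<in>carrier K. y \<oplus>\<^bsub>K\<^esub> x = \<zero>\<^bsub>K\<^esub>" if x: "x \<in> carrier K" for x
    proof -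
      obtain u where u: "u \<in> carrier N" "x = S u" using x K by auto
      have "S (\<ominus>\<^bsub>N\<^esub> u) \<oplus>\<^bsub>K\<^esub> x = \<zero>\<^bsub>K\<^esub>" using u by (simp add: add zero N.M.l_neg)
      moreover have "S (\<ominus>\<^bsub>N\<^esub> u) \<in> carrier K" using u K by simp
      ultimately show ?thesis by blast
    qed
  qed (auto simp: K add zero N.M.a_ac)
  have module: "Module.module (Linf \<mu>) K"
    by (rule moduleI[OF N.R.cring_axioms group])
      (auto simp: K add smult N.smult_l_distr N.smult_r_distr N.smult_assoc1 simp del: Linf_simps)
  have RK: "normed_space (real_nspace \<mu> K)"
  proof (intro normed_space.intro seminormed_space.intro normed_space_axioms.intro real_nspace_module[OF module])
    fix x y and c :: real assume "x \<in> carrier (real_nspace \<mu> K)"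
    then obtain u where u: "u \<in> carrier N" "x = S u" using K by auto
    show "0 \<le> nrm (real_nspace \<mu> K) x" using RN.nrm_nonneg[of u] u by (simp add: nrm)
    show "nrm (real_nspace \<mu> K) (c \<odot>\<^bsub>real_nspace \<mu> K\<^esub> x) = \<bar>c\<bar> * nrm (real_nspace \<mu> K) x"
      using RN.nrm_scale[of u c] u by (simp add: smult nrm)
    show "nrm (real_nspace \<mu> K) x = 0 \<Longrightarrow> x = \<zero>\<^bsub>real_nspace \<mu> K\<^esub>"
      using RN.nrm_zero_imp[of u] u by (simp add: nrm zero)
    assume "y \<in> carrier (real_nspace \<mu> K)"
    then obtain v where v: "v \<in> carrier N" "y = S v" using K by auto
    show "nrm (real_nspace \<mu> K) (x \<oplus>\<^bsub>real_nspace \<mu> K\<^esub> y) \<le> nrm (real_nspace \<mu> K) x + nrm (real_nspace \<mu> K) y"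
      using RN.nrm_triangle[of u v] u v by (simp add: add nrm)
  qed
  interpret RK: normed_space "real_nspace \<mu> K" by (rule RK)
  have dist: "ndist (real_nspace \<mu> K) (S u) (S v) = ndist (real_nspace \<mu> N) u v" if "u \<in> carrier N" "v \<in> carrier N" for u v
  proof -
    have "S u \<ominus>\<^bsub>real_nspace \<mu> K\<^esub> S v = S (u \<oplus>\<^bsub>N\<^esub> const_class \<mu> (-1) \<odot>\<^bsub>N\<^esub> v)"
      using that RK.V.minus_eq[of "S u" "S v"] RK.smult_simps(6)[of "S v", symmetric] K by (simp add: add smult)
    moreover have "u \<ominus>\<^bsub>real_nspace \<mu> N\<^esub> v = u \<oplus>\<^bsub>N\<^esub> const_class \<mu> (-1) \<odot>\<^bsub>N\<^esub> v"
      using that RN.V.minus_eq[of u v] RN.smult_simps(6)[of v] by simp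
    ultimately show ?thesis using that K by (simp add: ndist_def nrm)
  qed
  have "RK.metric.mcomplete"
    unfolding RK.metric.mcomplete_def
  proof (intro allI impI)
    fix s assume s: "RK.metric.MCauchy s"
    have "s n \<in> S ` carrier N" for n using s K unfolding RK.metric.MCauchy_def by auto
    then have "\<forall>n. \<exists>u. u \<in> carrier N \<and> s n = S u" by blast
    from choice[OF this] obtain t where t: "\<And>n. t n \<in> carrier N" "\<And>n. s n = S (t n)" by blast
    have "RN.metric.MCauchy t" using s t(1) unfolding RK.metric.MCauchy_def RN.metric.MCauchy_def by (auto simp: t(2) dist)
    moreover have "RN.metric.mcomplete" using N by (simp add: Lp_normed_module_def normed_space_banach)
    ultimately obtain u where u: "limitin RN.metric.mtopology t u sequentially" unfolding RN.metric.mcomplete_def by blast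
    have "limitin RK.metric.mtopology s (S u) sequentially"
      using u t(1) K unfolding RK.metric.limit_metric_sequentially RN.metric.limit_metric_sequentially by (auto simp: t(2) dist)
    then show "\<exists>x. limitin RK.metric.mtopology s x sequentially" ..
  qed
  then have "banach_space (real_nspace \<mu> K)" using RK by (simp add: normed_space_banach)
  with module show ?thesis
    using N by (auto simp: Lp_normed_module_def K smult pnorm nrm)
qed

context pullback_module
begin

abbreviation "LQ \<equiv> Lq_weak_pb X A p M Y \<phi> q"

text \<open>
  The class of all sections that correspond to \<open>L\<close>; this is the inverse of the isomorphism.
\<close>

definition sec :: "('w \<Rightarrow> ('y \<Rightarrow> real) set) \<Rightarrow> ('y \<Rightarrow> (nat \<Rightarrow> 'v) set \<Rightarrow> real) set" where
  "sec L = {w. corr w L}"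

text \<open>
  Two sections are equivalent exactly if they induce the same pairings almost everywhere, hence if
  they correspond to the same functional.
\<close>

lemma corr_weak_class:
  assumes r: "corr w L"
  shows "weak_class Y V Test w = sec L"
proof -
  note L = corrD(2)[OF r]
  have "(\<forall>v\<in>carrier M. AE y in Y. w' y ((\<lambda>y\<in>space Y. TV v y) y) - w y ((\<lambda>y\<in>space Y. TV v y) y) = 0) \<longleftrightarrow> corr w' L"
    if w': "w' \<in> WS" for w'
  proof -
    have "(AE y in Y. w' y ((\<lambda>y\<in>space Y. TV v y) y) - w y ((\<lambda>y\<in>space Y. TV v y) y) = 0) \<longleftrightarrow>
      (AE y in Y. ae_rep (L (\<phi>s v)) y = w' y (TV v y))" if v: "v \<in> carrier M" for v
      by (rule eventually_subst) (use corrD(3)[OF r v] AE_space in eventually_elim, auto)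
    then show ?thesis unfolding corr_iff_AE[OF w' L] by blast
  qed
  then show ?thesis unfolding weak_class_def sec_def null_sets_iff_AE Test_ball using corrD(1) by blast
qed

lemma sec_rep: assumes "L \<in> carrier D.DM" shows "corr (weak_rep (sec L)) L"
proof -
  obtain w where "corr w L" by (rule functional_induced[OF assms])
  then have "weak_rep (sec L) \<in> sec L" unfolding weak_rep_def by (intro someI[of "\<lambda>w. w \<in> sec L" w]) (simp add: sec_def)
  then show ?thesis by (simp add: sec_def)
qed

lemma pnorm_class:
  assumes r: "corr w L"
  shows "ae_class Y (wr w) = pnorm D.DM L"
  unfolding D.pnorm_DM using corr_weak_pnorm[OF r] by (intro ae_class_eqI) (auto elim: eventually_mono)

text \<open>
  A section of finite \<open>L\<^sup>q\<close> norm induces a functional, and every functional has a section, whose weak norm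
  is the pointwise norm of the functional and thus belongs to \<open>L\<^sup>q\<close>.
\<close>

lemma LQ_carrier: "carrier LQ = sec ` carrier D.DM"
proof (intro equalityI subsetI)
  fix W assume "W \<in> carrier LQ"
  then obtain w where w: "W = weak_class Y V Test w" "w \<in> WS" "AE y in Y. \<bar>wn w y\<bar> \<noteq> \<infinity>" "ae_class Y (wr w) \<in> Lp_set Y q"
    by (auto simp: Lq_weak_pb_def Lq_weak_def Let_def)
  have m[measurable]: "wr w \<in> borel_measurable Y" using weak_pnorm_ess_sup(1)[OF w(2)] by simp
  have "integrable Y (\<lambda>y. \<bar>ae_rep (ae_class Y (wr w)) y\<bar> powr q)" using w(4) by (simp add: Lp_set_iff)
  then have "integrable Y (\<lambda>y. \<bar>wr w y\<bar> powr q)"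
  proof (rule integrable_cong_AE_imp)
    show "(\<lambda>y. \<bar>wr w y\<bar> powr q) \<in> borel_measurable Y" using borel_measurable_abs[OF m] by (rule powr_real_measurable) simp
  qed (use AE_ae_rep_class[OF m] in \<open>auto elim: eventually_mono\<close>)
  from section_induces[OF w(2,3) this] obtain L where r: "corr w L" by blast
  then show "W \<in> sec ` carrier D.DM" using corr_weak_class[OF r] corrD(2)[OF r] w(1) by blast
next
  fix W assume "W \<in> sec ` carrier D.DM"
  then obtain L where L: "L \<in> carrier D.DM" "W = sec L" by blast
  note r = sec_rep[OF L(1)]
  have "ae_class Y (wr (weak_rep (sec L))) \<in> Lp_set Y q"
    unfolding pnorm_class[OF r] using D.DM_Lp_normed L(1) by (simp add: Lp_normed_module_def)
  then show "W \<in> carrier LQ" unfolding L(2)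
    using corr_weak_class[OF r] corrD(1)[OF r] corr_finite[OF r]
    by (auto simp: Lq_weak_pb_def Lq_weak_def Let_def)
qed

lemma LQ_simps:
  "pnorm LQ W = ae_class Y (wr (weak_rep W))" "nrm LQ W = Lp_norm Y q (pnorm LQ W)"
  "\<zero>\<^bsub>LQ\<^esub> = weak_class Y V Test (\<lambda>y\<in>space Y. \<lambda>b\<in>carrier (fib y). 0)"
  "W1 \<oplus>\<^bsub>LQ\<^esub> W2 = weak_class Y V Test (\<lambda>y\<in>space Y. \<lambda>b\<in>carrier (fib y). weak_rep W1 y b + weak_rep W2 y b)"
  "F \<odot>\<^bsub>LQ\<^esub> W = weak_class Y V Test (\<lambda>y\<in>space Y. \<lambda>b\<in>carrier (fib y). ae_rep F y * weak_rep W y b)"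
  by (simp_all add: Lq_weak_pb_def Lq_weak_def Let_def)

lemma corr_add:
  assumes r1: "corr w1 L1" and r2: "corr w2 L2"
  shows "corr (\<lambda>y\<in>space Y. \<lambda>b\<in>carrier (fib y). w1 y b + w2 y b) (L1 \<oplus>\<^bsub>D.DM\<^esub> L2)" (is "corr ?w _")
proof -
  note w = corrD(1)[OF r1] corrD(1)[OF r2] and L = corrD(2)[OF r1] corrD(2)[OF r2]
  have tv: "AE y in Y. w1 y (TV v y) + w2 y (TV v y) = ?w y (TV v y)" if "v \<in> carrier M" for v
    using AE_space by eventually_elim (use that in simp)
  have "?w \<in> WS" unfolding WS_iff
    using w FB.topological_dual_comb(1) ae_measurable_cong[OF ae_measurable_comb(1)[OF WS_measurable[OF w(1)] WS_measurable[OF w(2)]] tv]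
    by (auto simp: WS_iff PiE_iff)
  moreover have "AE y in Y. ae_rep ((L1 \<oplus>\<^bsub>D.DM\<^esub> L2) (\<phi>s v)) y = ?w y (TV v y)" if v: "v \<in> carrier M" for v
  proof -
    have "L1 (\<phi>s v) \<in> ae_classes Y" "L2 (\<phi>s v) \<in> ae_classes Y"
      using D.DM_linear(1)[OF L(1), of "\<phi>s v" "\<phi>s v"] D.DM_linear(1)[OF L(2), of "\<phi>s v" "\<phi>s v"] v Lp_set_ae_classes by auto
    from ae_map2_classes(4)[OF this] corrD(3)[OF r1 v] corrD(3)[OF r2 v] tv[OF v]
    show ?thesis by eventually_elim (use v in simp)
  qed
  ultimately show ?thesis using corr_iff_AE D.DM_closed(1)[OF L] by blast
qed

lemma corr_smult:
  assumes r: "corr w L" and F: "F \<in> carrier (Linf Y)"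
  shows "corr (\<lambda>y\<in>space Y. \<lambda>b\<in>carrier (fib y). ae_rep F y * w y b) (F \<odot>\<^bsub>D.DM\<^esub> L)" (is "corr ?w _")
proof -
  note w = corrD(1)[OF r] and L = corrD(2)[OF r]
  have Fm: "ae_measurable Y (ae_rep F)" using Linf_ae_classes[OF F] by (intro ae_measurable_borel) simp
  have tv: "AE y in Y. ae_rep F y * w y (TV v y) = ?w y (TV v y)" if "v \<in> carrier M" for v
    using AE_space by eventually_elim (use that in simp)
  have "?w \<in> WS" unfolding WS_iff
    using w FB.topological_dual_comb(2) ae_measurable_cong[OF ae_measurable_comb(2)[OF Fm WS_measurable[OF w]] tv]
    by (auto simp: WS_iff PiE_iff)
  moreover have "AE y in Y. ae_rep ((F \<odot>\<^bsub>D.DM\<^esub> L) (\<phi>s v)) y = ?w y (TV v y)" if v: "v \<in> carrier M" for v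
  proof -
    have "L (\<phi>s v) \<in> ae_classes Y"
      using D.DM_linear(1)[OF L, of "\<phi>s v" "\<phi>s v"] v Lp_set_ae_classes by auto
    from ae_map2_classes(5)[OF Linf_ae_classes[OF F] this] corrD(3)[OF r v] tv[OF v]
    show ?thesis by eventually_elim (use v in simp)
  qed
  ultimately show ?thesis using corr_iff_AE D.DM_closed(2)[OF L F] by blast
qed

lemma corr_zero: "corr (\<lambda>y\<in>space Y. \<lambda>b\<in>carrier (fib y). 0) \<zero>\<^bsub>D.DM\<^esub>"
proof -
  obtain w where r: "corr w \<zero>\<^bsub>D.DM\<^esub>" by (rule functional_induced[OF D.DM_zero])
  let ?w = "\<lambda>y\<in>space Y. \<lambda>b\<in>carrier (fib y). 0 :: real"
  have "(\<lambda>b\<in>carrier (fib y). 0) \<in> topological_dual (fib y)" if y: "y \<in> space Y" for y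
  proof -
    have "w y \<in> topological_dual (fib y)" using corrD(1)[OF r] y by (auto simp: WS_iff)
    from FB.topological_dual_comb(2)[OF this this, of 0] show ?thesis by simp
  qed
  moreover have tv: "AE y in Y. 0 = ?w y (TV v y)" if v: "v \<in> carrier M" for v
    using AE_space by eventually_elim (use v in simp)
  have "ae_measurable Y (\<lambda>y. ?w y (TV v y))" if v: "v \<in> carrier M" for v
    by (rule ae_measurable_cong[OF ae_measurable_borel tv[OF v]]) simp
  ultimately have "?w \<in> WS" by (auto simp: WS_iff)
  moreover have "AE y in Y. ae_rep (\<zero>\<^bsub>D.DM\<^esub> (\<phi>s v)) y = ?w y (TV v y)" if v: "v \<in> carrier M" for v
    using AE_ae_rep_class[of "\<lambda>_. 0 :: real" Y, OF borel_measurable_const] tv[OF v] by eventually_elim (use v in simp)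
  ultimately show ?thesis using corr_iff_AE D.DM_zero by blast
qed

lemma inj_sec: "inj_on sec (carrier D.DM)"
proof (rule inj_onI)
  fix L L' assume L: "L \<in> carrier D.DM" "L' \<in> carrier D.DM" "sec L = sec L'"
  have "corr (weak_rep (sec L)) L" "corr (weak_rep (sec L)) L'" using sec_rep[OF L(1)] sec_rep[OF L(2)] L(3) by auto
  then show "L = L'" using corr_unique[of _ L' L] L(1) by (auto simp: corr_def)
qed

text \<open>
  The operations on classes of sections are, by the way in which they are defined, those of the
  corresponding functionals, so that the structure of the dual is transported along \<open>sec\<close>.
\<close>

lemma LQ_normed: "Lp_normed_module Y q LQ"
proof (rule Lp_normed_module_transport[OF D.DM_Lp_normed, of sec])
  show "bij_betw sec (carrier D.DM) (carrier LQ)" using inj_sec by (simp add: bij_betw_def LQ_carrier)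
  fix L assume L: "L \<in> carrier D.DM"
  show "pnorm LQ (sec L) = pnorm D.DM L" by (simp only: LQ_simps pnorm_class[OF sec_rep[OF L]])
  then show "nrm LQ (sec L) = nrm D.DM L" using D.DM_Lp_normed L by (simp add: LQ_simps(2) Lp_normed_module_def)
  show "sec L \<oplus>\<^bsub>LQ\<^esub> sec L' = sec (L \<oplus>\<^bsub>D.DM\<^esub> L')" if "L' \<in> carrier D.DM" for L'
    unfolding LQ_simps by (rule corr_weak_class[OF corr_add[OF sec_rep[OF L] sec_rep[OF that]]])
  show "F \<odot>\<^bsub>LQ\<^esub> sec L = sec (F \<odot>\<^bsub>D.DM\<^esub> L)" if "F \<in> carrier (Linf Y)" for F
    unfolding LQ_simps by (rule corr_weak_class[OF corr_smult[OF sec_rep[OF L] that]])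
next
  show "\<zero>\<^bsub>LQ\<^esub> = sec \<zero>\<^bsub>D.DM\<^esub>" unfolding LQ_simps by (rule corr_weak_class[OF corr_zero])
qed

lemma induced_by_iff:
  assumes L: "L \<in> carrier D.DM"
  shows "induced_by X A p M Y \<phi> P \<phi>s (sec L) L' \<longleftrightarrow> L' = L"
proof
  assume i: "induced_by X A p M Y \<phi> P \<phi>s (sec L) L'"
  note r = sec_rep[OF L]
  have "L' \<in> carrier D.DM" using i by (simp add: induced_by_def)
  moreover have "L' (\<phi>s v) = L (\<phi>s v)" if v: "v \<in> carrier M" for v
  proof -
    have "weak_rep (sec L) \<in> sec L" using r by (simp add: sec_def)
    then have "L' (\<phi>s v) = ae_class Y (\<lambda>y. weak_rep (sec L) y (TV v y))" using i v unfolding induced_by_def by blast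
    also have "\<dots> = L (\<phi>s v)" using r v unfolding corr_def by simp
    finally show ?thesis .
  qed
  ultimately show "L' = L" by (rule corr_unique[OF r])
next
  show "L' = L \<Longrightarrow> induced_by X A p M Y \<phi> P \<phi>s (sec L) L'"
    using L unfolding induced_by_def sec_def corr_def by blast
qed

lemma I_map_sec: "L \<in> carrier D.DM \<Longrightarrow> I_map X A p M Y \<phi> P \<phi>s (sec L) = L"
  unfolding I_map_def by (rule the_equality) (subst (asm) induced_by_iff | subst induced_by_iff | assumption | rule refl)+

theorem isomorphism:
  "\<forall>\<omega>\<in>carrier LQ. \<exists>!L. induced_by X A p M Y \<phi> P \<phi>s \<omega> L"
  "normed_module_iso Y q LQ D.DM (I_map X A p M Y \<phi> P \<phi>s)"
proof -
  show "\<forall>\<omega>\<in>carrier LQ. \<exists>!L. induced_by X A p M Y \<phi> P \<phi>s \<omega> L"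
    unfolding LQ_carrier by (auto simp: induced_by_iff)
  let ?I = "I_map X A p M Y \<phi> P \<phi>s"
  have "bij_betw ?I (carrier LQ) (carrier D.DM)"
    unfolding LQ_carrier by (rule bij_betw_byWitness[of _ sec]) (auto simp: I_map_sec)
  moreover have "?I (W1 \<oplus>\<^bsub>LQ\<^esub> W2) = ?I W1 \<oplus>\<^bsub>D.DM\<^esub> ?I W2" if W: "W1 \<in> carrier LQ" "W2 \<in> carrier LQ" for W1 W2
  proof -
    obtain L1 L2 where L: "L1 \<in> carrier D.DM" "L2 \<in> carrier D.DM" "W1 = sec L1" "W2 = sec L2" using W by (auto simp: LQ_carrier)
    have "W1 \<oplus>\<^bsub>LQ\<^esub> W2 = sec (L1 \<oplus>\<^bsub>D.DM\<^esub> L2)"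
      unfolding LQ_simps L by (rule corr_weak_class[OF corr_add[OF sec_rep[OF L(1)] sec_rep[OF L(2)]]])
    then show ?thesis using L D.DM_closed(1)[OF L(1,2)] by (simp add: I_map_sec del: D.DM_simps)
  qed
  moreover have "?I (F \<odot>\<^bsub>LQ\<^esub> W) = F \<odot>\<^bsub>D.DM\<^esub> ?I W" if F: "F \<in> carrier (Linf Y)" and W: "W \<in> carrier LQ" for F W
  proof -
    obtain L where L: "L \<in> carrier D.DM" "W = sec L" using W by (auto simp: LQ_carrier)
    have "F \<odot>\<^bsub>LQ\<^esub> W = sec (F \<odot>\<^bsub>D.DM\<^esub> L)"
      unfolding LQ_simps L by (rule corr_weak_class[OF corr_smult[OF sec_rep[OF L(1)] F]])
    then show ?thesis using L D.DM_closed(2)[OF L(1) F] by (simp add: I_map_sec del: D.DM_simps)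
  qed
  moreover have "pnorm D.DM (?I W) = pnorm LQ W" if W: "W \<in> carrier LQ" for W
  proof -
    obtain L where L: "L \<in> carrier D.DM" "W = sec L" using W by (auto simp: LQ_carrier)
    then show ?thesis by (simp only: I_map_sec LQ_simps(1) pnorm_class[OF sec_rep[OF L(1)]])
  qed
  ultimately show "normed_module_iso Y q LQ D.DM ?I"
    using LQ_normed D.DM_Lp_normed unfolding normed_module_iso_def by blast
qed

end

theorem theorem3p11:
  fixes X :: "'x measure" and Y :: "'y measure" and A :: "nat \<Rightarrow> 'x set"
    and \<phi> :: "'y \<Rightarrow> 'x" and p q :: real
    and M :: "('x, 'v) Lmodule" and N :: "('y, 'w) Lmodule" and \<phi>s :: "'v \<Rightarrow> 'w"
  assumes "sigma_finite_measure X" and "sigma_finite_measure Y"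
    and "dense_sequence X A" and "separable_measure Y"
    and "\<phi> \<in> measurable Y X" and "distr Y X \<phi> = X"
    and "1 < p" and "1 < q" and "1 / p + 1 / q = 1"
    and "Lp_normed_module X p M"
    and "is_pullback X Y \<phi> p M N \<phi>s"
  shows "weak_banach_bundle Y (pb_fibre X A p M \<phi>) (pb_test X A p M Y \<phi>) \<and>
    (\<forall>\<omega>\<in>carrier (Lq_weak_pb X A p M Y \<phi> q). \<exists>!L. induced_by X A p M Y \<phi> N \<phi>s \<omega> L) \<and>
    Lp_normed_module Y q (Lq_weak_pb X A p M Y \<phi> q) \<and>
    normed_module_iso Y q (Lq_weak_pb X A p M Y \<phi> q) (module_dual Y N)
      (I_map X A p M Y \<phi> N \<phi>s)"
proof -
  obtain B where B: "dense_sequence Y B" using assms(4) by (auto simp: separable_measure_def)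
  have N: "Lp_normed_module Y p N" using assms(11) by (simp add: is_pullback_def)
  have "pullback_module X Y p q M A B \<phi> N \<phi>s"
    by (intro pullback_module.intro fibred_module.intro fibred_module_axioms.intro dual_module.intro
      dual_module_axioms.intro Lp_module.intro measure_preserving.intro pullback_module_axioms.intro assms B N)
  then interpret pullback_module X Y p q M A B \<phi> N \<phi>s .
  show ?thesis using weak_bundle isomorphism LQ_normed by blast
qed

end
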